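(* Let $(R,\mathfrak m,k)$ be a commutative Noetherian local ring and let $M$ be a nonzero finitely generated $R$-module equipped with an $\mathfrak m$-stable filtration $\mathbb M$. Let $\operatorname{ld}_R(M)=d<\infty$ and assume that $M$ is of homogeneous type with respect to $\mathbb M$. Then $$\operatorname{reg}_{R^g}(gr_{\mathbb M}(M))=\max\{t_i(gr_{\mathbb M}(M))-i:\ 0\le i\le d\}.$$
   Context: An $\mathfrak m$-stable filtration $\mathbb M=\{\mathfrak F_pM\}_{p\ge0}$ of $M$ is a descending chain of submodules with $\mathfrak F_0M=M$, $\mathfrak m\,\mathfrak F_pM\subseteq\mathfrak F_{p+1}M$ for all $p\ge0$, with equality for all $p\gg0$. Put $R^g=\bigoplus_{p\ge0}\mathfrak m^p/\mathfrak m^{p+1}$ (a standard graded $k$-algebra) and $gr_{\mathbb M}(M)=\bigoplus_{p\ge0}\mathfrak F_pM/\mathfrak F_{p+1}M$, a finitely generated graded $R^g$-module. For a finitely generated graded $R^g$-module $N$: $\beta_{ij}^{R^g}(N)=\dim_k\operatorname{Tor}^{R^g}_i(N,k)_j$, $t_i(N)=\sup\{j:\beta^{R^g}_{ij}(N)\ne0\}$ (with $t_i(N)=-\infty$ if $\operatorname{Tor}_i^{R^g}(N,k)=0$), and $\operatorname{reg}_{R^g}(N)=\sup\{j-i:\beta_{ij}^{R^g}(N)\ne0\}$. Also $\beta_i(-)=\dim_k\operatorname{Tor}_i(-,k)$ over the indicated ring. $M$ is of homogeneous type with respect to $\mathbb M$ if $\beta_i^R(M)=\beta_i^{R^g}(gr_{\mathbb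 M}(M))$ for every $i\ge0$. Linearity defect: let $\mathbf F$ be a minimal free resolution of $M$ over $R$. The standard filtration of $\mathbf F$ consists of the subcomplexes $\mathfrak F^i\mathbf F$ with $(\mathfrak F^i\mathbf F)_n=\mathfrak m^{i-n}F_n$, where $\mathfrak m^j=R$ for $j\le0$. Its associated graded complex is $\operatorname{lin}^R(\mathbf F)$, a complex of graded $R^g$-modules with $\operatorname{lin}^R(\mathbf F)_n=F_n^g(-n)$, where $F_n^g=\bigoplus_p\mathfrak m^pF_n/\mathfrak m^{p+1}F_n$. Then $\operatorname{ld}_R(M)=\sup\{i:H_i(\operatorname{lin}^R(\mathbf F))\ne0\}$. *)

theory Defs
  imports
    "HOL-Algebra.Ideal_Product"
    "HOL-Algebra.QuotRing"
    "HOL-Algebra.Ring_Divisibility"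
    "HOL-Algebra.Generated_Groups"
    "Jordan_Normal_Form.Missing_VectorSpace"
    "HOL-Library.Extended_Real"
begin

hide_const (open) Modules.module Multiset.mult

locale noetherian_local_ring = cring R + noetherian_ring R + maximalideal \<mm> R
  for R (structure) and \<mm> +
  assumes unique_maximal: "maximalideal I R \<Longrightarrow> I = \<mm>"


section \<open>Modules\<close>

text \<open>
  Modules are the records of \<open>HOL-Algebra\<close>. Their ring fields \<^const>\<open>mult\<close> and \<^const>\<open>one\<close>
  carry no information for the module structure.
\<close>

definition self_module :: "('a, 'r) ring_scheme \<Rightarrow> ('a, 'a) module" where
  "self_module R =
    \<lparr>carrier = carrier R, mult = mult R, one = one R, zero = zero R, add = add R, smult = mult R\<rparr>"

definition finitely_generated :: "('a, 'r) ring_scheme \<Rightarrow> ('a, 'b, 'm) module_scheme \<Rightarrow> bool" where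
  "finitely_generated R M \<longleftrightarrow>
    (\<exists>S. finite S \<and> S \<subseteq> carrier M \<and> module.span R M S = carrier M)"

definition zero_module :: "('a, 'b, 'm) module_scheme \<Rightarrow> bool" where
  "zero_module M \<longleftrightarrow> carrier M = {\<zero>\<^bsub>M\<^esub>}"

text \<open>The subquotient \<open>A/B\<close> for submodules \<open>B \<subseteq> A\<close> of \<open>M\<close>.\<close>

definition quotient_module ::
    "('a, 'b, 'm) module_scheme \<Rightarrow> 'b set \<Rightarrow> 'b set \<Rightarrow> ('a, 'b set) module" where
  "quotient_module M A B =
    \<lparr>carrier = (\<lambda>x. B +>\<^bsub>M\<^esub> x) ` A, mult = undefined, one = undefined,
     zero = B, add = set_add M,
     smult = (\<lambda>r X. \<Union>x\<in>X. B +>\<^bsub>M\<^esub> (r \<odot>\<^bsub>M\<^esub> x))\<rparr>"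

definition ideal_smult ::
    "('a, 'r) ring_scheme \<Rightarrow> 'a set \<Rightarrow> ('a, 'b, 'm) module_scheme \<Rightarrow> 'b set \<Rightarrow> 'b set" where
  "ideal_smult R I M N = module.span R M {r \<odot>\<^bsub>M\<^esub> x | r x. r \<in> I \<and> x \<in> N}"

abbreviation ideal_power :: "('a, 'r) ring_scheme \<Rightarrow> 'a set \<Rightarrow> nat \<Rightarrow> 'a set" where
  "ideal_power R I p \<equiv> I [^]\<^bsub>ideals_set R\<^esub> p"

text \<open>The free module of rank \<open>n\<close>.\<close>

abbreviation free_module :: "('a, 'r) ring_scheme \<Rightarrow> nat \<Rightarrow> ('a, nat \<Rightarrow> 'a) module" where
  "free_module R n \<equiv> ring.func_space R {..<n}"

text \<open>The residue field \<open>R/I\<close> of a maximal ideal \<open>I\<close>, as an \<open>R\<close>-module.\<close>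

definition residue_module :: "('a, 'r) ring_scheme \<Rightarrow> 'a set \<Rightarrow> ('a, 'a set) module" where
  "residue_module R I = quotient_module (self_module R) (carrier R) I"

text \<open>
  An \<open>R\<close>-module annihilated by \<open>I\<close>, as a module over \<open>R/I\<close>: the image of a coset under
  \<open>\<lambda>r. r \<odot> v\<close> is then a singleton.
\<close>

definition residue_space :: "('a, 'b, 'm) module_scheme \<Rightarrow> ('a set, 'b) module" where
  "residue_space V =
    \<lparr>carrier = carrier V, mult = undefined, one = undefined, zero = zero V, add = add V,
     smult = (\<lambda>c v. the_elem ((\<lambda>r. r \<odot>\<^bsub>V\<^esub> v) ` c))\<rparr>"

definition residue_dim ::
    "('a, 'r) ring_scheme \<Rightarrow> 'a set \<Rightarrow> ('a, 'b, 'm) module_scheme \<Rightarrow> nat" where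
  "residue_dim R I V = vectorspace.dim (R Quot I) (residue_space V)"


section \<open>Tensor products\<close>

text \<open>
  \<open>M \<otimes>\<^sub>R N\<close> is the free module on the set of pairs modulo the submodule generated by the
  bilinearity relations.
\<close>

definition finsupp_module :: "('a, 'r) ring_scheme \<Rightarrow> 's set \<Rightarrow> ('a, 's \<Rightarrow> 'a) module" where
  "finsupp_module R S = (ring.func_space R S)
    \<lparr>carrier := {f \<in> S \<rightarrow>\<^sub>E carrier R. finite {s \<in> S. f s \<noteq> \<zero>\<^bsub>R\<^esub>}}\<rparr>"

definition finsupp_single :: "('a, 'r) ring_scheme \<Rightarrow> 's set \<Rightarrow> 's \<Rightarrow> ('s \<Rightarrow> 'a)" where
  "finsupp_single R S t = (\<lambda>s\<in>S. if s = t then \<one>\<^bsub>R\<^esub> else \<zero>\<^bsub>R\<^esub>)"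

definition tensor_relations ::
    "('a, 'r) ring_scheme \<Rightarrow> ('a, 'b, 'm) module_scheme \<Rightarrow> ('a, 'c, 'n) module_scheme
      \<Rightarrow> ('b \<times> 'c \<Rightarrow> 'a) set" where
  "tensor_relations R M N =
    (let P = finsupp_module R (carrier M \<times> carrier N);
         e = (\<lambda>x y. finsupp_single R (carrier M \<times> carrier N) (x, y))
     in module.span R P
      ({e (x \<oplus>\<^bsub>M\<^esub> x') y \<ominus>\<^bsub>P\<^esub> (e x y \<oplus>\<^bsub>P\<^esub> e x' y) | x x' y.
          x \<in> carrier M \<and> x' \<in> carrier M \<and> y \<in> carrier N} \<union>
       {e x (y \<oplus>\<^bsub>N\<^esub> y') \<ominus>\<^bsub>P\<^esub> (e x y \<oplus>\<^bsub>P\<^esub> e x y') | x y y'.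
          x \<in> carrier M \<and> y \<in> carrier N \<and> y' \<in> carrier N} \<union>
       {e (r \<odot>\<^bsub>M\<^esub> x) y \<ominus>\<^bsub>P\<^esub> (r \<odot>\<^bsub>P\<^esub> e x y) | r x y.
          r \<in> carrier R \<and> x \<in> carrier M \<and> y \<in> carrier N} \<union>
       {e x (r \<odot>\<^bsub>N\<^esub> y) \<ominus>\<^bsub>P\<^esub> (r \<odot>\<^bsub>P\<^esub> e x y) | r x y.
          r \<in> carrier R \<and> x \<in> carrier M \<and> y \<in> carrier N}))"

definition tensor ::
    "('a, 'r) ring_scheme \<Rightarrow> ('a, 'b, 'm) module_scheme \<Rightarrow> ('a, 'c, 'n) module_scheme
      \<Rightarrow> ('a, ('b \<times> 'c \<Rightarrow> 'a) set) module" where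
  "tensor R M N =
    (let P = finsupp_module R (carrier M \<times> carrier N)
     in quotient_module P (carrier P) (tensor_relations R M N))"

definition pure_tensor ::
    "('a, 'r) ring_scheme \<Rightarrow> ('a, 'b, 'm) module_scheme \<Rightarrow> ('a, 'c, 'n) module_scheme
      \<Rightarrow> 'b \<Rightarrow> 'c \<Rightarrow> ('b \<times> 'c \<Rightarrow> 'a) set" where
  "pure_tensor R M N x y =
    tensor_relations R M N +>\<^bsub>finsupp_module R (carrier M \<times> carrier N)\<^esub>
      finsupp_single R (carrier M \<times> carrier N) (x, y)"

text \<open>
  The map \<open>\<phi> \<otimes> id : M \<otimes> N \<rightarrow> M' \<otimes> N\<close>: a representative \<open>\<Sum> r\<^sub>i \<cdot> (x\<^sub>i, y\<^sub>i)\<close> of the class \<open>X\<close>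
  is sent to the class of \<open>\<Sum> r\<^sub>i \<cdot> (\<phi> x\<^sub>i, y\<^sub>i)\<close>, that is, to \<open>\<Sum> r\<^sub>i (\<phi> x\<^sub>i \<otimes> y\<^sub>i)\<close>.
\<close>

definition tensor_map ::
    "('a, 'r) ring_scheme \<Rightarrow> ('a, 'b, 'm) module_scheme \<Rightarrow> ('a, 'd, 'k) module_scheme
      \<Rightarrow> ('a, 'c, 'n) module_scheme \<Rightarrow> ('b \<Rightarrow> 'd)
      \<Rightarrow> ('b \<times> 'c \<Rightarrow> 'a) set \<Rightarrow> ('d \<times> 'c \<Rightarrow> 'a) set" where
  "tensor_map R M M' N \<phi> X =
    (\<Union>f\<in>X. \<Oplus>\<^bsub>tensor R M' N\<^esub> t\<in>{t \<in> carrier M \<times> carrier N. f t \<noteq> \<zero>\<^bsub>R\<^esub>}.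
       f t \<odot>\<^bsub>tensor R M' N\<^esub> pure_tensor R M' N (\<phi> (fst t)) (snd t))"


section \<open>Complexes and free resolutions\<close>

text \<open>
  Complexes live in degrees \<open>n \<ge> 0\<close>; \<open>differential C n\<close> maps \<open>obj C n\<close> to \<open>obj C (n - 1)\<close> for
  \<open>n \<ge> 1\<close>, and \<open>differential C 0\<close> is ignored.
\<close>

record ('a, 'b) chain_complex =
  obj :: "nat \<Rightarrow> ('a, 'b) module"
  differential :: "nat \<Rightarrow> 'b \<Rightarrow> 'b"

definition cycles :: "('a, 'b) chain_complex \<Rightarrow> nat \<Rightarrow> 'b set" where
  "cycles C n =
    (if n = 0 then carrier (obj C 0)
     else {x \<in> carrier (obj C n). differential C n x = \<zero>\<^bsub>obj C (n - 1)\<^esub>})"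

definition boundaries :: "('a, 'b) chain_complex \<Rightarrow> nat \<Rightarrow> 'b set" where
  "boundaries C n = differential C (Suc n) ` carrier (obj C (Suc n))"

definition homology :: "('a, 'b) chain_complex \<Rightarrow> nat \<Rightarrow> ('a, 'b set) module" where
  "homology C n = quotient_module (obj C n) (cycles C n) (boundaries C n)"

definition resolution ::
    "('a, 'r) ring_scheme \<Rightarrow> ('a, 'b, 'm) module_scheme \<Rightarrow> ('a, 'c) chain_complex
      \<Rightarrow> ('c \<Rightarrow> 'b) \<Rightarrow> bool" where
  "resolution R M C \<epsilon> \<longleftrightarrow>
    (\<forall>n. differential C (Suc n) \<in> module_hom R (obj C (Suc n)) (obj C n)) \<and>
    (\<forall>n. cycles C (Suc n) = boundaries C (Suc n)) \<and>
    \<epsilon> \<in> module_hom R (obj C 0) M \<and>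
    \<epsilon> ` carrier (obj C 0) = carrier M \<and>
    {x \<in> carrier (obj C 0). \<epsilon> x = \<zero>\<^bsub>M\<^esub>} = boundaries C 0"

text \<open>
  Resolutions by free modules of finite rank; over a Noetherian ring they exist for every
  finitely generated module.
\<close>

definition free_resolution ::
    "('a, 'r) ring_scheme \<Rightarrow> ('a, 'b, 'm) module_scheme \<Rightarrow> ('a, nat \<Rightarrow> 'a) chain_complex \<Rightarrow> bool"
  where
  "free_resolution R M C \<longleftrightarrow>
    (\<forall>n. \<exists>b. obj C n = free_module R b) \<and> (\<exists>\<epsilon>. resolution R M C \<epsilon>)"

definition minimal_free_resolution ::
    "('a, 'r) ring_scheme \<Rightarrow> 'a set \<Rightarrow> ('a, 'b, 'm) module_scheme
      \<Rightarrow> ('a, nat \<Rightarrow> 'a) chain_complex \<Rightarrow> bool" where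
  "minimal_free_resolution R \<mm> M C \<longleftrightarrow>
    free_resolution R M C \<and>
    (\<forall>n. boundaries C n \<subseteq> ideal_smult R \<mm> (obj C n) (carrier (obj C n)))"


section \<open>Tor and Betti numbers\<close>

definition tensor_complex ::
    "('a, 'r) ring_scheme \<Rightarrow> ('a, 'b) chain_complex \<Rightarrow> ('a, 'c, 'n) module_scheme
      \<Rightarrow> ('a, ('b \<times> 'c \<Rightarrow> 'a) set) chain_complex" where
  "tensor_complex R C N =
    \<lparr>obj = (\<lambda>n. tensor R (obj C n) N),
     differential = (\<lambda>n. tensor_map R (obj C n) (obj C (n - 1)) N (differential C n))\<rparr>"

text \<open>The choice of the resolution affects \<open>Tor\<close> only up to isomorphism.\<close>

definition Tor ::
    "('a, 'r) ring_scheme \<Rightarrow> nat \<Rightarrow> ('a, 'b, 'm) module_scheme \<Rightarrow> ('a, 'c, 'n) module_scheme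
      \<Rightarrow> ('a, ((nat \<Rightarrow> 'a) \<times> 'c \<Rightarrow> 'a) set set) module" where
  "Tor R i M N = homology (tensor_complex R (SOME C. free_resolution R M C) N) i"

definition betti ::
    "('a, 'r) ring_scheme \<Rightarrow> 'a set \<Rightarrow> ('a, 'b, 'm) module_scheme \<Rightarrow> nat \<Rightarrow> nat" where
  "betti R \<mm> M i = residue_dim R \<mm> (Tor R i M (residue_module R \<mm>))"

text \<open>
  Gradings are given by their families of homogeneous components, indexed by \<open>int\<close>.
  The component of degree \<open>j\<close> of \<open>\<Oplus>\<^sub>l R(-s l)\<close> is \<open>\<Oplus>\<^sub>l R\<^sub>j\<^sub>-\<^sub>s\<^sub>l\<close>.
\<close>

definition free_grading ::
    "('a, 'r) ring_scheme \<Rightarrow> (int \<Rightarrow> 'a set) \<Rightarrow> nat \<Rightarrow> (nat \<Rightarrow> int) \<Rightarrow> int \<Rightarrow> (nat \<Rightarrow> 'a) set" where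
  "free_grading R gR b s j = {f \<in> carrier (free_module R b). \<forall>l<b. f l \<in> gR (j - s l)}"

definition graded_free_resolution ::
    "('a, 'r) ring_scheme \<Rightarrow> (int \<Rightarrow> 'a set) \<Rightarrow> ('a, 'b, 'm) module_scheme \<Rightarrow> (int \<Rightarrow> 'b set)
      \<Rightarrow> ('a, nat \<Rightarrow> 'a) chain_complex \<Rightarrow> (nat \<Rightarrow> int \<Rightarrow> (nat \<Rightarrow> 'a) set) \<Rightarrow> bool" where
  "graded_free_resolution R gR M gM C gC \<longleftrightarrow>
    (\<forall>n. \<exists>b s. obj C n = free_module R b \<and> gC n = free_grading R gR b s) \<and>
    (\<forall>n j. differential C (Suc n) ` gC (Suc n) j \<subseteq> gC n j) \<and>
    (\<exists>\<epsilon>. resolution R M C \<epsilon> \<and> (\<forall>j. \<epsilon> ` gC 0 j \<subseteq> gM j))"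

definition tensor_grading ::
    "('a, 'r) ring_scheme \<Rightarrow> ('a, 'b, 'm) module_scheme \<Rightarrow> (int \<Rightarrow> 'b set)
      \<Rightarrow> ('a, 'c, 'n) module_scheme \<Rightarrow> (int \<Rightarrow> 'c set) \<Rightarrow> int \<Rightarrow> ('b \<times> 'c \<Rightarrow> 'a) set set" where
  "tensor_grading R M gM N gN j =
    generate (add_monoid (tensor R M N))
      {pure_tensor R M N x y | x y p q. p + q = j \<and> x \<in> gM p \<and> y \<in> gN q}"

text \<open>
  \<open>Tor\<^sub>i(M, N)\<^sub>j\<close>, the classes of the cycles of degree \<open>j\<close>. This is a submodule only if the
  elements of positive degree of \<open>R\<close> annihilate \<open>Tor\<close>, as they do for \<open>N = k\<close>.
\<close>

definition graded_Tor ::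
    "('a, 'r) ring_scheme \<Rightarrow> (int \<Rightarrow> 'a set) \<Rightarrow> nat \<Rightarrow> ('a, 'b, 'm) module_scheme
      \<Rightarrow> (int \<Rightarrow> 'b set) \<Rightarrow> ('a, 'c, 'n) module_scheme \<Rightarrow> (int \<Rightarrow> 'c set) \<Rightarrow> int
      \<Rightarrow> ('a, ((nat \<Rightarrow> 'a) \<times> 'c \<Rightarrow> 'a) set set) module" where
  "graded_Tor R gR i M gM N gN j =
    (let (C, gC) = (SOME (C, gC). graded_free_resolution R gR M gM C gC);
         T = tensor_complex R C N
     in (homology T i)\<lparr>carrier :=
          (\<lambda>z. boundaries T i +>\<^bsub>obj T i\<^esub> z) `
            (cycles T i \<inter> tensor_grading R (obj C i) (gC i) N gN j)\<rparr>)"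

text \<open>Here \<open>I\<close> is the irrelevant ideal and the residue field \<open>R/I\<close> sits in degree \<open>0\<close>.\<close>

definition graded_betti ::
    "('a, 'r) ring_scheme \<Rightarrow> (int \<Rightarrow> 'a set) \<Rightarrow> 'a set \<Rightarrow> ('a, 'b, 'm) module_scheme
      \<Rightarrow> (int \<Rightarrow> 'b set) \<Rightarrow> nat \<Rightarrow> int \<Rightarrow> nat" where
  "graded_betti R gR I M gM i j =
    (let k = residue_module R I
     in residue_dim R I
          (graded_Tor R gR i M gM k (\<lambda>q. if q = 0 then carrier k else {\<zero>\<^bsub>k\<^esub>}) j))"


section \<open>Associated graded objects\<close>

definition stable_filtration ::
    "('a, 'r) ring_scheme \<Rightarrow> 'a set \<Rightarrow> ('a, 'b, 'm) module_scheme \<Rightarrow> (nat \<Rightarrow> 'b set) \<Rightarrow> bool" where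
  "stable_filtration R \<mm> M F \<longleftrightarrow>
    F 0 = carrier M \<and>
    (\<forall>p. submodule R (F p) M \<and> F (Suc p) \<subseteq> F p \<and> ideal_smult R \<mm> M (F p) \<subseteq> F (Suc p)) \<and>
    (\<exists>p0. \<forall>p\<ge>p0. ideal_smult R \<mm> M (F p) = F (Suc p))"

text \<open>
  \<open>\<Oplus>\<^sub>p F\<^sub>p/F\<^sub>p\<^sub>+\<^sub>1\<close>, whose elements are the finitely supported sequences of cosets. Scalars are
  elements of \<open>\<Oplus>\<^sub>p \<mm>\<^sup>p/\<mm>\<^sup>p\<^sup>+\<^sup>1\<close>, and the degree \<open>n\<close> part of \<open>a \<odot> u\<close> is \<open>\<Sum>\<^sub>p\<^sub>\<le>\<^sub>n a\<^sub>p \<cdot> u\<^sub>n\<^sub>-\<^sub>p\<close>.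
\<close>

definition gr_module ::
    "('a, 'b, 'm) module_scheme \<Rightarrow> (nat \<Rightarrow> 'b set) \<Rightarrow> (nat \<Rightarrow> 'a set, nat \<Rightarrow> 'b set) module" where
  "gr_module M F =
    \<lparr>carrier = {u. (\<forall>p. u p \<in> carrier (quotient_module M (F p) (F (Suc p)))) \<and>
                   finite {p. u p \<noteq> F (Suc p)}},
     mult = undefined, one = undefined,
     zero = (\<lambda>p. F (Suc p)),
     add = (\<lambda>u v p. u p <+>\<^bsub>M\<^esub> v p),
     smult = (\<lambda>a u n. \<Oplus>\<^bsub>quotient_module M (F n) (F (Suc n))\<^esub> p\<in>{..n}.
       (\<Union>r\<in>a p. \<Union>x\<in>u (n - p). F (Suc n) +>\<^bsub>M\<^esub> (r \<odot>\<^bsub>M\<^esub> x)))\<rparr>"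

definition gr_map ::
    "('b, 'm) ring_scheme \<Rightarrow> (nat \<Rightarrow> 'b set) \<Rightarrow> ('c \<Rightarrow> 'b) \<Rightarrow> (nat \<Rightarrow> 'c set) \<Rightarrow> (nat \<Rightarrow> 'b set)" where
  "gr_map N G f u = (\<lambda>p. \<Union>x\<in>u p. G (Suc p) +>\<^bsub>N\<^esub> f x)"

definition gr_ring :: "('a, 'r) ring_scheme \<Rightarrow> 'a set \<Rightarrow> (nat \<Rightarrow> 'a set) ring" where
  "gr_ring R \<mm> =
    (let G = gr_module (self_module R) (ideal_power R \<mm>)
     in \<lparr>carrier = carrier G, mult = smult G,
         one = (\<lambda>p. ideal_power R \<mm> (Suc p) +>\<^bsub>R\<^esub> (if p = 0 then \<one>\<^bsub>R\<^esub> else \<zero>\<^bsub>R\<^esub>)),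
         zero = zero G, add = add G\<rparr>)"

text \<open>The grading of both \<^const>\<open>gr_ring\<close> and \<^const>\<open>gr_module\<close>; it vanishes in negative degrees.\<close>

definition gr_grading :: "(nat \<Rightarrow> 'b set, 'm) ring_scheme \<Rightarrow> int \<Rightarrow> (nat \<Rightarrow> 'b set) set" where
  "gr_grading G j = {u \<in> carrier G. \<forall>p. int p \<noteq> j \<longrightarrow> u p = \<zero>\<^bsub>G\<^esub> p}"

text \<open>\<open>\<Oplus>\<^sub>p\<^sub>\<ge>\<^sub>1 \<mm>\<^sup>p/\<mm>\<^sup>p\<^sup>+\<^sup>1\<close>, the kernel of the projection of \<^const>\<open>gr_ring\<close> onto \<open>k = R/\<mm>\<close>.\<close>

definition gr_irrelevant :: "('a, 'r) ring_scheme \<Rightarrow> 'a set \<Rightarrow> (nat \<Rightarrow> 'a set) set" where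
  "gr_irrelevant R \<mm> = {a \<in> carrier (gr_ring R \<mm>). a 0 = \<zero>\<^bsub>gr_ring R \<mm>\<^esub> 0}"

definition gr_betti ::
    "('a, 'r) ring_scheme \<Rightarrow> 'a set \<Rightarrow> ('a, 'b, 'm) module_scheme \<Rightarrow> (nat \<Rightarrow> 'b set)
      \<Rightarrow> nat \<Rightarrow> int \<Rightarrow> nat" where
  "gr_betti R \<mm> M F i j =
    graded_betti (gr_ring R \<mm>) (gr_grading (gr_ring R \<mm>)) (gr_irrelevant R \<mm>)
      (gr_module M F) (gr_grading (gr_module M F)) i j"

definition gr_top_degree ::
    "('a, 'r) ring_scheme \<Rightarrow> 'a set \<Rightarrow> ('a, 'b, 'm) module_scheme \<Rightarrow> (nat \<Rightarrow> 'b set)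
      \<Rightarrow> nat \<Rightarrow> ereal" where
  "gr_top_degree R \<mm> M F i = Sup {ereal (real_of_int j) | j. gr_betti R \<mm> M F i j \<noteq> 0}"

definition gr_regularity ::
    "('a, 'r) ring_scheme \<Rightarrow> 'a set \<Rightarrow> ('a, 'b, 'm) module_scheme \<Rightarrow> (nat \<Rightarrow> 'b set) \<Rightarrow> ereal" where
  "gr_regularity R \<mm> M F =
    Sup {ereal (real_of_int (j - int i)) | i j. gr_betti R \<mm> M F i j \<noteq> 0}"

definition homogeneous_type ::
    "('a, 'r) ring_scheme \<Rightarrow> 'a set \<Rightarrow> ('a, 'b, 'm) module_scheme \<Rightarrow> (nat \<Rightarrow> 'b set) \<Rightarrow> bool" where
  "homogeneous_type R \<mm> M F \<longleftrightarrow>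
    (\<forall>i. betti R \<mm> M i = betti (gr_ring R \<mm>) (gr_irrelevant R \<mm>) (gr_module M F) i)"


section \<open>Linearity defect\<close>

text \<open>
  The filtration \<open>(\<FF>\<^sup>i C)\<^sub>n = \<mm>\<^sup>i\<^sup>-\<^sup>n C\<^sub>n\<close>; truncated subtraction gives \<open>\<mm>\<^sup>j = R\<close> for \<open>j \<le> 0\<close>.
\<close>

definition standard_filtration ::
    "('a, 'r) ring_scheme \<Rightarrow> 'a set \<Rightarrow> ('a, 'b) chain_complex \<Rightarrow> nat \<Rightarrow> nat \<Rightarrow> 'b set" where
  "standard_filtration R \<mm> C n i =
    ideal_smult R (ideal_power R \<mm> (i - n)) (obj C n) (carrier (obj C n))"

definition lin_complex ::
    "('a, 'r) ring_scheme \<Rightarrow> 'a set \<Rightarrow> ('a, 'b) chain_complex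
      \<Rightarrow> (nat \<Rightarrow> 'a set, nat \<Rightarrow> 'b set) chain_complex" where
  "lin_complex R \<mm> C =
    \<lparr>obj = (\<lambda>n. gr_module (obj C n) (standard_filtration R \<mm> C n)),
     differential = (\<lambda>n. gr_map (obj C (n - 1)) (standard_filtration R \<mm> C (n - 1))
       (differential C n))\<rparr>"

text \<open>Minimal free resolutions are unique up to isomorphism, so the choice is immaterial.\<close>

definition linearity_defect ::
    "('a, 'r) ring_scheme \<Rightarrow> 'a set \<Rightarrow> ('a, 'b, 'm) module_scheme \<Rightarrow> ereal" where
  "linearity_defect R \<mm> M =
    (let C = (SOME C. minimal_free_resolution R \<mm> M C)
     in Sup {ereal (real i) | i. \<not> zero_module (homology (lin_complex R \<mm> C) i)})"

end

theory Submission imports Defs "HOL-Algebra.UnivPoly" begin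

text \<open>
  Lift minimal generators of the filtration step by step. Artin--Rees keeps the induced filtrations
  on the kernels stable, so this gives a resolution \<open>C\<close> of \<open>M\<close> over \<open>R\<close> by filtered free modules,
  with strict differentials, whose associated graded complex is the minimal graded free resolution
  of \<open>gr M\<close>; the shifts of its generators are the degrees in which the graded Betti numbers do not
  vanish. If \<open>M\<close> is of homogeneous type, the ranks of \<open>C\<close> are the Betti numbers of \<open>M\<close>, so \<open>C\<close> itself
  is minimal. Let \<open>i\<close> exceed the linearity defect. If all generators of \<open>C\<^sub>i\<^sub>-\<^sub>1\<close> had shifts below
  \<open>a - 1\<close>, the differential would send a generator of \<open>C\<^sub>i\<close> with shift \<open>a\<close> into \<open>\<mm>\<^sup>2 C\<^sub>i\<^sub>-\<^sub>1\<close>, and its class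
  would be a nonzero homology class of the linear part. Hence \<open>max (shift) - i\<close> does not increase
  with \<open>i\<close> beyond the linearity defect \<open>d\<close>, and the regularity is attained at some \<open>i \<le> d\<close>.
\<close>

text \<open>\<open>Tor\<close>, \<open>graded_Tor\<close> and \<open>linearity_defect\<close> use
  resolutions selected by \<open>SOME\<close>, not the one constructed here. Betti numbers are
  therefore rewritten with \<open>tor_cycles\<close> and \<open>tor_bounds\<close>, submodules of
  the free modules themselves, and carried over by chain maps in both directions: the composite is
  homotopic to the identity, and a homotopy changes a lift of a cycle of
  \<open>C \<otimes> R/I\<close> only by a member of \<open>tor_bounds\<close>. Linear parts of
  different resolutions are never compared; a single basis vector is moved into the selected
  resolution and back. Homogeneous type enters as an inequality: the ranks are at most the Betti
  numbers of \<open>gr M\<close>, hence of \<open>M\<close>, and ranks that do not exceed the Betti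
  numbers force minimality. Artin--Rees is proved by leading coefficients of monomials in generators
  of the ideal, with Dickson's lemma and the chain condition, instead of finite generation over a
  Rees algebra. Elements of associated graded objects are represented by finite sequences of lifts,
  \<open>fin_seqs\<close>. A scalar sequence is a polynomial, so the ring laws of
  \<open>gr_ring\<close> come from \<open>UP R\<close>.\<close>

lemma module_hom_zero:
  assumes "module R M" "module R N" "f \<in> module_hom R M N"
  shows "f \<zero>\<^bsub>M\<^esub> = \<zero>\<^bsub>N\<^esub>"
proof -
  interpret mod_hom R M N f
    using assms by (simp add: mod_hom_def mod_hom_axioms_def)
  show ?thesis by simp
qed

lemma module_hom_minus:
  assumes "module R M" "module R N" "f \<in> module_hom R M N" "x \<in> carrier M" "y \<in> carrier M"
  shows "f (x \<ominus>\<^bsub>M\<^esub> y) = f x \<ominus>\<^bsub>N\<^esub> f y"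
proof -
  interpret mod_hom R M N f
    using assms by (simp add: mod_hom_def mod_hom_axioms_def)
  show ?thesis using assms by simp
qed

lemma module_hom_finsum:
  assumes "module R M" "module R N" "f \<in> module_hom R M N" "finite A" "g \<in> A \<rightarrow> carrier M"
  shows "f (\<Oplus>\<^bsub>M\<^esub>a\<in>A. g a) = (\<Oplus>\<^bsub>N\<^esub>a\<in>A. f (g a))"
proof -
  interpret mod_hom R M N f
    using assms by (simp add: mod_hom_def mod_hom_axioms_def)
  interpret M': module R M by fact
  interpret N': module R N by fact
  show ?thesis using assms(4,5)
  proof (induction A rule: finite_induct)
    case (insert a A)
    then have "g a \<in> carrier M" "g \<in> A \<rightarrow> carrier M" "(\<lambda>a. f (g a)) \<in> A \<rightarrow> carrier N"
      by auto
    with insert show ?case by simp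
  qed auto
qed

lemma module_homI:
  assumes "\<And>x. x \<in> carrier M \<Longrightarrow> f x \<in> carrier N"
    and "\<And>x y. x \<in> carrier M \<Longrightarrow> y \<in> carrier M \<Longrightarrow> f (x \<oplus>\<^bsub>M\<^esub> y) = f x \<oplus>\<^bsub>N\<^esub> f y"
    and "\<And>r x. r \<in> carrier R \<Longrightarrow> x \<in> carrier M \<Longrightarrow> f (r \<odot>\<^bsub>M\<^esub> x) = r \<odot>\<^bsub>N\<^esub> f x"
  shows "f \<in> module_hom R M N"
  using assms unfolding module_hom_def by auto

lemma module_hom_in: "f \<in> module_hom R M N \<Longrightarrow> x \<in> carrier M \<Longrightarrow> f x \<in> carrier N"
  by (auto simp: module_hom_def)

lemma module_hom_comp:
  assumes "f \<in> module_hom R M N" "g \<in> module_hom R N P"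
  shows "(\<lambda>x. g (f x)) \<in> module_hom R M P"
  using assms unfolding module_hom_def by (auto simp: Pi_iff)

lemma (in module) hom_sub:
  assumes "module R N" "f \<in> module_hom R N M" "g \<in> module_hom R N M"
  shows "(\<lambda>x. f x \<ominus>\<^bsub>M\<^esub> g x) \<in> module_hom R N M"
proof (rule module_homI)
  note [simp] = module_hom_in[OF assms(2)] module_hom_in[OF assms(3)]
  fix x assume [simp]: "x \<in> carrier N"
  show "f x \<ominus>\<^bsub>M\<^esub> g x \<in> carrier M" by simp
  fix y assume [simp]: "y \<in> carrier N"
  show "f (x \<oplus>\<^bsub>N\<^esub> y) \<ominus>\<^bsub>M\<^esub> g (x \<oplus>\<^bsub>N\<^esub> y) = f x \<ominus>\<^bsub>M\<^esub> g x \<oplus>\<^bsub>M\<^esub> (f y \<ominus>\<^bsub>M\<^esub> g y)"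
    using assms by (simp add: module_hom_add M.minus_eq M.minus_add M.a_ac)
next
  note [simp] = module_hom_in[OF assms(2)] module_hom_in[OF assms(3)]
  fix x r assume [simp]: "x \<in> carrier N" "r \<in> carrier R"
  show "f (r \<odot>\<^bsub>N\<^esub> x) \<ominus>\<^bsub>M\<^esub> g (r \<odot>\<^bsub>N\<^esub> x) = r \<odot>\<^bsub>M\<^esub> (f x \<ominus>\<^bsub>M\<^esub> g x)"
    using assms by (simp add: module_hom_smult M.minus_eq smult_r_distr smult_r_minus)
qed

section \<open>Submodules: closure properties, preimages, images and sums\<close>

lemma submodule_in: "submodule R N M \<Longrightarrow> x \<in> N \<Longrightarrow> x \<in> carrier M"
  by (auto simp: submodule_def)

lemma submodule_add: "submodule R N M \<Longrightarrow> x \<in> N \<Longrightarrow> y \<in> N \<Longrightarrow> x \<oplus>\<^bsub>M\<^esub> y \<in> N"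
  by (auto simp: submodule_def)

lemma submodule_smult: "submodule R N M \<Longrightarrow> r \<in> carrier R \<Longrightarrow> x \<in> N \<Longrightarrow> r \<odot>\<^bsub>M\<^esub> x \<in> N"
  by (auto simp: submodule_def)

lemma submodule_zero: "submodule R N M \<Longrightarrow> \<zero>\<^bsub>M\<^esub> \<in> N"
  by (auto simp: submodule_def)

text \<open>The locale \<open>submodule\<close> has no clause for negation; closure under it comes
  from the scalar \<open>\<ominus> \<one>\<close>.\<close>

lemma submodule_minus:
  assumes "submodule R N M" "x \<in> N" "y \<in> N"
  shows "x \<ominus>\<^bsub>M\<^esub> y \<in> N"
proof -
  interpret LinearCombinations.submodule R N M by fact
  interpret module R M by (rule module)
  have "(\<ominus>\<^bsub>R\<^esub> \<one>\<^bsub>R\<^esub>) \<odot>\<^bsub>M\<^esub> y \<in> N"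
    using submodule_smult[OF assms(1) _ assms(3)] by simp
  then have "\<ominus>\<^bsub>M\<^esub> y \<in> N"
    using smult_minus_1 submodule_in[OF assms(1,3)] by simp
  then show ?thesis unfolding a_minus_def using assms by auto
qed

lemma submodule_minusD:
  assumes "submodule R N M" "x \<in> carrier M" "y \<in> N" "x \<ominus>\<^bsub>M\<^esub> y \<in> N"
  shows "x \<in> N"
proof -
  interpret LinearCombinations.submodule R N M by fact
  interpret module R M by (rule module)
  have "(x \<ominus>\<^bsub>M\<^esub> y) \<oplus>\<^bsub>M\<^esub> y \<in> N" using assms by (intro submodule_add)
  moreover have "(x \<ominus>\<^bsub>M\<^esub> y) \<oplus>\<^bsub>M\<^esub> y = x"
    using assms(2) submodule_in[OF assms(1,3)] by (simp add: M.minus_eq M.a_assoc M.l_neg)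
  ultimately show ?thesis by simp
qed

lemma submodule_finsum:
  assumes "submodule R N M" "finite A" "\<And>a. a \<in> A \<Longrightarrow> g a \<in> N"
  shows "(\<Oplus>\<^bsub>M\<^esub>a\<in>A. g a) \<in> N"
proof -
  interpret LinearCombinations.submodule R N M by fact
  interpret module R M by (rule module)
  show ?thesis using assms(2,3)
  proof (induction A rule: finite_induct)
    case (insert a A)
    then have "(\<Oplus>\<^bsub>M\<^esub>a\<in>insert a A. g a) = g a \<oplus>\<^bsub>M\<^esub> (\<Oplus>\<^bsub>M\<^esub>a\<in>A. g a)"
      using subset by (intro finsum_insert) auto
    then show ?case using insert by auto
  qed auto
qed

lemma submodule_inter:
  assumes "submodule R N M" "submodule R N' M"
  shows "submodule R (N \<inter> N') M"
  using assms by (auto simp: submodule_def)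

lemma submodule_carrier: "module R M \<Longrightarrow> submodule R (carrier M) M"
  by (auto simp: submodule_def module.axioms module.smult_closed abelian_group.axioms
     intro: abelian_monoid.a_closed abelian_monoid.zero_closed)

lemma module_hom_vimage:
  assumes "module R M" "module R N" "f \<in> module_hom R M N" "submodule R K N"
  shows "submodule R {x \<in> carrier M. f x \<in> K} M"
proof -
  interpret mod_hom R M N f
    using assms by (simp add: mod_hom_def mod_hom_axioms_def)
  interpret K: LinearCombinations.submodule R K N by fact
  show ?thesis by unfold_locales auto
qed

lemma module_hom_image:
  assumes "module R M" "module R N" "f \<in> module_hom R M N" "submodule R K M"
  shows "submodule R (f ` K) N"
proof -
  interpret mod_hom R M N f
    using assms by (simp add: mod_hom_def mod_hom_axioms_def)
  interpret K: LinearCombinations.submodule R K M by fact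
  show ?thesis
  proof
    show "f ` K \<subseteq> carrier N" using K.subset by auto
    fix v w c assume "v \<in> f ` K" "w \<in> f ` K"
    then show "v \<oplus>\<^bsub>N\<^esub> w \<in> f ` K"
      using K.subset by (auto simp flip: f_add simp: subset_iff)
  next
    show "\<zero>\<^bsub>N\<^esub> \<in> f ` K" using K.zero_closed f0_is_0 by (metis imageI)
    fix v c assume "v \<in> f ` K" "c \<in> carrier R"
    then show "c \<odot>\<^bsub>N\<^esub> v \<in> f ` K"
      using K.subset by (auto simp flip: f_smult simp: subset_iff)
  qed
qed

lemma submodule_sum:
  assumes "submodule R N M" "submodule R N' M"
  shows "submodule R (N <+>\<^bsub>M\<^esub> N') M"
proof -
  interpret N: LinearCombinations.submodule R N M by fact
  interpret N': LinearCombinations.submodule R N' M by fact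
  interpret module R M by (rule N.module)
  note [simp] = N.subset[THEN subsetD] N'.subset[THEN subsetD]
  show ?thesis
  proof
    show "N <+>\<^bsub>M\<^esub> N' \<subseteq> carrier M" by (auto simp: set_add_def')
    have "\<zero>\<^bsub>M\<^esub> = \<zero>\<^bsub>M\<^esub> \<oplus>\<^bsub>M\<^esub> \<zero>\<^bsub>M\<^esub>" by simp
    then show "\<zero>\<^bsub>M\<^esub> \<in> N <+>\<^bsub>M\<^esub> N'" unfolding set_add_def' using N.zero_closed N'.zero_closed by blast
    fix v w assume "v \<in> N <+>\<^bsub>M\<^esub> N'" "w \<in> N <+>\<^bsub>M\<^esub> N'"
    then obtain a b c d where *: "a \<in> N" "b \<in> N'" "c \<in> N" "d \<in> N'" and "v = a \<oplus>\<^bsub>M\<^esub> b" "w = c \<oplus>\<^bsub>M\<^esub> d"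
      by (auto simp: set_add_def')
    then have "v \<oplus>\<^bsub>M\<^esub> w = (a \<oplus>\<^bsub>M\<^esub> c) \<oplus>\<^bsub>M\<^esub> (b \<oplus>\<^bsub>M\<^esub> d)" by (simp add: M.a_ac)
    then show "v \<oplus>\<^bsub>M\<^esub> w \<in> N <+>\<^bsub>M\<^esub> N'" unfolding set_add_def' using * N.m_closed N'.m_closed by blast
  next
    fix v c assume "v \<in> N <+>\<^bsub>M\<^esub> N'" and c: "c \<in> carrier R"
    then obtain a b where *: "a \<in> N" "b \<in> N'" and "v = a \<oplus>\<^bsub>M\<^esub> b"
      by (auto simp: set_add_def')
    then have "c \<odot>\<^bsub>M\<^esub> v = c \<odot>\<^bsub>M\<^esub> a \<oplus>\<^bsub>M\<^esub> c \<odot>\<^bsub>M\<^esub> b" using c by (simp add: smult_r_distr)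
    then show "c \<odot>\<^bsub>M\<^esub> v \<in> N <+>\<^bsub>M\<^esub> N'" unfolding set_add_def' using * c N.smult_closed N'.smult_closed by blast
  qed
qed

lemma sum_sub_left: "submodule R N M \<Longrightarrow> submodule R N' M \<Longrightarrow> N \<subseteq> N <+>\<^bsub>M\<^esub> N'"
proof
  assume N: "submodule R N M" and N': "submodule R N' M"
  interpret LinearCombinations.submodule R N M by fact
  interpret module R M by (rule module)
  fix x assume "x \<in> N"
  then have "x = x \<oplus>\<^bsub>M\<^esub> \<zero>\<^bsub>M\<^esub>" using submodule_in[OF N] by simp
  then show "x \<in> N <+>\<^bsub>M\<^esub> N'" unfolding set_add_def' using \<open>x \<in> N\<close> submodule_zero[OF N'] by blast
qed

lemma sum_sub_right: "submodule R N M \<Longrightarrow> submodule R N' M \<Longrightarrow> N' \<subseteq> N <+>\<^bsub>M\<^esub> N'"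
proof
  assume N: "submodule R N M" and N': "submodule R N' M"
  interpret LinearCombinations.submodule R N M by fact
  interpret module R M by (rule module)
  fix x assume "x \<in> N'"
  then have "x = \<zero>\<^bsub>M\<^esub> \<oplus>\<^bsub>M\<^esub> x" using submodule_in[OF N'] by simp
  then show "x \<in> N <+>\<^bsub>M\<^esub> N'" unfolding set_add_def' using \<open>x \<in> N'\<close> submodule_zero[OF N] by blast
qed

lemma sum_sub:
  assumes "submodule R K M" "N \<subseteq> K" "N' \<subseteq> K"
  shows "N <+>\<^bsub>M\<^esub> N' \<subseteq> K"
  using assms submodule_add[OF assms(1)] by (auto simp: set_add_def')

lemma in_sumE:
  assumes "x \<in> N <+>\<^bsub>M\<^esub> N'"
  obtains a b where "a \<in> N" "b \<in> N'" "x = a \<oplus>\<^bsub>M\<^esub> b"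
  using assms by (auto simp: set_add_def')

section \<open>Free modules\<close>

definition std_vec :: "('a, 'r) ring_scheme \<Rightarrow> nat \<Rightarrow> nat \<Rightarrow> nat \<Rightarrow> 'a" where
  "std_vec R b l = (\<lambda>i\<in>{..<b}. if i = l then \<one>\<^bsub>R\<^esub> else \<zero>\<^bsub>R\<^esub>)"

text \<open>Read as a function of \<open>f\<close>, this is the linear map out of the free module of
  rank \<open>b\<close> that sends basis vector \<open>l\<close> to \<open>u l\<close>. By
  \<open>free_hom_eq_comb\<close> every map out of a free module has this shape, so maps are
  constructed and compared on basis vectors only.\<close>

definition comb :: "('a, 'b, 'm) module_scheme \<Rightarrow> nat \<Rightarrow> (nat \<Rightarrow> 'b) \<Rightarrow> (nat \<Rightarrow> 'a) \<Rightarrow> 'b" where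
  "comb N b u f = (\<Oplus>\<^bsub>N\<^esub>l\<in>{..<b}. f l \<odot>\<^bsub>N\<^esub> u l)"

context cring
begin

lemma free_carrier: "carrier (free_module R b) = {..<b} \<rightarrow>\<^sub>E carrier R"
  by (simp add: func_space_def)

lemma free_in: "f \<in> carrier (free_module R b) \<Longrightarrow> l < b \<Longrightarrow> f l \<in> carrier R"
  by (auto simp: func_space_def)

lemma free_zero: "\<zero>\<^bsub>free_module R b\<^esub> = (\<lambda>l\<in>{..<b}. \<zero>)"
  by (simp add: func_space_def)

lemma free_add: "f \<oplus>\<^bsub>free_module R b\<^esub> g = (\<lambda>l\<in>{..<b}. f l \<oplus> g l)"
  by (simp add: func_space_def)

lemma free_smult: "r \<odot>\<^bsub>free_module R b\<^esub> g = (\<lambda>l\<in>{..<b}. r \<otimes> g l)"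
  by (simp add: func_space_def)

lemma free_module: "module R (free_module R b)"
  by (rule func_space_is_module)

lemma free_eqI:
  assumes "f \<in> carrier (free_module R b)" "g \<in> carrier (free_module R b)" "\<And>l. l < b \<Longrightarrow> f l = g l"
  shows "f = g"
  using assms unfolding free_carrier by (intro PiE_ext[of f "{..<b}" _ g]) auto

lemma free_minus:
  assumes "f \<in> carrier (free_module R b)" "g \<in> carrier (free_module R b)" "l < b"
  shows "(f \<ominus>\<^bsub>free_module R b\<^esub> g) l = f l \<ominus> g l"
proof -
  interpret F: module R "free_module R b" by (rule free_module)
  define h where "h = f \<ominus>\<^bsub>free_module R b\<^esub> g"
  have h: "h \<in> carrier (free_module R b)" unfolding h_def using assms(1,2) by (rule F.minus_closed)
  have "h \<oplus>\<^bsub>free_module R b\<^esub> g = f"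
    using assms(1,2) unfolding h_def by (simp add: F.M.minus_eq F.M.a_assoc F.M.l_neg)
  then have eq: "h l \<oplus> g l = f l"
    using assms(3) by (auto simp: free_add)
  have "h l \<in> carrier R" "g l \<in> carrier R" using free_in assms(2,3) h by blast+
  then have "h l = f l \<ominus> g l" unfolding eq[symmetric] by (simp add: minus_eq a_assoc r_neg)
  then show ?thesis by (simp add: h_def)
qed

lemma std_vec_closed: "std_vec R b l \<in> carrier (free_module R b)"
  by (auto simp: std_vec_def free_carrier)

lemma free_finsum:
  assumes "finite A" "g \<in> A \<rightarrow> carrier (free_module R b)" "i < b"
  shows "(\<Oplus>\<^bsub>free_module R b\<^esub>a\<in>A. g a) i = (\<Oplus>a\<in>A. g a i)"
proof -
  interpret F: module R "free_module R b" by (rule free_module)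
  show ?thesis using assms(1,2)
  proof (induction A rule: finite_induct)
    case empty
    then show ?case using assms(3) by (simp add: free_zero)
  next
    case (insert a A)
    have "g a i \<in> carrier R" "(\<lambda>a. g a i) \<in> A \<rightarrow> carrier R"
      using insert.prems assms(3) by (auto intro!: free_in)
    then show ?case using insert assms(3) by (simp add: free_add Pi_iff)
  qed
qed

lemma free_comb_std:
  assumes f: "f \<in> carrier (free_module R b)"
  shows "comb (free_module R b) b (std_vec R b) f = f"
proof -
  interpret F: module R "free_module R b" by (rule free_module)
  have c: "(\<lambda>l. f l \<odot>\<^bsub>free_module R b\<^esub> std_vec R b l) \<in> {..<b} \<rightarrow> carrier (free_module R b)"
    using f std_vec_closed by (auto intro!: free_in)
  show ?thesis
  proof (rule free_eqI)
    show "comb (free_module R b) b (std_vec R b) f \<in> carrier (free_module R b)"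
      unfolding comb_def using c by (intro F.finsum_closed)
    fix i assume i: "i < b"
    have "comb (free_module R b) b (std_vec R b) f i
        = (\<Oplus>l\<in>{..<b}. (f l \<odot>\<^bsub>free_module R b\<^esub> std_vec R b l) i)"
      unfolding comb_def using c i by (intro free_finsum) auto
    also have "\<dots> = (\<Oplus>l\<in>{..<b}. if i = l then f l else \<zero>)"
      using f i by (intro finsum_cong') (auto simp: free_smult std_vec_def free_in)
    also have "\<dots> = f i"
      using i f by (intro finsum_singleton) (auto intro: free_in)
    finally show "comb (free_module R b) b (std_vec R b) f i = f i" .
  qed (use f in auto)
qed

lemma comb_hom:
  assumes "module R N" "\<And>l. l < b \<Longrightarrow> u l \<in> carrier N"
  shows "comb N b u \<in> module_hom R (free_module R b) N"
proof -
  interpret N: module R N by fact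
  show ?thesis
  proof (rule module_homI)
    fix f assume f: "f \<in> carrier (free_module R b)"
    show "comb N b u f \<in> carrier N"
      unfolding comb_def using f assms(2) by (intro N.finsum_closed) (auto intro: free_in)
    fix g assume g: "g \<in> carrier (free_module R b)"
    have "comb N b u (f \<oplus>\<^bsub>free_module R b\<^esub> g)
        = (\<Oplus>\<^bsub>N\<^esub>l\<in>{..<b}. f l \<odot>\<^bsub>N\<^esub> u l \<oplus>\<^bsub>N\<^esub> g l \<odot>\<^bsub>N\<^esub> u l)"
      unfolding comb_def using f g assms(2)
      by (intro N.finsum_cong') (auto simp: free_add N.smult_l_distr free_in)
    also have "\<dots> = comb N b u f \<oplus>\<^bsub>N\<^esub> comb N b u g"
      unfolding comb_def using f g assms(2) by (intro N.finsum_addf) (auto simp: free_in)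
    finally show "comb N b u (f \<oplus>\<^bsub>free_module R b\<^esub> g) = comb N b u f \<oplus>\<^bsub>N\<^esub> comb N b u g" .
  next
    fix f r assume f: "f \<in> carrier (free_module R b)" and r: "r \<in> carrier R"
    have "r \<odot>\<^bsub>N\<^esub> comb N b u f = (\<Oplus>\<^bsub>N\<^esub>l\<in>{..<b}. r \<odot>\<^bsub>N\<^esub> (f l \<odot>\<^bsub>N\<^esub> u l))"
      unfolding comb_def using r f assms(2)
      by (intro N.finsum_smult_ldistr) (auto simp: free_in)
    also have "\<dots> = comb N b u (r \<odot>\<^bsub>free_module R b\<^esub> f)"
      unfolding comb_def using f r assms(2)
      by (intro N.finsum_cong') (auto simp: free_smult N.smult_assoc1 free_in)
    finally show "comb N b u (r \<odot>\<^bsub>free_module R b\<^esub> f) = r \<odot>\<^bsub>N\<^esub> comb N b u f" by simp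
  qed
qed

lemma comb_std:
  assumes "module R N" "\<And>l. l < b \<Longrightarrow> u l \<in> carrier N" "l < b"
  shows "comb N b u (std_vec R b l) = u l"
proof -
  interpret N: module R N by fact
  have "comb N b u (std_vec R b l) = (\<Oplus>\<^bsub>N\<^esub>i\<in>{..<b}. if l = i then u i else \<zero>\<^bsub>N\<^esub>)"
    unfolding comb_def using assms(2) by (intro N.finsum_cong') (auto simp: std_vec_def)
  also have "\<dots> = u l" using assms(2,3) by (intro N.M.finsum_singleton) auto
  finally show ?thesis .
qed

lemma free_hom_eq_comb:
  assumes N: "module R N" and g: "g \<in> module_hom R (free_module R b) N"
    and f: "f \<in> carrier (free_module R b)"
  shows "g f = comb N b (\<lambda>l. g (std_vec R b l)) f"
proof -
  interpret F: module R "free_module R b" by (rule free_module)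
  interpret N: module R N by fact
  have "g f = g (comb (free_module R b) b (std_vec R b) f)" using free_comb_std[OF f] by simp
  also have "\<dots> = (\<Oplus>\<^bsub>N\<^esub>l\<in>{..<b}. g (f l \<odot>\<^bsub>free_module R b\<^esub> std_vec R b l))"
    unfolding comb_def using f std_vec_closed
    by (intro module_hom_finsum[OF free_module N g]) (auto intro!: F.smult_closed free_in)
  also have "\<dots> = comb N b (\<lambda>l. g (std_vec R b l)) f"
    unfolding comb_def using f std_vec_closed module_hom_in[OF g]
    by (intro N.finsum_cong') (auto simp: module_hom_smult[OF g] free_in)
  finally show ?thesis .
qed

lemma comb_in_submodule:
  assumes "submodule R K N" "\<And>l. l < b \<Longrightarrow> f l \<odot>\<^bsub>N\<^esub> u l \<in> K"
  shows "comb N b u f \<in> K"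
  unfolding comb_def using assms by (intro submodule_finsum) auto

text \<open>The coordinate ideals may differ. Instances are \<open>shift_filt\<close> (powers of one
  ideal with varying exponents), vectors with prescribed vanishing coordinates, and an ideal times a
  free module.\<close>

lemma free_submoduleI:
  assumes "\<And>l. l < b \<Longrightarrow> ideal (I l) R"
  shows "submodule R {f \<in> carrier (free_module R b). \<forall>l<b. f l \<in> I l} (free_module R b)"
proof -
  interpret F: module R "free_module R b" by (rule free_module)
  let ?K = "{f \<in> carrier (free_module R b). \<forall>l<b. f l \<in> I l}"
  show ?thesis
  proof
    show "\<zero>\<^bsub>free_module R b\<^esub> \<in> ?K"
      using assms by (auto simp: free_zero free_carrier ideal_def additive_subgroup.zero_closed)
    fix f g assume fg: "f \<in> ?K" "g \<in> ?K"
    have "(f \<oplus>\<^bsub>free_module R b\<^esub> g) l \<in> I l" if "l < b" for l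
      using that fg additive_subgroup.a_closed[OF ideal.axioms(1)[OF assms[OF that]]]
      by (simp add: free_add)
    with fg show "f \<oplus>\<^bsub>free_module R b\<^esub> g \<in> ?K" by simp
  next
    fix c f assume fg: "f \<in> ?K" "c \<in> carrier R"
    have "(c \<odot>\<^bsub>free_module R b\<^esub> f) l \<in> I l" if "l < b" for l
      using that fg ideal.I_l_closed[OF assms[OF that]]
      by (simp add: free_smult)
    with fg show "c \<odot>\<^bsub>free_module R b\<^esub> f \<in> ?K" by simp
  qed auto
qed

end

text \<open>Projectivity of a free module, with an explicit lift: \<open>g\<close> after
  \<open>comb Q b p\<close> agrees with \<open>f\<close> on basis vectors, hence everywhere by
  \<open>free_hom_eq_comb\<close>. Only the images of the basis vectors have to be hit by
  \<open>g\<close>.\<close>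

lemma free_hom_lift:
  assumes "cring R" "module R Q" "module R N"
    and f: "f \<in> module_hom R (free_module R b) N" and g: "g \<in> module_hom R Q N"
    and p: "\<And>l. l < b \<Longrightarrow> p l \<in> carrier Q \<and> g (p l) = f (std_vec R b l)"
  shows "comb Q b p \<in> module_hom R (free_module R b) Q \<and>
    (\<forall>x \<in> carrier (free_module R b). g (comb Q b p x) = f x)"
proof -
  interpret R: cring R by fact
  have c: "comb Q b p \<in> module_hom R (free_module R b) Q"
    using p by (intro R.comb_hom assms) auto
  have "g (comb Q b p x) = f x" if "x \<in> carrier (free_module R b)" for x
  proof -
    have "g (comb Q b p x) = comb N b (\<lambda>l. g (comb Q b p (std_vec R b l))) x"
      using R.free_hom_eq_comb[OF assms(3) module_hom_comp[OF c g] that] .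
    also have "\<dots> = comb N b (\<lambda>l. f (std_vec R b l)) x"
    proof -
      interpret N: module R N by fact
      have "g (comb Q b p (std_vec R b l)) = f (std_vec R b l)" if "l < b" for l
        using R.comb_std[OF assms(2), of b p] p that by simp
      then show ?thesis unfolding comb_def[of N] using that module_hom_in[OF f] R.std_vec_closed
        by (intro N.finsum_cong') (auto intro!: N.smult_closed simp: R.free_in)
    qed
    also have "\<dots> = f x" using R.free_hom_eq_comb[OF assms(3) f that] by simp
    finally show ?thesis .
  qed
  with c show ?thesis by blast
qed

section \<open>Finite generation over Noetherian rings\<close>

text \<open>Finite generation of a subset inside its ambient module, so that submodules need not be
  turned into modules. For a submodule \<open>N\<close> the last inclusion is an equality, because
  \<open>S \<subseteq> N\<close>.\<close>

definition fin_gen :: "('a, 'r) ring_scheme \<Rightarrow> ('a, 'b, 'm) module_scheme \<Rightarrow> 'b set \<Rightarrow> bool" where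
  "fin_gen R M N \<longleftrightarrow> (\<exists>S. finite S \<and> S \<subseteq> N \<and> N \<subseteq> module.span R M S)"

lemma (in module) span_hom_image:
  assumes N: "module R N" and h: "h \<in> module_hom R M N" and S: "S \<subseteq> carrier M"
    and T: "submodule R T N" "h ` S \<subseteq> T" and y: "y \<in> span S"
  shows "h y \<in> T"
proof -
  have "submodule R {x \<in> carrier M. h x \<in> T} M"
    using module_hom_vimage[OF _ N h T(1)] module_axioms by simp
  then have "span S \<subseteq> {x \<in> carrier M. h x \<in> T}"
    using S T(2) by (intro span_is_subset) auto
  then show ?thesis using y by auto
qed

lemma (in module) smult_hom:
  assumes "r \<in> carrier R"
  shows "(\<lambda>x. r \<odot>\<^bsub>M\<^esub> x) \<in> module_hom R M M"
  using assms by (intro module_homI) (auto simp: smult_r_distr smult_assoc1[symmetric] R.m_comm)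

text \<open>The sum of the cyclic submodule of \<open>v\<close> and \<open>span S\<close> is a
  submodule containing \<open>insert v S\<close>, hence contains its span.\<close>

lemma (in module) span_insertE:
  assumes S: "S \<subseteq> carrier M" and v: "v \<in> carrier M" and y: "y \<in> span (insert v S)"
  obtains c w where "c \<in> carrier R" "w \<in> span S" "y = c \<odot>\<^bsub>M\<^esub> v \<oplus>\<^bsub>M\<^esub> w"
proof -
  have sp: "submodule R (span S) M" by (rule span_is_submodule[OF S])
  let ?V = "{c \<odot>\<^bsub>M\<^esub> v | c. c \<in> carrier R}"
  have V: "submodule R ?V M"
  proof
    show "?V \<subseteq> carrier M" using v by auto
    have "\<zero>\<^bsub>M\<^esub> = \<zero>\<^bsub>R\<^esub> \<odot>\<^bsub>M\<^esub> v" using v by simp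
    then show "\<zero>\<^bsub>M\<^esub> \<in> ?V" by blast
    fix p q assume "p \<in> ?V" "q \<in> ?V"
    then obtain c d where "c \<in> carrier R" "d \<in> carrier R" "p = c \<odot>\<^bsub>M\<^esub> v" "q = d \<odot>\<^bsub>M\<^esub> v" by blast
    then have "p \<oplus>\<^bsub>M\<^esub> q = (c \<oplus>\<^bsub>R\<^esub> d) \<odot>\<^bsub>M\<^esub> v" "c \<oplus>\<^bsub>R\<^esub> d \<in> carrier R"
      using v by (simp_all add: smult_l_distr)
    then show "p \<oplus>\<^bsub>M\<^esub> q \<in> ?V" by blast
  next
    fix r p assume "r \<in> carrier R" "p \<in> ?V"
    then obtain c where "c \<in> carrier R" "p = c \<odot>\<^bsub>M\<^esub> v" by blast
    then have "r \<odot>\<^bsub>M\<^esub> p = (r \<otimes>\<^bsub>R\<^esub> c) \<odot>\<^bsub>M\<^esub> v" "r \<otimes>\<^bsub>R\<^esub> c \<in> carrier R"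
      using v \<open>r \<in> carrier R\<close> by (simp_all add: smult_assoc1)
    then show "r \<odot>\<^bsub>M\<^esub> p \<in> ?V" by blast
  qed
  have "v = \<one>\<^bsub>R\<^esub> \<odot>\<^bsub>M\<^esub> v" using v by simp
  then have "v \<in> ?V" by blast
  then have "insert v S \<subseteq> ?V <+>\<^bsub>M\<^esub> span S"
    using sum_sub_left[OF V sp] sum_sub_right[OF V sp] in_own_span[OF S] by auto
  then have "span (insert v S) \<subseteq> ?V <+>\<^bsub>M\<^esub> span S"
    by (rule span_is_subset[OF _ submodule_sum[OF V sp]])
  then show ?thesis using y that by (auto simp: set_add_def')
qed

lemma fin_gen_comb:
  assumes M: "module R M" and N: "submodule R N M" and fg: "fin_gen R M N"
  shows "\<exists>n u. (\<forall>l<n. u l \<in> N) \<and> N = comb M n u ` carrier (free_module R n)"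
proof -
  interpret module R M by fact
  obtain S where S: "finite S" "S \<subseteq> N" "N \<subseteq> span S" using fg unfolding fin_gen_def by auto
  obtain n u where u: "S = u ` {i::nat. i < n}" using finite_imp_nat_seg_image_inj_on[OF S(1)] by auto
  have uN: "u l \<in> N" if "l < n" for l using u S(2) that by auto
  then have uM: "u l \<in> carrier M" if "l < n" for l using submodule_in[OF N] that by auto
  have hom: "comb M n u \<in> module_hom R (free_module R n) M" using R.comb_hom[OF M uM] .
  have "submodule R (comb M n u ` carrier (free_module R n)) M"
    by (rule module_hom_image[OF R.free_module M hom submodule_carrier[OF R.free_module]])
  moreover have "S \<subseteq> comb M n u ` carrier (free_module R n)"
  proof
    fix y assume "y \<in> S"
    then obtain l where l: "l < n" "y = u l" unfolding u by auto
    then have "y = comb M n u (std_vec R n l)" using R.comb_std[OF M, of n u] uM by simp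
    then show "y \<in> comb M n u ` carrier (free_module R n)" using R.std_vec_closed by blast
  qed
  ultimately have "N \<subseteq> comb M n u ` carrier (free_module R n)"
    using span_is_subset S(3) by blast
  moreover have "comb M n u ` carrier (free_module R n) \<subseteq> N"
    using uN by (auto intro!: R.comb_in_submodule[OF N] submodule_smult[OF N] R.free_in)
  ultimately show ?thesis using uN by blast
qed

lemma (in cring) idealI':
  assumes "J \<subseteq> carrier R" "\<zero> \<in> J" "\<And>x y. x \<in> J \<Longrightarrow> y \<in> J \<Longrightarrow> x \<oplus> y \<in> J"
    "\<And>r x. r \<in> carrier R \<Longrightarrow> x \<in> J \<Longrightarrow> r \<otimes> x \<in> J"
  shows "ideal J R"
proof (rule idealI)
  show "subgroup J (add_monoid R)"
  proof (rule add.subgroupI)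
    fix x assume x: "x \<in> J"
    then have "\<ominus> x = (\<ominus> \<one>) \<otimes> x" using assms(1) by (auto simp: l_minus)
    then show "\<ominus> x \<in> J" using assms(4)[of "\<ominus> \<one>" x] x by simp
  qed (use assms in auto)
  fix a x assume "a \<in> J" "x \<in> carrier R"
  then show "x \<otimes> a \<in> J" "a \<otimes> x \<in> J"
    using assms(1) assms(4)[of x a] m_comm[of a x] by (auto simp: subset_iff)
qed (rule ring_axioms)

text \<open>Induction on the number \<open>j\<close> of coordinates that may be nonzero. In the
  step, the \<open>j\<close>-th coordinates of members of \<open>?K (Suc j)\<close> form an ideal;
  lifts of finitely many generators of it reduce every member to \<open>?K j\<close>, where the
  induction hypothesis applies.\<close>

lemma (in noetherian_ring) free_submodule_fin_gen:
  assumes "cring R" and K: "submodule R K (free_module R b)"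
  shows "fin_gen R (free_module R b) K"
proof -
  interpret cring R by fact
  interpret F: module R "free_module R b" by (rule free_module)
  let ?K = "\<lambda>j. {f \<in> K. \<forall>l<b. j \<le> l \<longrightarrow> f l = \<zero>}"
  have Ksub: "submodule R (?K j) (free_module R b)" for j
  proof -
    have "ideal (if j \<le> l then {\<zero>} else carrier R) R" for l by (simp add: zeroideal oneideal)
    then have "submodule R {f \<in> carrier (free_module R b). \<forall>l<b. f l \<in> (if j \<le> l then {\<zero>} else carrier R)} (free_module R b)"
      by (intro free_submoduleI) auto
    from submodule_inter[OF K this]
    have "submodule R (K \<inter> {f \<in> carrier (free_module R b). \<forall>l<b. f l \<in> (if j \<le> l then {\<zero>} else carrier R)}) (free_module R b)" .
    moreover have "(K \<inter> {f \<in> carrier (free_module R b). \<forall>l<b. f l \<in> (if j \<le> l then {\<zero>} else carrier R)}) = ?K j"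
      using submodule_in[OF K] by (auto split: if_splits) (metis free_in)
    ultimately show ?thesis by simp
  qed
  have "fin_gen R (free_module R b) (?K j)" for j
  proof (induction j)
    case 0
    have "?K 0 \<subseteq> {\<zero>\<^bsub>free_module R b\<^esub>}"
      using submodule_in[OF K] by (auto intro!: free_eqI simp: F.M.zero_closed) (auto simp: free_zero)
    then show ?case unfolding fin_gen_def
      using submodule_zero[OF F.span_is_submodule[of "{}"]] by (intro exI[of _ "{}"]) auto
  next
    case (Suc j)
    show ?case
    proof (cases "j < b")
      case False
      then have "?K (Suc j) = ?K j" by auto
      with Suc show ?thesis by simp
    next
      case j: True
      obtain S where S: "finite S" "S \<subseteq> ?K j" "?K j \<subseteq> F.span S" using Suc unfolding fin_gen_def by auto
      \<comment> \<open>Used twice: for \<open>?K (Suc j)\<close>, to obtain finitely many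
        generators, and for the span of their lifts \<open>h a\<close>, to see that every element of
        the ideal is the \<open>j\<close>-th coordinate of a combination of these lifts.\<close>
      have co: "ideal ((\<lambda>f. f j) ` T) R" if T: "submodule R T (free_module R b)" for T
      proof (rule idealI')
        note Tin = submodule_in[OF T]
        show "(\<lambda>f. f j) ` T \<subseteq> carrier R" using Tin free_in j by blast
        have "(\<zero>\<^bsub>free_module R b\<^esub>) j = \<zero>" using j by (simp add: free_zero)
        then show "\<zero> \<in> (\<lambda>f. f j) ` T" using submodule_zero[OF T] by (metis imageI)
        fix x y assume "x \<in> (\<lambda>f. f j) ` T" "y \<in> (\<lambda>f. f j) ` T"
        then obtain f g where fg: "f \<in> T" "g \<in> T" "x = f j" "y = g j" by auto
        then have "x \<oplus> y = (f \<oplus>\<^bsub>free_module R b\<^esub> g) j" using j by (simp add: free_add)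
        then show "x \<oplus> y \<in> (\<lambda>f. f j) ` T" using submodule_add[OF T fg(1,2)] by blast
      next
        fix r x assume r: "r \<in> carrier R" and "x \<in> (\<lambda>f. f j) ` T"
        then obtain f where f: "f \<in> T" "x = f j" by auto
        then have "r \<otimes> x = (r \<odot>\<^bsub>free_module R b\<^esub> f) j" using j by (simp add: free_smult)
        then show "r \<otimes> x \<in> (\<lambda>f. f j) ` T" using submodule_smult[OF T r f(1)] by blast
      qed
      obtain A where A: "A \<subseteq> carrier R" "finite A" "(\<lambda>f. f j) ` ?K (Suc j) = Idl A"
        using finetely_gen[OF co[OF Ksub[of "Suc j"]]] by auto
      have "\<forall>a\<in>A. \<exists>f. f \<in> ?K (Suc j) \<and> f j = a"
      proof
        fix a assume "a \<in> A"
        then have "a \<in> (\<lambda>f. f j) ` ?K (Suc j)" using genideal_self[OF A(1)] A(3) by blast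
        then show "\<exists>f. f \<in> ?K (Suc j) \<and> f j = a" by blast
      qed
      from bchoice[OF this] obtain h where h: "\<forall>a\<in>A. h a \<in> ?K (Suc j) \<and> h a j = a" ..
      have hA: "h ` A \<subseteq> ?K (Suc j)" using h by blast
      then have hc: "h ` A \<subseteq> carrier (free_module R b)" using submodule_in[OF Ksub[of "Suc j"]] by blast
      have Sc: "S \<subseteq> carrier (free_module R b)" using S(2) submodule_in[OF Ksub[of j]] by blast
      have SK: "S \<subseteq> ?K (Suc j)" using S(2) by auto
      have sA: "F.span (h ` A) \<subseteq> ?K (Suc j)" by (rule F.span_is_subset[OF hA Ksub])
      have sub: "submodule R (F.span (h ` A \<union> S)) (free_module R b)"
        using hc Sc by (intro F.span_is_submodule) auto
      have "?K (Suc j) \<subseteq> F.span (h ` A \<union> S)"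
      proof
        fix f assume f: "f \<in> ?K (Suc j)"
        have "A \<subseteq> (\<lambda>f. f j) ` F.span (h ` A)"
        proof
          fix a assume a: "a \<in> A"
          then have "h a \<in> F.span (h ` A)" "a = h a j" using h F.in_own_span[OF hc] by auto
          then show "a \<in> (\<lambda>f. f j) ` F.span (h ` A)" by blast
        qed
        then have "Idl A \<subseteq> (\<lambda>f. f j) ` F.span (h ` A)"
          by (intro genideal_minimal co F.span_is_submodule hc)
        moreover have "f j \<in> Idl A" unfolding A(3)[symmetric] using f by (rule imageI)
        ultimately obtain g where g: "g \<in> F.span (h ` A)" "g j = f j" by (metis (no_types, lifting) imageE subsetD)
        have gK: "g \<in> ?K (Suc j)" using g sA by auto
        have fc: "f \<in> carrier (free_module R b)" "g \<in> carrier (free_module R b)"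
          using f gK submodule_in[OF K] by auto
        have "f \<ominus>\<^bsub>free_module R b\<^esub> g \<in> ?K (Suc j)" by (rule submodule_minus[OF Ksub f gK])
        moreover have "(f \<ominus>\<^bsub>free_module R b\<^esub> g) j = \<zero>"
          using g(2) j fc by (simp add: free_minus free_in)
        ultimately have "f \<ominus>\<^bsub>free_module R b\<^esub> g \<in> ?K j"
          by (auto simp: le_less Suc_le_eq)
        then have "f \<ominus>\<^bsub>free_module R b\<^esub> g \<in> F.span (h ` A \<union> S)"
          using S(3) F.span_is_monotone[of S "h ` A \<union> S"] by blast
        moreover have "g \<in> F.span (h ` A \<union> S)" using g F.span_is_monotone[of "h ` A" "h ` A \<union> S"] by blast
        ultimately show "f \<in> F.span (h ` A \<union> S)"
          using submodule_minusD[OF sub fc(1)] by blast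
      qed
      then show ?thesis unfolding fin_gen_def using A(2) S(1) hA SK
        by (intro exI[of _ "h ` A \<union> S"]) auto
    qed
  qed
  from this[of b] show ?thesis using submodule_in[OF K]
    by (simp add: Collect_conj_eq)
qed

text \<open>Pull \<open>N\<close> back along a surjection from a free module, use the free case
  there, and push the generators forward.\<close>

lemma (in noetherian_ring) submodule_fin_gen:
  assumes M: "module R M" and fg: "finitely_generated R M" and N: "submodule R N M"
  shows "fin_gen R M N"
proof -
  interpret M: module R M by fact
  have "fin_gen R M (carrier M)"
    using fg unfolding finitely_generated_def fin_gen_def by auto
  then obtain n u where u: "\<And>l. l < n \<Longrightarrow> u l \<in> carrier M"
    and eq: "carrier M = comb M n u ` carrier (free_module R n)"
    using fin_gen_comb[OF M submodule_carrier[OF M]] by blast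
  have hom: "comb M n u \<in> module_hom R (free_module R n) M" using M.R.comb_hom[OF M u] .
  let ?K = "{f \<in> carrier (free_module R n). comb M n u f \<in> N}"
  interpret F: module R "free_module R n" by (rule M.R.free_module)
  have K: "submodule R ?K (free_module R n)"
    by (rule module_hom_vimage[OF M.R.free_module M hom N])
  obtain S where S: "finite S" "S \<subseteq> ?K" "?K \<subseteq> F.span S"
    using free_submodule_fin_gen[OF M.R.cring_axioms K] unfolding fin_gen_def by auto
  have im: "comb M n u ` S \<subseteq> N" using S(2) by auto
  then have imc: "comb M n u ` S \<subseteq> carrier M" using submodule_in[OF N] by auto
  have "N \<subseteq> M.span (comb M n u ` S)"
  proof
    fix y assume y: "y \<in> N"
    then obtain f where f: "f \<in> carrier (free_module R n)" "y = comb M n u f"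
      using submodule_in[OF N] eq by blast
    then have "f \<in> F.span S" using y S(3) by auto
    then show "y \<in> M.span (comb M n u ` S)" unfolding f(2)
      using S(2) M.in_own_span[OF imc]
      by (intro F.span_hom_image[OF M hom _ M.span_is_submodule[OF imc]]) auto
  qed
  then show ?thesis unfolding fin_gen_def using S(1) im by blast
qed

section \<open>Powers of an ideal\<close>

context cring
begin

lemma ideals_set_simps [simp]:
  "one (ideals_set R) = carrier R" "mult (ideals_set R) = ideal_prod R"
  by (simp_all add: ideals_set_def)

lemma ideal_power_0: "ideal_power R I (0::nat) = carrier R"
  by simp

lemma ideal_power_Suc: "ideal_power R I (Suc p) = ideal_prod R (ideal_power R I p) I"
  by simp

lemma ideal_power_ideal: "ideal I R \<Longrightarrow> ideal (ideal_power R I (p::nat)) R"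
  by (induction p) (simp_all add: ideal_power_0 ideal_power_Suc oneideal ideal_prod_is_ideal)

lemma ideal_power_in: "ideal I R \<Longrightarrow> r \<in> ideal_power R I (p::nat) \<Longrightarrow> r \<in> carrier R"
  using ideal.Icarr[OF ideal_power_ideal] .

lemma ideal_power_mult_I:
  assumes "ideal I R" "r \<in> ideal_power R I (p::nat)" "t \<in> I"
  shows "r \<otimes> t \<in> ideal_power R I (Suc p)"
  unfolding ideal_power_Suc using assms by (auto intro: ideal_prod.prod)

lemma ideal_power_antimono:
  assumes I: "ideal I R" and "p \<le> q"
  shows "ideal_power R I q \<subseteq> ideal_power R I (p::nat)"
  using assms(2)
proof (induction q rule: dec_induct)
  case (step q)
  then show ?case
    using ideal_prod_inter[OF ideal_power_ideal[OF I] I] unfolding ideal_power_Suc by blast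
qed simp

lemma ideal_power_Suc_0:
  assumes I: "ideal I R"
  shows "ideal_power R I (Suc 0) = I"
proof
  show "ideal_power R I (Suc 0) \<subseteq> I"
    using ideal_prod_inter[OF ideal_power_ideal[OF I] I] unfolding ideal_power_Suc by blast
  show "I \<subseteq> ideal_power R I (Suc 0)"
  proof
    fix r assume "r \<in> I"
    then show "r \<in> ideal_power R I (Suc 0)"
      using ideal_power_mult_I[OF I, of \<one> 0 r] ideal.Icarr[OF I] by (simp add: ideal_power_0)
  qed
qed

lemma ideal_power_mult:
  assumes I: "ideal I R" and r: "r \<in> ideal_power R I (p::nat)" and "t \<in> ideal_power R I (q::nat)"
  shows "r \<otimes> t \<in> ideal_power R I (p + q)"
  using assms(3)
proof (induction q arbitrary: t)
  case 0
  then show ?case using r ideal.I_r_closed[OF ideal_power_ideal[OF I]] by (simp add: ideal_power_0)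
next
  case (Suc q)
  have rc: "r \<in> carrier R" using ideal_power_in[OF I r] .
  interpret J: ideal "ideal_power R I (p + Suc q)" R by (rule ideal_power_ideal[OF I])
  from Suc.prems show ?case unfolding ideal_power_Suc
  proof (induction t rule: ideal_prod.induct)
    case (prod i j)
    then have "(r \<otimes> i) \<otimes> j \<in> ideal_power R I (Suc (p + q))"
      using Suc.IH by (intro ideal_power_mult_I[OF I])
    then show ?case using rc ideal_power_in[OF I prod(1)] ideal.Icarr[OF I prod(2)]
      by (simp add: m_assoc)
  next
    case (sum s t)
    then have "s \<in> carrier R" "t \<in> carrier R"
      using ideal_prod_in_carrier[OF ideal_power_ideal[OF I] I] by blast+
    with sum rc show ?case by (simp add: r_distr ideal_prod.sum)
  qed
qed

end

section \<open>The Artin--Rees lemma\<close>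

text \<open>Index \<open>0\<close> is the most significant. In the exponents used below the index of
  the basis vector is stored last, at \<open>s\<close>, so it is compared after all variables.
  Raising the same index on both sides preserves the order (\<open>lex_less_incr\<close>), which
  makes it a monomial order.\<close>

definition lex_less :: "(nat \<Rightarrow> nat) \<Rightarrow> (nat \<Rightarrow> nat) \<Rightarrow> bool" where
  "lex_less e e' \<longleftrightarrow> (\<exists>i. e i < e' i \<and> (\<forall>j<i. e j = e' j))"

lemma lex_less_irrefl: "\<not> lex_less e e"
  by (auto simp: lex_less_def)

lemma lex_less_trans:
  assumes "lex_less e e'" "lex_less e' e''"
  shows "lex_less e e''"
proof -
  obtain i j where "e i < e' i" "\<forall>k<i. e k = e' k" "e' j < e'' j" "\<forall>k<j. e' k = e'' k"
    using assms by (auto simp: lex_less_def)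
  then have "e (min i j) < e'' (min i j) \<and> (\<forall>k<min i j. e k = e'' k)"
    by (cases i j rule: linorder_cases) (auto simp: min_def)
  then show ?thesis unfolding lex_less_def by blast
qed

lemma lex_less_total: "e \<noteq> e' \<Longrightarrow> lex_less e e' \<or> lex_less e' e"
proof -
  assume "e \<noteq> e'"
  then have ex: "\<exists>i. e i \<noteq> e' i" by auto
  define i where "i = (LEAST i. e i \<noteq> e' i)"
  have "e i \<noteq> e' i" unfolding i_def by (rule LeastI_ex[OF ex])
  moreover have "\<forall>j<i. e j = e' j" unfolding i_def using not_less_Least by blast
  ultimately show ?thesis unfolding lex_less_def by (metis linorder_neqE_nat)
qed

lemma lex_less_incr: "lex_less e e' \<Longrightarrow> lex_less (e(i := Suc (e i))) (e'(i := Suc (e' i)))"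
  unfolding lex_less_def by auto

lemma finite_lex_max:
  assumes "finite D" "D \<noteq> {}"
  shows "\<exists>e\<in>D. \<forall>e'\<in>D. e' = e \<or> lex_less e' e"
  using assms
proof (induction D rule: finite_ne_induct)
  case (insert d D)
  then obtain e where e: "e \<in> D" "\<forall>e'\<in>D. e' = e \<or> lex_less e' e" by auto
  show ?case
  proof (cases "lex_less e d")
    case True
    then show ?thesis using e by (metis insert_iff lex_less_trans)
  next
    case False
    then show ?thesis using e lex_less_total[of e d] by auto
  qed
qed auto

text \<open>Every sequence has a monotone subsequence, and a decreasing one of natural numbers is
  constant from the point where it attains its minimum.\<close>

lemma nat_seq_mono_subseq:
  fixes u :: "nat \<Rightarrow> nat"
  shows "\<exists>r :: nat \<Rightarrow> nat. strict_mono r \<and> mono (u \<circ> r)"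
proof -
  obtain r :: "nat \<Rightarrow> nat" where r: "strict_mono r" "monoseq (u \<circ> r)"
    using seq_monosub[of u] by (auto simp: comp_def)
  show ?thesis
  proof (cases "incseq (u \<circ> r)")
    case False
    then have dec: "decseq (u \<circ> r)" using r(2) by (auto simp: monoseq_iff)
    define m where "m = (LEAST m. m \<in> range (u \<circ> r))"
    have "m \<in> range (u \<circ> r)" unfolding m_def by (rule LeastI) (rule rangeI)
    then obtain N where N: "m = u (r N)" by auto
    have const: "u (r (N + n)) = m" for n
    proof (rule antisym)
      show "u (r (N + n)) \<le> m" using decseqD[OF dec, of N "N + n"] N by simp
      show "m \<le> u (r (N + n))" unfolding m_def by (rule Least_le) auto
    qed
    have "strict_mono (\<lambda>n. r (N + n))" using r(1) by (auto simp: strict_mono_def)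
    moreover have "mono (u \<circ> (\<lambda>n. r (N + n)))" by (simp add: mono_def const)
    ultimately show ?thesis by blast
  qed (use r in blast)
qed

text \<open>Dickson's lemma in sequential form: one coordinate after the other is made nondecreasing
  by passing to a subsequence, and this does not disturb the coordinates already treated.\<close>

lemma monotone_subsequence:
  fixes f :: "nat \<Rightarrow> nat \<Rightarrow> nat"
  shows "\<exists>r :: nat \<Rightarrow> nat. strict_mono r \<and> (\<forall>i<m. mono (\<lambda>n. f (r n) i))"
proof (induction m)
  case 0
  show ?case by (rule exI[of _ id]) (simp add: strict_mono_def)
next
  case (Suc m)
  then obtain r :: "nat \<Rightarrow> nat" where r: "strict_mono r" "\<forall>i<m. mono (\<lambda>n. f (r n) i)" by auto
  obtain r' :: "nat \<Rightarrow> nat" where r': "strict_mono r'" "mono ((\<lambda>n. f (r n) m) \<circ> r')"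
    using nat_seq_mono_subseq by blast
  have "mono (\<lambda>n::nat. f (r (r' n)) i)" if "i < Suc m" for i
  proof (cases "i = m")
    case True
    then show ?thesis using r'(2) by (simp add: comp_def)
  next
    case False
    then have "mono (\<lambda>n. f (r n) i)" using r(2) that by auto
    then show ?thesis using strict_mono_mono[OF r'(1)] unfolding mono_def by blast
  qed
  moreover have "strict_mono (\<lambda>n. r (r' n))" using r(1) r'(1) by (simp add: strict_mono_def)
  ultimately show ?case by blast
qed

text \<open>The \<open>I\<close>-adic filtration of a free module whose basis vector
  \<open>l\<close> is put in degree \<open>a l\<close>. Truncated subtraction makes the condition on
  coordinate \<open>l\<close> void for \<open>p \<le> a l\<close>.\<close>

definition shift_filt ::
    "('a, 'r) ring_scheme \<Rightarrow> 'a set \<Rightarrow> nat \<Rightarrow> (nat \<Rightarrow> nat) \<Rightarrow> nat \<Rightarrow> (nat \<Rightarrow> 'a) set" where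
  "shift_filt R I b a p = {f \<in> carrier (free_module R b). \<forall>l<b. f l \<in> ideal_power R I (p - a l)}"

context cring
begin

lemma shift_filt_submodule: "ideal I R \<Longrightarrow> submodule R (shift_filt R I b a p) (free_module R b)"
  unfolding shift_filt_def by (intro free_submoduleI ideal_power_ideal)

lemma shift_filt_in: "f \<in> shift_filt R I b a p \<Longrightarrow> f \<in> carrier (free_module R b)"
  by (simp add: shift_filt_def)

lemma shift_filt_antimono: "ideal I R \<Longrightarrow> p \<le> q \<Longrightarrow> shift_filt R I b a q \<subseteq> shift_filt R I b a p"
  unfolding shift_filt_def using ideal_power_antimono[of I "p - a l" "q - a l" for l]
  by (auto simp: subset_iff diff_le_mono)

lemma shift_filt_smult:
  assumes I: "ideal I R" and r: "r \<in> ideal_power R I q" and f: "f \<in> shift_filt R I b a p"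
  shows "r \<odot>\<^bsub>free_module R b\<^esub> f \<in> shift_filt R I b a (q + p)"
proof -
  interpret F: module R "free_module R b" by (rule free_module)
  have "r \<otimes> f l \<in> ideal_power R I (q + p - a l)" if "l < b" for l
  proof -
    have "r \<otimes> f l \<in> ideal_power R I (q + (p - a l))"
      using f that by (intro ideal_power_mult[OF I r]) (auto simp: shift_filt_def)
    moreover have "q + p - a l \<le> q + (p - a l)" by simp
    ultimately show ?thesis using ideal_power_antimono[OF I] by blast
  qed
  then show ?thesis
    using f F.smult_closed[OF ideal_power_in[OF I r]] unfolding shift_filt_def by (auto simp: free_smult)
qed

end

lemma (in abelian_group) add_minus_add_left:
  assumes "x \<in> carrier G" "y \<in> carrier G" "z \<in> carrier G"
  shows "(x \<oplus> y) \<ominus> (x \<oplus> z) = y \<ominus> z"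
proof -
  have "(x \<oplus> y) \<ominus> (x \<oplus> z) = (x \<oplus> \<ominus> x) \<oplus> (y \<oplus> \<ominus> z)"
    unfolding minus_eq using assms by (subst minus_add) (simp_all add: a_ac)
  then show ?thesis using assms by (simp add: r_neg minus_eq)
qed

section \<open>Monomials in generators of the ideal\<close>

locale shifted_monomials = cring R + ideal I R for R (structure) and I +
  fixes x :: "nat \<Rightarrow> 'a" and s b :: nat and a :: "nat \<Rightarrow> nat"
  assumes x_gen: "I = Idl (x ` {..<s})" "\<And>i. i < s \<Longrightarrow> x i \<in> carrier R"
begin

text \<open>
  An exponent \<open>e\<close> encodes the monomial \<open>x\<^sub>0\<^sup>e\<^sup>0 \<dots> x\<^sub>s\<^sub>-\<^sub>1\<^sup>e\<^sup>(\<^sup>s\<^sup>-\<^sup>1\<^sup>)\<close> times the basis vector with index \<open>e s\<close>.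
\<close>

definition "mono_of e = (\<Otimes>i\<in>{..<s}. x i [^] (e i :: nat))"
definition "mdeg e = (\<Sum>i<s. e i) + a (e s)"
definition "exps = {e :: nat \<Rightarrow> nat. e s < b \<and> (\<forall>i>s. e i = 0)}"
definition "mvec e = mono_of e \<odot>\<^bsub>free_module R b\<^esub> std_vec R b (e s)"
definition "below e = {e' \<in> exps. mdeg e' = mdeg e \<and> lex_less e' e}"

sublocale F: module R "free_module R b" by (rule free_module)

lemma I_ideal: "ideal I R" by (rule ideal_axioms)

lemma x_in_I: "i < s \<Longrightarrow> x i \<in> I"
  using genideal_self[of "x ` {..<s}"] x_gen by auto

lemma mono_closed: "mono_of e \<in> carrier R"
  unfolding mono_of_def using x_gen by (intro finprod_closed) auto

lemma mono_up:
  assumes i: "i < s"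
  shows "mono_of (e(i := Suc (e i))) = x i \<otimes> mono_of e"
proof -
  let ?P = "\<lambda>e. (\<Otimes>j\<in>{..<s} - {i}. x j [^] (e j :: nat))"
  have split: "mono_of e = x i [^] (e i) \<otimes> ?P e" for e
  proof -
    have "mono_of e = (\<Otimes>j\<in>insert i ({..<s} - {i}). x j [^] (e j))"
      unfolding mono_of_def using i by (simp add: insert_absorb)
    also have "\<dots> = x i [^] (e i) \<otimes> ?P e" using x_gen i by (intro finprod_insert) auto
    finally show ?thesis .
  qed
  have "?P (e(i := Suc (e i))) = ?P e" using x_gen by (intro finprod_cong') auto
  moreover have "?P e \<in> carrier R" using x_gen by (intro finprod_closed) auto
  ultimately show ?thesis unfolding split using x_gen i by (simp add: m_ac)
qed

lemma mono_power: "mono_of e \<in> ideal_power R I (\<Sum>i<s. e i)"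
proof -
  have pow: "x i [^] n \<in> ideal_power R I n" if "i < s" for i and n :: nat
  proof (induction n)
    case (Suc n)
    then show ?case using ideal_power_mult_I[OF I_ideal Suc x_in_I[OF that]] by simp
  qed simp
  have "(\<Otimes>i\<in>A. x i [^] e i) \<in> ideal_power R I (\<Sum>i\<in>A. e i)" if "finite A" "A \<subseteq> {..<s}" for A
    using that
  proof (induction A rule: finite_induct)
    case (insert i A)
    then have "x i [^] e i \<otimes> (\<Otimes>i\<in>A. x i [^] e i) \<in> ideal_power R I (e i + (\<Sum>i\<in>A. e i))"
      by (intro ideal_power_mult[OF I_ideal] pow) auto
    moreover have "(\<Otimes>i\<in>insert i A. x i [^] e i) = x i [^] e i \<otimes> (\<Otimes>i\<in>A. x i [^] e i)"
      using insert x_gen by (intro finprod_insert) auto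
    ultimately show ?case using insert by simp
  qed simp
  then show ?thesis unfolding mono_of_def by simp
qed

lemma mon_closed: "mvec e \<in> carrier (free_module R b)"
  unfolding mvec_def using mono_closed std_vec_closed by (intro F.smult_closed)

lemma mon_filt: "mvec e \<in> shift_filt R I b a (mdeg e)"
proof -
  have "mono_of e \<otimes> (if l = e s then \<one> else \<zero>) \<in> ideal_power R I (mdeg e - a l)" for l
    using mono_power[of e] mono_closed[of e]
      additive_subgroup.zero_closed[OF ideal.axioms(1)[OF ideal_power_ideal[OF I_ideal, of "mdeg e - a l"]]]
    by (auto simp: mdeg_def)
  moreover have "mvec e l = mono_of e \<otimes> (if l = e s then \<one> else \<zero>)" if "l < b" for l
    using that by (simp add: mvec_def free_smult std_vec_def)
  ultimately show ?thesis using mon_closed by (simp add: shift_filt_def)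
qed

lemma mon_up: "i < s \<Longrightarrow> mvec (e(i := Suc (e i))) = x i \<odot>\<^bsub>free_module R b\<^esub> mvec e"
  unfolding mvec_def using mono_up[of i e] mono_closed[of e] std_vec_closed[of b "e s"] x_gen
  by (simp add: F.smult_assoc1)

lemma mdeg_up: "i < s \<Longrightarrow> mdeg (e(i := Suc (e i))) = Suc (mdeg e)"
  unfolding mdeg_def by (simp add: sum.remove[of "{..<s}" i])

lemma exps_up: "i < s \<Longrightarrow> e(i := n) \<in> exps \<longleftrightarrow> e \<in> exps"
  unfolding exps_def by auto

lemma finite_deg: "finite {e \<in> exps. mdeg e = p}"
proof (rule finite_subset)
  let ?F = "{e. \<forall>i. (i \<in> {..s} \<longrightarrow> e i \<in> {..p + b}) \<and> (i \<notin> {..s} \<longrightarrow> e i = (0::nat))}"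
  show "finite ?F" by (rule finite_set_of_finite_funs) auto
  show "{e \<in> exps. mdeg e = p} \<subseteq> ?F"
  proof (clarify, intro conjI impI)
    fix e i assume e: "e \<in> exps" "p = mdeg e"
    show "e i = 0" if "i \<notin> {..s}" using e that by (auto simp: exps_def)
    assume "i \<in> {..s}"
    moreover have "e i \<le> (\<Sum>i<s. e i)" if "i < s" using that by (intro member_le_sum) auto
    ultimately show "e i \<in> {..mdeg e + b}" using e
      by (cases "i = s") (auto simp: exps_def mdeg_def)
  qed
qed

lemma mon_span_closed: "mvec ` D \<subseteq> carrier (free_module R b)"
  using mon_closed by auto

lemma span_filt: "D \<subseteq> {e \<in> exps. mdeg e = p} \<Longrightarrow> F.span (mvec ` D) \<subseteq> shift_filt R I b a p"
  using mon_filt by (intro F.span_is_subset shift_filt_submodule I_ideal) auto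

text \<open>Multiplication by \<open>x i\<close> is linear and takes monomials to monomials, so only
  the generators of the span have to be checked.\<close>

lemma span_up:
  assumes "i < s" "y \<in> F.span (mvec ` D)" "(\<lambda>e. e(i := Suc (e i))) ` D \<subseteq> D'"
  shows "x i \<odot>\<^bsub>free_module R b\<^esub> y \<in> F.span (mvec ` D')"
proof (rule F.span_hom_image[OF free_module F.smult_hom mon_span_closed _ _ assms(2)])
  show "x i \<in> carrier R" using x_gen assms by auto
  show "submodule R (F.span (mvec ` D')) (free_module R b)"
    by (rule F.span_is_submodule[OF mon_span_closed])
  show "(\<odot>\<^bsub>free_module R b\<^esub>) (x i) ` mvec ` D \<subseteq> F.span (mvec ` D')"
  proof clarify
    fix e assume "e \<in> D"
    then have "mvec (e(i := Suc (e i))) \<in> mvec ` D'" using assms(3) by blast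
    then have "mvec (e(i := Suc (e i))) \<in> F.span (mvec ` D')"
      using F.in_own_span[OF mon_span_closed] by blast
    then show "x i \<odot>\<^bsub>free_module R b\<^esub> mvec e \<in> F.span (mvec ` D')"
      by (simp only: mon_up[OF assms(1)])
  qed
qed

text \<open>Induction on \<open>q\<close>. For fixed \<open>i\<close> in the \<open>q\<close>-th
  power, the \<open>j\<close> for which \<open>i \<otimes> j\<close> times the basis vector lies in
  the span form an ideal containing all \<open>x t\<close> (by \<open>span_up\<close>), hence all of
  \<open>I\<close>; such products generate the next power additively.\<close>

lemma power_span:
  assumes l: "l < b" and "r \<in> ideal_power R I q"
  shows "r \<odot>\<^bsub>free_module R b\<^esub> std_vec R b l \<in> F.span (mvec ` {e \<in> exps. mdeg e = q + a l})"
  using assms(2)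
proof (induction q arbitrary: r)
  case 0
  let ?e = "\<lambda>i. if i = s then l else 0"
  have e: "?e \<in> {e \<in> exps. mdeg e = 0 + a l}" using l by (simp add: exps_def mdeg_def)
  have "mono_of ?e = \<one>" unfolding mono_of_def using x_gen(2)
    by (intro finprod_one_eqI) auto
  then have "std_vec R b l = mvec ?e" using std_vec_closed by (simp add: mvec_def)
  moreover have "mvec ?e \<in> F.span (mvec ` {e \<in> exps. mdeg e = 0 + a l})"
    by (rule subsetD[OF F.in_own_span[OF mon_span_closed] imageI[OF e]])
  ultimately show ?case
    using 0 submodule_smult[OF F.span_is_submodule[OF mon_span_closed]] by simp
next
  case (Suc q)
  let ?S = "F.span (mvec ` {e \<in> exps. mdeg e = Suc q + a l})"
  have S: "submodule R ?S (free_module R b)" by (rule F.span_is_submodule[OF mon_span_closed])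
  have prod: "(i \<otimes> j) \<odot>\<^bsub>free_module R b\<^esub> std_vec R b l \<in> ?S" if i: "i \<in> ideal_power R I q" and j: "j \<in> I" for i j
  proof -
    have ic: "i \<in> carrier R" using ideal_power_in[OF I_ideal i] .
    let ?J = "{j \<in> carrier R. (i \<otimes> j) \<odot>\<^bsub>free_module R b\<^esub> std_vec R b l \<in> ?S}"
    have "ideal ?J R"
    proof (rule idealI')
      show "\<zero> \<in> ?J" using ic std_vec_closed submodule_zero[OF S] by simp
      fix y z assume "y \<in> ?J" "z \<in> ?J"
      then show "y \<oplus> z \<in> ?J" using ic std_vec_closed submodule_add[OF S]
        by (simp add: r_distr F.smult_l_distr)
    next
      fix r y assume r: "r \<in> carrier R" and y: "y \<in> ?J"
      have "(i \<otimes> (r \<otimes> y)) \<odot>\<^bsub>free_module R b\<^esub> std_vec R b l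
          = r \<odot>\<^bsub>free_module R b\<^esub> ((i \<otimes> y) \<odot>\<^bsub>free_module R b\<^esub> std_vec R b l)"
        using r y ic std_vec_closed by (simp add: F.smult_assoc1[symmetric] m_lcomm)
      then show "r \<otimes> y \<in> ?J" using r y submodule_smult[OF S] by simp
    qed auto
    moreover have "x ` {..<s} \<subseteq> ?J"
    proof (clarify, intro conjI)
      fix t assume t: "t < s"
      show "x t \<in> carrier R" using x_gen t by auto
      have "x t \<odot>\<^bsub>free_module R b\<^esub> (i \<odot>\<^bsub>free_module R b\<^esub> std_vec R b l) \<in> ?S"
        by (rule span_up[OF t Suc.IH[OF i]]) (use t in \<open>auto simp: mdeg_up exps_up\<close>)
      then show "(i \<otimes> x t) \<odot>\<^bsub>free_module R b\<^esub> std_vec R b l \<in> ?S"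
        using ic std_vec_closed x_gen(2)[OF t] by (simp add: F.smult_assoc1[symmetric] m_comm)
    qed
    ultimately have "Idl (x ` {..<s}) \<subseteq> ?J" by (rule genideal_minimal)
    then show ?thesis using j x_gen(1) by blast
  qed
  from Suc.prems have "r \<in> ideal_prod R (ideal_power R I q) I" by simp
  then show ?case
  proof (induction r rule: ideal_prod.induct)
    case (sum r t)
    then have "r \<in> carrier R" "t \<in> carrier R"
      using ideal_prod_in_carrier[OF ideal_power_ideal[OF I_ideal] I_ideal] by blast+
    with sum show ?case using std_vec_closed submodule_add[OF S] by (simp add: F.smult_l_distr)
  qed (rule prod)
qed

text \<open>A coordinate with \<open>a l > p\<close> would be unrestricted, while every monomial on
  that basis vector has degree at least \<open>a l\<close>; the bound on the shifts excludes this
  case. Coordinatewise the claim is \<open>power_span\<close>.\<close>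

lemma filt_span:
  assumes "\<And>l. l < b \<Longrightarrow> a l \<le> p"
  shows "shift_filt R I b a p \<subseteq> F.span (mvec ` {e \<in> exps. mdeg e = p})"
proof
  fix f assume f: "f \<in> shift_filt R I b a p"
  have "comb (free_module R b) b (std_vec R b) f \<in> F.span (mvec ` {e \<in> exps. mdeg e = p})"
  proof (rule comb_in_submodule[OF F.span_is_submodule[OF mon_span_closed]])
    fix l assume l: "l < b"
    then show "f l \<odot>\<^bsub>free_module R b\<^esub> std_vec R b l \<in> F.span (mvec ` {e \<in> exps. mdeg e = p})"
      using power_span[OF l, of "f l" "p - a l"] f assms[OF l] by (simp add: shift_filt_def)
  qed
  then show "f \<in> F.span (mvec ` {e \<in> exps. mdeg e = p})"
    using free_comb_std[OF shift_filt_in[OF f]] by simp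
qed

section \<open>Leading coefficient ideals of a submodule\<close>

context
  fixes K
  assumes K: "submodule R K (free_module R b)"
begin

text \<open>The analogue of the leading coefficient ideals of Groebner basis theory over a ring. The
  monomials \<open>mvec e\<close> may be linearly dependent, so an element has no well-defined
  leading exponent; the ideal is attached to the exponent \<open>e\<close> and asks for some
  expression with all other terms below \<open>e\<close>.\<close>

definition "lead e = {c \<in> carrier R. \<exists>y\<in>F.span (mvec ` below e).
  c \<odot>\<^bsub>free_module R b\<^esub> mvec e \<oplus>\<^bsub>free_module R b\<^esub> y \<in> K}"

lemma lead_ideal: "ideal (lead e) R"
proof (rule idealI')
  let ?F = "free_module R b"
  have S: "submodule R (F.span (mvec ` below e)) ?F" by (rule F.span_is_submodule[OF mon_span_closed])
  note in_S = submodule_in[OF S]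
  show "lead e \<subseteq> carrier R" by (auto simp: lead_def)
  have "\<zero> \<odot>\<^bsub>?F\<^esub> mvec e \<oplus>\<^bsub>?F\<^esub> \<zero>\<^bsub>?F\<^esub> \<in> K"
    using mon_closed submodule_zero[OF K] by simp
  then show "\<zero> \<in> lead e" unfolding lead_def using submodule_zero[OF S] by blast
  fix c d assume "c \<in> lead e" "d \<in> lead e"
  then obtain y z where y: "y \<in> F.span (mvec ` below e)" "c \<odot>\<^bsub>?F\<^esub> mvec e \<oplus>\<^bsub>?F\<^esub> y \<in> K"
    and z: "z \<in> F.span (mvec ` below e)" "d \<odot>\<^bsub>?F\<^esub> mvec e \<oplus>\<^bsub>?F\<^esub> z \<in> K"
    and c: "c \<in> carrier R" "d \<in> carrier R" unfolding lead_def by blast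
  have "(c \<oplus> d) \<odot>\<^bsub>?F\<^esub> mvec e \<oplus>\<^bsub>?F\<^esub> (y \<oplus>\<^bsub>?F\<^esub> z)
      = (c \<odot>\<^bsub>?F\<^esub> mvec e \<oplus>\<^bsub>?F\<^esub> y) \<oplus>\<^bsub>?F\<^esub> (d \<odot>\<^bsub>?F\<^esub> mvec e \<oplus>\<^bsub>?F\<^esub> z)"
    using c mon_closed in_S[OF y(1)] in_S[OF z(1)] by (simp add: F.smult_l_distr F.M.a_ac)
  then show "c \<oplus> d \<in> lead e"
    unfolding lead_def using c submodule_add[OF K y(2) z(2)] submodule_add[OF S y(1) z(1)] by force
next
  let ?F = "free_module R b"
  have S: "submodule R (F.span (mvec ` below e)) ?F" by (rule F.span_is_submodule[OF mon_span_closed])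
  note in_S = submodule_in[OF S]
  fix r c assume r: "r \<in> carrier R" and "c \<in> lead e"
  then obtain y where y: "y \<in> F.span (mvec ` below e)" "c \<odot>\<^bsub>?F\<^esub> mvec e \<oplus>\<^bsub>?F\<^esub> y \<in> K"
    and c: "c \<in> carrier R" unfolding lead_def by blast
  have "(r \<otimes> c) \<odot>\<^bsub>?F\<^esub> mvec e \<oplus>\<^bsub>?F\<^esub> (r \<odot>\<^bsub>?F\<^esub> y) = r \<odot>\<^bsub>?F\<^esub> (c \<odot>\<^bsub>?F\<^esub> mvec e \<oplus>\<^bsub>?F\<^esub> y)"
    using r c mon_closed in_S[OF y(1)] by (simp add: F.smult_assoc1 F.smult_r_distr)
  then show "r \<otimes> c \<in> lead e"
    unfolding lead_def using r c submodule_smult[OF K r y(2)] submodule_smult[OF S r y(1)] by force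
qed

lemma below_up: "i < s \<Longrightarrow> (\<lambda>e. e(i := Suc (e i))) ` below e \<subseteq> below (e(i := Suc (e i)))"
  unfolding below_def by (auto simp: mdeg_up exps_up lex_less_incr)

text \<open>Multiplying by \<open>x i\<close> turns an expression for \<open>e\<close> into one for
  the raised exponent with the same leading coefficient, because raising preserves equality of
  degrees and the lexicographic order (\<open>below_up\<close>).\<close>

lemma lead_up:
  assumes i: "i < s"
  shows "lead e \<subseteq> lead (e(i := Suc (e i)))"
proof
  let ?F = "free_module R b"
  have S: "submodule R (F.span (mvec ` below e)) ?F" by (rule F.span_is_submodule[OF mon_span_closed])
  fix c assume "c \<in> lead e"
  then obtain y where y: "y \<in> F.span (mvec ` below e)" "c \<odot>\<^bsub>?F\<^esub> mvec e \<oplus>\<^bsub>?F\<^esub> y \<in> K"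
    and c: "c \<in> carrier R" unfolding lead_def by blast
  have xi: "x i \<in> carrier R" using x_gen i by auto
  have "c \<odot>\<^bsub>?F\<^esub> mvec (e(i := Suc (e i))) \<oplus>\<^bsub>?F\<^esub> (x i \<odot>\<^bsub>?F\<^esub> y)
      = x i \<odot>\<^bsub>?F\<^esub> (c \<odot>\<^bsub>?F\<^esub> mvec e \<oplus>\<^bsub>?F\<^esub> y)"
    using c xi mon_closed[of e] submodule_in[OF S y(1)]
    by (simp add: mon_up[OF i] F.smult_r_distr F.smult_assoc1[symmetric] m_comm)
  then have "c \<odot>\<^bsub>?F\<^esub> mvec (e(i := Suc (e i))) \<oplus>\<^bsub>?F\<^esub> (x i \<odot>\<^bsub>?F\<^esub> y) \<in> K"
    using submodule_smult[OF K xi y(2)] by simp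
  then show "c \<in> lead (e(i := Suc (e i)))"
    unfolding lead_def using c span_up[OF i y(1) below_up[OF i]] by blast
qed

text \<open>\<open>lead_up\<close> is applied along a path of unit steps, by induction on the total
  distance \<open>n\<close> of the exponents. Only variables can be raised in this way, so the basis
  index has to agree.\<close>

lemma lead_mono:
  assumes "e \<in> exps" "e' \<in> exps" "e s = e' s" "\<And>i. i < s \<Longrightarrow> e i \<le> e' i"
  shows "lead e \<subseteq> lead e'"
proof -
  have "lead e \<subseteq> lead e'" if "n = (\<Sum>i<s. e' i - e i)" "e' \<in> exps" "e s = e' s" "\<forall>i<s. e i \<le> e' i" for n e'
    using that
  proof (induction n arbitrary: e')
    case 0
    then have "\<forall>i<s. e' i \<le> e i" by simp
    with 0 have "\<forall>i<s. e' i = e i" by (simp add: order_antisym)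
    then have "e' = e" using 0 assms(1) unfolding exps_def fun_eq_iff by (metis (mono_tags, lifting) linorder_cases mem_Collect_eq)
    then show ?case by simp
  next
    case (Suc n)
    then obtain i where i: "i < s" "e i < e' i"
      by (metis (no_types, lifting) Suc_neq_Zero diff_is_0_eq lessThan_iff linorder_not_less sum.neutral)
    define d where "d = e'(i := e' i - 1)"
    have e': "e' = d(i := Suc (d i))" unfolding d_def using i by auto
    have "(\<Sum>i<s. e' i - e i) = (e' i - e i) + (\<Sum>j\<in>{..<s} - {i}. e' j - e j)"
      using i by (simp add: sum.remove)
    moreover have "(\<Sum>i<s. d i - e i) = (e' i - 1 - e i) + (\<Sum>j\<in>{..<s} - {i}. e' j - e j)"
      using i by (simp add: sum.remove d_def)
    ultimately have "n = (\<Sum>i<s. d i - e i)" using Suc.prems(1) i by simp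
    moreover have "d \<in> exps" "e s = d s" "\<forall>i<s. e i \<le> d i"
      using Suc.prems i by (auto simp: d_def exps_up)
    ultimately have "lead e \<subseteq> lead d" by (rule Suc.IH)
    also have "\<dots> \<subseteq> lead e'" unfolding e' by (rule lead_up[OF i(1)])
    finally show ?case .
  qed
  then show ?thesis using assms by blast
qed

text \<open>Otherwise there are exponents of unbounded degree whose ideal differs from those of all
  immediate predecessors. Dickson's lemma makes a sequence of them increasing, and the chain
  condition makes the ideals constant from \<open>N\<close> on. An immediate predecessor
  \<open>d\<close> of a later exponent that still dominates \<open>g N\<close> then has the same
  ideal, a contradiction.\<close>

lemma lead_stable:
  assumes noeth: "noetherian_ring R"
  shows "\<exists>p0. \<forall>e\<in>exps. p0 < mdeg e \<longrightarrow> (\<exists>i<s. 0 < e i \<and> lead e = lead (e(i := e i - 1)))"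
proof (rule ccontr)
  assume "\<not> ?thesis"
  then have "\<forall>n. \<exists>e. e \<in> exps \<and> n < mdeg e \<and> \<not> (\<exists>i<s. 0 < e i \<and> lead e = lead (e(i := e i - 1)))" by blast
  then obtain f where f: "\<And>n. f n \<in> exps" "\<And>n. n < mdeg (f n)"
    "\<And>n i. i < s \<Longrightarrow> 0 < f n i \<Longrightarrow> lead (f n) \<noteq> lead ((f n)(i := f n i - 1))" by metis
  \<comment> \<open>Coordinate \<open>s\<close> records the basis index and coordinate
    \<open>s + 1\<close> its complement to \<open>b\<close>; if both are nondecreasing, the basis
    index is constant along the subsequence (\<open>g_s\<close>).\<close>
  define h where "h n i = (if i < s then f n i else if i = s then f n s else b - f n s)" for n i
  obtain r :: "nat \<Rightarrow> nat" where r: "strict_mono r" "\<forall>i<s + 2. mono (\<lambda>n. h (r n) i)"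
    using monotone_subsequence[of "s + 2" h] by blast
  define g where "g n = f (r n)" for n
  have g_mono: "g m i \<le> g n i" if "m \<le> n" "i < s" for m n i
  proof -
    have "mono (\<lambda>n. h (r n) i)" using r(2) that by simp
    from monoD[OF this that(1)] show ?thesis using that(2) by (simp add: h_def g_def)
  qed
  have g_s: "g m s = g n s" if "m \<le> n" for m n
  proof -
    have "mono (\<lambda>n::nat. h (r n) s)" "mono (\<lambda>n::nat. h (r n) (Suc s))" using r(2) by auto
    from this[THEN monoD, OF that] have "g m s \<le> g n s" "b - g m s \<le> b - g n s"
      by (auto simp: h_def g_def)
    moreover have "g m s < b" "g n s < b" using f(1) by (auto simp: g_def exps_def)
    ultimately show ?thesis by linarith
  qed
  have ge: "g n \<in> exps" for n using f(1) by (simp add: g_def)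
  have chain: "lead (g m) \<subseteq> lead (g n)" if "m \<le> n" for m n
    using g_s[OF that] g_mono[OF that] by (intro lead_mono ge) auto
  have "(\<Union>(range (\<lambda>n. lead (g n)))) \<in> range (\<lambda>n. lead (g n))"
  proof (rule noetherian_ring.ideal_chain_is_trivial[OF noeth])
    show "subset.chain {I. ideal I R} (range (\<lambda>n. lead (g n)))"
      unfolding subset_chain_def
    proof (intro conjI ballI)
      fix X Y assume "X \<in> range (\<lambda>n. lead (g n))" "Y \<in> range (\<lambda>n. lead (g n))"
      then obtain m n where "X = lead (g m)" "Y = lead (g n)" by auto
      then show "X \<subseteq> Y \<or> Y \<subseteq> X" using chain[of m n] chain[of n m] by (cases "m \<le> n") auto
    qed (use lead_ideal in auto)
  qed auto
  then obtain N where N: "(\<Union>n. lead (g n)) = lead (g N)" by auto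
  \<comment> \<open>Since \<open>n \<le> r n < mdeg (g n)\<close>, the degree of \<open>g n\<close>
    exceeds that of \<open>g N\<close>; as the basis index is constant, some variable exponent must
    have grown.\<close>
  define n where "n = N + mdeg (g N)"
  have "mdeg (g N) < mdeg (g n)"
  proof -
    have "n \<le> r n" using r(1) by (simp add: strict_mono_imp_increasing)
    then show ?thesis using f(2)[of "r n"] by (simp add: g_def n_def)
  qed
  moreover have Nn: "N \<le> n" by (simp add: n_def)
  ultimately obtain i where i: "i < s" "g N i < g n i"
    unfolding mdeg_def using g_s[OF Nn] sum_mono[of "{..<s}" "g n" "g N"] by (metis add_less_cancel_right lessThan_iff linorder_not_less)
  define d where "d = (g n)(i := g n i - 1)"
  have de: "d \<in> exps" using ge i by (simp add: d_def exps_up)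
  have "lead (g N) \<subseteq> lead d"
    using g_s[OF Nn] g_mono[OF Nn] i by (intro lead_mono ge de) (auto simp: d_def)
  moreover have "lead d \<subseteq> lead (g n)"
    using i by (intro lead_mono ge de) (auto simp: d_def)
  moreover have "lead (g n) \<subseteq> lead (g N)" using N by blast
  ultimately have "lead (g n) = lead d" using chain[OF Nn] by blast
  then show False using f(3)[of i "r n"] i by (simp add: d_def g_def)
qed

text \<open>Division by leading terms. The set \<open>D\<close> is closed downwards. If
  \<open>e\<close> is its largest exponent and \<open>c\<close> the coefficient of \<open>y\<close>
  there, stability of the ideals gives an element \<open>z\<close> of \<open>K\<close> in degree
  \<open>p\<close> with coefficient \<open>c\<close> at the exponent lowered at \<open>i\<close>.
  Then \<open>y\<close> minus \<open>x i\<close> times \<open>z\<close> involves only exponents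
  below \<open>e\<close>, and \<open>x i\<close> times \<open>z\<close> lies in
  \<open>T\<close>.\<close>

lemma artin_rees_step:
  assumes stable: "\<And>e. e \<in> exps \<Longrightarrow> mdeg e = Suc p \<Longrightarrow> \<exists>i<s. 0 < e i \<and> lead e = lead (e(i := e i - 1))"
    and T: "submodule R T (free_module R b)"
      "\<And>r z. r \<in> I \<Longrightarrow> z \<in> K \<inter> shift_filt R I b a p \<Longrightarrow> r \<odot>\<^bsub>free_module R b\<^esub> z \<in> T"
    and D: "D \<subseteq> {e \<in> exps. mdeg e = Suc p}" "\<And>e e'. e \<in> D \<Longrightarrow> e' \<in> below e \<Longrightarrow> e' \<in> D"
    and y: "y \<in> K" "y \<in> F.span (mvec ` D)"
  shows "y \<in> T"
  using D y
proof (induction "card D" arbitrary: D y)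
  case 0
  have "finite D" using 0(2) finite_deg finite_subset by blast
  then have "D = {}" using 0 by simp
  moreover have "F.span {} \<subseteq> T" by (rule F.span_is_subset[OF _ T(1)]) simp
  ultimately show ?case using 0 by auto
next
  case (Suc n)
  let ?F = "free_module R b"
  have fin: "finite D" using Suc(3) finite_deg finite_subset by blast
  have "D \<noteq> {}" using Suc(2) by auto
  from finite_lex_max[OF fin this] obtain e where e: "e \<in> D" "\<forall>e'\<in>D. e' = e \<or> lex_less e' e" by auto
  have ee: "e \<in> exps" "mdeg e = Suc p" using e(1) Suc(3) by auto
  have below: "below e = D - {e}"
  proof
    show "below e \<subseteq> D - {e}" using Suc(4)[OF e(1)] by (auto simp: below_def lex_less_irrefl)
    show "D - {e} \<subseteq> below e" using e Suc(3) ee by (auto simp: below_def)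
  qed
  then have De: "mvec ` D = insert (mvec e) (mvec ` below e)" using e(1) by auto
  obtain c w where c: "c \<in> carrier R" and w: "w \<in> F.span (mvec ` below e)"
    and y: "y = c \<odot>\<^bsub>?F\<^esub> mvec e \<oplus>\<^bsub>?F\<^esub> w"
    using F.span_insertE[OF mon_span_closed[of "below e"] mon_closed[of e]] Suc(6) unfolding De by metis
  have "c \<in> lead e" unfolding lead_def using c w Suc(5) y by blast
  moreover obtain i where i: "i < s" "0 < e i" "lead e = lead (e(i := e i - 1))"
    using stable[OF ee] by auto
  define d where "d = e(i := e i - 1)"
  have ed: "e = d(i := Suc (d i))" unfolding d_def using i by auto
  have dd: "d \<in> exps" "mdeg d = p" using ee mdeg_up[OF i(1), of d] i exps_up[OF i(1)] unfolding ed[symmetric] by (auto simp: d_def)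
  ultimately obtain v where v: "v \<in> F.span (mvec ` below d)" "c \<odot>\<^bsub>?F\<^esub> mvec d \<oplus>\<^bsub>?F\<^esub> v \<in> K"
    using i(3) unfolding d_def[symmetric] lead_def by auto
  define z where "z = c \<odot>\<^bsub>?F\<^esub> mvec d \<oplus>\<^bsub>?F\<^esub> v"
  have xi: "x i \<in> carrier R" using x_gen i by auto
  have vc: "v \<in> carrier ?F" using v(1) F.span_is_subset2[OF mon_span_closed] by blast
  have wc: "w \<in> carrier ?F" using w F.span_is_subset2[OF mon_span_closed] by blast
  have Gp: "submodule R (shift_filt R I b a p) ?F" by (rule shift_filt_submodule[OF I_ideal])
  have "v \<in> shift_filt R I b a p" using v(1) span_filt[of "below d" p] dd by (auto simp: below_def)
  moreover have "mvec d \<in> shift_filt R I b a p" using mon_filt[of d] dd by simp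
  ultimately have zG: "z \<in> shift_filt R I b a p" unfolding z_def
    using c by (intro submodule_add[OF Gp] submodule_smult[OF Gp])
  have zK: "z \<in> K" using v(2) z_def by simp
  have zc: "z \<in> carrier ?F" using shift_filt_in[OF zG] .
  have xz: "x i \<odot>\<^bsub>?F\<^esub> z = c \<odot>\<^bsub>?F\<^esub> mvec e \<oplus>\<^bsub>?F\<^esub> x i \<odot>\<^bsub>?F\<^esub> v"
    unfolding z_def using c xi vc mon_closed[of d] mon_up[OF i(1), of d] ed
    by (simp add: F.smult_r_distr F.smult_assoc1[symmetric] m_comm)
  have xv: "x i \<odot>\<^bsub>?F\<^esub> v \<in> F.span (mvec ` below e)"
    using span_up[OF i(1) v(1) below_up[OF i(1)]] ed by simp
  have "y \<ominus>\<^bsub>?F\<^esub> x i \<odot>\<^bsub>?F\<^esub> z = w \<ominus>\<^bsub>?F\<^esub> x i \<odot>\<^bsub>?F\<^esub> v"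
    unfolding y xz using c wc mon_closed[of e] F.smult_closed[OF xi vc]
    by (intro F.M.add_minus_add_left) auto
  also have "\<dots> \<in> F.span (mvec ` below e)"
    by (rule submodule_minus[OF F.span_is_submodule[OF mon_span_closed] w xv])
  finally have yz: "y \<ominus>\<^bsub>?F\<^esub> x i \<odot>\<^bsub>?F\<^esub> z \<in> F.span (mvec ` below e)" .
  have yzK: "y \<ominus>\<^bsub>?F\<^esub> x i \<odot>\<^bsub>?F\<^esub> z \<in> K"
    by (rule submodule_minus[OF K Suc(5) submodule_smult[OF K xi zK]])
  have "y \<ominus>\<^bsub>?F\<^esub> x i \<odot>\<^bsub>?F\<^esub> z \<in> T"
  proof (rule Suc(1)[OF _ _ _ yzK yz])
    show "n = card (below e)" using Suc(2) below e(1) fin by simp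
    show "below e \<subseteq> {e \<in> exps. mdeg e = Suc p}" using ee by (auto simp: below_def)
    show "e'' \<in> below e" if "e' \<in> below e" "e'' \<in> below e'" for e' e''
      using that lex_less_trans by (auto simp: below_def)
  qed
  moreover have "x i \<odot>\<^bsub>?F\<^esub> z \<in> T" using T(2)[OF x_in_I[OF i(1)]] zK zG by blast
  ultimately show ?case
    using submodule_minusD[OF T(1)] submodule_in[OF K Suc(5)] by blast
qed

end

end

text \<open>The inclusion that makes the filtration induced on \<open>K\<close> stable; the opposite
  one is formal (\<open>shift_filt_smult\<close>). In the application of
  \<open>artin_rees_step\<close>, \<open>D\<close> consists of all exponents of degree
  \<open>Suc p\<close> and \<open>T\<close> is the product of \<open>I\<close> with the step
  \<open>p\<close>.\<close>

theorem (in noetherian_ring) artin_rees: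
  assumes "cring R" and I: "ideal I R" and K: "submodule R K (free_module R b)"
  shows "\<exists>p0. \<forall>p\<ge>p0. K \<inter> shift_filt R I b a (Suc p)
    \<subseteq> ideal_smult R I (free_module R b) (K \<inter> shift_filt R I b a p)"
proof -
  interpret cring R by fact
  interpret F: module R "free_module R b" by (rule free_module)
  obtain A where A: "A \<subseteq> carrier R" "finite A" "I = Idl A" using finetely_gen[OF I] by auto
  obtain x and s :: nat where x: "A = x ` {i. i < s}"
    using finite_imp_nat_seg_image_inj_on[OF A(2)] by auto
  have set: "{i::nat. i < s} = {..<s}" by auto
  interpret shifted_monomials R I x s b a
    using A(1,3) unfolding x set
    by (intro shifted_monomials.intro shifted_monomials_axioms.intro is_cring I) auto
  obtain p0 where p0: "\<And>e. e \<in> exps \<Longrightarrow> p0 < mdeg e \<Longrightarrow> \<exists>i<s. 0 < e i \<and> lead K e = lead K (e(i := e i - 1))"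
    using lead_stable[OF K noetherian_ring_axioms] by blast
  \<comment> \<open>The sum of the shifts bounds every single one, so that \<open>filt_span\<close>
    applies in degree \<open>Suc p\<close>; the summand \<open>p0\<close> puts this degree into the
    stable range.\<close>
  have "K \<inter> shift_filt R I b a (Suc p)
      \<subseteq> ideal_smult R I (free_module R b) (K \<inter> shift_filt R I b a p)"
    if p: "p \<ge> p0 + (\<Sum>l<b. a l)" for p
  proof
    fix y assume y: "y \<in> K \<inter> shift_filt R I b a (Suc p)"
    have al: "a l \<le> Suc p" if "l < b" for l
    proof -
      have "a l \<le> (\<Sum>l<b. a l)" using that by (intro member_le_sum) auto
      then show ?thesis using p by simp
    qed
    let ?G = "{r \<odot>\<^bsub>free_module R b\<^esub> z | r z. r \<in> I \<and> z \<in> K \<inter> shift_filt R I b a p}"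
    have Gc: "?G \<subseteq> carrier (free_module R b)"
      using submodule_in[OF K] ideal.Icarr[OF I] by auto
    show "y \<in> ideal_smult R I (free_module R b) (K \<inter> shift_filt R I b a p)"
      unfolding ideal_smult_def
    proof (rule artin_rees_step[OF K _ F.span_is_submodule[OF Gc]])
      show "\<exists>i<s. 0 < e i \<and> lead K e = lead K (e(i := e i - 1))" if "e \<in> exps" "mdeg e = Suc p" for e
        using p0[OF that(1)] that(2) p by simp
      show "r \<odot>\<^bsub>free_module R b\<^esub> z \<in> F.span ?G" if "r \<in> I" "z \<in> K \<inter> shift_filt R I b a p" for r z
        using F.in_own_span[OF Gc] that by blast
      show "{e \<in> exps. mdeg e = Suc p} \<subseteq> {e \<in> exps. mdeg e = Suc p}" by simp
      show "e' \<in> {e \<in> exps. mdeg e = Suc p}" if "e \<in> {e \<in> exps. mdeg e = Suc p}" "e' \<in> below e" for e e'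
        using that by (simp add: below_def)
      show "y \<in> K" using y by simp
      show "y \<in> F.span (mvec ` {e \<in> exps. mdeg e = Suc p})" using filt_span[OF al] y by auto
    qed
  qed
  then show ?thesis by blast
qed

section \<open>Minimal generators of a filtered module\<close>

lemma (in module) cyclic_submodule:
  assumes J: "ideal J R" and v: "v \<in> carrier M"
  shows "submodule R {c \<odot>\<^bsub>M\<^esub> v | c. c \<in> J} M"
proof
  interpret J: ideal J R by fact
  show "{c \<odot>\<^bsub>M\<^esub> v | c. c \<in> J} \<subseteq> carrier M" using v J.Icarr by auto
  have "\<zero>\<^bsub>M\<^esub> = \<zero>\<^bsub>R\<^esub> \<odot>\<^bsub>M\<^esub> v" using v by simp
  then show "\<zero>\<^bsub>M\<^esub> \<in> {c \<odot>\<^bsub>M\<^esub> v | c. c \<in> J}" using J.zero_closed by blast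
  fix p q assume "p \<in> {c \<odot>\<^bsub>M\<^esub> v | c. c \<in> J}" "q \<in> {c \<odot>\<^bsub>M\<^esub> v | c. c \<in> J}"
  then obtain c d where "c \<in> J" "d \<in> J" "p = c \<odot>\<^bsub>M\<^esub> v" "q = d \<odot>\<^bsub>M\<^esub> v" by blast
  then have "p \<oplus>\<^bsub>M\<^esub> q = (c \<oplus>\<^bsub>R\<^esub> d) \<odot>\<^bsub>M\<^esub> v" "c \<oplus>\<^bsub>R\<^esub> d \<in> J"
    using v J.Icarr J.a_closed by (simp_all add: smult_l_distr)
  then show "p \<oplus>\<^bsub>M\<^esub> q \<in> {c \<odot>\<^bsub>M\<^esub> v | c. c \<in> J}" by blast
next
  interpret J: ideal J R by fact
  fix r p assume r: "r \<in> carrier R" and "p \<in> {c \<odot>\<^bsub>M\<^esub> v | c. c \<in> J}"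
  then obtain c where "c \<in> J" "p = c \<odot>\<^bsub>M\<^esub> v" by blast
  then have "r \<odot>\<^bsub>M\<^esub> p = (r \<otimes>\<^bsub>R\<^esub> c) \<odot>\<^bsub>M\<^esub> v" "r \<otimes>\<^bsub>R\<^esub> c \<in> J"
    using v r J.Icarr J.I_l_closed by (simp_all add: smult_assoc1)
  then show "r \<odot>\<^bsub>M\<^esub> p \<in> {c \<odot>\<^bsub>M\<^esub> v | c. c \<in> J}" by blast
qed

lemma (in module) ideal_smult_submodule:
  assumes "ideal J R" "N \<subseteq> carrier M"
  shows "submodule R (ideal_smult R J M N) M"
  unfolding ideal_smult_def using ideal.Icarr[OF assms(1)] assms(2) by (intro span_is_submodule) auto

lemma (in module) ideal_smultI:
  assumes "ideal J R" "N \<subseteq> carrier M" "r \<in> J" "x \<in> N"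
  shows "r \<odot>\<^bsub>M\<^esub> x \<in> ideal_smult R J M N"
proof -
  have "{r \<odot>\<^bsub>M\<^esub> x | r x. r \<in> J \<and> x \<in> N} \<subseteq> carrier M" using ideal.Icarr[OF assms(1)] assms(2) by auto
  from in_own_span[OF this] show ?thesis unfolding ideal_smult_def using assms by blast
qed

lemma (in module) ideal_smult_subset:
  assumes "submodule R K M" "\<And>r x. r \<in> J \<Longrightarrow> x \<in> N \<Longrightarrow> r \<odot>\<^bsub>M\<^esub> x \<in> K"
  shows "ideal_smult R J M N \<subseteq> K"
  unfolding ideal_smult_def using assms by (intro span_is_subset) auto

lemma (in abelian_group) add_minus_left:
  assumes "x \<in> carrier G" "y \<in> carrier G"
  shows "(x \<oplus> y) \<ominus> x = y"
proof -
  have "(x \<oplus> y) \<ominus> x = y \<oplus> (x \<oplus> \<ominus> x)" unfolding minus_eq using assms by (simp add: a_ac)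
  then show ?thesis using assms by (simp add: r_neg)
qed

lemma set_add_mono: "A \<subseteq> A' \<Longrightarrow> B \<subseteq> B' \<Longrightarrow> A <+>\<^bsub>M\<^esub> B \<subseteq> A' <+>\<^bsub>M\<^esub> B'"
  unfolding set_add_def' by blast

context noetherian_local_ring
begin

lemma \<mm>_ideal: "ideal \<mm> R" by (rule ideal_axioms)

lemma one_notin: "\<one> \<notin> \<mm>"
  using I_notcarr one_imp_carrier by auto

text \<open>A nonunit lies in a maximal ideal, and there is only one. Zorn's lemma is applied to the
  proper ideals containing \<open>r\<close>; over a Noetherian ring a nonempty chain contains its
  own union, so upper bounds are immediate.\<close>

lemma in_max_or_unit:
  assumes r: "r \<in> carrier R" "r \<notin> \<mm>"
  shows "\<exists>c\<in>carrier R. c \<otimes> r = \<one>"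
proof (rule ccontr)
  assume no: "\<not> ?thesis"
  let ?A = "{J. ideal J R \<and> \<one> \<notin> J \<and> r \<in> J}"
  have base: "PIdl r \<in> ?A"
    using cgenideal_ideal[OF r(1)] cgenideal_self[OF r(1)] no by (auto simp: cgenideal_def)
  have "\<exists>J\<in>?A. \<forall>X\<in>?A. J \<subseteq> X \<longrightarrow> X = J"
  proof (rule subset_Zorn)
    fix C assume C: "subset.chain ?A C"
    show "\<exists>U\<in>?A. \<forall>X\<in>C. X \<subseteq> U"
    proof (cases "C = {}")
      case False
      have "subset.chain {I. ideal I R} C" using C unfolding subset_chain_def by auto
      then have "\<Union>C \<in> C" by (rule ideal_chain_is_trivial[OF False])
      then show ?thesis using C unfolding subset_chain_def by blast
    qed (use base in auto)
  qed
  then obtain J where J: "ideal J R" "\<one> \<notin> J" "r \<in> J"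
    and max: "\<And>X. ideal X R \<Longrightarrow> \<one> \<notin> X \<Longrightarrow> r \<in> X \<Longrightarrow> J \<subseteq> X \<Longrightarrow> X = J" by blast
  have "maximalideal J R"
  proof (rule maximalidealI[OF J(1)])
    show "carrier R \<noteq> J" using J(2) by auto
    show "K = J \<or> K = carrier R" if "ideal K R" "J \<subseteq> K" "K \<subseteq> carrier R" for K
      using max[OF that(1)] that J(3) ideal.one_imp_carrier[OF that(1)] by blast
  qed
  then show False using unique_maximal J(3) r(2) by blast
qed

text \<open>Relative form, proved by removing generators modulo \<open>S\<close> one at a time
  instead of by determinants: if \<open>v\<close> is one of the generators and \<open>T\<close> the
  remaining ones, then \<open>v\<close> is \<open>c\<close> times \<open>v\<close> plus an element
  of \<open>S\<close> plus the span of \<open>T\<close>, with \<open>c\<close> in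
  \<open>\<mm>\<close>, and \<open>\<one> \<ominus> c\<close> is a unit.\<close>

lemma nakayama:
  assumes M: "module R M" and N: "submodule R N M" and fg: "fin_gen R M N"
    and S: "submodule R S M" and sub: "N \<subseteq> S <+>\<^bsub>M\<^esub> ideal_smult R \<mm> M N"
  shows "N \<subseteq> S"
proof -
  interpret M: module R M by fact
  have "N \<subseteq> S" if "finite T" "T \<subseteq> N" "N \<subseteq> S <+>\<^bsub>M\<^esub> M.span T" for T
    using that
  proof (induction T rule: finite_induct)
    case empty
    have "M.span {} \<subseteq> S" by (rule M.span_is_subset[OF _ S]) simp
    then have "S <+>\<^bsub>M\<^esub> M.span {} \<subseteq> S" using sum_sub[OF S] by blast
    then show ?case using empty by blast
  next
    case (insert v T)
    have v: "v \<in> N" "v \<in> carrier M" and T: "T \<subseteq> carrier M" using insert submodule_in[OF N] by auto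
    have spT: "submodule R (M.span T) M" by (rule M.span_is_submodule[OF T])
    have ST: "submodule R (S <+>\<^bsub>M\<^esub> M.span T) M" by (rule submodule_sum[OF S spT])
    let ?V = "{c \<odot>\<^bsub>M\<^esub> v | c. c \<in> \<mm>}"
    have V: "submodule R ?V M" by (rule M.cyclic_submodule[OF \<mm>_ideal v(2)])
    have VST: "submodule R (?V <+>\<^bsub>M\<^esub> (S <+>\<^bsub>M\<^esub> M.span T)) M" by (rule submodule_sum[OF V ST])
    note in_ST = sum_sub_right[OF V ST, THEN subsetD]
    have "ideal_smult R \<mm> M N \<subseteq> ?V <+>\<^bsub>M\<^esub> (S <+>\<^bsub>M\<^esub> M.span T)"
    proof (rule M.ideal_smult_subset[OF VST])
      fix r x assume r: "r \<in> \<mm>" and "x \<in> N"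
      then obtain s y where s: "s \<in> S" "y \<in> M.span (insert v T)" and x: "x = s \<oplus>\<^bsub>M\<^esub> y"
        using insert.prems(2) unfolding set_add_def' by blast
      obtain c w where c: "c \<in> carrier R" and w: "w \<in> M.span T" and y: "y = c \<odot>\<^bsub>M\<^esub> v \<oplus>\<^bsub>M\<^esub> w"
        using M.span_insertE[OF T v(2) s(2)] .
      have rc: "r \<in> carrier R" using Icarr r by simp
      have sc: "s \<in> carrier M" "w \<in> carrier M" using submodule_in[OF S s(1)] submodule_in[OF spT w] .
      have "r \<odot>\<^bsub>M\<^esub> x = (r \<otimes> c) \<odot>\<^bsub>M\<^esub> v \<oplus>\<^bsub>M\<^esub> (r \<odot>\<^bsub>M\<^esub> s \<oplus>\<^bsub>M\<^esub> r \<odot>\<^bsub>M\<^esub> w)"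
        unfolding x y using rc c sc v(2) by (simp add: M.smult_r_distr M.smult_assoc1 M.M.a_ac)
      moreover have "(r \<otimes> c) \<odot>\<^bsub>M\<^esub> v \<in> ?V" using I_r_closed[OF r c] by blast
      moreover have "r \<odot>\<^bsub>M\<^esub> s \<oplus>\<^bsub>M\<^esub> r \<odot>\<^bsub>M\<^esub> w \<in> S <+>\<^bsub>M\<^esub> M.span T"
        unfolding set_add_def' using submodule_smult[OF S rc s(1)] submodule_smult[OF spT rc w] by blast
      ultimately show "r \<odot>\<^bsub>M\<^esub> x \<in> ?V <+>\<^bsub>M\<^esub> (S <+>\<^bsub>M\<^esub> M.span T)" unfolding set_add_def' by blast
    qed
    moreover have "S \<subseteq> ?V <+>\<^bsub>M\<^esub> (S <+>\<^bsub>M\<^esub> M.span T)" using in_ST sum_sub_left[OF S spT] by blast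
    ultimately have "v \<in> ?V <+>\<^bsub>M\<^esub> (S <+>\<^bsub>M\<^esub> M.span T)" using sub v(1) sum_sub[OF VST] by blast
    then obtain c z where c: "c \<in> \<mm>" and z: "z \<in> S <+>\<^bsub>M\<^esub> M.span T" and vz: "v = c \<odot>\<^bsub>M\<^esub> v \<oplus>\<^bsub>M\<^esub> z"
      unfolding set_add_def' by blast
    have cc: "c \<in> carrier R" using Icarr c by simp
    have zc: "z \<in> carrier M" using submodule_in[OF ST z] .
    have "\<one> \<ominus> c \<notin> \<mm>"
    proof
      assume "\<one> \<ominus> c \<in> \<mm>"
      then have "(\<one> \<ominus> c) \<oplus> c \<in> \<mm>" using c by (rule a_closed)
      then show False using one_notin cc by (simp add: minus_eq a_assoc l_neg)
    qed
    then obtain e where e: "e \<in> carrier R" "e \<otimes> (\<one> \<ominus> c) = \<one>" using in_max_or_unit[of "\<one> \<ominus> c"] cc by auto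
    have "(\<one> \<ominus> c) \<odot>\<^bsub>M\<^esub> v = v \<ominus>\<^bsub>M\<^esub> c \<odot>\<^bsub>M\<^esub> v"
      using cc v(2) by (simp add: minus_eq M.smult_l_distr M.smult_l_minus M.M.minus_eq)
    also have "\<dots> = z"
      by (subst vz) (use cc v(2) zc in \<open>simp add: M.M.minus_eq M.M.a_ac M.M.r_neg1 M.M.r_neg2 M.M.r_neg\<close>)
    finally have "v = e \<odot>\<^bsub>M\<^esub> z"
      using e cc v(2) by (metis M.smult_assoc1 M.smult_one minus_closed one_closed)
    then have "v \<in> S <+>\<^bsub>M\<^esub> M.span T" using submodule_smult[OF ST e(1) z] by simp
    moreover have "T \<subseteq> S <+>\<^bsub>M\<^esub> M.span T" using M.in_own_span[OF T] sum_sub_right[OF S spT] by blast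
    ultimately have "M.span (insert v T) \<subseteq> S <+>\<^bsub>M\<^esub> M.span T" by (intro M.span_is_subset[OF _ ST]) auto
    then have "N \<subseteq> S <+>\<^bsub>M\<^esub> M.span T"
      using insert.prems(2) sum_sub[OF ST sum_sub_left[OF S spT]] by blast
    then show ?case using insert by auto
  qed
  moreover obtain T where T: "finite T" "T \<subseteq> N" "N \<subseteq> M.span T" using fg unfolding fin_gen_def by auto
  moreover have "N \<subseteq> S <+>\<^bsub>M\<^esub> M.span T"
    using T sum_sub_right[OF S M.span_is_submodule[of T]] submodule_in[OF N] by blast
  ultimately show ?thesis by blast
qed

lemma shift_filt_std:
  assumes "l < b" "r \<in> ideal_power R \<mm> (q - a l)"
  shows "r \<odot>\<^bsub>free_module R b\<^esub> std_vec R b l \<in> shift_filt R \<mm> b a q"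
proof -
  interpret F: module R "free_module R b" by (rule free_module)
  have r: "r \<in> carrier R" using ideal_power_in[OF \<mm>_ideal assms(2)] .
  have "(r \<odot>\<^bsub>free_module R b\<^esub> std_vec R b l) i \<in> ideal_power R \<mm> (q - a i)" if "i < b" for i
    using assms that r additive_subgroup.zero_closed[OF ideal.axioms(1)[OF ideal_power_ideal[OF \<mm>_ideal]]]
    by (auto simp: free_smult std_vec_def)
  then show ?thesis unfolding shift_filt_def using r std_vec_closed by auto
qed

end

locale stable_filtered_module = noetherian_local_ring R \<mm> + M: module R M
  for R :: "('a, 'r) ring_scheme" (structure) and \<mm> and M :: "('a, 'b, 'm) module_scheme" +
  fixes F :: "nat \<Rightarrow> 'b set"
  assumes fg: "finitely_generated R M" and stable: "stable_filtration R \<mm> M F"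
begin

lemma M_module: "module R M" by (rule M.module_axioms)

lemma F_0: "F 0 = carrier M"
  and F_sub: "submodule R (F p) M"
  and F_Suc: "F (Suc p) \<subseteq> F p"
  and F_smult: "ideal_smult R \<mm> M (F p) \<subseteq> F (Suc p)"
  using stable unfolding stable_filtration_def by auto

lemma F_in: "x \<in> F p \<Longrightarrow> x \<in> carrier M" using submodule_in[OF F_sub] .

lemma F_antimono: "p \<le> q \<Longrightarrow> F q \<subseteq> F p"
  by (induction q rule: dec_induct) (use F_Suc in blast)+

lemma F_power:
  assumes "r \<in> ideal_power R \<mm> q" "x \<in> F p"
  shows "r \<odot>\<^bsub>M\<^esub> x \<in> F (q + p)"
  using assms(1)
proof (induction q arbitrary: r)
  case 0
  then show ?case using submodule_smult[OF F_sub] assms(2) by simp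
next
  case (Suc q)
  then have "r \<in> ideal_prod R (ideal_power R \<mm> q) \<mm>" by simp
  then show ?case
  proof (induction r rule: ideal_prod.induct)
    case (prod i j)
    then have ij: "i \<in> carrier R" "j \<in> carrier R" using Icarr ideal_power_in[OF \<mm>_ideal] by auto
    have "j \<odot>\<^bsub>M\<^esub> (i \<odot>\<^bsub>M\<^esub> x) \<in> ideal_smult R \<mm> M (F (q + p))"
      using prod Suc.IH F_in by (intro M.ideal_smultI \<mm>_ideal) auto
    moreover have "j \<odot>\<^bsub>M\<^esub> (i \<odot>\<^bsub>M\<^esub> x) = (i \<otimes> j) \<odot>\<^bsub>M\<^esub> x"
      using ij F_in[OF assms(2)] by (simp add: M.smult_assoc1[symmetric] m_comm)
    ultimately show ?case using F_smult[of "q + p"] by auto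
  next
    case (sum s t)
    then have "s \<in> carrier R" "t \<in> carrier R"
      using ideal_prod_in_carrier[OF ideal_power_ideal[OF \<mm>_ideal] \<mm>_ideal] by blast+
    with sum show ?case using F_in[OF assms(2)] submodule_add[OF F_sub] by (simp add: M.smult_l_distr)
  qed
qed

lemma comb_filt_submodule:
  assumes "\<And>l. l < b \<Longrightarrow> u l \<in> F (a l)"
  shows "submodule R (comb M b u ` shift_filt R \<mm> b a p) M"
  using assms F_in
  by (intro module_hom_image[OF free_module M_module comb_hom[OF M_module] shift_filt_submodule[OF \<mm>_ideal]]) auto

lemma comb_filt_subset:
  assumes "\<And>l. l < b \<Longrightarrow> u l \<in> F (a l)"
  shows "comb M b u ` shift_filt R \<mm> b a p \<subseteq> F p"
proof clarify
  fix f assume f: "f \<in> shift_filt R \<mm> b a p"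
  show "comb M b u f \<in> F p"
  proof (rule comb_in_submodule[OF F_sub])
    fix l assume l: "l < b"
    then have "f l \<odot>\<^bsub>M\<^esub> u l \<in> F ((p - a l) + a l)"
      using f assms by (intro F_power) (auto simp: shift_filt_def)
    then show "f l \<odot>\<^bsub>M\<^esub> u l \<in> F p" using F_antimono[of p "(p - a l) + a l"] by (meson le_diff_conv2 le_add_diff nat_le_linear subsetD le_refl diff_le_self le_diff_conv)
  qed
qed

lemma comb_filt_term:
  assumes u: "\<And>l. l < b \<Longrightarrow> u l \<in> F (a l)" and "l < b" "r \<in> ideal_power R \<mm> (p - a l)"
  shows "r \<odot>\<^bsub>M\<^esub> u l \<in> comb M b u ` shift_filt R \<mm> b a p"
proof -
  have uc: "u l \<in> carrier M" if "l < b" for l using F_in[OF u[OF that]] .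
  have "comb M b u (r \<odot>\<^bsub>free_module R b\<^esub> std_vec R b l) = r \<odot>\<^bsub>M\<^esub> u l"
    using module_hom_smult[OF comb_hom[OF M_module uc] ideal_power_in[OF \<mm>_ideal assms(3)] std_vec_closed]
      comb_std[OF M_module uc assms(2)] by simp
  then show ?thesis using shift_filt_std[where a = a and q = p, OF assms(2,3)] by (metis imageI)
qed

text \<open>Generation modulo the next step, that is, the classes of the \<open>u l\<close> generate
  the associated graded module. This form is easy to check after deleting a generator, and
  \<open>weak_gens_strong\<close> upgrades it to generation of each \<open>F p\<close>.\<close>

definition weak_gens :: "nat \<Rightarrow> (nat \<Rightarrow> nat) \<Rightarrow> (nat \<Rightarrow> 'b) \<Rightarrow> bool" where
  "weak_gens b a u \<longleftrightarrow> (\<forall>l<b. u l \<in> F (a l)) \<and>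
    (\<forall>p. F p \<subseteq> comb M b u ` shift_filt R \<mm> b a p <+>\<^bsub>M\<^esub> F (Suc p))"

text \<open>Up to the index \<open>p0\<close> of stability, generators of each \<open>F p\<close>
  are taken with degree \<open>p\<close>; from there on \<open>F (Suc p)\<close> is
  \<open>\<mm>\<close> times \<open>F p\<close> and no new generators are required.\<close>

lemma ex_weak_gens: "\<exists>b a u. weak_gens b a u"
proof -
  obtain p0 where p0: "\<And>p. p \<ge> p0 \<Longrightarrow> ideal_smult R \<mm> M (F p) = F (Suc p)"
    using stable unfolding stable_filtration_def by blast
  have "\<exists>xs. set xs \<subseteq> F p \<and> F p \<subseteq> M.span (set xs)" for p
    using submodule_fin_gen[OF M_module fg F_sub[of p]] finite_list unfolding fin_gen_def by metis
  then obtain xs where xs: "\<And>p. set (xs p) \<subseteq> F p" "\<And>p. F p \<subseteq> M.span (set (xs p))" by metis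
  \<comment> \<open>Entries are pairs of a degree and a generator, so that one element may occur
    with several degrees.\<close>
  define L where "L = concat (map (\<lambda>p. map (Pair p) (xs p)) [0..<Suc p0])"
  have L: "z \<in> set L \<longleftrightarrow> fst z \<le> p0 \<and> snd z \<in> set (xs (fst z))" for z
    by (cases z) (auto simp: L_def image_iff simp del: upt_Suc)
  define b where "b = length L"
  define a where "a l = fst (L ! l)" for l
  define u where "u l = snd (L ! l)" for l
  have u: "u l \<in> F (a l)" if "l < b" for l
    using L[of "L ! l"] nth_mem[of l L] that xs(1) by (auto simp: b_def u_def a_def)
  have S: "submodule R (comb M b u ` shift_filt R \<mm> b a p) M" for p
    by (rule comb_filt_submodule[OF u])
  have uc: "u l \<in> carrier M" if "l < b" for l using F_in[OF u[OF that]] .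
  have low: "F p \<subseteq> comb M b u ` shift_filt R \<mm> b a p" if "p \<le> p0" for p
  proof -
    have "set (xs p) \<subseteq> comb M b u ` shift_filt R \<mm> b a p"
    proof
      fix y assume y: "y \<in> set (xs p)"
      then have "(p, y) \<in> set L" using that by (simp add: L)
      then obtain l where l: "l < b" "L ! l = (p, y)" by (auto simp: in_set_conv_nth b_def)
      have "\<one> \<odot>\<^bsub>M\<^esub> u l \<in> comb M b u ` shift_filt R \<mm> b a p"
        using l by (intro comb_filt_term[OF u]) (auto simp: a_def)
      then show "y \<in> comb M b u ` shift_filt R \<mm> b a p" using uc[OF l(1)] l(2) by (simp add: u_def)
    qed
    then have "M.span (set (xs p)) \<subseteq> comb M b u ` shift_filt R \<mm> b a p"
      by (rule M.span_is_subset[OF _ S])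
    then show ?thesis using xs(2) by blast
  qed
  have high: "F (p0 + n) \<subseteq> comb M b u ` shift_filt R \<mm> b a (p0 + n)" for n
  proof (induction n)
    case (Suc n)
    have "ideal_smult R \<mm> M (F (p0 + n)) \<subseteq> comb M b u ` shift_filt R \<mm> b a (p0 + Suc n)"
    proof (rule M.ideal_smult_subset[OF S])
      fix r x assume r: "r \<in> \<mm>" and "x \<in> F (p0 + n)"
      then obtain f where f: "f \<in> shift_filt R \<mm> b a (p0 + n)" "x = comb M b u f" using Suc by blast
      have "r \<odot>\<^bsub>free_module R b\<^esub> f \<in> shift_filt R \<mm> b a (Suc 0 + (p0 + n))"
        using r ideal_power_Suc_0[OF \<mm>_ideal] by (intro shift_filt_smult[OF \<mm>_ideal _ f(1)]) simp
      moreover have "comb M b u (r \<odot>\<^bsub>free_module R b\<^esub> f) = r \<odot>\<^bsub>M\<^esub> x"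
        unfolding f(2) using module_hom_smult[OF comb_hom[OF M_module uc] Icarr[OF r] shift_filt_in[OF f(1)]] .
      ultimately show "r \<odot>\<^bsub>M\<^esub> x \<in> comb M b u ` shift_filt R \<mm> b a (p0 + Suc n)"
        by (metis add_Suc add_Suc_right add_0 imageI)
    qed
    then show ?case using p0[of "p0 + n"] by simp
  qed (use low in simp)
  have "F p \<subseteq> comb M b u ` shift_filt R \<mm> b a p" for p
    using low[of p] high[of "p - p0"] by (cases "p \<le> p0") auto
  then have "F p \<subseteq> comb M b u ` shift_filt R \<mm> b a p <+>\<^bsub>M\<^esub> F (Suc p)" for p
    using sum_sub_left[OF S F_sub] by blast
  then show ?thesis unfolding weak_gens_def using u by blast
qed

text \<open>Iteration places \<open>F p\<close> inside the generated part plus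
  \<open>F (p + n)\<close> for every \<open>n\<close>. For \<open>n = Suc p0\<close> the second
  summand lies in \<open>\<mm>\<close> times \<open>F p\<close> by stability, and Nakayama's lemma
  removes it.\<close>

lemma weak_gens_strong:
  assumes "weak_gens b a u"
  shows "F p = comb M b u ` shift_filt R \<mm> b a p"
proof
  have u: "\<And>l. l < b \<Longrightarrow> u l \<in> F (a l)"
    and weak: "\<And>p. F p \<subseteq> comb M b u ` shift_filt R \<mm> b a p <+>\<^bsub>M\<^esub> F (Suc p)"
    using assms unfolding weak_gens_def by auto
  let ?S = "\<lambda>p. comb M b u ` shift_filt R \<mm> b a p"
  have S: "submodule R (?S p) M" for p by (rule comb_filt_submodule[OF u])
  show "?S p \<subseteq> F p" by (rule comb_filt_subset[OF u])
  have far: "F p \<subseteq> ?S p <+>\<^bsub>M\<^esub> F (p + n)" for n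
  proof (induction n)
    case 0
    then show ?case using sum_sub_right[OF S F_sub] by simp
  next
    case (Suc n)
    have SF: "submodule R (?S p <+>\<^bsub>M\<^esub> F (p + Suc n)) M" by (rule submodule_sum[OF S F_sub])
    have "?S (p + n) \<subseteq> ?S p" using shift_filt_antimono[OF \<mm>_ideal, of p "p + n" b a] by auto
    then have "?S (p + n) <+>\<^bsub>M\<^esub> F (Suc (p + n)) \<subseteq> ?S p <+>\<^bsub>M\<^esub> F (p + Suc n)"
      by (simp add: set_add_mono)
    then have "F (p + n) \<subseteq> ?S p <+>\<^bsub>M\<^esub> F (p + Suc n)" using weak[of "p + n"] by blast
    then show ?case using Suc sum_sub[OF SF sum_sub_left[OF S F_sub]] by blast
  qed
  obtain p0 where p0: "\<And>p. p \<ge> p0 \<Longrightarrow> ideal_smult R \<mm> M (F p) = F (Suc p)"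
    using stable unfolding stable_filtration_def by blast
  have mF: "submodule R (ideal_smult R \<mm> M (F p)) M"
    using F_in by (intro M.ideal_smult_submodule[OF \<mm>_ideal]) auto
  have "ideal_smult R \<mm> M (F (p + p0)) \<subseteq> ideal_smult R \<mm> M (F p)"
    using F_in F_antimono[of p "p + p0"]
    by (intro M.ideal_smult_subset[OF mF] M.ideal_smultI[OF \<mm>_ideal]) auto
  then have "F (p + Suc p0) \<subseteq> ideal_smult R \<mm> M (F p)" using p0[of "p + p0"] by simp
  then have "F p \<subseteq> ?S p <+>\<^bsub>M\<^esub> ideal_smult R \<mm> M (F p)"
    by (rule subset_trans[OF far[of "Suc p0"] set_add_mono[OF order_refl]])
  then show "F p \<subseteq> ?S p"
    by (rule nakayama[OF M_module F_sub submodule_fin_gen[OF M_module fg F_sub] S])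
qed

text \<open>The relation is solved for \<open>u j\<close>, whose coefficient is a unit. This
  expresses \<open>u j\<close> by the other generators modulo \<open>F (Suc p)\<close>, where
  \<open>p\<close> is its own degree, so it can be replaced wherever it contributes to some
  \<open>F q\<close> modulo \<open>F (Suc q)\<close>.\<close>

lemma weak_gens_drop:
  assumes wg: "weak_gens b a u" and f: "f \<in> shift_filt R \<mm> b a p" "comb M b u f \<in> F (Suc p)"
    and j: "j < b" "a j = p" "f j \<notin> \<mm>"
  shows "\<exists>a' u'. weak_gens (b - 1) a' u'"
proof -
  have u: "\<And>l. l < b \<Longrightarrow> u l \<in> F (a l)"
    and weak: "\<And>p. F p \<subseteq> comb M b u ` shift_filt R \<mm> b a p <+>\<^bsub>M\<^esub> F (Suc p)"
    using wg unfolding weak_gens_def by auto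
  have uc: "u l \<in> carrier M" if "l < b" for l using F_in[OF u[OF that]] .
  interpret Fr: module R "free_module R b" by (rule free_module)
  have hom: "comb M b u \<in> module_hom R (free_module R b) M" by (rule comb_hom[OF M_module uc])
  \<comment> \<open>The last index takes the vacant place \<open>j\<close>, so that the indices
    below \<open>b - 1\<close> enumerate all generators except \<open>u j\<close>.\<close>
  define \<sigma> where "\<sigma> l = (if l = j then b - 1 else l)" for l
  define a' where "a' l = a (\<sigma> l)" for l
  define u' where "u' l = u (\<sigma> l)" for l
  have \<sigma>: "\<sigma> l < b" if "l < b - 1" for l using that j(1) by (auto simp: \<sigma>_def)
  have u': "u' l \<in> F (a' l)" if "l < b - 1" for l using u[OF \<sigma>[OF that]] by (simp add: u'_def a'_def)
  let ?T = "\<lambda>q. comb M (b - 1) u' ` shift_filt R \<mm> (b - 1) a' q"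
  have T: "submodule R (?T q) M" for q by (rule comb_filt_submodule[OF u'])
  have other: "r \<odot>\<^bsub>M\<^esub> u l \<in> ?T q" if l: "l < b" "l \<noteq> j" "r \<in> ideal_power R \<mm> (q - a l)" for l r q
  proof -
    define k where "k = (if l = b - 1 then j else l)"
    have k: "k < b - 1" "\<sigma> k = l" using l j(1) by (auto simp: k_def \<sigma>_def)
    have "u' k = u l" "a' k = a l" using k(2) by (simp_all add: u'_def a'_def)
    then show ?thesis using comb_filt_term[where a = a' and r = r and p = q, OF u' k(1)] l(3) by simp
  qed
  have W: "submodule R (?T q <+>\<^bsub>M\<^esub> F (Suc q)) M" for q by (rule submodule_sum[OF T F_sub])
  note T_W = sum_sub_left[OF T F_sub, THEN subsetD] and F_W = sum_sub_right[OF T F_sub, THEN subsetD]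
  have fc: "f \<in> carrier (free_module R b)" using shift_filt_in[OF f(1)] .
  have fj: "f j \<in> carrier R" using free_in[OF fc j(1)] .
  obtain c where c: "c \<in> carrier R" "c \<otimes> f j = \<one>" using in_max_or_unit[OF fj j(3)] by auto
  define f0 where "f0 = (\<lambda>l\<in>{..<b}. if l = j then \<zero> else f l)"
  have f0c: "f0 \<in> carrier (free_module R b)" using free_in[OF fc] by (simp add: f0_def free_carrier restrict_PiE_iff)
  have "f = f0 \<oplus>\<^bsub>free_module R b\<^esub> f j \<odot>\<^bsub>free_module R b\<^esub> std_vec R b j"
  proof (rule free_eqI[OF fc])
    show "f0 \<oplus>\<^bsub>free_module R b\<^esub> f j \<odot>\<^bsub>free_module R b\<^esub> std_vec R b j \<in> carrier (free_module R b)"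
      using f0c fj std_vec_closed by auto
    show "f l = (f0 \<oplus>\<^bsub>free_module R b\<^esub> f j \<odot>\<^bsub>free_module R b\<^esub> std_vec R b j) l" if "l < b" for l
      using that fc fj free_in[OF fc that] by (auto simp: free_add free_smult std_vec_def f0_def)
  qed
  from arg_cong[OF this, of "comb M b u"]
  have "comb M b u f = comb M b u (f0 \<oplus>\<^bsub>free_module R b\<^esub> f j \<odot>\<^bsub>free_module R b\<^esub> std_vec R b j)" .
  also have "\<dots> = comb M b u f0 \<oplus>\<^bsub>M\<^esub> comb M b u (f j \<odot>\<^bsub>free_module R b\<^esub> std_vec R b j)"
    using fj std_vec_closed by (intro module_hom_add[OF hom f0c]) simp
  also have "comb M b u (f j \<odot>\<^bsub>free_module R b\<^esub> std_vec R b j) = f j \<odot>\<^bsub>M\<^esub> u j"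
    using module_hom_smult[OF hom fj std_vec_closed] comb_std[OF M_module uc j(1)] by simp
  finally have fjuj: "f j \<odot>\<^bsub>M\<^esub> u j = comb M b u f \<ominus>\<^bsub>M\<^esub> comb M b u f0"
    using M.M.add_minus_left[OF module_hom_in[OF hom f0c] M.smult_closed[OF fj uc[OF j(1)]]] by simp
  \<comment> \<open>For \<open>q < p\<close> the element \<open>u j\<close> already lies in
    \<open>F (Suc q)\<close>, because it lies in \<open>F p\<close>. From \<open>p\<close> on,
    multiplying the solved relation by \<open>t\<close>, which lies in the power
    \<open>q - p\<close> of \<open>\<mm>\<close>, puts the error into
    \<open>F (Suc q)\<close>.\<close>
  have main: "r \<odot>\<^bsub>M\<^esub> u j \<in> ?T q <+>\<^bsub>M\<^esub> F (Suc q)" if r: "r \<in> ideal_power R \<mm> (q - a j)" for r q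
  proof (cases "q < p")
    case True
    have "r \<odot>\<^bsub>M\<^esub> u j \<in> F p" using u[OF j(1)] j(2) ideal_power_in[OF \<mm>_ideal r] submodule_smult[OF F_sub] by auto
    then show ?thesis using F_antimono[of "Suc q" p] True F_W by auto
  next
    case False
    have rc: "r \<in> carrier R" using ideal_power_in[OF \<mm>_ideal r] .
    define t where "t = r \<otimes> c"
    have t: "t \<in> ideal_power R \<mm> (q - p)"
      unfolding t_def using ideal.I_r_closed[OF ideal_power_ideal[OF \<mm>_ideal]] r c(1) j(2) by simp
    have tc: "t \<in> carrier R" using ideal_power_in[OF \<mm>_ideal t] .
    have "r \<odot>\<^bsub>M\<^esub> u j = t \<odot>\<^bsub>M\<^esub> (f j \<odot>\<^bsub>M\<^esub> u j)"
      using rc c fj uc[OF j(1)] by (simp add: t_def M.smult_assoc1[symmetric] m_assoc)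
    also have "\<dots> = t \<odot>\<^bsub>M\<^esub> comb M b u f \<ominus>\<^bsub>M\<^esub> t \<odot>\<^bsub>M\<^esub> comb M b u f0"
      unfolding fjuj using tc module_hom_in[OF hom f0c] module_hom_in[OF hom fc]
      by (simp add: M.M.minus_eq M.smult_r_distr M.smult_r_minus)
    also have "\<dots> \<in> ?T q <+>\<^bsub>M\<^esub> F (Suc q)"
    proof (rule submodule_minus[OF W])
      have "t \<odot>\<^bsub>M\<^esub> comb M b u f \<in> F (q - p + Suc p)" by (rule F_power[OF t f(2)])
      then show "t \<odot>\<^bsub>M\<^esub> comb M b u f \<in> ?T q <+>\<^bsub>M\<^esub> F (Suc q)" using False F_W by simp
      have "comb M b u (t \<odot>\<^bsub>free_module R b\<^esub> f0) \<in> ?T q"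
      proof (rule comb_in_submodule[OF T])
        fix l assume l: "l < b"
        have tf: "t \<odot>\<^bsub>free_module R b\<^esub> f \<in> shift_filt R \<mm> b a q"
          using shift_filt_smult[OF \<mm>_ideal t f(1)] False by simp
        show "(t \<odot>\<^bsub>free_module R b\<^esub> f0) l \<odot>\<^bsub>M\<^esub> u l \<in> ?T q"
        proof (cases "l = j")
          case True
          then have "(t \<odot>\<^bsub>free_module R b\<^esub> f0) l = \<zero>" using l tc by (simp add: free_smult f0_def)
          then show ?thesis using uc[OF l] submodule_zero[OF T] by simp
        next
          case False
          then have "(t \<odot>\<^bsub>free_module R b\<^esub> f0) l = (t \<odot>\<^bsub>free_module R b\<^esub> f) l"
            using l by (simp add: free_smult f0_def)
          moreover have "(t \<odot>\<^bsub>free_module R b\<^esub> f) l \<in> ideal_power R \<mm> (q - a l)"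
            using tf l by (simp add: shift_filt_def)
          ultimately show ?thesis using other[OF l False] by simp
        qed
      qed
      then show "t \<odot>\<^bsub>M\<^esub> comb M b u f0 \<in> ?T q <+>\<^bsub>M\<^esub> F (Suc q)"
        using T_W by (simp add: module_hom_smult[OF hom tc f0c])
    qed
    finally show ?thesis .
  qed
  have "F q \<subseteq> ?T q <+>\<^bsub>M\<^esub> F (Suc q)" for q
  proof -
    have "comb M b u ` shift_filt R \<mm> b a q \<subseteq> ?T q <+>\<^bsub>M\<^esub> F (Suc q)"
    proof clarify
      fix g assume g: "g \<in> shift_filt R \<mm> b a q"
      show "comb M b u g \<in> ?T q <+>\<^bsub>M\<^esub> F (Suc q)"
      proof (rule comb_in_submodule[OF W])
        fix l assume l: "l < b"
        have "g l \<in> ideal_power R \<mm> (q - a l)" using g l by (simp add: shift_filt_def)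
        then show "g l \<odot>\<^bsub>M\<^esub> u l \<in> ?T q <+>\<^bsub>M\<^esub> F (Suc q)"
          using main[of "g l" q] other[OF l, of "g l" q] T_W by (cases "l = j") auto
      qed
    qed
    then show ?thesis using weak[of q] sum_sub[OF W _ sum_sub_right[OF T F_sub]] by blast
  qed
  then show ?thesis unfolding weak_gens_def using u' by blast
qed

text \<open>The least possible number of generators is chosen; a relation with a unit coefficient at
  a generator of the same degree would allow a deletion. The last clause means that the kernel of
  the induced cover of the associated graded module has coordinates in the irrelevant ideal.\<close>

theorem minimal_filtered_generators:
  "\<exists>b a u. (\<forall>l<b. u l \<in> F (a l)) \<and> (\<forall>p. F p = comb M b u ` shift_filt R \<mm> b a p) \<and>
    (\<forall>p. \<forall>f\<in>shift_filt R \<mm> b a p. comb M b u f \<in> F (Suc p) \<longrightarrow> (\<forall>l<b. a l = p \<longrightarrow> f l \<in> \<mm>))"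
proof -
  define b where "b = (LEAST b. \<exists>a u. weak_gens b a u)"
  have "\<exists>a u. weak_gens b a u" unfolding b_def by (rule LeastI_ex[OF ex_weak_gens])
  then obtain a u where wg: "weak_gens b a u" by blast
  have "f l \<in> \<mm>" if "f \<in> shift_filt R \<mm> b a p" "comb M b u f \<in> F (Suc p)" "l < b" "a l = p" for f l p
  proof (rule ccontr)
    assume "f l \<notin> \<mm>"
    then have "\<exists>a u. weak_gens (b - 1) a u" using weak_gens_drop[OF wg] that by blast
    then have "b \<le> b - 1" unfolding b_def by (rule Least_le)
    then show False using that(3) by simp
  qed
  then show ?thesis using wg weak_gens_strong[OF wg] unfolding weak_gens_def by blast
qed

end

section \<open>Minimal filtered resolutions\<close>

lemma (in cring) shift_filt_0: "shift_filt R I b a 0 = carrier (free_module R b)"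
  by (auto simp: shift_filt_def free_in)

lemma (in module) inclusion_hom:
  "submodule R N M \<Longrightarrow> (\<lambda>x. x) \<in> module_hom R (M\<lparr>carrier := N\<rparr>) M"
  by (rule module_homI) (auto simp: submodule_in)

lemma (in module) submodule_restrict:
  assumes "submodule R N M" "submodule R K M" "K \<subseteq> N"
  shows "submodule R K (M\<lparr>carrier := N\<rparr>)"
  using submodule_is_module[OF assms(1)] assms(2,3) by (simp add: submodule_def)

lemma (in module) comb_restrict:
  assumes N: "submodule R N M" and f: "f \<in> carrier (free_module R b)" and u: "\<And>l. l < b \<Longrightarrow> u l \<in> N"
  shows "comb (M\<lparr>carrier := N\<rparr>) b u f = comb M b u f"
proof -
  have "(\<lambda>l. f l \<odot>\<^bsub>M\<lparr>carrier := N\<rparr>\<^esub> u l) \<in> {..<b} \<rightarrow> carrier (M\<lparr>carrier := N\<rparr>)"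
    using submodule_smult[OF N] u R.free_in[OF f] by auto
  from module_hom_finsum[OF submodule_is_module[OF N] module_axioms inclusion_hom[OF N] _ this]
  show ?thesis by (simp add: comb_def)
qed

context noetherian_local_ring
begin

text \<open>Artin--Rees gives the stability clause. \<open>K\<close> becomes a module by restricting
  the carrier of the free module, so spans and ideal products taken inside it are first identified
  with those of the free module (\<open>span_li_not_depend\<close>).\<close>

lemma kernel_filtration:
  assumes K: "submodule R K (free_module R b)"
  shows "stable_filtered_module R \<mm> ((free_module R b)\<lparr>carrier := K\<rparr>) (\<lambda>p. K \<inter> shift_filt R \<mm> b a p)"
proof -
  interpret F: module R "free_module R b" by (rule free_module)
  let ?N = "(free_module R b)\<lparr>carrier := K\<rparr>"
  have N: "module R ?N" by (rule F.submodule_is_module[OF K])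
  interpret N: module R ?N by (rule N)
  let ?G = "\<lambda>p. K \<inter> shift_filt R \<mm> b a p"
  have G: "submodule R (?G p) (free_module R b)" for p
    by (rule submodule_inter[OF K shift_filt_submodule[OF \<mm>_ideal]])
  have smult: "ideal_smult R \<mm> ?N (?G p) = ideal_smult R \<mm> (free_module R b) (?G p)" for p
    unfolding ideal_smult_def using submodule_smult[OF K] Icarr
    by (subst F.span_li_not_depend[OF _ K]) auto
  have "finitely_generated R ?N"
  proof -
    obtain S where S: "finite S" "S \<subseteq> K" "K \<subseteq> F.span S"
      using free_submodule_fin_gen[OF is_cring K] unfolding fin_gen_def by auto
    have "F.span S \<subseteq> K" by (rule F.span_is_subset[OF S(2) K])
    then have "module.span R ?N S = K" using F.span_li_not_depend(1)[OF S(2) K] S(3) by simp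
    then show ?thesis unfolding finitely_generated_def using S by auto
  qed
  moreover have "stable_filtration R \<mm> ?N ?G"
  proof -
    have low: "ideal_smult R \<mm> ?N (?G p) \<subseteq> ?G (Suc p)" for p
      unfolding smult
    proof (rule F.ideal_smult_subset[OF G])
      fix r x assume r: "r \<in> \<mm>" and x: "x \<in> ?G p"
      have "r \<odot>\<^bsub>free_module R b\<^esub> x \<in> shift_filt R \<mm> b a (Suc 0 + p)"
        using r x ideal_power_Suc_0[OF \<mm>_ideal] by (intro shift_filt_smult[OF \<mm>_ideal]) auto
      then show "r \<odot>\<^bsub>free_module R b\<^esub> x \<in> ?G (Suc p)"
        using submodule_smult[OF K Icarr[OF r]] x by simp
    qed
    obtain p0 where p0: "\<forall>p\<ge>p0. ?G (Suc p) \<subseteq> ideal_smult R \<mm> (free_module R b) (?G p)"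
      using artin_rees[OF is_cring \<mm>_ideal K] by blast
    have "\<forall>p\<ge>p0. ideal_smult R \<mm> ?N (?G p) = ?G (Suc p)"
      using p0 low unfolding smult by blast
    moreover have "?G 0 = carrier ?N" using submodule_in[OF K] by (auto simp: shift_filt_0)
    moreover have "submodule R (?G p) ?N" for p by (rule F.submodule_restrict[OF K G]) simp
    moreover have "?G (Suc p) \<subseteq> ?G p" for p using shift_filt_antimono[OF \<mm>_ideal, of p "Suc p"] by auto
    ultimately show ?thesis unfolding stable_filtration_def using low by blast
  qed
  ultimately show ?thesis
    using noetherian_local_ring_axioms N
    by (simp add: stable_filtered_module_def stable_filtered_module_axioms_def)
qed

text \<open>Minimal generators of the filtered module \<open>K\<close>, followed by the inclusion.
  Equality of the images for every \<open>p\<close>, not only for \<open>p = 0\<close>, is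
  strictness of the new map.\<close>

lemma kernel_cover:
  assumes K: "submodule R K (free_module R b)"
  shows "\<exists>b' a' \<delta>. \<delta> \<in> module_hom R (free_module R b') (free_module R b) \<and>
    (\<forall>p. \<delta> ` shift_filt R \<mm> b' a' p = K \<inter> shift_filt R \<mm> b a p) \<and>
    (\<forall>p. \<forall>f\<in>shift_filt R \<mm> b' a' p. \<delta> f \<in> shift_filt R \<mm> b a (Suc p) \<longrightarrow>
      (\<forall>l<b'. a' l = p \<longrightarrow> f l \<in> \<mm>))"
proof -
  interpret F: module R "free_module R b" by (rule free_module)
  let ?N = "(free_module R b)\<lparr>carrier := K\<rparr>" and ?G = "\<lambda>p. K \<inter> shift_filt R \<mm> b a p"
  obtain b' a' u where u: "\<And>l. l < b' \<Longrightarrow> u l \<in> ?G (a' l)"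
    and gen: "\<And>p. ?G p = comb ?N b' u ` shift_filt R \<mm> b' a' p"
    and min: "\<And>p f l. f \<in> shift_filt R \<mm> b' a' p \<Longrightarrow> comb ?N b' u f \<in> ?G (Suc p) \<Longrightarrow>
       l < b' \<Longrightarrow> a' l = p \<Longrightarrow> f l \<in> \<mm>"
    using stable_filtered_module.minimal_filtered_generators[OF kernel_filtration[OF K, of a]] by metis
  have uK: "u l \<in> K" if "l < b'" for l using u[OF that] by auto
  have eq: "comb ?N b' u f = comb (free_module R b) b' u f" if "f \<in> shift_filt R \<mm> b' a' p" for f p
    by (rule F.comb_restrict[OF K shift_filt_in[OF that] uK])
  have hom: "comb (free_module R b) b' u \<in> module_hom R (free_module R b') (free_module R b)"
    using submodule_in[OF K uK] by (intro comb_hom free_module)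
  have gen': "comb (free_module R b) b' u ` shift_filt R \<mm> b' a' p = ?G p" for p
    unfolding gen using eq by (intro image_cong) auto
  moreover have "f l \<in> \<mm>" if "f \<in> shift_filt R \<mm> b' a' p" "comb (free_module R b) b' u f \<in> shift_filt R \<mm> b a (Suc p)"
      "l < b'" "a' l = p" for p f l
    using min[OF that(1) _ that(3,4)] gen'[of p] eq[OF that(1)] that(1,2) by auto
  ultimately show ?thesis using hom by blast
qed

end

text \<open>The equalities for all \<open>p\<close> contain exactness (the case
  \<open>p = 0\<close>, where \<open>shift_filt\<close> is the whole free module) as well as
  strictness. The clauses \<open>\<epsilon>_min\<close> and \<open>\<delta>_min\<close> say that a
  relation in degree \<open>p\<close>, holding up to the next step, has no unit coefficient at a
  generator of degree \<open>p\<close>.\<close>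

locale filtered_resolution = stable_filtered_module R \<mm> M F
  for R :: "('a, 'r) ring_scheme" (structure) and \<mm> and M :: "('a, 'b, 'm) module_scheme" and F +
  fixes rk :: "nat \<Rightarrow> nat" and sh :: "nat \<Rightarrow> nat \<Rightarrow> nat"
    and \<delta> :: "nat \<Rightarrow> (nat \<Rightarrow> 'a) \<Rightarrow> nat \<Rightarrow> 'a" and \<epsilon> :: "(nat \<Rightarrow> 'a) \<Rightarrow> 'b"
  assumes \<epsilon>_hom: "\<epsilon> \<in> module_hom R (free_module R (rk 0)) M"
    and \<epsilon>_filt: "\<epsilon> ` shift_filt R \<mm> (rk 0) (sh 0) p = F p"
    and \<epsilon>_min: "f \<in> shift_filt R \<mm> (rk 0) (sh 0) p \<Longrightarrow> \<epsilon> f \<in> F (Suc p) \<Longrightarrow>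
      l < rk 0 \<Longrightarrow> sh 0 l = p \<Longrightarrow> f l \<in> \<mm>"
    and \<delta>_hom: "\<delta> (Suc n) \<in> module_hom R (free_module R (rk (Suc n))) (free_module R (rk n))"
    and \<delta>_1_filt: "\<delta> (Suc 0) ` shift_filt R \<mm> (rk (Suc 0)) (sh (Suc 0)) p =
      {x \<in> shift_filt R \<mm> (rk 0) (sh 0) p. \<epsilon> x = \<zero>\<^bsub>M\<^esub>}"
    and \<delta>_filt: "\<delta> (Suc (Suc n)) ` shift_filt R \<mm> (rk (Suc (Suc n))) (sh (Suc (Suc n))) p =
      {x \<in> shift_filt R \<mm> (rk (Suc n)) (sh (Suc n)) p. \<delta> (Suc n) x = \<zero>\<^bsub>free_module R (rk n)\<^esub>}"
    and \<delta>_min: "f \<in> shift_filt R \<mm> (rk (Suc n)) (sh (Suc n)) p \<Longrightarrow>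
      \<delta> (Suc n) f \<in> shift_filt R \<mm> (rk n) (sh n) (Suc p) \<Longrightarrow>
      l < rk (Suc n) \<Longrightarrow> sh (Suc n) l = p \<Longrightarrow> f l \<in> \<mm>"

theorem (in stable_filtered_module) ex_filtered_resolution:
  "\<exists>rk sh \<delta> \<epsilon>. filtered_resolution R \<mm> M F rk sh \<delta> \<epsilon>"
proof -
  obtain b0 a0 u0 where u0: "\<And>l. l < b0 \<Longrightarrow> u0 l \<in> F (a0 l)"
    and gen0: "\<And>p. F p = comb M b0 u0 ` shift_filt R \<mm> b0 a0 p"
    and min0: "\<And>p f l. f \<in> shift_filt R \<mm> b0 a0 p \<Longrightarrow> comb M b0 u0 f \<in> F (Suc p) \<Longrightarrow>
       l < b0 \<Longrightarrow> a0 l = p \<Longrightarrow> f l \<in> \<mm>"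
    using minimal_filtered_generators by metis
  define \<epsilon> where "\<epsilon> = comb M b0 u0"
  have \<epsilon>: "\<epsilon> \<in> module_hom R (free_module R b0) M"
    unfolding \<epsilon>_def using u0 F_in by (intro comb_hom M_module) blast
  have ker: "submodule R {x \<in> carrier (free_module R b). h x = \<zero>\<^bsub>N\<^esub>} (free_module R b)"
    if "module R N" "h \<in> module_hom R (free_module R b) N" for N :: "('a, 'c, 'n) module_scheme" and b h
  proof -
    interpret h: mod_hom R "free_module R b" N h
      using that free_module by (simp add: mod_hom_def mod_hom_axioms_def)
    show ?thesis using h.ker_is_submodule by (simp add: h.ker_def)
  qed
  \<comment> \<open>The state of the recursion: rank, shifts, the map into the previous module, and
    the kernel \<open>K\<close> that the next module has to cover. In degree \<open>0\<close> this
    kernel is that of \<open>\<epsilon>\<close>, which is why \<open>P\<close> fixes it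
    there.\<close>
  define P where "P n s = (case s of (b, a, \<delta>, K) \<Rightarrow> submodule R K (free_module R b) \<and>
      (n = 0 \<longrightarrow> b = b0 \<and> a = a0 \<and> K = {x \<in> carrier (free_module R b0). \<epsilon> x = \<zero>\<^bsub>M\<^esub>}))"
    for n :: nat and s :: "nat \<times> (nat \<Rightarrow> nat) \<times> ((nat \<Rightarrow> 'a) \<Rightarrow> nat \<Rightarrow> 'a) \<times> (nat \<Rightarrow> 'a) set"
  define Q where "Q n s s' = (case s of (b, a, \<delta>0, K) \<Rightarrow> case s' of (b', a', \<delta>, K') \<Rightarrow>
      \<delta> \<in> module_hom R (free_module R b') (free_module R b) \<and>
      (\<forall>p. \<delta> ` shift_filt R \<mm> b' a' p = K \<inter> shift_filt R \<mm> b a p) \<and>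
      (\<forall>p. \<forall>f\<in>shift_filt R \<mm> b' a' p. \<delta> f \<in> shift_filt R \<mm> b a (Suc p) \<longrightarrow>
        (\<forall>l<b'. a' l = p \<longrightarrow> f l \<in> \<mm>)) \<and>
      K' = {x \<in> carrier (free_module R b'). \<delta> x = \<zero>\<^bsub>free_module R b\<^esub>})"
    for n :: nat and s s' :: "nat \<times> (nat \<Rightarrow> nat) \<times> ((nat \<Rightarrow> 'a) \<Rightarrow> nat \<Rightarrow> 'a) \<times> (nat \<Rightarrow> 'a) set"
  have "\<exists>s. \<forall>n. P n (s n) \<and> Q n (s n) (s (Suc n))"
  proof (rule dependent_nat_choice)
    \<comment> \<open>No differential leaves degree \<open>0\<close> of the complex, hence the dummy
      component.\<close>
    have "P 0 (b0, a0, undefined, {x \<in> carrier (free_module R b0). \<epsilon> x = \<zero>\<^bsub>M\<^esub>})"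
      unfolding P_def using ker[OF M_module \<epsilon>] by simp
    then show "\<exists>s. P 0 s" by blast
    fix s n assume "P n s"
    then obtain b a \<delta>0 K where s: "s = (b, a, \<delta>0, K)" and K: "submodule R K (free_module R b)"
      unfolding P_def by (cases s) auto
    obtain b' a' \<delta> where \<delta>: "\<delta> \<in> module_hom R (free_module R b') (free_module R b)"
      "\<forall>p. \<delta> ` shift_filt R \<mm> b' a' p = K \<inter> shift_filt R \<mm> b a p"
      "\<forall>p. \<forall>f\<in>shift_filt R \<mm> b' a' p. \<delta> f \<in> shift_filt R \<mm> b a (Suc p) \<longrightarrow>
        (\<forall>l<b'. a' l = p \<longrightarrow> f l \<in> \<mm>)"
      using kernel_cover[OF K, of a] by blast
    let ?s = "(b', a', \<delta>, {x \<in> carrier (free_module R b'). \<delta> x = \<zero>\<^bsub>free_module R b\<^esub>})"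
    have "P (Suc n) ?s" unfolding P_def using ker[OF free_module \<delta>(1)] by simp
    moreover have "Q n s ?s" unfolding Q_def s using \<delta> by simp
    ultimately show "\<exists>s'. P (Suc n) s' \<and> Q n s s'" by blast
  qed
  then obtain s where P: "\<And>n. P n (s n)" and Q: "\<And>n. Q n (s n) (s (Suc n))" by blast
  define rk where "rk n = fst (s n)" for n
  define sh where "sh n = fst (snd (s n))" for n
  define \<delta> where "\<delta> n = fst (snd (snd (s n)))" for n
  define K where "K n = snd (snd (snd (s n)))" for n
  have s: "s n = (rk n, sh n, \<delta> n, K n)" for n by (simp add: rk_def sh_def \<delta>_def K_def)
  have init: "rk 0 = b0" "sh 0 = a0" "K 0 = {x \<in> carrier (free_module R b0). \<epsilon> x = \<zero>\<^bsub>M\<^esub>}"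
    using P[of 0] unfolding s P_def by auto
  have step: "\<delta> (Suc n) \<in> module_hom R (free_module R (rk (Suc n))) (free_module R (rk n))"
    "\<delta> (Suc n) ` shift_filt R \<mm> (rk (Suc n)) (sh (Suc n)) p = K n \<inter> shift_filt R \<mm> (rk n) (sh n) p"
    "f \<in> shift_filt R \<mm> (rk (Suc n)) (sh (Suc n)) p \<Longrightarrow> \<delta> (Suc n) f \<in> shift_filt R \<mm> (rk n) (sh n) (Suc p) \<Longrightarrow>
      l < rk (Suc n) \<Longrightarrow> sh (Suc n) l = p \<Longrightarrow> f l \<in> \<mm>"
    "K (Suc n) = {x \<in> carrier (free_module R (rk (Suc n))). \<delta> (Suc n) x = \<zero>\<^bsub>free_module R (rk n)\<^esub>}"
    for n p f l
    using Q[of n] unfolding s Q_def by auto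
  have "filtered_resolution R \<mm> M F rk sh \<delta> \<epsilon>"
  proof (intro filtered_resolution.intro filtered_resolution_axioms.intro stable_filtered_module_axioms)
    show "\<epsilon> \<in> module_hom R (free_module R (rk 0)) M" using \<epsilon> init by simp
    show "\<epsilon> ` shift_filt R \<mm> (rk 0) (sh 0) p = F p" for p unfolding init \<epsilon>_def by (rule gen0[symmetric])
    show "f l \<in> \<mm>" if "f \<in> shift_filt R \<mm> (rk 0) (sh 0) p" "\<epsilon> f \<in> F (Suc p)" "l < rk 0" "sh 0 l = p" for f p l
      using min0[of f p l] that init unfolding \<epsilon>_def by simp
    show "\<delta> (Suc n) \<in> module_hom R (free_module R (rk (Suc n))) (free_module R (rk n))" for n by (rule step)
    show "\<delta> (Suc 0) ` shift_filt R \<mm> (rk (Suc 0)) (sh (Suc 0)) p =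
      {x \<in> shift_filt R \<mm> (rk 0) (sh 0) p. \<epsilon> x = \<zero>\<^bsub>M\<^esub>}" for p
      unfolding step(2) using init shift_filt_in by auto
    show "\<delta> (Suc (Suc n)) ` shift_filt R \<mm> (rk (Suc (Suc n))) (sh (Suc (Suc n))) p =
      {x \<in> shift_filt R \<mm> (rk (Suc n)) (sh (Suc n)) p. \<delta> (Suc n) x = \<zero>\<^bsub>free_module R (rk n)\<^esub>}" for n p
      unfolding step(2) step(4) using shift_filt_in by auto
    show "f l \<in> \<mm>" if "f \<in> shift_filt R \<mm> (rk (Suc n)) (sh (Suc n)) p"
      "\<delta> (Suc n) f \<in> shift_filt R \<mm> (rk n) (sh n) (Suc p)" "l < rk (Suc n)" "sh (Suc n) l = p" for f n p l
      by (rule step(3)[OF that])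
  qed
  then show ?thesis by blast
qed

context filtered_resolution
begin

definition cplx :: "('a, nat \<Rightarrow> 'a) chain_complex" where
  "cplx = \<lparr>obj = \<lambda>n. free_module R (rk n), differential = \<delta>\<rparr>"

lemma cplx_simps [simp]: "obj cplx n = free_module R (rk n)" "differential cplx = \<delta>"
  by (simp_all add: cplx_def)

end

section \<open>Comparison of free resolutions\<close>

lemma module_hom_ideal_smult:
  assumes M: "module R M" and N: "module R N" and f: "f \<in> module_hom R M N" and I: "ideal I R"
    and x: "x \<in> ideal_smult R I M (carrier M)"
  shows "f x \<in> ideal_smult R I N (carrier N)"
proof -
  interpret M: module R M by fact
  interpret N: module R N by fact
  let ?K = "{x \<in> carrier M. f x \<in> ideal_smult R I N (carrier N)}"
  have K: "submodule R ?K M"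
    by (rule module_hom_vimage[OF M N f N.ideal_smult_submodule[OF I]]) simp
  have "ideal_smult R I M (carrier M) \<subseteq> ?K"
  proof (rule M.ideal_smult_subset[OF K])
    fix r x assume r: "r \<in> I" and x: "x \<in> carrier M"
    have rc: "r \<in> carrier R" using ideal.Icarr[OF I r] .
    have "f (r \<odot>\<^bsub>M\<^esub> x) = r \<odot>\<^bsub>N\<^esub> f x" by (rule module_hom_smult[OF f rc x])
    then show "r \<odot>\<^bsub>M\<^esub> x \<in> ?K"
      using N.ideal_smultI[OF I _ r module_hom_in[OF f x]] rc x by simp
  qed
  then show ?thesis using x by blast
qed

definition chain_map ::
    "('a, 'r) ring_scheme \<Rightarrow> ('a, 'b) chain_complex \<Rightarrow> ('a, 'c) chain_complex \<Rightarrow> (nat \<Rightarrow> 'b \<Rightarrow> 'c) \<Rightarrow> bool"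
  where
  "chain_map R C D \<phi> \<longleftrightarrow> (\<forall>n. \<phi> n \<in> module_hom R (obj C n) (obj D n)) \<and>
    (\<forall>n. \<forall>x\<in>carrier (obj C (Suc n)).
      differential D (Suc n) (\<phi> (Suc n) x) = \<phi> n (differential C (Suc n) x))"

lemma chain_map_hom: "chain_map R C D \<phi> \<Longrightarrow> \<phi> n \<in> module_hom R (obj C n) (obj D n)"
  by (simp add: chain_map_def)

text \<open>\<open>tor_cycles\<close> and \<open>tor_bounds\<close> are the preimages in \<open>C\<^sub>n\<close> of the cycles and boundaries of \<open>C \<otimes> R/I\<close>.\<close>

definition ideal_part :: "('a, 'r) ring_scheme \<Rightarrow> 'a set \<Rightarrow> ('a, 'b) chain_complex \<Rightarrow> nat \<Rightarrow> 'b set" where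
  "ideal_part R I C n = ideal_smult R I (obj C n) (carrier (obj C n))"

definition tor_cycles :: "('a, 'r) ring_scheme \<Rightarrow> 'a set \<Rightarrow> ('a, 'b) chain_complex \<Rightarrow> nat \<Rightarrow> 'b set" where
  "tor_cycles R I C n =
    {x \<in> carrier (obj C n). n = 0 \<or> differential C n x \<in> ideal_part R I C (n - 1)}"

definition tor_bounds :: "('a, 'r) ring_scheme \<Rightarrow> 'a set \<Rightarrow> ('a, 'b) chain_complex \<Rightarrow> nat \<Rightarrow> 'b set" where
  "tor_bounds R I C n = boundaries C n <+>\<^bsub>obj C n\<^esub> ideal_part R I C n"

locale free_res = cring S + M: module S M
  for S :: "('a, 'r) ring_scheme" (structure) and M :: "('a, 'b, 'm) module_scheme" +
  fixes C :: "('a, nat \<Rightarrow> 'a) chain_complex" and \<epsilon> :: "(nat \<Rightarrow> 'a) \<Rightarrow> 'b" and b :: "nat \<Rightarrow> nat"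
  assumes obj: "obj C n = free_module S (b n)" and res: "resolution S M C \<epsilon>"
begin

abbreviation "d n \<equiv> differential C n"

lemma d_hom: "d (Suc n) \<in> module_hom S (obj C (Suc n)) (obj C n)"
  and exact: "cycles C (Suc n) = boundaries C (Suc n)"
  and eps_hom: "\<epsilon> \<in> module_hom S (obj C 0) M"
  and eps_surj: "\<epsilon> ` carrier (obj C 0) = carrier M"
  and eps_ker: "{x \<in> carrier (obj C 0). \<epsilon> x = \<zero>\<^bsub>M\<^esub>} = boundaries C 0"
  using res unfolding resolution_def by auto

lemma obj_module: "module S (obj C n)" unfolding obj by (rule free_module)

lemma bound_sub: "submodule S (boundaries C n) (obj C n)"
  unfolding boundaries_def
  by (rule module_hom_image[OF obj_module obj_module d_hom submodule_carrier[OF obj_module]])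

lemma d_in_bound: "x \<in> carrier (obj C (Suc n)) \<Longrightarrow> d (Suc n) x \<in> boundaries C n"
  unfolding boundaries_def by (rule imageI)

lemma d_bound: "x \<in> boundaries C (Suc n) \<Longrightarrow> d (Suc n) x = \<zero>\<^bsub>obj C n\<^esub>"
  unfolding exact[symmetric] by (simp add: cycles_def)

lemma bound_in: "x \<in> boundaries C n \<Longrightarrow> x \<in> carrier (obj C n)"
  using submodule_in[OF bound_sub] .

lemma boundI: "x \<in> carrier (obj C (Suc n)) \<Longrightarrow> d (Suc n) x = \<zero>\<^bsub>obj C n\<^esub> \<Longrightarrow> x \<in> boundaries C (Suc n)"
  unfolding exact[symmetric] by (simp add: cycles_def)

text \<open>\<open>P\<close> carries a side condition on the chosen preimages; in the comparison
  theorem it is homogeneity of a prescribed degree.\<close>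

lemma lift:
  assumes N: "f \<in> module_hom S (free_module S c) (obj C n)"
    and p: "\<And>l. l < c \<Longrightarrow> \<exists>y\<in>carrier (obj C (Suc n)). d (Suc n) y = f (std_vec S c l) \<and> P l y"
  shows "\<exists>h\<in>module_hom S (free_module S c) (obj C (Suc n)).
    (\<forall>x\<in>carrier (free_module S c). d (Suc n) (h x) = f x) \<and> (\<forall>l<c. P l (h (std_vec S c l)))"
proof -
  have "\<forall>l\<in>{..<c}. \<exists>y. y \<in> carrier (obj C (Suc n)) \<and> d (Suc n) y = f (std_vec S c l) \<and> P l y"
    using p by blast
  from bchoice[OF this] obtain y where
    y: "\<And>l. l < c \<Longrightarrow> y l \<in> carrier (obj C (Suc n)) \<and> d (Suc n) (y l) = f (std_vec S c l) \<and> P l (y l)" by auto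
  have h: "comb (obj C (Suc n)) c y \<in> module_hom S (free_module S c) (obj C (Suc n)) \<and>
    (\<forall>x \<in> carrier (free_module S c). d (Suc n) (comb (obj C (Suc n)) c y x) = f x)"
    using y by (intro free_hom_lift[OF is_cring obj_module obj_module N d_hom]) auto
  moreover have "\<forall>l<c. P l (comb (obj C (Suc n)) c y (std_vec S c l))"
    using comb_std[OF obj_module, of c y] y by simp
  ultimately show ?thesis by blast
qed

end

text \<open>Gradings enter only as families of sets over an arbitrary index type, with the
  hypothesis \<open>ext\<close> saying that a map is graded once the basis vectors have the right
  degrees. A one-element index type yields the ungraded theorem (\<open>comparison\<close>), integer
  degrees the graded one (\<open>graded_chain_map\<close>).\<close>

lemma graded_comparison:
  fixes C D :: "('a, nat \<Rightarrow> 'a) chain_complex" and s :: "nat \<Rightarrow> nat \<Rightarrow> 'd"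
  assumes C: "free_res S M C \<epsilon> b" and D: "free_res S M D \<eta> b'"
    and std: "\<And>n l. l < b n \<Longrightarrow> std_vec S (b n) l \<in> gC n (s n l)"
    and dC: "\<And>n j x. x \<in> gC (Suc n) j \<Longrightarrow> differential C (Suc n) x \<in> gC n j"
    and eps: "\<And>j x. x \<in> gC 0 j \<Longrightarrow> \<epsilon> x \<in> gM j"
    and lift0: "\<And>j x. x \<in> gM j \<Longrightarrow> x \<in> carrier M \<Longrightarrow> \<exists>y\<in>carrier (obj D 0). \<eta> y = x \<and> y \<in> gD 0 j"
    and lift: "\<And>n j x. x \<in> gD n j \<Longrightarrow> x \<in> boundaries D n \<Longrightarrow>
      \<exists>y\<in>carrier (obj D (Suc n)). differential D (Suc n) y = x \<and> y \<in> gD (Suc n) j"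
    and ext: "\<And>n h j x. h \<in> module_hom S (obj C n) (obj D n) \<Longrightarrow>
      (\<And>l. l < b n \<Longrightarrow> h (std_vec S (b n) l) \<in> gD n (s n l)) \<Longrightarrow> x \<in> gC n j \<Longrightarrow> h x \<in> gD n j"
  shows "\<exists>\<phi>. chain_map S C D \<phi> \<and> (\<forall>x\<in>carrier (obj C 0). \<eta> (\<phi> 0 x) = \<epsilon> x) \<and>
    (\<forall>n j x. x \<in> gC n j \<longrightarrow> \<phi> n x \<in> gD n j)"
proof -
  interpret C: free_res S M C \<epsilon> b by fact
  interpret D: free_res S M D \<eta> b' by fact
  \<comment> \<open>The last clause, that \<open>\<phi>\<close> maps boundaries of \<open>C\<close>
    to boundaries of \<open>D\<close>, is the invariant that permits the next lift; in degree
    \<open>0\<close> it comes from compatibility with the augmentations.\<close>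
  define P where "P n \<phi> \<longleftrightarrow> \<phi> \<in> module_hom S (obj C n) (obj D n) \<and> (\<forall>j x. x \<in> gC n j \<longrightarrow> \<phi> x \<in> gD n j) \<and>
    (n = 0 \<longrightarrow> (\<forall>x\<in>carrier (obj C 0). \<eta> (\<phi> x) = \<epsilon> x)) \<and>
    (\<forall>x\<in>carrier (obj C (Suc n)). \<phi> (C.d (Suc n) x) \<in> boundaries D n)" for n \<phi>
  define Q where "Q n \<phi> \<phi>' \<longleftrightarrow> (\<forall>x\<in>carrier (obj C (Suc n)). D.d (Suc n) (\<phi>' x) = \<phi> (C.d (Suc n) x))" for n \<phi> \<phi>'
  have "\<exists>\<phi>. \<forall>n. P n (\<phi> n) \<and> Q n (\<phi> n) (\<phi> (Suc n))"
  proof (rule dependent_nat_choice)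
    have "\<forall>l\<in>{..<b 0}. \<exists>y. y \<in> carrier (obj D 0) \<and> \<eta> y = \<epsilon> (std_vec S (b 0) l) \<and> y \<in> gD 0 (s 0 l)"
    proof
      fix l assume "l \<in> {..<b 0}"
      then have "\<epsilon> (std_vec S (b 0) l) \<in> gM (s 0 l)" using eps std by simp
      moreover have "\<epsilon> (std_vec S (b 0) l) \<in> carrier M"
        using module_hom_in[OF C.eps_hom] C.std_vec_closed unfolding C.obj by blast
      ultimately show "\<exists>y. y \<in> carrier (obj D 0) \<and> \<eta> y = \<epsilon> (std_vec S (b 0) l) \<and> y \<in> gD 0 (s 0 l)"
        using lift0 by blast
    qed
    from bchoice[OF this] obtain y where
      y: "\<And>l. l < b 0 \<Longrightarrow> y l \<in> carrier (obj D 0) \<and> \<eta> (y l) = \<epsilon> (std_vec S (b 0) l) \<and> y l \<in> gD 0 (s 0 l)"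
      by auto
    define \<phi> where "\<phi> = comb (obj D 0) (b 0) y"
    have \<phi>: "\<phi> \<in> module_hom S (obj C 0) (obj D 0) \<and> (\<forall>x \<in> carrier (obj C 0). \<eta> (\<phi> x) = \<epsilon> x)"
      unfolding \<phi>_def C.obj using y C.eps_hom unfolding C.obj
      by (intro free_hom_lift[OF C.is_cring D.obj_module C.M.module_axioms _ D.eps_hom]) auto
    have "P 0 \<phi>"
      unfolding P_def
    proof (intro conjI allI impI ballI)
      fix j x assume x: "x \<in> gC 0 j"
      show "\<phi> x \<in> gD 0 j"
      proof (rule ext[OF _ _ x])
        show "\<phi> (std_vec S (b 0) l) \<in> gD 0 (s 0 l)" if "l < b 0" for l
          unfolding \<phi>_def using C.comb_std[OF D.obj_module[of 0], of "b 0" y l] y that by simp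
      qed (use \<phi> in blast)
    next
      fix x assume x: "x \<in> carrier (obj C (Suc 0))"
      have "C.d (Suc 0) x \<in> boundaries C 0" using C.d_in_bound[OF x] .
      then have "C.d (Suc 0) x \<in> carrier (obj C 0)" "\<epsilon> (C.d (Suc 0) x) = \<zero>\<^bsub>M\<^esub>"
        unfolding C.eps_ker[symmetric] by auto
      then show "\<phi> (C.d (Suc 0) x) \<in> boundaries D 0"
        unfolding D.eps_ker[symmetric] using \<phi> module_hom_in[of \<phi> S "obj C 0"] by auto
    qed (use \<phi> in auto)
    then show "\<exists>\<phi>. P 0 \<phi>" by blast
  next
    fix \<phi> n assume P: "P n \<phi>"
    have comp: "(\<lambda>x. \<phi> (C.d (Suc n) x)) \<in> module_hom S (free_module S (b (Suc n))) (obj D n)"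
      using module_hom_comp[OF C.d_hom] P unfolding P_def C.obj by blast
    have "\<exists>y\<in>carrier (obj D (Suc n)). D.d (Suc n) y = \<phi> (C.d (Suc n) (std_vec S (b (Suc n)) l)) \<and> y \<in> gD (Suc n) (s (Suc n) l)"
      if l: "l < b (Suc n)" for l
    proof -
      have "\<phi> (C.d (Suc n) (std_vec S (b (Suc n)) l)) \<in> gD n (s (Suc n) l)"
        using P dC[OF std[OF l]] unfolding P_def by blast
      moreover have "std_vec S (b (Suc n)) l \<in> carrier (obj C (Suc n))"
        using C.std_vec_closed unfolding C.obj by blast
      ultimately show ?thesis using lift P unfolding P_def by blast
    qed
    from D.lift[where P = "\<lambda>l y. y \<in> gD (Suc n) (s (Suc n) l)", OF comp this]
    obtain \<phi>' where \<phi>': "\<phi>' \<in> module_hom S (obj C (Suc n)) (obj D (Suc n))"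
      and eq: "\<And>x. x \<in> carrier (obj C (Suc n)) \<Longrightarrow> D.d (Suc n) (\<phi>' x) = \<phi> (C.d (Suc n) x)"
      and std': "\<And>l. l < b (Suc n) \<Longrightarrow> \<phi>' (std_vec S (b (Suc n)) l) \<in> gD (Suc n) (s (Suc n) l)"
      unfolding C.obj by blast
    have "P (Suc n) \<phi>'"
      unfolding P_def
    proof (intro conjI allI impI ballI)
      show "\<phi>' x \<in> gD (Suc n) j" if "x \<in> gC (Suc n) j" for j x using ext[OF \<phi>' std' that] .
      fix x assume x: "x \<in> carrier (obj C (Suc (Suc n)))"
      have dx: "C.d (Suc (Suc n)) x \<in> boundaries C (Suc n)" by (rule C.d_in_bound[OF x])
      have "D.d (Suc n) (\<phi>' (C.d (Suc (Suc n)) x)) = \<phi> (C.d (Suc n) (C.d (Suc (Suc n)) x))"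
        by (rule eq[OF C.bound_in[OF dx]])
      also have "\<dots> = \<phi> \<zero>\<^bsub>obj C n\<^esub>" using C.d_bound[OF dx] by simp
      also have "\<dots> = \<zero>\<^bsub>obj D n\<^esub>"
        using P unfolding P_def by (intro module_hom_zero[OF C.obj_module D.obj_module]) blast
      finally show "\<phi>' (C.d (Suc (Suc n)) x) \<in> boundaries D (Suc n)"
        by (intro D.boundI module_hom_in[OF \<phi>'] C.bound_in[OF dx])
    qed (use \<phi>' in auto)
    then show "\<exists>\<phi>'. P (Suc n) \<phi>' \<and> Q n \<phi> \<phi>'" using eq unfolding Q_def by blast
  qed
  then obtain \<phi> where \<phi>: "\<And>n. P n (\<phi> n)" "\<And>n. Q n (\<phi> n) (\<phi> (Suc n))" by blast
  have "chain_map S C D \<phi>" using \<phi> unfolding chain_map_def P_def Q_def by blast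
  moreover have "\<forall>x\<in>carrier (obj C 0). \<eta> (\<phi> 0 x) = \<epsilon> x" using \<phi>(1)[of 0] unfolding P_def by blast
  moreover have "\<forall>n j x. x \<in> gC n j \<longrightarrow> \<phi> n x \<in> gD n j" using \<phi>(1) unfolding P_def by blast
  ultimately show ?thesis by blast
qed

lemma comparison:
  assumes C: "free_res S M C \<epsilon> b" and D: "free_res S M D \<eta> b'"
  shows "\<exists>\<phi>. chain_map S C D \<phi> \<and> (\<forall>x\<in>carrier (obj C 0). \<eta> (\<phi> 0 x) = \<epsilon> x)"
proof -
  interpret C: free_res S M C \<epsilon> b by fact
  interpret D: free_res S M D \<eta> b' by fact
  have "\<exists>\<phi>. chain_map S C D \<phi> \<and> (\<forall>x\<in>carrier (obj C 0). \<eta> (\<phi> 0 x) = \<epsilon> x) \<and>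
    (\<forall>n (j::unit) x. x \<in> carrier (obj C n) \<longrightarrow> \<phi> n x \<in> carrier (obj D n))"
  proof (rule graded_comparison[OF C D, of "\<lambda>n j. carrier (obj C n)" "\<lambda>_ _. ()" "\<lambda>_. carrier M" "\<lambda>n j. carrier (obj D n)"])
    show "std_vec S (b n) l \<in> carrier (obj C n)" for n l unfolding C.obj by (rule C.std_vec_closed)
    show "\<exists>y\<in>carrier (obj D 0). \<eta> y = x \<and> y \<in> carrier (obj D 0)" if "x \<in> carrier M" for x
      using that unfolding D.eps_surj[symmetric] by blast
    show "\<exists>y\<in>carrier (obj D (Suc n)). D.d (Suc n) y = x \<and> y \<in> carrier (obj D (Suc n))"
      if "x \<in> boundaries D n" for x n using that unfolding boundaries_def by blast
    show "h x \<in> carrier (obj D n)" if "h \<in> module_hom S (obj C n) (obj D n)" "x \<in> carrier (obj C n)" for n h x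
      using module_hom_in[OF that] .
  qed (auto intro: module_hom_in[OF C.d_hom] module_hom_in[OF C.eps_hom])
  then show ?thesis by blast
qed

context free_res
begin

lemma homotopy_identity:
  assumes \<theta>: "chain_map S C C \<theta>" and \<theta>0: "\<And>x. x \<in> carrier (obj C 0) \<Longrightarrow> \<epsilon> (\<theta> 0 x) = \<epsilon> x"
  shows "\<exists>h. (\<forall>n. h n \<in> module_hom S (obj C n) (obj C (Suc n))) \<and>
    (\<forall>x\<in>carrier (obj C 0). d (Suc 0) (h 0 x) = \<theta> 0 x \<ominus>\<^bsub>obj C 0\<^esub> x) \<and>
    (\<forall>n. \<forall>x\<in>carrier (obj C (Suc n)).
      d (Suc (Suc n)) (h (Suc n) x) = (\<theta> (Suc n) x \<ominus>\<^bsub>obj C (Suc n)\<^esub> x) \<ominus>\<^bsub>obj C (Suc n)\<^esub> h n (d (Suc n) x))"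
proof -
  have \<theta>_hom: "\<theta> n \<in> module_hom S (obj C n) (obj C n)" for n using \<theta> unfolding chain_map_def by blast
  have \<theta>_d: "d (Suc n) (\<theta> (Suc n) x) = \<theta> n (d (Suc n) x)" if "x \<in> carrier (obj C (Suc n))" for n x
    using \<theta> that unfolding chain_map_def by blast
  have diff_hom: "(\<lambda>x. \<theta> n x \<ominus>\<^bsub>obj C n\<^esub> x) \<in> module_hom S (obj C n) (obj C n)" for n
    by (rule module.hom_sub[OF obj_module obj_module \<theta>_hom]) (rule module_homI, auto)
  have std_in: "std_vec S (b n) l \<in> carrier (obj C n)" for n l unfolding obj by (rule std_vec_closed)
  have lift': "\<exists>h\<in>module_hom S (obj C m) (obj C (Suc n)). \<forall>x\<in>carrier (obj C m). d (Suc n) (h x) = f x"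
    if f: "f \<in> module_hom S (obj C m) (obj C n)" and im: "\<And>x. x \<in> carrier (obj C m) \<Longrightarrow> f x \<in> boundaries C n" for m n f
  proof -
    have "\<exists>y\<in>carrier (obj C (Suc n)). d (Suc n) y = f (std_vec S (b m) l) \<and> True" if "l < b m" for l
      using im[OF std_in[of m l]] unfolding boundaries_def by (auto simp: image_iff)
    from lift[where P = "\<lambda>_ _. True" and f = f and c = "b m" and n = n, OF _ this] show ?thesis using f unfolding obj[of m] by blast
  qed
  \<comment> \<open>The middle clause is the homotopy equation on boundaries. It makes the
    right-hand side of the next equation a cycle, which exactness then lifts.\<close>
  define P where "P n h \<longleftrightarrow> h \<in> module_hom S (obj C n) (obj C (Suc n)) \<and>
    (\<forall>y\<in>carrier (obj C (Suc n)). d (Suc n) (h (d (Suc n) y)) = \<theta> n (d (Suc n) y) \<ominus>\<^bsub>obj C n\<^esub> d (Suc n) y) \<and>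
    (n = 0 \<longrightarrow> (\<forall>x\<in>carrier (obj C 0). d (Suc 0) (h x) = \<theta> 0 x \<ominus>\<^bsub>obj C 0\<^esub> x))" for n h
  define Q where "Q n h h' \<longleftrightarrow> (\<forall>x\<in>carrier (obj C (Suc n)).
    d (Suc (Suc n)) (h' x) = (\<theta> (Suc n) x \<ominus>\<^bsub>obj C (Suc n)\<^esub> x) \<ominus>\<^bsub>obj C (Suc n)\<^esub> h (d (Suc n) x))" for n h h'
  have "\<exists>h. \<forall>n. P n (h n) \<and> Q n (h n) (h (Suc n))"
  proof (rule dependent_nat_choice)
    have "\<theta> 0 x \<ominus>\<^bsub>obj C 0\<^esub> x \<in> boundaries C 0" if x: "x \<in> carrier (obj C 0)" for x
    proof -
      have "\<epsilon> (\<theta> 0 x \<ominus>\<^bsub>obj C 0\<^esub> x) = \<epsilon> (\<theta> 0 x) \<ominus>\<^bsub>M\<^esub> \<epsilon> x"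
        by (rule module_hom_minus[OF obj_module M.module_axioms eps_hom module_hom_in[OF \<theta>_hom x] x])
      also have "\<dots> = \<zero>\<^bsub>M\<^esub>" using \<theta>0[OF x] module_hom_in[OF eps_hom x] by (simp add: M.M.minus_eq M.M.r_neg)
      finally show ?thesis unfolding eps_ker[symmetric] using module_hom_in[OF diff_hom x] by simp
    qed
    from lift'[OF diff_hom this] obtain h where "h \<in> module_hom S (obj C 0) (obj C (Suc 0))"
      "\<forall>x\<in>carrier (obj C 0). d (Suc 0) (h x) = \<theta> 0 x \<ominus>\<^bsub>obj C 0\<^esub> x" by blast
    then have "P 0 h" unfolding P_def using module_hom_in[OF d_hom] by blast
    then show "\<exists>h. P 0 h" by blast
  next
    fix h n assume P: "P n h"
    then have h: "h \<in> module_hom S (obj C n) (obj C (Suc n))" unfolding P_def by blast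
    interpret X: module S "obj C (Suc n)" by (rule obj_module)
    interpret Y: module S "obj C n" by (rule obj_module)
    let ?f = "\<lambda>x. (\<theta> (Suc n) x \<ominus>\<^bsub>obj C (Suc n)\<^esub> x) \<ominus>\<^bsub>obj C (Suc n)\<^esub> h (d (Suc n) x)"
    have f: "?f \<in> module_hom S (obj C (Suc n)) (obj C (Suc n))"
      by (rule X.hom_sub[OF obj_module diff_hom module_hom_comp[OF d_hom h]])
    have fb: "?f x \<in> boundaries C (Suc n)" if x: "x \<in> carrier (obj C (Suc n))" for x
    proof (rule boundI[OF module_hom_in[OF f x]])
      note [simp] = module_hom_in[OF diff_hom x] module_hom_in[OF \<theta>_hom x] module_hom_in[OF d_hom x]
        module_hom_in[OF h] module_hom_in[OF \<theta>_hom]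
      have "d (Suc n) (?f x) = (d (Suc n) (\<theta> (Suc n) x) \<ominus>\<^bsub>obj C n\<^esub> d (Suc n) x) \<ominus>\<^bsub>obj C n\<^esub> d (Suc n) (h (d (Suc n) x))"
        using x by (simp add: module_hom_minus[OF obj_module obj_module d_hom])
      also have "\<dots> = \<zero>\<^bsub>obj C n\<^esub>"
        using P x unfolding P_def by (simp add: \<theta>_d)
      finally show "d (Suc n) (?f x) = \<zero>\<^bsub>obj C n\<^esub>" .
    qed
    from lift'[OF f fb] obtain h' where h': "h' \<in> module_hom S (obj C (Suc n)) (obj C (Suc (Suc n)))"
      and eq: "\<And>x. x \<in> carrier (obj C (Suc n)) \<Longrightarrow> d (Suc (Suc n)) (h' x) = ?f x" by blast
    have "P (Suc n) h'"
      unfolding P_def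
    proof (intro conjI ballI h')
      fix y assume y: "y \<in> carrier (obj C (Suc (Suc n)))"
      have dy: "d (Suc (Suc n)) y \<in> carrier (obj C (Suc n))" by (rule module_hom_in[OF d_hom y])
      have "h (d (Suc n) (d (Suc (Suc n)) y)) = \<zero>\<^bsub>obj C (Suc n)\<^esub>"
        using d_bound[OF d_in_bound[OF y]] module_hom_zero[OF obj_module obj_module h] by simp
      then show "d (Suc (Suc n)) (h' (d (Suc (Suc n)) y))
          = \<theta> (Suc n) (d (Suc (Suc n)) y) \<ominus>\<^bsub>obj C (Suc n)\<^esub> d (Suc (Suc n)) y"
        using eq[OF dy] module_hom_in[OF diff_hom dy] by (simp add: X.M.minus_eq)
    qed simp
    then show "\<exists>h'. P (Suc n) h' \<and> Q n h h'" unfolding Q_def using eq by blast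
  qed
  then obtain h where h: "\<And>n. P n (h n)" "\<And>n. Q n (h n) (h (Suc n))" by blast
  have "\<forall>x\<in>carrier (obj C 0). d (Suc 0) (h 0 x) = \<theta> 0 x \<ominus>\<^bsub>obj C 0\<^esub> x"
    using h(1)[of 0] unfolding P_def by blast
  then show ?thesis using h unfolding P_def Q_def by blast
qed

lemma ideal_part_sub: "ideal I S \<Longrightarrow> submodule S (ideal_part S I C n) (obj C n)"
  unfolding ideal_part_def by (rule module.ideal_smult_submodule[OF obj_module]) auto

lemma tor_bounds_sub: "ideal I S \<Longrightarrow> submodule S (tor_bounds S I C n) (obj C n)"
  unfolding tor_bounds_def by (rule submodule_sum[OF bound_sub ideal_part_sub])

lemma tor_cycles_sub: "ideal I S \<Longrightarrow> submodule S (tor_cycles S I C n) (obj C n)"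
proof (cases n)
  case 0
  then show ?thesis using submodule_carrier[OF obj_module] by (simp add: tor_cycles_def)
next
  case (Suc m)
  assume I: "ideal I S"
  show ?thesis unfolding Suc tor_cycles_def
    using module_hom_vimage[OF obj_module obj_module d_hom ideal_part_sub[OF I], of m] by simp
qed

lemma tor_bounds_cycles: "ideal I S \<Longrightarrow> tor_bounds S I C n \<subseteq> tor_cycles S I C n"
proof -
  assume I: "ideal I S"
  have "boundaries C n \<subseteq> tor_cycles S I C n"
    using bound_in d_bound submodule_zero[OF ideal_part_sub[OF I]]
    by (cases n) (auto simp: tor_cycles_def)
  moreover have "ideal_part S I C n \<subseteq> tor_cycles S I C n"
    using submodule_in[OF ideal_part_sub[OF I]] module_hom_ideal_smult[OF obj_module obj_module d_hom I]
    by (cases n) (auto simp: tor_cycles_def ideal_part_def)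
  ultimately show ?thesis unfolding tor_bounds_def by (rule sum_sub[OF tor_cycles_sub[OF I]])
qed

text \<open>With a homotopy \<open>h\<close>, the difference is the boundary \<open>d (h x)\<close>
  plus \<open>h (d x)\<close>. For \<open>x\<close> in \<open>tor_cycles\<close> the vector
  \<open>d x\<close> has coefficients in \<open>I\<close>, and a linear map sends it to
  \<open>ideal_part\<close> again.\<close>

lemma homotopic_mod_bounds:
  assumes I: "ideal I S" and \<theta>: "chain_map S C C \<theta>" and \<theta>0: "\<And>x. x \<in> carrier (obj C 0) \<Longrightarrow> \<epsilon> (\<theta> 0 x) = \<epsilon> x"
    and x: "x \<in> tor_cycles S I C n"
  shows "\<theta> n x \<ominus>\<^bsub>obj C n\<^esub> x \<in> tor_bounds S I C n"
proof -
  obtain h where h: "\<And>n. h n \<in> module_hom S (obj C n) (obj C (Suc n))"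
    and h0: "\<And>x. x \<in> carrier (obj C 0) \<Longrightarrow> d (Suc 0) (h 0 x) = \<theta> 0 x \<ominus>\<^bsub>obj C 0\<^esub> x"
    and hS: "\<And>n x. x \<in> carrier (obj C (Suc n)) \<Longrightarrow>
      d (Suc (Suc n)) (h (Suc n) x) = (\<theta> (Suc n) x \<ominus>\<^bsub>obj C (Suc n)\<^esub> x) \<ominus>\<^bsub>obj C (Suc n)\<^esub> h n (d (Suc n) x)"
    using homotopy_identity[OF \<theta> \<theta>0] by metis
  have xc: "x \<in> carrier (obj C n)" using x by (simp add: tor_cycles_def)
  have left: "boundaries C n \<subseteq> tor_bounds S I C n" and right: "ideal_part S I C n \<subseteq> tor_bounds S I C n"
    unfolding tor_bounds_def using sum_sub_left[OF bound_sub ideal_part_sub[OF I]] sum_sub_right[OF bound_sub ideal_part_sub[OF I]] .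
  have \<theta>x: "\<theta> n x \<in> carrier (obj C n)" by (rule module_hom_in[OF chain_map_hom[OF \<theta>] xc])
  interpret X: module S "obj C n" by (rule obj_module)
  show ?thesis
  proof (cases n)
    case 0
    then show ?thesis using h0 xc d_in_bound[OF module_hom_in[OF h xc]] left by auto
  next
    case (Suc m)
    have "d (Suc n) (h n x) \<in> tor_bounds S I C n" using d_in_bound[OF module_hom_in[OF h xc]] left by auto
    then have 1: "(\<theta> n x \<ominus>\<^bsub>obj C n\<^esub> x) \<ominus>\<^bsub>obj C n\<^esub> h m (d n x) \<in> tor_bounds S I C n"
      using hS[of x m] xc Suc by simp
    have "d n x \<in> ideal_part S I C m" using x Suc by (simp add: tor_cycles_def)
    then have "h m (d n x) \<in> ideal_part S I C n"
      using module_hom_ideal_smult[OF obj_module obj_module h I] Suc unfolding ideal_part_def by blast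
    then show ?thesis using submodule_minusD[OF tor_bounds_sub[OF I] _ _ 1] right \<theta>x xc by blast
  qed
qed

end

lemma chain_map_tor:
  assumes C: "free_res S M C \<epsilon> b" and D: "free_res S N D \<eta> b'" and I: "ideal I S" and \<phi>: "chain_map S C D \<phi>"
  shows "x \<in> tor_cycles S I C n \<Longrightarrow> \<phi> n x \<in> tor_cycles S I D n"
    and "x \<in> tor_bounds S I C n \<Longrightarrow> \<phi> n x \<in> tor_bounds S I D n"
    and "x \<in> ideal_part S I C n \<Longrightarrow> \<phi> n x \<in> ideal_part S I D n"
proof -
  interpret C: free_res S M C \<epsilon> b by fact
  interpret D: free_res S N D \<eta> b' by fact
  have hom: "\<phi> n \<in> module_hom S (obj C n) (obj D n)" for n using \<phi> unfolding chain_map_def by blast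
  have comm: "x \<in> carrier (obj C (Suc n)) \<Longrightarrow> D.d (Suc n) (\<phi> (Suc n) x) = \<phi> n (C.d (Suc n) x)" for n x
    using \<phi> unfolding chain_map_def by blast
  have ip: "\<phi> n x \<in> ideal_part S I D n" if "x \<in> ideal_part S I C n" for n x
    using module_hom_ideal_smult[OF C.obj_module D.obj_module hom I] that unfolding ideal_part_def by blast
  then show "x \<in> ideal_part S I C n \<Longrightarrow> \<phi> n x \<in> ideal_part S I D n" by simp
  show "x \<in> tor_cycles S I C n \<Longrightarrow> \<phi> n x \<in> tor_cycles S I D n"
    using comm ip module_hom_in[OF hom] by (cases n) (auto simp: tor_cycles_def)
  assume "x \<in> tor_bounds S I C n"
  then obtain y z where y: "y \<in> boundaries C n" and z: "z \<in> ideal_part S I C n" and x: "x = y \<oplus>\<^bsub>obj C n\<^esub> z"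
    unfolding tor_bounds_def by (rule in_sumE)
  have "\<phi> n y \<in> boundaries D n" using y comm module_hom_in[OF hom] unfolding boundaries_def by (auto simp flip: comm)
  moreover have "\<phi> n x = \<phi> n y \<oplus>\<^bsub>obj D n\<^esub> \<phi> n z"
    unfolding x using C.bound_in[OF y] submodule_in[OF C.ideal_part_sub[OF I] z] by (rule module_hom_add[OF hom])
  ultimately show "\<phi> n x \<in> tor_bounds S I D n" unfolding tor_bounds_def set_add_def' using ip[OF z] by blast
qed

lemma chain_map_comp: "chain_map S C D \<phi> \<Longrightarrow> chain_map S D E \<psi> \<Longrightarrow> chain_map S C E (\<lambda>n x. \<psi> n (\<phi> n x))"
  unfolding chain_map_def using module_hom_comp module_hom_in by metis

lemma resolutions_homotopy_equivalent:
  assumes C: "free_res S M C \<epsilon> b" and I: "ideal I S"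
    and \<phi>: "chain_map S C D \<phi>" "\<And>x. x \<in> carrier (obj C 0) \<Longrightarrow> \<eta> (\<phi> 0 x) = \<epsilon> x"
    and \<psi>: "chain_map S D C \<psi>" "\<And>x. x \<in> carrier (obj D 0) \<Longrightarrow> \<epsilon> (\<psi> 0 x) = \<eta> x"
    and x: "x \<in> tor_cycles S I C n"
  shows "\<psi> n (\<phi> n x) \<ominus>\<^bsub>obj C n\<^esub> x \<in> tor_bounds S I C n"
proof (rule free_res.homotopic_mod_bounds[OF C I chain_map_comp[OF \<phi>(1) \<psi>(1)] _ x])
  fix x assume x: "x \<in> carrier (obj C 0)"
  moreover have "\<phi> 0 x \<in> carrier (obj D 0)"
    by (rule module_hom_in[OF chain_map_hom[OF \<phi>(1)] x])
  ultimately show "\<epsilon> (\<psi> 0 (\<phi> 0 x)) = \<epsilon> x" using \<phi>(2) \<psi>(2) by simp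
qed

section \<open>Quotient modules\<close>

text \<open>Module laws pass along a surjection that respects the operations. It serves for
  quotients, for homology modules with a restricted carrier and for \<open>gr_module\<close>, none
  of which is known to be a module beforehand.\<close>

lemma image_module:
  assumes M: "module R M"
    and im: "h ` carrier M = carrier N"
    and add: "\<And>x y. x \<in> carrier M \<Longrightarrow> y \<in> carrier M \<Longrightarrow> h (x \<oplus>\<^bsub>M\<^esub> y) = h x \<oplus>\<^bsub>N\<^esub> h y"
    and smult: "\<And>r x. r \<in> carrier R \<Longrightarrow> x \<in> carrier M \<Longrightarrow> h (r \<odot>\<^bsub>M\<^esub> x) = r \<odot>\<^bsub>N\<^esub> h x"
    and zero: "h \<zero>\<^bsub>M\<^esub> = \<zero>\<^bsub>N\<^esub>"
  shows "module R N"
proof -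
  interpret module R M by fact
  have ex: "\<exists>x\<in>carrier M. y = h x" if "y \<in> carrier N" for y using that im by auto
  have hc: "h x \<in> carrier N" if "x \<in> carrier M" for x using that im by auto
  show ?thesis
  proof (rule moduleI[OF R.is_cring])
    show "abelian_group N"
    proof (rule abelian_groupI)
      show "\<zero>\<^bsub>N\<^esub> \<in> carrier N" using hc[OF M.zero_closed] zero by simp
      fix x assume "x \<in> carrier N"
      then obtain a where a: "a \<in> carrier M" "x = h a" using ex by blast
      show "\<zero>\<^bsub>N\<^esub> \<oplus>\<^bsub>N\<^esub> x = x" unfolding a(2) zero[symmetric] using a(1) by (simp add: add[symmetric])
      have "h (\<ominus>\<^bsub>M\<^esub> a) \<oplus>\<^bsub>N\<^esub> h a = \<zero>\<^bsub>N\<^esub>" using a(1) by (simp add: add[symmetric] M.l_neg zero)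
      then show "\<exists>y\<in>carrier N. y \<oplus>\<^bsub>N\<^esub> x = \<zero>\<^bsub>N\<^esub>" using a hc[of "\<ominus>\<^bsub>M\<^esub> a"] by auto
      fix y assume "y \<in> carrier N"
      then obtain b where b: "b \<in> carrier M" "y = h b" using ex by blast
      show "x \<oplus>\<^bsub>N\<^esub> y \<in> carrier N" using a b hc by (simp add: add[symmetric])
      show "x \<oplus>\<^bsub>N\<^esub> y = y \<oplus>\<^bsub>N\<^esub> x" using a b by (simp add: add[symmetric] M.a_comm)
      fix z assume "z \<in> carrier N"
      then obtain c where c: "c \<in> carrier M" "z = h c" using ex by blast
      show "(x \<oplus>\<^bsub>N\<^esub> y) \<oplus>\<^bsub>N\<^esub> z = x \<oplus>\<^bsub>N\<^esub> (y \<oplus>\<^bsub>N\<^esub> z)" using a b c by (simp add: add[symmetric] M.a_assoc)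
    qed
  next
    fix a x assume a: "a \<in> carrier R" and "x \<in> carrier N"
    then obtain p where p: "p \<in> carrier M" "x = h p" using ex by blast
    show "a \<odot>\<^bsub>N\<^esub> x \<in> carrier N" using a p hc by (simp add: smult[symmetric])
    fix b assume b: "b \<in> carrier R"
    show "(a \<oplus>\<^bsub>R\<^esub> b) \<odot>\<^bsub>N\<^esub> x = a \<odot>\<^bsub>N\<^esub> x \<oplus>\<^bsub>N\<^esub> b \<odot>\<^bsub>N\<^esub> x"
      using a b p by (simp add: smult[symmetric] add[symmetric] smult_l_distr)
    show "(a \<otimes>\<^bsub>R\<^esub> b) \<odot>\<^bsub>N\<^esub> x = a \<odot>\<^bsub>N\<^esub> (b \<odot>\<^bsub>N\<^esub> x)"
      using a b p by (simp add: smult[symmetric] smult_assoc1)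
  next
    fix a x y assume a: "a \<in> carrier R" and "x \<in> carrier N" "y \<in> carrier N"
    then obtain p q where p: "p \<in> carrier M" "x = h p" "q \<in> carrier M" "y = h q" using ex by blast
    show "a \<odot>\<^bsub>N\<^esub> (x \<oplus>\<^bsub>N\<^esub> y) = a \<odot>\<^bsub>N\<^esub> x \<oplus>\<^bsub>N\<^esub> a \<odot>\<^bsub>N\<^esub> y"
      using a p by (simp add: smult[symmetric] add[symmetric] smult_r_distr)
  next
    fix x assume "x \<in> carrier N"
    then obtain p where p: "p \<in> carrier M" "x = h p" using ex by blast
    show "\<one>\<^bsub>R\<^esub> \<odot>\<^bsub>N\<^esub> x = x" using p by (simp add: smult[symmetric])
  qed
qed

context module
begin

lemma coset_def':
  assumes B: "submodule R B M" and x: "x \<in> carrier M"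
  shows "B +>\<^bsub>M\<^esub> x = {z \<in> carrier M. z \<ominus>\<^bsub>M\<^esub> x \<in> B}"
proof
  show "B +>\<^bsub>M\<^esub> x \<subseteq> {z \<in> carrier M. z \<ominus>\<^bsub>M\<^esub> x \<in> B}"
  proof
    fix z assume "z \<in> B +>\<^bsub>M\<^esub> x"
    then obtain h where h: "h \<in> B" "z = h \<oplus>\<^bsub>M\<^esub> x" by (auto simp: a_r_coset_def')
    then have "z \<ominus>\<^bsub>M\<^esub> x = h" using submodule_in[OF B h(1)] x by (simp add: M.minus_eq M.a_assoc M.r_neg)
    then show "z \<in> {z \<in> carrier M. z \<ominus>\<^bsub>M\<^esub> x \<in> B}" using h submodule_in[OF B h(1)] x by simp
  qed
  show "{z \<in> carrier M. z \<ominus>\<^bsub>M\<^esub> x \<in> B} \<subseteq> B +>\<^bsub>M\<^esub> x"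
  proof
    fix z assume z: "z \<in> {z \<in> carrier M. z \<ominus>\<^bsub>M\<^esub> x \<in> B}"
    then have "z = (z \<ominus>\<^bsub>M\<^esub> x) \<oplus>\<^bsub>M\<^esub> x" using x by (simp add: M.minus_eq M.a_assoc M.l_neg)
    then show "z \<in> B +>\<^bsub>M\<^esub> x" using z unfolding a_r_coset_def' by blast
  qed
qed

lemma coset_eq_iff:
  assumes B: "submodule R B M" and x: "x \<in> carrier M" and y: "y \<in> carrier M"
  shows "B +>\<^bsub>M\<^esub> x = B +>\<^bsub>M\<^esub> y \<longleftrightarrow> x \<ominus>\<^bsub>M\<^esub> y \<in> B"
proof
  assume "B +>\<^bsub>M\<^esub> x = B +>\<^bsub>M\<^esub> y"
  moreover have "x \<in> B +>\<^bsub>M\<^esub> x"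
    using x submodule_zero[OF B] by (simp add: coset_def'[OF B x] M.minus_eq M.r_neg)
  ultimately show "x \<ominus>\<^bsub>M\<^esub> y \<in> B" by (simp add: coset_def'[OF B y])
next
  assume xy: "x \<ominus>\<^bsub>M\<^esub> y \<in> B"
  have "z \<ominus>\<^bsub>M\<^esub> x \<in> B \<longleftrightarrow> z \<ominus>\<^bsub>M\<^esub> y \<in> B" if z: "z \<in> carrier M" for z
  proof -
    have eq: "(z \<ominus>\<^bsub>M\<^esub> y) \<ominus>\<^bsub>M\<^esub> (x \<ominus>\<^bsub>M\<^esub> y) = z \<ominus>\<^bsub>M\<^esub> x"
    proof -
      have "(z \<ominus>\<^bsub>M\<^esub> y) \<ominus>\<^bsub>M\<^esub> (x \<ominus>\<^bsub>M\<^esub> y) = (\<ominus>\<^bsub>M\<^esub> y \<oplus>\<^bsub>M\<^esub> z) \<ominus>\<^bsub>M\<^esub> (\<ominus>\<^bsub>M\<^esub> y \<oplus>\<^bsub>M\<^esub> x)"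
        using x y z by (simp add: M.minus_eq M.a_comm)
      then show ?thesis using x y z by (simp add: M.add_minus_add_left)
    qed
    show ?thesis
    proof
      assume "z \<ominus>\<^bsub>M\<^esub> x \<in> B"
      then show "z \<ominus>\<^bsub>M\<^esub> y \<in> B" using submodule_minusD[OF B _ xy] x y z eq by simp
    next
      assume "z \<ominus>\<^bsub>M\<^esub> y \<in> B"
      from submodule_minus[OF B this xy] show "z \<ominus>\<^bsub>M\<^esub> x \<in> B" by (simp add: eq)
    qed
  qed
  then show "B +>\<^bsub>M\<^esub> x = B +>\<^bsub>M\<^esub> y" unfolding coset_def'[OF B x] coset_def'[OF B y] by blast
qed

lemma coset_self: "submodule R B M \<Longrightarrow> x \<in> carrier M \<Longrightarrow> x \<in> B +>\<^bsub>M\<^esub> x"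
  using submodule_zero[of R B M] by (simp add: coset_def' M.minus_eq M.r_neg)

lemma coset_mem:
  assumes "submodule R B M" "x \<in> carrier M" "y \<in> B +>\<^bsub>M\<^esub> x"
  shows "y \<in> carrier M" "y \<ominus>\<^bsub>M\<^esub> x \<in> B" "B +>\<^bsub>M\<^esub> y = B +>\<^bsub>M\<^esub> x"
  using assms(3) coset_eq_iff[OF assms(1) _ assms(2)] by (auto simp: coset_def'[OF assms(1,2)])

lemma coset_zero: "submodule R B M \<Longrightarrow> B +>\<^bsub>M\<^esub> \<zero>\<^bsub>M\<^esub> = B"
proof -
  assume B: "submodule R B M"
  have "z \<ominus>\<^bsub>M\<^esub> \<zero>\<^bsub>M\<^esub> = z" if "z \<in> carrier M" for z using that by (simp add: M.minus_eq)
  then show ?thesis using submodule_in[OF B] by (auto simp: coset_def'[OF B])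
qed

lemma coset_eq_B: "submodule R B M \<Longrightarrow> x \<in> carrier M \<Longrightarrow> B +>\<^bsub>M\<^esub> x = B \<longleftrightarrow> x \<in> B"
proof -
  assume B: "submodule R B M" and x: "x \<in> carrier M"
  then have "x \<ominus>\<^bsub>M\<^esub> \<zero>\<^bsub>M\<^esub> = x" by (simp add: M.minus_eq)
  then show ?thesis using coset_eq_iff[OF B x M.zero_closed] coset_zero[OF B] by simp
qed

lemma coset_add:
  assumes B: "submodule R B M" and x: "x \<in> carrier M" and y: "y \<in> carrier M"
  shows "(B +>\<^bsub>M\<^esub> x) <+>\<^bsub>M\<^esub> (B +>\<^bsub>M\<^esub> y) = B +>\<^bsub>M\<^esub> (x \<oplus>\<^bsub>M\<^esub> y)"
proof
  show "(B +>\<^bsub>M\<^esub> x) <+>\<^bsub>M\<^esub> (B +>\<^bsub>M\<^esub> y) \<subseteq> B +>\<^bsub>M\<^esub> (x \<oplus>\<^bsub>M\<^esub> y)"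
  proof
    fix z assume "z \<in> (B +>\<^bsub>M\<^esub> x) <+>\<^bsub>M\<^esub> (B +>\<^bsub>M\<^esub> y)"
    then obtain h k where h: "h \<in> B" "k \<in> B" "z = (h \<oplus>\<^bsub>M\<^esub> x) \<oplus>\<^bsub>M\<^esub> (k \<oplus>\<^bsub>M\<^esub> y)"
      by (auto simp: set_add_def' a_r_coset_def')
    then have "z = (h \<oplus>\<^bsub>M\<^esub> k) \<oplus>\<^bsub>M\<^esub> (x \<oplus>\<^bsub>M\<^esub> y)"
      using submodule_in[OF B] x y by (simp add: M.a_ac)
    then show "z \<in> B +>\<^bsub>M\<^esub> (x \<oplus>\<^bsub>M\<^esub> y)"
      using submodule_add[OF B h(1,2)] by (auto simp: a_r_coset_def')
  qed
  show "B +>\<^bsub>M\<^esub> (x \<oplus>\<^bsub>M\<^esub> y) \<subseteq> (B +>\<^bsub>M\<^esub> x) <+>\<^bsub>M\<^esub> (B +>\<^bsub>M\<^esub> y)"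
  proof
    fix z assume "z \<in> B +>\<^bsub>M\<^esub> (x \<oplus>\<^bsub>M\<^esub> y)"
    then obtain h where h: "h \<in> B" "z = h \<oplus>\<^bsub>M\<^esub> (x \<oplus>\<^bsub>M\<^esub> y)" by (auto simp: a_r_coset_def')
    then have "z = (h \<oplus>\<^bsub>M\<^esub> x) \<oplus>\<^bsub>M\<^esub> y" using submodule_in[OF B] x y by (simp add: M.a_assoc)
    moreover have "h \<oplus>\<^bsub>M\<^esub> x \<in> B +>\<^bsub>M\<^esub> x" using h by (auto simp: a_r_coset_def')
    ultimately show "z \<in> (B +>\<^bsub>M\<^esub> x) <+>\<^bsub>M\<^esub> (B +>\<^bsub>M\<^esub> y)"
      using coset_self[OF B y] unfolding set_add_def' by blast
  qed
qed

lemma coset_smult: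
  assumes B: "submodule R B M" and B': "submodule R B' M" and x: "x \<in> carrier M" and r: "r \<in> carrier R"
    and sub: "\<And>y. y \<in> B \<Longrightarrow> r \<odot>\<^bsub>M\<^esub> y \<in> B'"
  shows "(\<Union>y\<in>B +>\<^bsub>M\<^esub> x. B' +>\<^bsub>M\<^esub> (r \<odot>\<^bsub>M\<^esub> y)) = B' +>\<^bsub>M\<^esub> (r \<odot>\<^bsub>M\<^esub> x)"
proof -
  have eq: "B' +>\<^bsub>M\<^esub> (r \<odot>\<^bsub>M\<^esub> y) = B' +>\<^bsub>M\<^esub> (r \<odot>\<^bsub>M\<^esub> x)" if y: "y \<in> B +>\<^bsub>M\<^esub> x" for y
  proof -
    note yc = coset_mem[OF B x y]
    have "r \<odot>\<^bsub>M\<^esub> y \<ominus>\<^bsub>M\<^esub> r \<odot>\<^bsub>M\<^esub> x = r \<odot>\<^bsub>M\<^esub> (y \<ominus>\<^bsub>M\<^esub> x)"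
      using yc(1) x r by (simp add: M.minus_eq smult_r_distr smult_r_minus)
    then show ?thesis using sub[OF yc(2)] yc(1) x r by (simp add: coset_eq_iff[OF B'])
  qed
  show ?thesis
  proof
    show "(\<Union>y\<in>B +>\<^bsub>M\<^esub> x. B' +>\<^bsub>M\<^esub> (r \<odot>\<^bsub>M\<^esub> y)) \<subseteq> B' +>\<^bsub>M\<^esub> (r \<odot>\<^bsub>M\<^esub> x)"
      by (rule UN_least) (simp only: eq order_refl)
    show "B' +>\<^bsub>M\<^esub> (r \<odot>\<^bsub>M\<^esub> x) \<subseteq> (\<Union>y\<in>B +>\<^bsub>M\<^esub> x. B' +>\<^bsub>M\<^esub> (r \<odot>\<^bsub>M\<^esub> y))"
      by (rule UN_upper[OF coset_self[OF B x]])
  qed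
qed

end

lemma quotient_module_simps:
  "carrier (quotient_module M A B) = (\<lambda>x. B +>\<^bsub>M\<^esub> x) ` A"
  "zero (quotient_module M A B) = B" "add (quotient_module M A B) = set_add M"
  "smult (quotient_module M A B) = (\<lambda>r X. \<Union>x\<in>X. B +>\<^bsub>M\<^esub> (r \<odot>\<^bsub>M\<^esub> x))"
  by (simp_all add: quotient_module_def)

context module
begin

lemma quotient_add:
  assumes "submodule R B M" "x \<in> carrier M" "y \<in> carrier M"
  shows "(B +>\<^bsub>M\<^esub> x) \<oplus>\<^bsub>quotient_module M A B\<^esub> (B +>\<^bsub>M\<^esub> y) = B +>\<^bsub>M\<^esub> (x \<oplus>\<^bsub>M\<^esub> y)"
  using assms by (simp add: quotient_module_simps coset_add)

lemma quotient_smult: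
  assumes "submodule R B M" "x \<in> carrier M" "r \<in> carrier R"
  shows "r \<odot>\<^bsub>quotient_module M A B\<^esub> (B +>\<^bsub>M\<^esub> x) = B +>\<^bsub>M\<^esub> (r \<odot>\<^bsub>M\<^esub> x)"
  using assms submodule_smult[OF assms(1)] by (simp add: quotient_module_simps coset_smult)

lemma quotient_is_module:
  assumes A: "submodule R A M" and B: "submodule R B M"
  shows "module R (quotient_module M A B)"
proof (rule image_module[OF submodule_is_module[OF A], of "\<lambda>x. B +>\<^bsub>M\<^esub> x"])
  note [simp] = submodule_in[OF A]
  show "B +>\<^bsub>M\<^esub> (x \<oplus>\<^bsub>M\<lparr>carrier := A\<rparr>\<^esub> y) = (B +>\<^bsub>M\<^esub> x) \<oplus>\<^bsub>quotient_module M A B\<^esub> (B +>\<^bsub>M\<^esub> y)"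
    if "x \<in> carrier (M\<lparr>carrier := A\<rparr>)" "y \<in> carrier (M\<lparr>carrier := A\<rparr>)" for x y
    using that by (simp add: quotient_add[OF B])
  show "B +>\<^bsub>M\<^esub> (r \<odot>\<^bsub>M\<lparr>carrier := A\<rparr>\<^esub> x) = r \<odot>\<^bsub>quotient_module M A B\<^esub> (B +>\<^bsub>M\<^esub> x)"
    if "r \<in> carrier R" "x \<in> carrier (M\<lparr>carrier := A\<rparr>)" for r x
    using that by (simp add: quotient_smult[OF B])
qed (simp_all add: quotient_module_simps coset_zero[OF B])

lemma quotient_hom:
  assumes A: "submodule R A M" and B: "submodule R B M"
  shows "(\<lambda>x. B +>\<^bsub>M\<^esub> x) \<in> module_hom R (M\<lparr>carrier := A\<rparr>) (quotient_module M A B)"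
proof (rule module_homI)
  show "B +>\<^bsub>M\<^esub> x \<in> carrier (quotient_module M A B)" if "x \<in> carrier (M\<lparr>carrier := A\<rparr>)" for x
    using that by (simp add: quotient_module_simps)
  show "B +>\<^bsub>M\<^esub> (x \<oplus>\<^bsub>M\<lparr>carrier := A\<rparr>\<^esub> y) = (B +>\<^bsub>M\<^esub> x) \<oplus>\<^bsub>quotient_module M A B\<^esub> (B +>\<^bsub>M\<^esub> y)"
    if "x \<in> carrier (M\<lparr>carrier := A\<rparr>)" "y \<in> carrier (M\<lparr>carrier := A\<rparr>)" for x y
    using that submodule_in[OF A] by (simp add: quotient_add[OF B])
  show "B +>\<^bsub>M\<^esub> (r \<odot>\<^bsub>M\<lparr>carrier := A\<rparr>\<^esub> x) = r \<odot>\<^bsub>quotient_module M A B\<^esub> (B +>\<^bsub>M\<^esub> x)"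
    if "r \<in> carrier R" "x \<in> carrier (M\<lparr>carrier := A\<rparr>)" for r x
    using that submodule_in[OF A] by (simp add: quotient_smult[OF B])
qed

end

lemma self_module_simps [simp]:
  "carrier (self_module R) = carrier R" "add (self_module R) = add R" "zero (self_module R) = zero R"
  "smult (self_module R) = mult R"
  by (simp_all add: self_module_def)

lemma (in cring) self_module: "module R (self_module R)"
proof (rule moduleI[OF is_cring])
  show "abelian_group (self_module R)"
  proof (rule abelian_groupI)
    show "\<exists>y\<in>carrier (self_module R). y \<oplus>\<^bsub>self_module R\<^esub> x = \<zero>\<^bsub>self_module R\<^esub>"
      if "x \<in> carrier (self_module R)" for x using that l_neg[of x] by auto
  qed (simp_all add: a_ac)
qed (simp_all add: l_distr r_distr m_assoc)

lemma self_coset [simp]: "I +>\<^bsub>self_module R\<^esub> r = I +>\<^bsub>R\<^esub> r"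
  by (simp add: a_r_coset_def')

lemma self_set_add [simp]: "X <+>\<^bsub>self_module R\<^esub> Y = X <+>\<^bsub>R\<^esub> Y"
  by (simp add: set_add_def')

lemma (in cring) self_a_inv:
  assumes "x \<in> carrier R"
  shows "\<ominus>\<^bsub>self_module R\<^esub> x = \<ominus> x"
proof -
  interpret S: module R "self_module R" by (rule self_module)
  have "\<ominus> x \<oplus>\<^bsub>self_module R\<^esub> x = \<zero>\<^bsub>self_module R\<^esub>" using assms by (simp add: l_neg)
  from S.M.minus_equality[OF this] assms show ?thesis by simp
qed

lemma (in cring) ideal_self_submodule: "ideal I R \<Longrightarrow> submodule R I (self_module R)"
  using self_module by (auto simp: submodule_def ideal.Icarr ideal.I_l_closed
    additive_subgroup.a_closed additive_subgroup.zero_closed ideal.axioms(1))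

section \<open>Tensor products with the residue field\<close>

text \<open>The linear map on the free module over \<open>T\<close> with values
  \<open>\<beta>\<close> on the basis. The sum runs over the support, so this is literally the
  expression inside \<open>tensor_map\<close>.\<close>

definition finsupp_lin :: "('a, 'r) ring_scheme \<Rightarrow> 's set \<Rightarrow> ('a, 'b, 'm) module_scheme
    \<Rightarrow> ('s \<Rightarrow> 'b) \<Rightarrow> ('s \<Rightarrow> 'a) \<Rightarrow> 'b" where
  "finsupp_lin R T X \<beta> f = (\<Oplus>\<^bsub>X\<^esub>t\<in>{t \<in> T. f t \<noteq> \<zero>\<^bsub>R\<^esub>}. f t \<odot>\<^bsub>X\<^esub> \<beta> t)"

context cring
begin

lemma finsupp_simps:
  "carrier (finsupp_module R T) = {f \<in> T \<rightarrow>\<^sub>E carrier R. finite {s \<in> T. f s \<noteq> \<zero>}}"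
  "zero (finsupp_module R T) = (\<lambda>t\<in>T. \<zero>)"
  "f \<oplus>\<^bsub>finsupp_module R T\<^esub> g = (\<lambda>t\<in>T. f t \<oplus> g t)"
  "r \<odot>\<^bsub>finsupp_module R T\<^esub> f = (\<lambda>t\<in>T. r \<otimes> f t)"
  by (simp_all add: finsupp_module_def func_space_def)

lemma finsupp_is_module: "module R (finsupp_module R T)"
proof -
  interpret F: module R "func_space T" by (rule func_space_is_module)
  let ?K = "{f \<in> T \<rightarrow>\<^sub>E carrier R. finite {s \<in> T. f s \<noteq> \<zero>}}"
  have "submodule R ?K (func_space T)"
  proof
    show "?K \<subseteq> carrier (func_space T)" by (auto simp: func_space_def)
    show "\<zero>\<^bsub>func_space T\<^esub> \<in> ?K" by (auto simp: func_space_def)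
    fix f g assume f: "f \<in> ?K" and g: "g \<in> ?K"
    have "{s \<in> T. (f \<oplus>\<^bsub>func_space T\<^esub> g) s \<noteq> \<zero>} \<subseteq> {s \<in> T. f s \<noteq> \<zero>} \<union> {s \<in> T. g s \<noteq> \<zero>}"
      by (auto simp: func_space_def)
    then have "finite {s \<in> T. (f \<oplus>\<^bsub>func_space T\<^esub> g) s \<noteq> \<zero>}"
      using f g finite_subset by blast
    then show "f \<oplus>\<^bsub>func_space T\<^esub> g \<in> ?K" using f g by (auto simp: func_space_def PiE_iff)
  next
    fix r f assume r: "r \<in> carrier R" and f: "f \<in> ?K"
    have "{s \<in> T. (r \<odot>\<^bsub>func_space T\<^esub> f) s \<noteq> \<zero>} \<subseteq> {s \<in> T. f s \<noteq> \<zero>}"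
      using r by (auto simp: func_space_def)
    then have "finite {s \<in> T. (r \<odot>\<^bsub>func_space T\<^esub> f) s \<noteq> \<zero>}"
      using f finite_subset by blast
    then show "r \<odot>\<^bsub>func_space T\<^esub> f \<in> ?K" using r f by (auto simp: func_space_def PiE_iff)
  qed
  from F.submodule_is_module[OF this] show ?thesis by (simp add: finsupp_module_def)
qed

lemma finsupp_single_closed: "finsupp_single R T t \<in> carrier (finsupp_module R T)"
proof -
  have "{s \<in> T. finsupp_single R T t s \<noteq> \<zero>} \<subseteq> {t}" by (auto simp: finsupp_single_def)
  then have "finite {s \<in> T. finsupp_single R T t s \<noteq> \<zero>}" using finite_subset by blast
  then show ?thesis by (auto simp: finsupp_simps finsupp_single_def)
qed

text \<open>The support depends on \<open>f\<close>; sums for two functions can be added only after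
  both are extended by zero terms to a common finite index set.\<close>

lemma finsupp_lin_superset:
  assumes X: "module R X" and \<beta>: "\<And>t. t \<in> T \<Longrightarrow> \<beta> t \<in> carrier X" and f: "f \<in> carrier (finsupp_module R T)"
    and A: "finite A" "{t \<in> T. f t \<noteq> \<zero>} \<subseteq> A" "A \<subseteq> T"
  shows "finsupp_lin R T X \<beta> f = (\<Oplus>\<^bsub>X\<^esub>t\<in>A. f t \<odot>\<^bsub>X\<^esub> \<beta> t)"
proof -
  interpret X: module R X by fact
  have fc: "f t \<in> carrier R" if "t \<in> T" for t using f that by (auto simp: finsupp_simps)
  show ?thesis unfolding finsupp_lin_def
  proof (rule X.M.add.finprod_mono_neutral_cong_left[OF A(1,2)])
    show "f i \<odot>\<^bsub>X\<^esub> \<beta> i = \<zero>\<^bsub>X\<^esub>" if "i \<in> A - {t \<in> T. f t \<noteq> \<zero>}" for i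
      using that A(3) \<beta>[of i] by auto
    show "(\<lambda>t. f t \<odot>\<^bsub>X\<^esub> \<beta> t) \<in> A \<rightarrow> carrier X" using A(3) \<beta> fc by auto
  qed simp
qed

lemma finsupp_lin_hom:
  assumes X: "module R X" and \<beta>: "\<And>t. t \<in> T \<Longrightarrow> \<beta> t \<in> carrier X"
  shows "finsupp_lin R T X \<beta> \<in> module_hom R (finsupp_module R T) X"
proof (rule module_homI)
  interpret X: module R X by fact
  interpret P: module R "finsupp_module R T" by (rule finsupp_is_module)
  have fc: "f t \<in> carrier R" if "t \<in> T" "f \<in> carrier (finsupp_module R T)" for t f using that by (auto simp: finsupp_simps)
  fix f assume f: "f \<in> carrier (finsupp_module R T)"
  show "finsupp_lin R T X \<beta> f \<in> carrier X"
    unfolding finsupp_lin_def using \<beta> fc[OF _ f] by (intro X.finsum_closed) auto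
  have finf: "finite {t \<in> T. f t \<noteq> \<zero>}" using f by (simp add: finsupp_simps)
  fix g assume g: "g \<in> carrier (finsupp_module R T)"
  have fing: "finite {t \<in> T. g t \<noteq> \<zero>}" using g by (simp add: finsupp_simps)
  let ?A = "{t \<in> T. f t \<noteq> \<zero>} \<union> {t \<in> T. g t \<noteq> \<zero>}"
  have A: "finite ?A" "?A \<subseteq> T" using finf fing by auto
  have "finsupp_lin R T X \<beta> (f \<oplus>\<^bsub>finsupp_module R T\<^esub> g)
      = (\<Oplus>\<^bsub>X\<^esub>t\<in>?A. (f \<oplus>\<^bsub>finsupp_module R T\<^esub> g) t \<odot>\<^bsub>X\<^esub> \<beta> t)"
    by (rule finsupp_lin_superset[OF X \<beta> P.M.a_closed[OF f g] A(1) _ A(2)])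
      (auto simp: finsupp_simps)
  also have "\<dots> = (\<Oplus>\<^bsub>X\<^esub>t\<in>?A. f t \<odot>\<^bsub>X\<^esub> \<beta> t \<oplus>\<^bsub>X\<^esub> g t \<odot>\<^bsub>X\<^esub> \<beta> t)"
    using \<beta> fc[OF _ f] fc[OF _ g]
    by (intro X.finsum_cong') (auto simp: finsupp_simps X.smult_l_distr)
  also have "\<dots> = (\<Oplus>\<^bsub>X\<^esub>t\<in>?A. f t \<odot>\<^bsub>X\<^esub> \<beta> t) \<oplus>\<^bsub>X\<^esub> (\<Oplus>\<^bsub>X\<^esub>t\<in>?A. g t \<odot>\<^bsub>X\<^esub> \<beta> t)"
    using \<beta> fc[OF _ f] fc[OF _ g] by (intro X.finsum_addf) auto
  also have "(\<Oplus>\<^bsub>X\<^esub>t\<in>?A. f t \<odot>\<^bsub>X\<^esub> \<beta> t) = finsupp_lin R T X \<beta> f"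
    by (rule finsupp_lin_superset[OF X \<beta> f A(1) _ A(2), symmetric]) auto
  also have "(\<Oplus>\<^bsub>X\<^esub>t\<in>?A. g t \<odot>\<^bsub>X\<^esub> \<beta> t) = finsupp_lin R T X \<beta> g"
    by (rule finsupp_lin_superset[OF X \<beta> g A(1) _ A(2), symmetric]) auto
  finally show "finsupp_lin R T X \<beta> (f \<oplus>\<^bsub>finsupp_module R T\<^esub> g)
    = finsupp_lin R T X \<beta> f \<oplus>\<^bsub>X\<^esub> finsupp_lin R T X \<beta> g" .
next
  interpret X: module R X by fact
  interpret P: module R "finsupp_module R T" by (rule finsupp_is_module)
  fix r f assume r: "r \<in> carrier R" and f: "f \<in> carrier (finsupp_module R T)"
  have fc: "f t \<in> carrier R" if "t \<in> T" for t using that f by (auto simp: finsupp_simps)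
  let ?A = "{t \<in> T. f t \<noteq> \<zero>}"
  have A: "finite ?A" "?A \<subseteq> T" using f by (auto simp: finsupp_simps)
  have "finsupp_lin R T X \<beta> (r \<odot>\<^bsub>finsupp_module R T\<^esub> f)
      = (\<Oplus>\<^bsub>X\<^esub>t\<in>?A. (r \<odot>\<^bsub>finsupp_module R T\<^esub> f) t \<odot>\<^bsub>X\<^esub> \<beta> t)"
    by (rule finsupp_lin_superset[OF X \<beta> P.smult_closed[OF r f] A(1) _ A(2)])
      (use r in \<open>auto simp: finsupp_simps\<close>)
  also have "\<dots> = (\<Oplus>\<^bsub>X\<^esub>t\<in>?A. r \<odot>\<^bsub>X\<^esub> (f t \<odot>\<^bsub>X\<^esub> \<beta> t))"
    using \<beta> fc r by (intro X.finsum_cong') (auto simp: finsupp_simps X.smult_assoc1)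
  also have "\<dots> = r \<odot>\<^bsub>X\<^esub> finsupp_lin R T X \<beta> f"
    unfolding finsupp_lin_def using \<beta> fc r A(1) by (intro X.finsum_smult_ldistr[symmetric]) auto
  finally show "finsupp_lin R T X \<beta> (r \<odot>\<^bsub>finsupp_module R T\<^esub> f) = r \<odot>\<^bsub>X\<^esub> finsupp_lin R T X \<beta> f" .
qed

lemma finsupp_lin_single:
  assumes X: "module R X" and \<beta>: "\<And>t. t \<in> T \<Longrightarrow> \<beta> t \<in> carrier X" and t: "t \<in> T"
  shows "finsupp_lin R T X \<beta> (finsupp_single R T t) = \<beta> t"
proof -
  interpret X: module R X by fact
  have "finsupp_lin R T X \<beta> (finsupp_single R T t) = (\<Oplus>\<^bsub>X\<^esub>s\<in>{t}. finsupp_single R T t s \<odot>\<^bsub>X\<^esub> \<beta> s)"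
    using t by (intro finsupp_lin_superset[OF X \<beta> finsupp_single_closed]) (auto simp: finsupp_single_def split: if_splits)
  also have "\<dots> = \<beta> t" using t \<beta>[OF t] by (simp add: finsupp_single_def)
  finally show ?thesis .
qed

text \<open>Induction on the size of the support, splitting off one entry at a time.\<close>

lemma finsupp_generated:
  assumes K: "submodule R K (finsupp_module R T)" and gen: "\<And>t. t \<in> T \<Longrightarrow> finsupp_single R T t \<in> K"
    and f: "f \<in> carrier (finsupp_module R T)"
  shows "f \<in> K"
  using f
proof (induction "card {t \<in> T. f t \<noteq> \<zero>}" arbitrary: f)
  case 0
  then have "{t \<in> T. f t \<noteq> \<zero>} = {}" by (simp add: finsupp_simps)
  then have "f = \<zero>\<^bsub>finsupp_module R T\<^esub>"
    using 0(2) unfolding finsupp_simps by (intro ext) (auto simp: PiE_iff extensional_def)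
  then show ?case using submodule_zero[OF K] by simp
next
  case (Suc n)
  interpret P: module R "finsupp_module R T" by (rule finsupp_is_module)
  have fin: "finite {t \<in> T. f t \<noteq> \<zero>}" using Suc by (simp add: finsupp_simps)
  have fc: "f t \<in> carrier R" if "t \<in> T" for t using that Suc by (auto simp: finsupp_simps)
  obtain t where t: "t \<in> T" "f t \<noteq> \<zero>" using Suc(2) by (metis (mono_tags, lifting) Collect_empty_eq card.empty nat.distinct(1))
  define g where "g = (\<lambda>s\<in>T. if s = t then \<zero> else f s)"
  have supp: "{s \<in> T. g s \<noteq> \<zero>} = {s \<in> T. f s \<noteq> \<zero>} - {t}" by (auto simp: g_def)
  have g: "g \<in> carrier (finsupp_module R T)"
    using fin fc supp unfolding finsupp_simps by (auto simp: g_def)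
  have "n = card {s \<in> T. g s \<noteq> \<zero>}" unfolding supp using Suc(2) t fin by simp
  then have "g \<in> K" using Suc(1) g by blast
  moreover have "f = g \<oplus>\<^bsub>finsupp_module R T\<^esub> f t \<odot>\<^bsub>finsupp_module R T\<^esub> finsupp_single R T t"
    using Suc(3) fc t unfolding finsupp_simps
    by (intro ext) (auto simp: g_def finsupp_single_def PiE_iff extensional_def)
  ultimately show ?case
    using submodule_add[OF K _ submodule_smult[OF K fc[OF t(1)] gen[OF t(1)]]] by metis
qed

end

section \<open>Bilinear relations and maps out of a tensor product\<close>

context cring
begin

text \<open>This and the next two definitions name the parts that \<open>tensor_relations\<close>
  and \<open>tensor\<close> hide in a \<open>let\<close>.\<close>

definition tensor_free :: "('a, 'c, 'm) module_scheme \<Rightarrow> ('a, 'd, 'n) module_scheme \<Rightarrow> ('a, 'c \<times> 'd \<Rightarrow> 'a) module" where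
  "tensor_free M N = finsupp_module R (carrier M \<times> carrier N)"

definition tensor_gen :: "('a, 'c, 'm) module_scheme \<Rightarrow> ('a, 'd, 'n) module_scheme \<Rightarrow> 'c \<Rightarrow> 'd \<Rightarrow> 'c \<times> 'd \<Rightarrow> 'a" where
  "tensor_gen M N x y = finsupp_single R (carrier M \<times> carrier N) (x, y)"

definition bilinear_rels :: "('a, 'c, 'm) module_scheme \<Rightarrow> ('a, 'd, 'n) module_scheme \<Rightarrow> ('c \<times> 'd \<Rightarrow> 'a) set" where
  "bilinear_rels M N = (let P = tensor_free M N; e = tensor_gen M N in
      {e (x \<oplus>\<^bsub>M\<^esub> x') y \<ominus>\<^bsub>P\<^esub> (e x y \<oplus>\<^bsub>P\<^esub> e x' y) | x x' y.
          x \<in> carrier M \<and> x' \<in> carrier M \<and> y \<in> carrier N} \<union>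
       {e x (y \<oplus>\<^bsub>N\<^esub> y') \<ominus>\<^bsub>P\<^esub> (e x y \<oplus>\<^bsub>P\<^esub> e x y') | x y y'.
          x \<in> carrier M \<and> y \<in> carrier N \<and> y' \<in> carrier N} \<union>
       {e (r \<odot>\<^bsub>M\<^esub> x) y \<ominus>\<^bsub>P\<^esub> (r \<odot>\<^bsub>P\<^esub> e x y) | r x y.
          r \<in> carrier R \<and> x \<in> carrier M \<and> y \<in> carrier N} \<union>
       {e x (r \<odot>\<^bsub>N\<^esub> y) \<ominus>\<^bsub>P\<^esub> (r \<odot>\<^bsub>P\<^esub> e x y) | r x y.
          r \<in> carrier R \<and> x \<in> carrier M \<and> y \<in> carrier N})"

lemma tensor_relations_eq: "tensor_relations R M N = module.span R (tensor_free M N) (bilinear_rels M N)"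
  by (simp only: tensor_relations_def bilinear_rels_def tensor_free_def tensor_gen_def Let_def)

lemma tensor_eq: "tensor R M N = quotient_module (tensor_free M N) (carrier (tensor_free M N)) (tensor_relations R M N)"
  by (simp add: tensor_def tensor_free_def Let_def)

lemma pure_tensor_eq: "pure_tensor R M N x y = tensor_relations R M N +>\<^bsub>tensor_free M N\<^esub> tensor_gen M N x y"
  by (simp add: pure_tensor_def tensor_free_def tensor_gen_def)

lemma tensor_free_module: "module R (tensor_free M N)"
  unfolding tensor_free_def by (rule finsupp_is_module)

lemma tensor_gen_closed: "tensor_gen M N x y \<in> carrier (tensor_free M N)"
  unfolding tensor_gen_def tensor_free_def by (rule finsupp_single_closed)

lemma bilinear_rels_closed: "bilinear_rels M N \<subseteq> carrier (tensor_free M N)"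
proof -
  interpret P: module R "tensor_free M N" by (rule tensor_free_module)
  show ?thesis unfolding bilinear_rels_def Let_def using tensor_gen_closed P.smult_closed by (auto intro!: P.M.minus_closed P.M.a_closed P.smult_closed)
qed

lemma tensor_relations_sub: "submodule R (tensor_relations R M N) (tensor_free M N)"
  unfolding tensor_relations_eq by (rule module.span_is_submodule[OF tensor_free_module bilinear_rels_closed])

lemma tensor_module: "module R (tensor R M N)"
  unfolding tensor_eq
  by (rule module.quotient_is_module[OF tensor_free_module submodule_carrier[OF tensor_free_module] tensor_relations_sub])

lemma tensor_rel: "r \<in> bilinear_rels M N \<Longrightarrow> r \<in> tensor_relations R M N"
  unfolding tensor_relations_eq using module.in_own_span[OF tensor_free_module bilinear_rels_closed] by blast

lemma pure_tensor_closed: "pure_tensor R M N x y \<in> carrier (tensor R M N)"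
  unfolding pure_tensor_eq tensor_eq quotient_module_simps by (rule imageI[OF tensor_gen_closed])

lemma pure_tensor_bilinear:
  shows "x \<in> carrier M \<Longrightarrow> x' \<in> carrier M \<Longrightarrow> y \<in> carrier N \<Longrightarrow>
      pure_tensor R M N (x \<oplus>\<^bsub>M\<^esub> x') y = pure_tensor R M N x y \<oplus>\<^bsub>tensor R M N\<^esub> pure_tensor R M N x' y"
    and "x \<in> carrier M \<Longrightarrow> y \<in> carrier N \<Longrightarrow> y' \<in> carrier N \<Longrightarrow>
      pure_tensor R M N x (y \<oplus>\<^bsub>N\<^esub> y') = pure_tensor R M N x y \<oplus>\<^bsub>tensor R M N\<^esub> pure_tensor R M N x y'"
    and "r \<in> carrier R \<Longrightarrow> x \<in> carrier M \<Longrightarrow> y \<in> carrier N \<Longrightarrow>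
      pure_tensor R M N (r \<odot>\<^bsub>M\<^esub> x) y = r \<odot>\<^bsub>tensor R M N\<^esub> pure_tensor R M N x y"
    and "r \<in> carrier R \<Longrightarrow> x \<in> carrier M \<Longrightarrow> y \<in> carrier N \<Longrightarrow>
      pure_tensor R M N x (r \<odot>\<^bsub>N\<^esub> y) = r \<odot>\<^bsub>tensor R M N\<^esub> pure_tensor R M N x y"
proof -
  interpret P: module R "tensor_free M N" by (rule tensor_free_module)
  note B = tensor_relations_sub[of M N] and e = tensor_gen_closed[of M N]
  have add: "tensor_relations R M N +>\<^bsub>tensor_free M N\<^esub> f =
      (tensor_relations R M N +>\<^bsub>tensor_free M N\<^esub> g) \<oplus>\<^bsub>tensor R M N\<^esub> (tensor_relations R M N +>\<^bsub>tensor_free M N\<^esub> h)"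
    if "f \<ominus>\<^bsub>tensor_free M N\<^esub> (g \<oplus>\<^bsub>tensor_free M N\<^esub> h) \<in> bilinear_rels M N"
      "f \<in> carrier (tensor_free M N)" "g \<in> carrier (tensor_free M N)" "h \<in> carrier (tensor_free M N)" for f g h
    unfolding tensor_eq P.quotient_add[OF B that(3,4)]
    using P.coset_eq_iff[OF B that(2) P.M.a_closed[OF that(3,4)]] tensor_rel[OF that(1)] by simp
  have smult: "tensor_relations R M N +>\<^bsub>tensor_free M N\<^esub> f =
      r \<odot>\<^bsub>tensor R M N\<^esub> (tensor_relations R M N +>\<^bsub>tensor_free M N\<^esub> g)"
    if "f \<ominus>\<^bsub>tensor_free M N\<^esub> (r \<odot>\<^bsub>tensor_free M N\<^esub> g) \<in> bilinear_rels M N" "r \<in> carrier R"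
      "f \<in> carrier (tensor_free M N)" "g \<in> carrier (tensor_free M N)" for f g r
    unfolding tensor_eq P.quotient_smult[OF B that(4,2)]
    using P.coset_eq_iff[OF B that(3) P.smult_closed[OF that(2,4)]] tensor_rel[OF that(1)] by simp
  show "x \<in> carrier M \<Longrightarrow> x' \<in> carrier M \<Longrightarrow> y \<in> carrier N \<Longrightarrow>
      pure_tensor R M N (x \<oplus>\<^bsub>M\<^esub> x') y = pure_tensor R M N x y \<oplus>\<^bsub>tensor R M N\<^esub> pure_tensor R M N x' y"
    unfolding pure_tensor_eq by (rule add[OF _ e e e]) (unfold bilinear_rels_def Let_def, blast)
  show "x \<in> carrier M \<Longrightarrow> y \<in> carrier N \<Longrightarrow> y' \<in> carrier N \<Longrightarrow>
      pure_tensor R M N x (y \<oplus>\<^bsub>N\<^esub> y') = pure_tensor R M N x y \<oplus>\<^bsub>tensor R M N\<^esub> pure_tensor R M N x y'"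
    unfolding pure_tensor_eq by (rule add[OF _ e e e]) (unfold bilinear_rels_def Let_def, blast)
  show "r \<in> carrier R \<Longrightarrow> x \<in> carrier M \<Longrightarrow> y \<in> carrier N \<Longrightarrow>
      pure_tensor R M N (r \<odot>\<^bsub>M\<^esub> x) y = r \<odot>\<^bsub>tensor R M N\<^esub> pure_tensor R M N x y"
    unfolding pure_tensor_eq by (rule smult[OF _ _ e e]) (unfold bilinear_rels_def Let_def, blast+)
  show "r \<in> carrier R \<Longrightarrow> x \<in> carrier M \<Longrightarrow> y \<in> carrier N \<Longrightarrow>
      pure_tensor R M N x (r \<odot>\<^bsub>N\<^esub> y) = r \<odot>\<^bsub>tensor R M N\<^esub> pure_tensor R M N x y"
    unfolding pure_tensor_eq by (rule smult[OF _ _ e e]) (unfold bilinear_rels_def Let_def, blast+)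
qed

lemma tensor_generated:
  assumes K: "submodule R K (tensor R M N)"
    and gen: "\<And>x y. x \<in> carrier M \<Longrightarrow> y \<in> carrier N \<Longrightarrow> pure_tensor R M N x y \<in> K"
  shows "carrier (tensor R M N) \<subseteq> K"
proof
  interpret P: module R "tensor_free M N" by (rule tensor_free_module)
  let ?q = "\<lambda>f. tensor_relations R M N +>\<^bsub>tensor_free M N\<^esub> f"
  have hom: "?q \<in> module_hom R (tensor_free M N) (tensor R M N)"
    unfolding tensor_eq using P.quotient_hom[OF submodule_carrier[OF tensor_free_module] tensor_relations_sub]
    by simp
  have sub: "submodule R {f \<in> carrier (tensor_free M N). ?q f \<in> K} (tensor_free M N)"
    by (rule module_hom_vimage[OF tensor_free_module tensor_module hom K])
  fix X assume "X \<in> carrier (tensor R M N)"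
  then obtain f where f: "f \<in> carrier (tensor_free M N)" "X = ?q f" by (auto simp: tensor_eq quotient_module_simps)
  have "f \<in> {f \<in> carrier (tensor_free M N). ?q f \<in> K}"
    unfolding tensor_free_def
  proof (rule finsupp_generated)
    show "submodule R {f \<in> carrier (finsupp_module R (carrier M \<times> carrier N)).
        tensor_relations R M N +>\<^bsub>finsupp_module R (carrier M \<times> carrier N)\<^esub> f \<in> K}
       (finsupp_module R (carrier M \<times> carrier N))"
      using sub unfolding tensor_free_def .
    show "f \<in> carrier (finsupp_module R (carrier M \<times> carrier N))" using f unfolding tensor_free_def by simp
    fix t assume "t \<in> carrier M \<times> carrier N"
    then show "finsupp_single R (carrier M \<times> carrier N) t \<in> {f \<in> carrier (finsupp_module R (carrier M \<times> carrier N)).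
        tensor_relations R M N +>\<^bsub>finsupp_module R (carrier M \<times> carrier N)\<^esub> f \<in> K}"
      using gen[of "fst t" "snd t"] finsupp_single_closed
      by (auto simp: pure_tensor_def)
  qed
  then show "X \<in> K" using f by simp
qed

text \<open>The universal property modulo a submodule \<open>Y\<close>: bilinearity of
  \<open>\<beta>\<close> is only required up to \<open>Y\<close>. With \<open>Y\<close> zero it
  shows that \<open>tensor_map\<close> is well defined on pure tensors; with \<open>Y\<close> the
  product of \<open>I\<close> and \<open>M\<close> it computes the kernel of \<open>mu\<close>,
  where \<open>\<beta>\<close> depends on chosen representatives.\<close>

lemma tensor_relations_lin:
  assumes X: "module R X" and \<beta>: "\<And>t. t \<in> carrier M \<times> carrier N \<Longrightarrow> \<beta> t \<in> carrier X"
    and M: "module R M" and N: "module R N"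
    and Y: "submodule R Y X"
    and bil: "\<And>x x' y. x \<in> carrier M \<Longrightarrow> x' \<in> carrier M \<Longrightarrow> y \<in> carrier N \<Longrightarrow>
        \<beta> (x \<oplus>\<^bsub>M\<^esub> x', y) \<ominus>\<^bsub>X\<^esub> (\<beta> (x, y) \<oplus>\<^bsub>X\<^esub> \<beta> (x', y)) \<in> Y"
      "\<And>x y y'. x \<in> carrier M \<Longrightarrow> y \<in> carrier N \<Longrightarrow> y' \<in> carrier N \<Longrightarrow>
        \<beta> (x, y \<oplus>\<^bsub>N\<^esub> y') \<ominus>\<^bsub>X\<^esub> (\<beta> (x, y) \<oplus>\<^bsub>X\<^esub> \<beta> (x, y')) \<in> Y"
      "\<And>r x y. r \<in> carrier R \<Longrightarrow> x \<in> carrier M \<Longrightarrow> y \<in> carrier N \<Longrightarrow>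
        \<beta> (r \<odot>\<^bsub>M\<^esub> x, y) \<ominus>\<^bsub>X\<^esub> r \<odot>\<^bsub>X\<^esub> \<beta> (x, y) \<in> Y"
      "\<And>r x y. r \<in> carrier R \<Longrightarrow> x \<in> carrier M \<Longrightarrow> y \<in> carrier N \<Longrightarrow>
        \<beta> (x, r \<odot>\<^bsub>N\<^esub> y) \<ominus>\<^bsub>X\<^esub> r \<odot>\<^bsub>X\<^esub> \<beta> (x, y) \<in> Y"
    and f: "f \<in> tensor_relations R M N"
  shows "finsupp_lin R (carrier M \<times> carrier N) X \<beta> f \<in> Y"
proof -
  interpret P: module R "tensor_free M N" by (rule tensor_free_module)
  interpret M: module R M by fact
  interpret N: module R N by fact
  let ?L = "finsupp_lin R (carrier M \<times> carrier N) X \<beta>"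
  have L: "?L \<in> module_hom R (tensor_free M N) X"
    unfolding tensor_free_def by (rule finsupp_lin_hom[OF X \<beta>])
  have Le: "?L (tensor_gen M N x y) = \<beta> (x, y)" if "x \<in> carrier M" "y \<in> carrier N" for x y
    unfolding tensor_gen_def by (rule finsupp_lin_single[OF X \<beta>]) (use that in auto)
  note e = tensor_gen_closed[of M N]
  have sub: "submodule R {f \<in> carrier (tensor_free M N). ?L f \<in> Y} (tensor_free M N)"
    by (rule module_hom_vimage[OF tensor_free_module X L Y])
  have add: "f \<ominus>\<^bsub>tensor_free M N\<^esub> (g \<oplus>\<^bsub>tensor_free M N\<^esub> h) \<in> {f \<in> carrier (tensor_free M N). ?L f \<in> Y}"
    if "f \<in> carrier (tensor_free M N)" "g \<in> carrier (tensor_free M N)" "h \<in> carrier (tensor_free M N)"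
      "?L f \<ominus>\<^bsub>X\<^esub> (?L g \<oplus>\<^bsub>X\<^esub> ?L h) \<in> Y" for f g h
    using that module_hom_minus[OF tensor_free_module X L that(1) P.M.a_closed[OF that(2,3)]]
      module_hom_add[OF L that(2,3)] by simp
  have smult: "f \<ominus>\<^bsub>tensor_free M N\<^esub> (r \<odot>\<^bsub>tensor_free M N\<^esub> g) \<in> {f \<in> carrier (tensor_free M N). ?L f \<in> Y}"
    if "f \<in> carrier (tensor_free M N)" "g \<in> carrier (tensor_free M N)" "r \<in> carrier R"
      "?L f \<ominus>\<^bsub>X\<^esub> r \<odot>\<^bsub>X\<^esub> ?L g \<in> Y" for f g r
    using that module_hom_minus[OF tensor_free_module X L that(1) P.smult_closed[OF that(3,2)]]
      module_hom_smult[OF L that(3,2)] by simp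
  have "bilinear_rels M N \<subseteq> {f \<in> carrier (tensor_free M N). ?L f \<in> Y}"
    unfolding bilinear_rels_def Let_def
  proof (intro Un_least subsetI)
    fix z assume "z \<in> {tensor_gen M N (x \<oplus>\<^bsub>M\<^esub> x') y \<ominus>\<^bsub>tensor_free M N\<^esub>
        (tensor_gen M N x y \<oplus>\<^bsub>tensor_free M N\<^esub> tensor_gen M N x' y) | x x' y.
        x \<in> carrier M \<and> x' \<in> carrier M \<and> y \<in> carrier N}"
    then obtain x x' y where "x \<in> carrier M" "x' \<in> carrier M" "y \<in> carrier N" and
      z: "z = tensor_gen M N (x \<oplus>\<^bsub>M\<^esub> x') y \<ominus>\<^bsub>tensor_free M N\<^esub>
        (tensor_gen M N x y \<oplus>\<^bsub>tensor_free M N\<^esub> tensor_gen M N x' y)" by blast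
    then show "z \<in> {f \<in> carrier (tensor_free M N). ?L f \<in> Y}"
      unfolding z using bil(1) by (intro add e) (simp add: Le)
  next
    fix z assume "z \<in> {tensor_gen M N x (y \<oplus>\<^bsub>N\<^esub> y') \<ominus>\<^bsub>tensor_free M N\<^esub>
        (tensor_gen M N x y \<oplus>\<^bsub>tensor_free M N\<^esub> tensor_gen M N x y') | x y y'.
        x \<in> carrier M \<and> y \<in> carrier N \<and> y' \<in> carrier N}"
    then obtain x y y' where "x \<in> carrier M" "y \<in> carrier N" "y' \<in> carrier N" and
      z: "z = tensor_gen M N x (y \<oplus>\<^bsub>N\<^esub> y') \<ominus>\<^bsub>tensor_free M N\<^esub>
        (tensor_gen M N x y \<oplus>\<^bsub>tensor_free M N\<^esub> tensor_gen M N x y')" by blast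
    then show "z \<in> {f \<in> carrier (tensor_free M N). ?L f \<in> Y}"
      unfolding z using bil(2) by (intro add e) (simp add: Le)
  next
    fix z assume "z \<in> {tensor_gen M N (r \<odot>\<^bsub>M\<^esub> x) y \<ominus>\<^bsub>tensor_free M N\<^esub>
        (r \<odot>\<^bsub>tensor_free M N\<^esub> tensor_gen M N x y) | r x y.
        r \<in> carrier R \<and> x \<in> carrier M \<and> y \<in> carrier N}"
    then obtain r x y where "r \<in> carrier R" "x \<in> carrier M" "y \<in> carrier N" and
      z: "z = tensor_gen M N (r \<odot>\<^bsub>M\<^esub> x) y \<ominus>\<^bsub>tensor_free M N\<^esub>
        (r \<odot>\<^bsub>tensor_free M N\<^esub> tensor_gen M N x y)" by blast
    then show "z \<in> {f \<in> carrier (tensor_free M N). ?L f \<in> Y}"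
      unfolding z using bil(3) by (intro smult e) (simp_all add: Le)
  next
    fix z assume "z \<in> {tensor_gen M N x (r \<odot>\<^bsub>N\<^esub> y) \<ominus>\<^bsub>tensor_free M N\<^esub>
        (r \<odot>\<^bsub>tensor_free M N\<^esub> tensor_gen M N x y) | r x y.
        r \<in> carrier R \<and> x \<in> carrier M \<and> y \<in> carrier N}"
    then obtain r x y where "r \<in> carrier R" "x \<in> carrier M" "y \<in> carrier N" and
      z: "z = tensor_gen M N x (r \<odot>\<^bsub>N\<^esub> y) \<ominus>\<^bsub>tensor_free M N\<^esub>
        (r \<odot>\<^bsub>tensor_free M N\<^esub> tensor_gen M N x y)" by blast
    then show "z \<in> {f \<in> carrier (tensor_free M N). ?L f \<in> Y}"
      unfolding z using bil(4) by (intro smult e) (simp_all add: Le)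
  qed
  then have "tensor_relations R M N \<subseteq> {f \<in> carrier (tensor_free M N). ?L f \<in> Y}"
    unfolding tensor_relations_eq by (rule P.span_is_subset[OF _ sub])
  then show ?thesis using f by blast
qed

text \<open>\<open>tensor_map\<close> takes a union over all representatives of a class. The linear
  extension of \<open>\<beta>\<close> kills the relations, hence is constant on the class, and the
  union collapses to one value.\<close>

lemma tensor_map_pure:
  assumes M: "module R M" and M': "module R M'" and N: "module R N" and \<phi>: "\<phi> \<in> module_hom R M M'"
    and x: "x \<in> carrier M" and y: "y \<in> carrier N"
  shows "tensor_map R M M' N \<phi> (pure_tensor R M N x y) = pure_tensor R M' N (\<phi> x) y"
proof -
  interpret P: module R "tensor_free M N" by (rule tensor_free_module)
  interpret M: module R M by fact
  interpret M': module R M' by fact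
  interpret N: module R N by fact
  interpret T: module R "tensor R M' N" by (rule tensor_module)
  define \<beta> where "\<beta> t = pure_tensor R M' N (\<phi> (fst t)) (snd t)" for t
  have \<beta>: "\<beta> t \<in> carrier (tensor R M' N)" for t unfolding \<beta>_def by (rule pure_tensor_closed)
  let ?L = "finsupp_lin R (carrier M \<times> carrier N) (tensor R M' N) \<beta>"
  have L: "?L \<in> module_hom R (tensor_free M N) (tensor R M' N)"
    unfolding tensor_free_def by (rule finsupp_lin_hom[OF tensor_module \<beta>])
  have zero: "submodule R {\<zero>\<^bsub>tensor R M' N\<^esub>} (tensor R M' N)"
    by unfold_locales auto
  note [simp] = module_hom_in[OF \<phi>] module_hom_add[OF \<phi>] module_hom_smult[OF \<phi>]
    pure_tensor_bilinear[of _ M' _ _ N] pure_tensor_closed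
  have vanish: "?L f = \<zero>\<^bsub>tensor R M' N\<^esub>" if f: "f \<in> tensor_relations R M N" for f
  proof -
    have "?L f \<in> {\<zero>\<^bsub>tensor R M' N\<^esub>}"
      by (rule tensor_relations_lin[OF tensor_module \<beta> M N zero _ _ _ _ f])
        (auto simp: \<beta>_def T.M.minus_eq T.M.r_neg
          pure_tensor_bilinear(1)[of _ M' _ _ N] pure_tensor_bilinear(2)[of _ M' _ N]
          pure_tensor_bilinear(3)[of _ _ M' _ N] pure_tensor_bilinear(4)[of _ _ M' _ N])
    then show ?thesis by simp
  qed
  note e = tensor_gen_closed[of M N x y]
  have Le: "?L (tensor_gen M N x y) = \<beta> (x, y)"
    unfolding tensor_gen_def using x y by (intro finsupp_lin_single[OF tensor_module \<beta>]) auto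
  have const: "?L f = \<beta> (x, y)" if f: "f \<in> pure_tensor R M N x y" for f
  proof -
    note fc = P.coset_mem[OF tensor_relations_sub e f[unfolded pure_tensor_eq]]
    have "?L f \<ominus>\<^bsub>tensor R M' N\<^esub> ?L (tensor_gen M N x y) = \<zero>\<^bsub>tensor R M' N\<^esub>"
      using vanish[OF fc(2)] module_hom_minus[OF tensor_free_module tensor_module L fc(1) e] by simp
    then have "?L f = ?L (tensor_gen M N x y)"
      using module_hom_in[OF L fc(1)] module_hom_in[OF L e] by simp
    then show ?thesis using Le by simp
  qed
  have "tensor_map R M M' N \<phi> (pure_tensor R M N x y) = (\<Union>f\<in>pure_tensor R M N x y. ?L f)"
    unfolding tensor_map_def finsupp_lin_def \<beta>_def ..
  also have "\<dots> = (\<Union>f\<in>pure_tensor R M N x y. \<beta> (x, y))" using const by (intro SUP_cong) auto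
  also have "\<dots> = \<beta> (x, y)"
    using P.coset_self[OF tensor_relations_sub e] unfolding pure_tensor_eq by auto
  finally show ?thesis by (simp add: \<beta>_def)
qed

end

section \<open>Tensoring with R/I as reduction modulo I\<close>

locale residue_tensor = R?: cring R + ideal I R for R (structure) and I
begin

lemma I_ideal: "ideal I R" by (rule ideal_axioms)

abbreviation "k \<equiv> residue_module R I"

definition "res r = I +> r"

lemma I_sub: "submodule R I (self_module R)" by (rule ideal_self_submodule[OF I_ideal])

interpretation S: module R "self_module R" by (rule self_module)

lemma k_module: "module R k"
  unfolding residue_module_def
  using S.quotient_is_module[OF submodule_carrier[OF self_module] I_sub] by simp

lemma k_carrier: "carrier k = res ` carrier R"
  by (simp add: residue_module_def quotient_module_simps res_def)

lemma res_closed: "r \<in> carrier R \<Longrightarrow> res r \<in> carrier k"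
  by (simp add: k_carrier)

lemma res_add: "r \<in> carrier R \<Longrightarrow> s \<in> carrier R \<Longrightarrow> res r \<oplus>\<^bsub>k\<^esub> res s = res (r \<oplus> s)"
  using S.quotient_add[OF I_sub, of r s] by (simp add: residue_module_def res_def)

lemma res_smult: "r \<in> carrier R \<Longrightarrow> s \<in> carrier R \<Longrightarrow> r \<odot>\<^bsub>k\<^esub> res s = res (r \<otimes> s)"
  using S.quotient_smult[OF I_sub, of s r] by (simp add: residue_module_def res_def)

lemma self_minus: "x \<in> carrier R \<Longrightarrow> y \<in> carrier R \<Longrightarrow> x \<ominus>\<^bsub>self_module R\<^esub> y = x \<ominus> y"
  by (simp add: a_minus_def self_a_inv)

lemma res_eq_iff: "r \<in> carrier R \<Longrightarrow> s \<in> carrier R \<Longrightarrow> res r = res s \<longleftrightarrow> r \<ominus> s \<in> I"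
  using S.coset_eq_iff[OF I_sub, of r s] by (simp add: res_def self_minus)

lemma k_zero: "\<zero>\<^bsub>k\<^esub> = I"
  by (simp add: residue_module_def quotient_module_simps)

lemma res_eq_zero: "r \<in> carrier R \<Longrightarrow> res r = \<zero>\<^bsub>k\<^esub> \<longleftrightarrow> r \<in> I"
  using S.coset_eq_B[OF I_sub, of r] by (simp add: res_def k_zero)

lemma k_cases:
  assumes "y \<in> carrier k" obtains r where "r \<in> carrier R" "y = res r"
  using assms by (auto simp: k_carrier)

text \<open>The map \<open>x \<mapsto> x \<otimes> 1\<close>. By \<open>mu_surj\<close> and
  \<open>mu_kernel\<close> it identifies \<open>M / I M\<close> with \<open>M \<otimes> R/I\<close>,
  so that Tor can be computed inside the free modules of a resolution.\<close>

definition mu :: "('a, 'c, 'm) module_scheme \<Rightarrow> 'c \<Rightarrow> ('c \<times> 'a set \<Rightarrow> 'a) set" where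
  "mu M x = pure_tensor R M k x (res \<one>)"

lemma mu_hom: "mu M \<in> module_hom R M (tensor R M k)"
  unfolding mu_def using res_closed[of \<one>]
  by (intro module_homI pure_tensor_closed pure_tensor_bilinear) auto

lemma pure_tensor_res:
  assumes M: "module R M" and x: "x \<in> carrier M" and r: "r \<in> carrier R"
  shows "pure_tensor R M k x (res r) = mu M (r \<odot>\<^bsub>M\<^esub> x)"
proof -
  have "pure_tensor R M k x (res r) = pure_tensor R M k x (r \<odot>\<^bsub>k\<^esub> res \<one>)" using r by (simp add: res_smult)
  also have "\<dots> = r \<odot>\<^bsub>tensor R M k\<^esub> mu M x"
    unfolding mu_def using r x res_closed[of \<one>] by (intro pure_tensor_bilinear) auto
  also have "\<dots> = mu M (r \<odot>\<^bsub>M\<^esub> x)" by (rule module_hom_smult[OF mu_hom r x, symmetric])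
  finally show ?thesis .
qed

lemma mu_surj:
  assumes M: "module R M"
  shows "mu M ` carrier M = carrier (tensor R M k)"
proof
  interpret M: module R M by fact
  show "mu M ` carrier M \<subseteq> carrier (tensor R M k)" using module_hom_in[OF mu_hom] by auto
  show "carrier (tensor R M k) \<subseteq> mu M ` carrier M"
  proof (rule tensor_generated)
    show "submodule R (mu M ` carrier M) (tensor R M k)"
      by (rule module_hom_image[OF M tensor_module mu_hom submodule_carrier[OF M]])
    fix x y assume x: "x \<in> carrier M" and "y \<in> carrier k"
    then obtain r where "r \<in> carrier R" "y = res r" by (elim k_cases)
    then show "pure_tensor R M k x y \<in> mu M ` carrier M" using pure_tensor_res[OF M x] x by auto
  qed
qed

text \<open>An element of \<open>I M\<close> dies because its scalars vanish in \<open>R/I\<close>.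
  Conversely, multiplying \<open>x\<close> by a chosen representative of \<open>y\<close> is
  bilinear in the pair modulo \<open>I M\<close>, so the value at \<open>x \<otimes> 1\<close>
  detects \<open>x\<close> modulo \<open>I M\<close>.\<close>

lemma mu_kernel:
  assumes M: "module R M" and x: "x \<in> carrier M"
  shows "mu M x = \<zero>\<^bsub>tensor R M k\<^esub> \<longleftrightarrow> x \<in> ideal_smult R I M (carrier M)"
proof
  interpret M: module R M by fact
  interpret T: module R "tensor R M k" by (rule tensor_module)
  have zero: "submodule R {\<zero>\<^bsub>tensor R M k\<^esub>} (tensor R M k)" by unfold_locales auto
  assume x': "x \<in> ideal_smult R I M (carrier M)"
  have "ideal_smult R I M (carrier M) \<subseteq> {x \<in> carrier M. mu M x \<in> {\<zero>\<^bsub>tensor R M k\<^esub>}}"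
  proof (rule M.ideal_smult_subset[OF module_hom_vimage[OF M tensor_module mu_hom zero]])
    fix r x assume r: "r \<in> I" and x: "x \<in> carrier M"
    have rc: "r \<in> carrier R" using Icarr[OF r] .
    have k0: "\<zero>\<^bsub>k\<^esub> = res \<zero>" using res_eq_zero[of \<zero>] by simp
    have "mu M (r \<odot>\<^bsub>M\<^esub> x) = pure_tensor R M k x (res r)" using pure_tensor_res[OF M x rc] by simp
    also have "res r = res \<zero>" using res_eq_zero[OF rc] r k0 by simp
    also have "pure_tensor R M k x (res \<zero>) = \<zero>\<^bsub>tensor R M k\<^esub>"
      using pure_tensor_res[OF M x R.zero_closed] x module_hom_zero[OF M tensor_module mu_hom] by simp
    finally show "r \<odot>\<^bsub>M\<^esub> x \<in> {x \<in> carrier M. mu M x \<in> {\<zero>\<^bsub>tensor R M k\<^esub>}}" using rc x by simp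
  qed
  then show "mu M x = \<zero>\<^bsub>tensor R M k\<^esub>" using x' by blast
next
  interpret M: module R M by fact
  interpret k: module R k by (rule k_module)
  let ?Y = "ideal_smult R I M (carrier M)"
  have Y: "submodule R ?Y M" by (rule M.ideal_smult_submodule[OF I_ideal]) simp
  define rep where "rep y = (SOME r. r \<in> carrier R \<and> y = res r)" for y
  have rep: "rep y \<in> carrier R \<and> y = res (rep y)" if y: "y \<in> carrier k" for y
  proof -
    obtain r where "r \<in> carrier R" "y = res r" using y by (elim k_cases)
    then show ?thesis unfolding rep_def by (intro someI[of "\<lambda>r. r \<in> carrier R \<and> y = res r" r]) simp
  qed
  define \<beta> where "\<beta> t = rep (snd t) \<odot>\<^bsub>M\<^esub> fst t" for t
  have \<beta>: "\<beta> t \<in> carrier M" if "t \<in> carrier M \<times> carrier k" for t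
    using that rep by (auto simp: \<beta>_def)
  have inY: "c \<odot>\<^bsub>M\<^esub> x \<ominus>\<^bsub>M\<^esub> e \<odot>\<^bsub>M\<^esub> x \<in> ?Y" if "c \<in> carrier R" "e \<in> carrier R" "res c = res e" "x \<in> carrier M" for c e x
  proof -
    have "c \<odot>\<^bsub>M\<^esub> x \<ominus>\<^bsub>M\<^esub> e \<odot>\<^bsub>M\<^esub> x = (c \<ominus> e) \<odot>\<^bsub>M\<^esub> x"
      using that by (simp add: minus_eq M.M.minus_eq M.smult_l_distr M.smult_l_minus)
    then show ?thesis using that res_eq_iff[of c e] M.ideal_smultI[OF I_ideal order_refl] by simp
  qed
  have zeroY: "z \<ominus>\<^bsub>M\<^esub> z \<in> ?Y" if "z \<in> carrier M" for z
    using that submodule_zero[OF Y] by (simp add: M.M.minus_eq M.M.r_neg)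
  have rel: "finsupp_lin R (carrier M \<times> carrier k) M \<beta> f \<in> ?Y" if f: "f \<in> tensor_relations R M k" for f
  proof (rule tensor_relations_lin[OF M \<beta> M k_module Y _ _ _ _ f])
    fix x x' y assume *: "x \<in> carrier M" "x' \<in> carrier M" "y \<in> carrier k"
    then have "\<beta> (x \<oplus>\<^bsub>M\<^esub> x', y) = \<beta> (x, y) \<oplus>\<^bsub>M\<^esub> \<beta> (x', y)" using rep by (simp add: \<beta>_def M.smult_r_distr)
    then show "\<beta> (x \<oplus>\<^bsub>M\<^esub> x', y) \<ominus>\<^bsub>M\<^esub> (\<beta> (x, y) \<oplus>\<^bsub>M\<^esub> \<beta> (x', y)) \<in> ?Y"
      using zeroY \<beta>[of "(x, y)"] \<beta>[of "(x', y)"] * by simp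
  next
    fix x y y' assume *: "x \<in> carrier M" "y \<in> carrier k" "y' \<in> carrier k"
    have "\<beta> (x, y) \<oplus>\<^bsub>M\<^esub> \<beta> (x, y') = (rep y \<oplus> rep y') \<odot>\<^bsub>M\<^esub> x"
      using * rep by (simp add: \<beta>_def M.smult_l_distr)
    moreover have "res (rep (y \<oplus>\<^bsub>k\<^esub> y')) = res (rep y \<oplus> rep y')"
      using rep[OF *(2)] rep[OF *(3)] rep[OF k.M.a_closed[OF *(2,3)]] res_add by metis
    ultimately show "\<beta> (x, y \<oplus>\<^bsub>k\<^esub> y') \<ominus>\<^bsub>M\<^esub> (\<beta> (x, y) \<oplus>\<^bsub>M\<^esub> \<beta> (x, y')) \<in> ?Y"
      using inY * rep k.M.a_closed[OF *(2,3)] by (simp add: \<beta>_def)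
  next
    fix r x y assume *: "r \<in> carrier R" "x \<in> carrier M" "y \<in> carrier k"
    then have "\<beta> (r \<odot>\<^bsub>M\<^esub> x, y) = r \<odot>\<^bsub>M\<^esub> \<beta> (x, y)"
      using rep by (simp add: \<beta>_def M.smult_assoc1[symmetric] m_comm)
    then show "\<beta> (r \<odot>\<^bsub>M\<^esub> x, y) \<ominus>\<^bsub>M\<^esub> r \<odot>\<^bsub>M\<^esub> \<beta> (x, y) \<in> ?Y"
      using zeroY \<beta>[of "(x, y)"] * by simp
  next
    fix r x y assume *: "r \<in> carrier R" "x \<in> carrier M" "y \<in> carrier k"
    have "r \<odot>\<^bsub>M\<^esub> \<beta> (x, y) = (r \<otimes> rep y) \<odot>\<^bsub>M\<^esub> x"
      using * rep by (simp add: \<beta>_def M.smult_assoc1)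
    moreover have "res (rep (r \<odot>\<^bsub>k\<^esub> y)) = res (r \<otimes> rep y)"
      using rep[OF *(3)] rep[OF k.smult_closed[OF *(1,3)]] res_smult[OF *(1)] by metis
    ultimately show "\<beta> (x, r \<odot>\<^bsub>k\<^esub> y) \<ominus>\<^bsub>M\<^esub> r \<odot>\<^bsub>M\<^esub> \<beta> (x, y) \<in> ?Y"
      using inY * rep k.smult_closed[OF *(1,3)] by (simp add: \<beta>_def)
  qed
  assume "mu M x = \<zero>\<^bsub>tensor R M k\<^esub>"
  then have "tensor_relations R M k +>\<^bsub>tensor_free M k\<^esub> tensor_gen M k x (res \<one>) = tensor_relations R M k"
    unfolding mu_def pure_tensor_eq by (simp add: tensor_eq quotient_module_simps)
  then have "tensor_gen M k x (res \<one>) \<in> tensor_relations R M k"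
    by (rule iffD1[OF module.coset_eq_B[OF tensor_free_module tensor_relations_sub tensor_gen_closed]])
  from rel[OF this] have "\<beta> (x, res \<one>) \<in> ?Y"
    unfolding tensor_gen_def using finsupp_lin_single[where t = "(x, res \<one>)", OF M \<beta>] x res_closed[of \<one>] by simp
  then have 1: "rep (res \<one>) \<odot>\<^bsub>M\<^esub> x \<in> ?Y" by (simp add: \<beta>_def)
  have "\<one> \<odot>\<^bsub>M\<^esub> x \<ominus>\<^bsub>M\<^esub> rep (res \<one>) \<odot>\<^bsub>M\<^esub> x \<in> ?Y"
    using rep[OF res_closed[of \<one>]] x by (intro inY) auto
  then show "x \<in> ?Y" using submodule_minusD[OF Y x 1] x by simp
qed

end

section \<open>Dimensions over the residue field\<close>

lemma (in abelian_group) add_minus_right: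
  assumes "x \<in> carrier G" "z \<in> carrier G"
  shows "x \<oplus> (z \<ominus> x) = z"
  unfolding minus_eq using assms by (subst a_lcomm) (simp_all add: r_neg)

locale residue_field = R?: cring R + maximalideal I R for R (structure) and I
begin

sublocale residue_tensor R I by unfold_locales

context
  fixes V :: "('a, 'c, 'm) module_scheme"
  assumes V: "module R V" and kill: "\<And>r v. r \<in> I \<Longrightarrow> v \<in> carrier V \<Longrightarrow> r \<odot>\<^bsub>V\<^esub> v = \<zero>\<^bsub>V\<^esub>"
begin

interpretation V: module R V by (rule V)

lemma residue_space_simps:
  "carrier (residue_space V) = carrier V" "zero (residue_space V) = zero V" "add (residue_space V) = add V"
  by (simp_all add: residue_space_def)

lemma residue_space_smult:
  assumes r: "r \<in> carrier R" and v: "v \<in> carrier V"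
  shows "(I +> r) \<odot>\<^bsub>residue_space V\<^esub> v = r \<odot>\<^bsub>V\<^esub> v"
proof -
  have "s \<odot>\<^bsub>V\<^esub> v = r \<odot>\<^bsub>V\<^esub> v" if s: "s \<in> I +> r" for s
  proof -
    obtain h where h: "h \<in> I" "s = h \<oplus> r" using s by (auto simp: a_r_coset_def')
    then show ?thesis using r v kill[OF h(1) v] Icarr[OF h(1)] by (simp add: V.smult_l_distr)
  qed
  moreover have "r \<in> I +> r"
  proof -
    have "\<zero> \<oplus> r \<in> I +> r"
      unfolding a_r_coset_def' by (rule UN_I[OF additive_subgroup.zero_closed[OF is_additive_subgroup]]) simp
    then show ?thesis using r by simp
  qed
  ultimately have "(\<lambda>s. s \<odot>\<^bsub>V\<^esub> v) ` (I +> r) = {r \<odot>\<^bsub>V\<^esub> v}" by blast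
  then show ?thesis by (simp add: residue_space_def)
qed

lemma quot_carrierE:
  assumes "c \<in> carrier (R Quot I)" obtains r where "r \<in> carrier R" "c = I +> r"
  using assms by (auto simp: FactRing_def A_RCOSETS_def')

lemma quot_carrierI: "r \<in> carrier R \<Longrightarrow> I +> r \<in> carrier (R Quot I)"
  by (auto simp: FactRing_def A_RCOSETS_def')

lemma residue_vectorspace: "vectorspace (R Quot I) (residue_space V)"
proof -
  have hom: "(+>) I \<in> ring_hom R (R Quot I)" by (rule rcos_ring_hom)
  have field: "field (R Quot I)" using quotient_is_field is_cring by simp
  have "module (R Quot I) (residue_space V)"
  proof (rule moduleI)
    show "cring (R Quot I)" using field by (simp add: field_def domain_def)
    show "abelian_group (residue_space V)"
    proof (rule abelian_groupI, unfold residue_space_simps)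
      show "\<exists>y\<in>carrier V. y \<oplus>\<^bsub>V\<^esub> x = \<zero>\<^bsub>V\<^esub>" if "x \<in> carrier V" for x
        using V.M.l_neg[OF that] that by (intro bexI[of _ "\<ominus>\<^bsub>V\<^esub> x"]) auto
    qed (auto simp: V.M.a_ac)
  next
    fix c v assume "c \<in> carrier (R Quot I)" and v: "v \<in> carrier (residue_space V)"
    then obtain r where r: "r \<in> carrier R" "c = I +> r" by (elim quot_carrierE)
    show "c \<odot>\<^bsub>residue_space V\<^esub> v \<in> carrier (residue_space V)"
      using r v by (simp add: residue_space_simps residue_space_smult)
    fix d assume "d \<in> carrier (R Quot I)"
    then obtain s where s: "s \<in> carrier R" "d = I +> s" by (elim quot_carrierE)
    have "c \<oplus>\<^bsub>R Quot I\<^esub> d = I +> (r \<oplus> s)" "c \<otimes>\<^bsub>R Quot I\<^esub> d = I +> (r \<otimes> s)"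
      using ring_hom_add[OF hom r(1) s(1)] ring_hom_mult[OF hom r(1) s(1)] r s by simp_all
    then show "(c \<oplus>\<^bsub>R Quot I\<^esub> d) \<odot>\<^bsub>residue_space V\<^esub> v
        = c \<odot>\<^bsub>residue_space V\<^esub> v \<oplus>\<^bsub>residue_space V\<^esub> d \<odot>\<^bsub>residue_space V\<^esub> v"
      "(c \<otimes>\<^bsub>R Quot I\<^esub> d) \<odot>\<^bsub>residue_space V\<^esub> v = c \<odot>\<^bsub>residue_space V\<^esub> (d \<odot>\<^bsub>residue_space V\<^esub> v)"
      using r s v by (simp_all add: residue_space_simps residue_space_smult V.smult_l_distr V.smult_assoc1)
  next
    fix c v w assume "c \<in> carrier (R Quot I)" and v: "v \<in> carrier (residue_space V)" "w \<in> carrier (residue_space V)"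
    then obtain r where r: "r \<in> carrier R" "c = I +> r" by (elim quot_carrierE)
    then show "c \<odot>\<^bsub>residue_space V\<^esub> (v \<oplus>\<^bsub>residue_space V\<^esub> w)
        = c \<odot>\<^bsub>residue_space V\<^esub> v \<oplus>\<^bsub>residue_space V\<^esub> c \<odot>\<^bsub>residue_space V\<^esub> w"
      using v by (simp add: residue_space_simps residue_space_smult V.smult_r_distr)
  next
    fix v assume v: "v \<in> carrier (residue_space V)"
    have "\<one>\<^bsub>R Quot I\<^esub> = I +> \<one>" using ring_hom_one[OF hom] by simp
    then show "\<one>\<^bsub>R Quot I\<^esub> \<odot>\<^bsub>residue_space V\<^esub> v = v"
      using v residue_space_smult[of \<one> v] by (simp add: residue_space_simps)
  qed
  then show ?thesis using field by (simp add: vectorspace_def)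
qed

text \<open>Each scalar of \<open>R Quot I\<close> is the coset of a scalar of \<open>R\<close> that
  acts in the same way, so both rings have the same submodules.\<close>

lemma residue_span:
  assumes A: "A \<subseteq> carrier V"
  shows "module.span (R Quot I) (residue_space V) A = V.span A"
proof -
  interpret K: vectorspace "R Quot I" "residue_space V" by (rule residue_vectorspace)
  have A': "A \<subseteq> carrier (residue_space V)" using A by (simp add: residue_space_simps)
  have Ks: "submodule (R Quot I) (K.span A) (residue_space V)" by (rule K.span_is_submodule[OF A'])
  have "submodule R (K.span A) V"
  proof
    show "K.span A \<subseteq> carrier V" using submodule_in[OF Ks] by (auto simp: residue_space_simps)
    show "\<zero>\<^bsub>V\<^esub> \<in> K.span A" using submodule_zero[OF Ks] by (simp add: residue_space_simps)
    show "v \<oplus>\<^bsub>V\<^esub> w \<in> K.span A" if "v \<in> K.span A" "w \<in> K.span A" for v w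
      using submodule_add[OF Ks that] by (simp add: residue_space_simps)
    show "r \<odot>\<^bsub>V\<^esub> v \<in> K.span A" if "r \<in> carrier R" "v \<in> K.span A" for r v
      using submodule_smult[OF Ks quot_carrierI[OF that(1)] that(2)] submodule_in[OF Ks that(2)] that(1)
      by (simp add: residue_space_simps residue_space_smult)
  qed
  then have 1: "V.span A \<subseteq> K.span A" using K.in_own_span[OF A'] by (intro V.span_is_subset)
  have Vs: "submodule R (V.span A) V" by (rule V.span_is_submodule[OF A])
  have "submodule (R Quot I) (V.span A) (residue_space V)"
  proof
    show "V.span A \<subseteq> carrier (residue_space V)" using submodule_in[OF Vs] by (auto simp: residue_space_simps)
    show "\<zero>\<^bsub>residue_space V\<^esub> \<in> V.span A" using submodule_zero[OF Vs] by (simp add: residue_space_simps)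
    show "v \<oplus>\<^bsub>residue_space V\<^esub> w \<in> V.span A" if "v \<in> V.span A" "w \<in> V.span A" for v w
      using submodule_add[OF Vs that] by (simp add: residue_space_simps)
    fix c v assume "c \<in> carrier (R Quot I)" and v: "v \<in> V.span A"
    then obtain r where "r \<in> carrier R" "c = I +> r" by (elim quot_carrierE)
    then show "c \<odot>\<^bsub>residue_space V\<^esub> v \<in> V.span A"
      using submodule_smult[OF Vs _ v] submodule_in[OF Vs v] by (simp add: residue_space_smult)
  qed
  then have "K.span A \<subseteq> V.span A" using V.in_own_span[OF A] by (intro K.span_is_subset)
  with 1 show ?thesis by blast
qed

text \<open>\<open>dim\<close> is the least size of a finite spanning set, so equality of spans
  carries it over to spans over \<open>R\<close>; bases and linear independence never occur.\<close>

lemma residue_dim_eq: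
  "residue_dim R I V = (LEAST n. \<exists>A. finite A \<and> card A = n \<and> A \<subseteq> carrier V \<and> V.span A = carrier V)"
proof -
  interpret K: vectorspace "R Quot I" "residue_space V" by (rule residue_vectorspace)
  have "(\<exists>A. finite A \<and> card A = n \<and> A \<subseteq> carrier (residue_space V) \<and> K.span A = carrier (residue_space V))
    \<longleftrightarrow> (\<exists>A. finite A \<and> card A = n \<and> A \<subseteq> carrier V \<and> V.span A = carrier V)" for n
    unfolding residue_space_simps using residue_span by auto
  then show ?thesis unfolding residue_dim_def K.dim_def by simp
qed

end

text \<open>\<open>V\<close> is the quotient of \<open>Z\<close> by \<open>B\<close>, given through
  \<open>h\<close>. Spanning sets of \<open>V\<close> correspond to subsets of \<open>Z\<close> that
  span it modulo \<open>B\<close>: images of \<open>A\<close> give the upper bound, lifts of a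
  smallest spanning set give the second claim. The set \<open>A\<close> ensures that a finite
  spanning set exists at all.\<close>

lemma residue_dim_image:
  assumes X: "module R X" and Z: "submodule R Z X" and B: "submodule R B X"
    and im: "h ` Z = carrier V"
    and add: "\<And>x y. x \<in> Z \<Longrightarrow> y \<in> Z \<Longrightarrow> h (x \<oplus>\<^bsub>X\<^esub> y) = h x \<oplus>\<^bsub>V\<^esub> h y"
    and smult: "\<And>r x. r \<in> carrier R \<Longrightarrow> x \<in> Z \<Longrightarrow> h (r \<odot>\<^bsub>X\<^esub> x) = r \<odot>\<^bsub>V\<^esub> h x"
    and ker: "\<And>x. x \<in> Z \<Longrightarrow> h x = \<zero>\<^bsub>V\<^esub> \<longleftrightarrow> x \<in> B"
    and IB: "\<And>r x. r \<in> I \<Longrightarrow> x \<in> Z \<Longrightarrow> r \<odot>\<^bsub>X\<^esub> x \<in> B"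
    and A: "finite A" "A \<subseteq> Z" "Z \<subseteq> module.span R X A <+>\<^bsub>X\<^esub> B"
  shows "residue_dim R I V \<le> card A"
    and "\<exists>A'. finite A' \<and> card A' = residue_dim R I V \<and> A' \<subseteq> Z \<and> Z \<subseteq> module.span R X A' <+>\<^bsub>X\<^esub> B"
proof -
  interpret X: module R X by fact
  let ?Z = "X\<lparr>carrier := Z\<rparr>"
  have ZM: "module R ?Z" by (rule X.submodule_is_module[OF Z])
  have "module R V"
  proof (rule image_module[OF ZM, of h])
    show "h \<zero>\<^bsub>?Z\<^esub> = \<zero>\<^bsub>V\<^esub>" using ker[OF submodule_zero[OF Z]] submodule_zero[OF B] by simp
  qed (use im add smult in auto)
  then interpret V: module R V .
  have hom: "h \<in> module_hom R ?Z V" using im add smult by (intro module_homI) auto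
  have kill: "r \<odot>\<^bsub>V\<^esub> v = \<zero>\<^bsub>V\<^esub>" if r: "r \<in> I" and v: "v \<in> carrier V" for r v
  proof -
    obtain z where z: "z \<in> Z" "v = h z" using v im by auto
    have rc: "r \<in> carrier R" using Icarr[OF r] .
    show ?thesis using smult[OF rc z(1)] ker[OF submodule_smult[OF Z rc z(1)]] IB[OF r z(1)] z(2) by simp
  qed
  note dim = residue_dim_eq[OF V.module_axioms kill]
  let ?P = "\<lambda>n. \<exists>A. finite A \<and> card A = n \<and> A \<subseteq> carrier V \<and> V.span A = carrier V"
  have Zc: "z \<in> carrier X" if "z \<in> Z" for z using submodule_in[OF Z that] .
  have span_im: "h z \<in> V.span (h ` A')" if A': "A' \<subseteq> Z" and z: "z \<in> X.span A'" for A' z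
  proof -
    have c: "h ` A' \<subseteq> carrier V" using A' im by auto
    have "submodule R {x \<in> Z. h x \<in> V.span (h ` A')} ?Z"
      using module_hom_vimage[OF ZM V.module_axioms hom V.span_is_submodule[OF c]] by simp
    then have "module.span R ?Z A' \<subseteq> {x \<in> Z. h x \<in> V.span (h ` A')}"
      using A' V.in_own_span[OF c] by (intro module.span_is_subset[OF ZM]) auto
    then show ?thesis using z X.span_li_not_depend(1)[OF A' Z] by auto
  qed
  have Zin: "module.span R X A' \<subseteq> Z" if "A' \<subseteq> Z" for A' by (rule X.span_is_subset[OF that Z])
  have hA: "h ` A \<subseteq> carrier V" using A(2) im by auto
  have "carrier V \<subseteq> V.span (h ` A)"
  proof
    fix v assume "v \<in> carrier V"
    then obtain z where z: "z \<in> Z" "v = h z" using im by auto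
    then obtain x y where x: "x \<in> X.span A" and y: "y \<in> B" and zxy: "z = x \<oplus>\<^bsub>X\<^esub> y"
      using A(3) by (meson in_sumE subsetD)
    have xZ: "x \<in> Z" using Zin[OF A(2)] x by auto
    have "y = z \<ominus>\<^bsub>X\<^esub> x" using zxy X.M.add_minus_left[OF Zc[OF xZ] submodule_in[OF B y]] by simp
    then have yZ: "y \<in> Z" using submodule_minus[OF Z z(1) xZ] by simp
    have "h x \<in> carrier V" using im xZ by auto
    then have "v = h x" unfolding z(2) zxy using add[OF xZ yZ] ker[OF yZ] y by simp
    then show "v \<in> V.span (h ` A)" using span_im[OF A(2) x] by simp
  qed
  then have gen: "V.span (h ` A) = carrier V" using V.span_is_subset2[OF hA] by blast
  then have P: "?P (card (h ` A))" using A(1) hA by blast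
  have dimP: "residue_dim R I V = (LEAST n. ?P n)" using dim by simp
  have "residue_dim R I V \<le> card (h ` A)" using Least_le[of ?P, OF P] dimP by simp
  then show "residue_dim R I V \<le> card A" using card_image_le[OF A(1), of h] by simp
  have "?P (LEAST n. ?P n)" by (rule LeastI[of ?P, OF P])
  then obtain W where W: "finite W" "card W = residue_dim R I V" "W \<subseteq> carrier V" "V.span W = carrier V"
    unfolding dimP[symmetric] by auto
  have "\<forall>w\<in>W. \<exists>z. z \<in> Z \<and> h z = w" using W(3) im by force
  from bchoice[OF this] obtain g where g: "\<And>w. w \<in> W \<Longrightarrow> g w \<in> Z \<and> h (g w) = w" by auto
  have "inj_on g W" using g by (metis inj_onI)
  then have card: "card (g ` W) = residue_dim R I V" using W(2) card_image by metis
  have gZ: "g ` W \<subseteq> Z" using g by auto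
  have hg: "h ` g ` W = W" using g by force
  have "Z \<subseteq> X.span (g ` W) <+>\<^bsub>X\<^esub> B"
  proof
    fix z assume z: "z \<in> Z"
    have gX: "g ` W \<subseteq> carrier X" using gZ Zc by blast
    have Ssub: "submodule R (X.span (g ` W)) ?Z"
      by (rule X.submodule_restrict[OF Z X.span_is_submodule[OF gX] Zin[OF gZ]])
    have "submodule R (h ` X.span (g ` W)) V" by (rule module_hom_image[OF ZM V.module_axioms hom Ssub])
    moreover have "W \<subseteq> h ` X.span (g ` W)" using hg X.in_own_span[OF gX] by blast
    ultimately have "carrier V \<subseteq> h ` X.span (g ` W)" using W(4) V.span_is_subset by blast
    then obtain x where x: "x \<in> X.span (g ` W)" "h z = h x" using im z by blast
    have xZ: "x \<in> Z" using Zin[OF gZ] x by auto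
    have zx: "z \<ominus>\<^bsub>X\<^esub> x \<in> Z" by (rule submodule_minus[OF Z z xZ])
    have "h (z \<ominus>\<^bsub>X\<^esub> x) \<oplus>\<^bsub>V\<^esub> h x = h z"
      using add[OF zx xZ] Zc[OF z] Zc[OF xZ] by (simp add: X.M.minus_eq X.M.a_assoc X.M.l_neg)
    then have "h (z \<ominus>\<^bsub>X\<^esub> x) = \<zero>\<^bsub>V\<^esub>"
      using x(2) im zx xZ z by (metis V.M.add.r_cancel_one' V.M.add.l_cancel_one image_eqI)
    then have "z \<ominus>\<^bsub>X\<^esub> x \<in> B" using ker[OF zx] by simp
    moreover have "z = x \<oplus>\<^bsub>X\<^esub> (z \<ominus>\<^bsub>X\<^esub> x)"
      using Zc[OF z] Zc[OF xZ] by (simp add: X.M.add_minus_right)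
    ultimately show "z \<in> X.span (g ` W) <+>\<^bsub>X\<^esub> B" unfolding set_add_def' using x(1) by blast
  qed
  then show "\<exists>A'. finite A' \<and> card A' = residue_dim R I V \<and> A' \<subseteq> Z \<and> Z \<subseteq> module.span R X A' <+>\<^bsub>X\<^esub> B"
    using W(1) card gZ by blast
qed

end

section \<open>Betti numbers from arbitrary free resolutions\<close>

locale free_res_field = free_res S M C \<epsilon> b + residue_field S I
  for S :: "('a, 'r) ring_scheme" (structure) and M :: "('a, 'b, 'm) module_scheme" and C \<epsilon> b I
begin

abbreviation "Tc \<equiv> tensor_complex S C k"
abbreviation "Z n \<equiv> tor_cycles S I C n"
abbreviation "B n \<equiv> tor_bounds S I C n"

lemma tc_simps: "obj Tc n = tensor S (obj C n) k"
  "differential Tc n = tensor_map S (obj C n) (obj C (n - 1)) k (d n)"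
  by (simp_all add: tensor_complex_def)

lemma tc_module: "module S (obj Tc n)" unfolding tc_simps by (rule tensor_module)

lemma mu_hom': "mu (obj C n) \<in> module_hom S (obj C n) (obj Tc n)"
  unfolding tc_simps by (rule mu_hom)

lemma mu_ker': "x \<in> carrier (obj C n) \<Longrightarrow> mu (obj C n) x = \<zero>\<^bsub>obj Tc n\<^esub> \<longleftrightarrow> x \<in> ideal_part S I C n"
  unfolding tc_simps ideal_part_def by (rule mu_kernel[OF obj_module])

lemma tc_carrier: "carrier (obj Tc n) = mu (obj C n) ` carrier (obj C n)"
  unfolding tc_simps by (rule mu_surj[OF obj_module, symmetric])

lemma tc_diff:
  assumes "x \<in> carrier (obj C (Suc n))"
  shows "differential Tc (Suc n) (mu (obj C (Suc n)) x) = mu (obj C n) (d (Suc n) x)"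
  unfolding tc_simps mu_def
  using tensor_map_pure[OF obj_module obj_module k_module d_hom assms res_closed[of \<one>]] by simp

lemma tc_boundaries: "boundaries Tc n = mu (obj C n) ` boundaries C n"
  unfolding boundaries_def tc_carrier image_image using tc_diff by (intro image_cong) auto

text \<open>\<open>x \<otimes> 1\<close> is a cycle when \<open>d x \<otimes> 1\<close> is zero,
  that is, by \<open>mu_kernel\<close>, when \<open>d x\<close> lies in \<open>ideal_part\<close>;
  this is the condition that defines \<open>Z n\<close>.\<close>

lemma tc_cycles: "cycles Tc n = mu (obj C n) ` Z n"
proof (cases n)
  case 0
  then show ?thesis by (simp add: cycles_def tor_cycles_def tc_carrier)
next
  case (Suc m)
  have "mu (obj C (Suc m)) x \<in> cycles Tc (Suc m) \<longleftrightarrow> x \<in> Z (Suc m)" if "x \<in> carrier (obj C (Suc m))" for x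
    using that tc_diff[OF that] mu_ker'[OF module_hom_in[OF d_hom that]] module_hom_in[OF mu_hom' that]
    by (simp add: cycles_def tor_cycles_def)
  moreover have "cycles Tc (Suc m) \<subseteq> mu (obj C (Suc m)) ` carrier (obj C (Suc m))"
    unfolding tc_carrier[symmetric] by (auto simp: cycles_def)
  moreover have "Z (Suc m) \<subseteq> carrier (obj C (Suc m))" by (auto simp: tor_cycles_def)
  ultimately show ?thesis unfolding Suc by blast
qed

text \<open>For \<open>x\<close> in \<open>Z n\<close> this is the class of
  \<open>x \<otimes> 1\<close> in Tor. By \<open>nu_ker\<close> and \<open>homology_eq\<close> it
  presents Tor as \<open>Z n\<close> modulo \<open>B n\<close>, both of which are submodules of the
  free module.\<close>

definition nu :: "nat \<Rightarrow> (nat \<Rightarrow> 'a) \<Rightarrow> ((nat \<Rightarrow> 'a) \<times> 'a set \<Rightarrow> 'a) set set" where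
  "nu n x = boundaries Tc n +>\<^bsub>obj Tc n\<^esub> mu (obj C n) x"

lemma tc_bound_sub: "submodule S (boundaries Tc n) (obj Tc n)"
  unfolding tc_boundaries by (rule module_hom_image[OF obj_module tc_module mu_hom' bound_sub])

lemma nu_add:
  assumes "x \<in> carrier (obj C n)" "y \<in> carrier (obj C n)"
  shows "nu n (x \<oplus>\<^bsub>obj C n\<^esub> y) = nu n x \<oplus>\<^bsub>homology Tc n\<^esub> nu n y"
  unfolding nu_def homology_def module_hom_add[OF mu_hom' assms]
  using module.quotient_add[OF tc_module tc_bound_sub] module_hom_in[OF mu_hom'] assms by auto

lemma nu_smult:
  assumes "r \<in> carrier S" "x \<in> carrier (obj C n)"
  shows "nu n (r \<odot>\<^bsub>obj C n\<^esub> x) = r \<odot>\<^bsub>homology Tc n\<^esub> nu n x"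
  unfolding nu_def homology_def module_hom_smult[OF mu_hom' assms]
  using module.quotient_smult[OF tc_module tc_bound_sub] module_hom_in[OF mu_hom'] assms by auto

lemma nu_ker:
  assumes x: "x \<in> carrier (obj C n)"
  shows "nu n x = \<zero>\<^bsub>homology Tc n\<^esub> \<longleftrightarrow> x \<in> B n"
proof -
  interpret X: module S "obj C n" by (rule obj_module)
  interpret T: module S "obj Tc n" by (rule tc_module)
  have "nu n x = \<zero>\<^bsub>homology Tc n\<^esub> \<longleftrightarrow> mu (obj C n) x \<in> mu (obj C n) ` boundaries C n"
    using T.coset_eq_B[OF tc_bound_sub module_hom_in[OF mu_hom' x]]
    by (simp add: nu_def homology_def quotient_module_simps tc_boundaries)
  also have "\<dots> \<longleftrightarrow> x \<in> B n"
  proof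
    assume "mu (obj C n) x \<in> mu (obj C n) ` boundaries C n"
    then obtain y where y: "y \<in> boundaries C n" "mu (obj C n) x = mu (obj C n) y" by auto
    have yc: "y \<in> carrier (obj C n)" using bound_in[OF y(1)] .
    have "mu (obj C n) (x \<ominus>\<^bsub>obj C n\<^esub> y) = \<zero>\<^bsub>obj Tc n\<^esub>"
      using module_hom_minus[OF obj_module tc_module mu_hom' x yc] y(2) module_hom_in[OF mu_hom' yc] by simp
    then have "x \<ominus>\<^bsub>obj C n\<^esub> y \<in> ideal_part S I C n" using mu_ker'[of "x \<ominus>\<^bsub>obj C n\<^esub> y" n] x yc by simp
    moreover have "x = y \<oplus>\<^bsub>obj C n\<^esub> (x \<ominus>\<^bsub>obj C n\<^esub> y)"
      using x yc by (simp add: X.M.add_minus_right)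
    ultimately show "x \<in> B n" unfolding tor_bounds_def set_add_def' using y(1) by blast
  next
    assume "x \<in> B n"
    then obtain y z where y: "y \<in> boundaries C n" and z: "z \<in> ideal_part S I C n" and xx: "x = y \<oplus>\<^bsub>obj C n\<^esub> z"
      unfolding tor_bounds_def by (rule in_sumE)
    have zc: "z \<in> carrier (obj C n)" using submodule_in[OF ideal_part_sub[OF I_ideal] z] .
    have "mu (obj C n) x = mu (obj C n) y"
      unfolding xx module_hom_add[OF mu_hom' bound_in[OF y] zc]
      using mu_ker'[OF zc] z module_hom_in[OF mu_hom' bound_in[OF y]] by simp
    then show "mu (obj C n) x \<in> mu (obj C n) ` boundaries C n" using y by auto
  qed
  finally show ?thesis .
qed

text \<open>\<open>Y\<close> is the module of all cycles in the case of Betti numbers, and the part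
  \<open>Zg n j\<close> of degree \<open>j\<close> in the case of graded Betti numbers.\<close>

lemma tor_dim:
  assumes Y: "submodule S Y (obj C n)" and V: "V = (homology Tc n)\<lparr>carrier := nu n ` Y\<rparr>"
    and A: "finite A" "A \<subseteq> Y" "Y \<subseteq> module.span S (obj C n) A <+>\<^bsub>obj C n\<^esub> B n"
  shows "residue_dim S I V \<le> card A"
    and "\<exists>A'. finite A' \<and> card A' = residue_dim S I V \<and> A' \<subseteq> Y \<and>
      Y \<subseteq> module.span S (obj C n) A' <+>\<^bsub>obj C n\<^esub> B n"
proof -
  have Yc: "x \<in> carrier (obj C n)" if "x \<in> Y" for x using submodule_in[OF Y that] .
  have IB: "r \<odot>\<^bsub>obj C n\<^esub> x \<in> B n" if r: "r \<in> I" and x: "x \<in> Y" for r x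
  proof -
    have "r \<odot>\<^bsub>obj C n\<^esub> x \<in> ideal_part S I C n"
      unfolding ideal_part_def by (rule module.ideal_smultI[OF obj_module I_ideal order_refl r Yc[OF x]])
    then show ?thesis unfolding tor_bounds_def using sum_sub_right[OF bound_sub ideal_part_sub[OF I_ideal]] by blast
  qed
  have im: "nu n ` Y = carrier V" by (simp add: V)
  have add: "nu n (x \<oplus>\<^bsub>obj C n\<^esub> y) = nu n x \<oplus>\<^bsub>V\<^esub> nu n y" if "x \<in> Y" "y \<in> Y" for x y
    using nu_add[OF Yc[OF that(1)] Yc[OF that(2)]] by (simp add: V)
  have smult: "nu n (r \<odot>\<^bsub>obj C n\<^esub> x) = r \<odot>\<^bsub>V\<^esub> nu n x" if "r \<in> carrier S" "x \<in> Y" for r x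
    using nu_smult[OF that(1) Yc[OF that(2)]] by (simp add: V)
  have ker: "nu n x = \<zero>\<^bsub>V\<^esub> \<longleftrightarrow> x \<in> B n" if "x \<in> Y" for x using nu_ker[OF Yc[OF that]] by (simp add: V)
  note dim = residue_dim_image[OF obj_module Y tor_bounds_sub[OF I_ideal] im add smult ker IB A]
  show "residue_dim S I V \<le> card A" by (rule dim(1))
  show "\<exists>A'. finite A' \<and> card A' = residue_dim S I V \<and> A' \<subseteq> Y \<and>
      Y \<subseteq> module.span S (obj C n) A' <+>\<^bsub>obj C n\<^esub> B n" by (rule dim(2))
qed

lemma homology_eq: "homology Tc n = (homology Tc n)\<lparr>carrier := nu n ` Z n\<rparr>"
  unfolding homology_def quotient_module_def tc_cycles nu_def image_image by simp

end

text \<open>Lifts of a spanning set of Tor to the free module. In this form Betti numbers are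
  compared between resolutions by applying chain maps to a finite set.\<close>

definition spans_tor where
  "spans_tor S I C n A \<longleftrightarrow> finite A \<and> A \<subseteq> tor_cycles S I C n \<and>
    tor_cycles S I C n \<subseteq> module.span S (obj C n) A <+>\<^bsub>obj C n\<^esub> tor_bounds S I C n"

text \<open>The image of \<open>A\<close> under a comparison map works: a cycle \<open>z\<close> of
  \<open>D\<close> agrees with \<open>\<phi> n (\<psi> n z)\<close> modulo
  \<open>tor_bounds\<close>, and \<open>\<psi> n z\<close> is spanned by \<open>A\<close> modulo
  \<open>tor_bounds\<close>.\<close>

lemma spans_tor_transfer:
  assumes C: "free_res S M C \<epsilon> b" and D: "free_res S M D \<eta> b'" and I: "ideal I S"
    and A: "spans_tor S I C n A"
  shows "\<exists>A'. spans_tor S I D n A' \<and> card A' \<le> card A"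
proof -
  interpret C: free_res S M C \<epsilon> b by fact
  interpret D: free_res S M D \<eta> b' by fact
  interpret X: module S "obj C n" by (rule C.obj_module)
  interpret Y: module S "obj D n" by (rule D.obj_module)
  obtain \<phi> where \<phi>: "chain_map S C D \<phi>" "\<And>x. x \<in> carrier (obj C 0) \<Longrightarrow> \<eta> (\<phi> 0 x) = \<epsilon> x"
    using comparison[OF C D] by blast
  obtain \<psi> where \<psi>: "chain_map S D C \<psi>" "\<And>x. x \<in> carrier (obj D 0) \<Longrightarrow> \<epsilon> (\<psi> 0 x) = \<eta> x"
    using comparison[OF D C] by blast
  have hom: "\<phi> n \<in> module_hom S (obj C n) (obj D n)" by (rule chain_map_hom[OF \<phi>(1)])
  have A': "finite A" "A \<subseteq> tor_cycles S I C n"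
    "tor_cycles S I C n \<subseteq> X.span A <+>\<^bsub>obj C n\<^esub> tor_bounds S I C n" using A unfolding spans_tor_def by auto
  have Ac: "A \<subseteq> carrier (obj C n)" using A'(2) submodule_in[OF C.tor_cycles_sub[OF I]] by blast
  have \<phi>A: "\<phi> n ` A \<subseteq> tor_cycles S I D n" using A'(2) chain_map_tor(1)[OF C D I \<phi>(1)] by blast
  then have \<phi>Ac: "\<phi> n ` A \<subseteq> carrier (obj D n)" using submodule_in[OF D.tor_cycles_sub[OF I]] by blast
  note sp = Y.span_is_submodule[OF \<phi>Ac]
  have B: "submodule S (tor_bounds S I D n) (obj D n)" by (rule D.tor_bounds_sub[OF I])
  have sum: "submodule S (Y.span (\<phi> n ` A) <+>\<^bsub>obj D n\<^esub> tor_bounds S I D n) (obj D n)" by (rule submodule_sum[OF sp B])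
  have "tor_cycles S I D n \<subseteq> Y.span (\<phi> n ` A) <+>\<^bsub>obj D n\<^esub> tor_bounds S I D n"
  proof
    fix z assume z: "z \<in> tor_cycles S I D n"
    have zc: "z \<in> carrier (obj D n)" using submodule_in[OF D.tor_cycles_sub[OF I] z] .
    have "\<psi> n z \<in> tor_cycles S I C n" by (rule chain_map_tor(1)[OF D C I \<psi>(1) z])
    then obtain x y where x: "x \<in> X.span A" and y: "y \<in> tor_bounds S I C n" and xy: "\<psi> n z = x \<oplus>\<^bsub>obj C n\<^esub> y"
      using A'(3) by (meson in_sumE subsetD)
    have xc: "x \<in> carrier (obj C n)" "y \<in> carrier (obj C n)"
      using X.span_is_subset2[OF Ac] x submodule_in[OF C.tor_bounds_sub[OF I] y] by auto
    have "\<phi> n x \<in> Y.span (\<phi> n ` A)"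
      using Y.in_own_span[OF \<phi>Ac] by (intro X.span_hom_image[OF D.obj_module hom Ac sp _ x]) auto
    moreover have "\<phi> n y \<in> tor_bounds S I D n" by (rule chain_map_tor(2)[OF C D I \<phi>(1) y])
    ultimately have w: "\<phi> n (\<psi> n z) \<in> Y.span (\<phi> n ` A) <+>\<^bsub>obj D n\<^esub> tor_bounds S I D n"
      unfolding xy module_hom_add[OF hom xc] set_add_def' by blast
    have "\<phi> n (\<psi> n z) \<ominus>\<^bsub>obj D n\<^esub> z \<in> tor_bounds S I D n"
      by (rule resolutions_homotopy_equivalent[OF D I \<psi> \<phi> z])
    then have "\<phi> n (\<psi> n z) \<ominus>\<^bsub>obj D n\<^esub> z \<in> Y.span (\<phi> n ` A) <+>\<^bsub>obj D n\<^esub> tor_bounds S I D n"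
      using sum_sub_right[OF sp B] by blast
    from submodule_minus[OF sum w this]
    have "\<phi> n (\<psi> n z) \<ominus>\<^bsub>obj D n\<^esub> (\<phi> n (\<psi> n z) \<ominus>\<^bsub>obj D n\<^esub> z) \<in> Y.span (\<phi> n ` A) <+>\<^bsub>obj D n\<^esub> tor_bounds S I D n" .
    moreover have wc: "\<phi> n (\<psi> n z) \<in> carrier (obj D n)" using submodule_in[OF sum w] .
    have "\<phi> n (\<psi> n z) \<ominus>\<^bsub>obj D n\<^esub> (\<phi> n (\<psi> n z) \<ominus>\<^bsub>obj D n\<^esub> z) = z"
      using wc zc by (simp add: Y.M.minus_eq Y.M.minus_add Y.M.r_neg2 Y.M.r_neg1)
    ultimately show "z \<in> Y.span (\<phi> n ` A) <+>\<^bsub>obj D n\<^esub> tor_bounds S I D n" by simp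
  qed
  then have "spans_tor S I D n (\<phi> n ` A)" unfolding spans_tor_def using A'(1) \<phi>A by blast
  moreover have "card (\<phi> n ` A) \<le> card A" by (rule card_image_le[OF A'(1)])
  ultimately show ?thesis by blast
qed

text \<open>\<open>Tor\<close> uses the resolution \<open>D\<close> selected by \<open>SOME\<close>:
  a spanning set is moved there and bounds the dimension, and a smallest one is moved back to
  \<open>C\<close>.\<close>

lemma betti_spans_tor:
  assumes C: "free_res S M C \<epsilon> b" and I: "maximalideal I S" and A: "spans_tor S I C n A"
  shows "betti S I M n \<le> card A" "\<exists>A'. spans_tor S I C n A' \<and> card A' \<le> betti S I M n"
proof -
  interpret C: free_res S M C \<epsilon> b by fact
  have I': "ideal I S" using I by (simp add: maximalideal_def)
  define D where "D = (SOME D. free_resolution S M D)"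
  have "free_resolution S M C" unfolding free_resolution_def using C.obj C.res by blast
  then have "free_resolution S M D" unfolding D_def by (rule someI[of "free_resolution S M"])
  then obtain \<eta> where "resolution S M D \<eta>" "\<forall>n. \<exists>b. obj D n = free_module S b"
    unfolding free_resolution_def by blast
  moreover then obtain b' where "\<And>n. obj D n = free_module S (b' n)" by metis
  ultimately have D: "free_res S M D \<eta> b'"
    using C.free_res_axioms C.is_cring C.M.module_axioms by (simp add: free_res_def free_res_axioms_def)
  interpret D: free_res_field S M D \<eta> b' I
    using D I C.is_cring by (simp add: free_res_field_def residue_field_def)
  have bet: "betti S I M n = residue_dim S I (homology (tensor_complex S D (residue_module S I)) n)"
    unfolding betti_def Tor_def D_def ..
  obtain A1 where A1: "spans_tor S I D n A1" "card A1 \<le> card A" using spans_tor_transfer[OF C D I' A] by blast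
  note dim = D.tor_dim[OF D.tor_cycles_sub[OF I'] D.homology_eq]
  have "betti S I M n \<le> card A1" unfolding bet using A1(1) unfolding spans_tor_def by (intro dim(1)) auto
  then show "betti S I M n \<le> card A" using A1 by simp
  obtain A2 where "finite A2" "card A2 = betti S I M n" "A2 \<subseteq> tor_cycles S I D n"
    "tor_cycles S I D n \<subseteq> module.span S (obj D n) A2 <+>\<^bsub>obj D n\<^esub> tor_bounds S I D n"
    using dim(2)[of A1] A1(1) unfolding spans_tor_def bet by blast
  then have "spans_tor S I D n A2" unfolding spans_tor_def by blast
  from spans_tor_transfer[OF D C I' this]
  show "\<exists>A'. spans_tor S I C n A' \<and> card A' \<le> betti S I M n" using \<open>card A2 = betti S I M n\<close> by auto
qed

section \<open>Associated graded modules\<close>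

locale filtered_mod = R?: cring R + N: module R N
  for R :: "('a, 'r) ring_scheme" (structure) and I :: "'a set" and N :: "('a, 'b, 'm) module_scheme"
    and G :: "nat \<Rightarrow> 'b set" +
  assumes I_ideal: "ideal I R" and G_sub: "submodule R (G p) N" and G_Suc: "G (Suc p) \<subseteq> G p"
    and G_power: "r \<in> ideal_power R I q \<Longrightarrow> x \<in> G p \<Longrightarrow> r \<odot>\<^bsub>N\<^esub> x \<in> G (q + p)"

text \<open>Lifts of elements of the associated graded module; as a set this is the direct sum of
  the \<open>G p\<close>. Sums and products with scalars are computed on such sequences and only
  then reduced by \<open>seq_class\<close>.\<close>

definition fin_seqs :: "('a, 'b, 'm) module_scheme \<Rightarrow> (nat \<Rightarrow> 'b set) \<Rightarrow> (nat \<Rightarrow> 'b) set" where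
  "fin_seqs N G = {f. (\<forall>p. f p \<in> G p) \<and> (\<exists>n. \<forall>p\<ge>n. f p = \<zero>\<^bsub>N\<^esub>)}"

definition seq_class :: "('a, 'b, 'm) module_scheme \<Rightarrow> (nat \<Rightarrow> 'b set) \<Rightarrow> (nat \<Rightarrow> 'b) \<Rightarrow> nat \<Rightarrow> 'b set" where
  "seq_class N G f = (\<lambda>p. G (Suc p) +>\<^bsub>N\<^esub> f p)"

definition conv :: "('a, 'b, 'm) module_scheme \<Rightarrow> (nat \<Rightarrow> 'a) \<Rightarrow> (nat \<Rightarrow> 'b) \<Rightarrow> nat \<Rightarrow> 'b" where
  "conv N \<alpha> f = (\<lambda>n. \<Oplus>\<^bsub>N\<^esub>p\<in>{..n}. \<alpha> p \<odot>\<^bsub>N\<^esub> f (n - p))"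

definition single_seq :: "('a, 'b, 'm) module_scheme \<Rightarrow> nat \<Rightarrow> 'b \<Rightarrow> nat \<Rightarrow> 'b" where
  "single_seq N q x = (\<lambda>p. if p = q then x else \<zero>\<^bsub>N\<^esub>)"

text \<open>The Rees algebra of \<open>I\<close>: polynomials whose coefficient in degree
  \<open>p\<close> lies in the \<open>p\<close>-th power of \<open>I\<close>.\<close>

abbreviation "rees R I \<equiv> fin_seqs (self_module R) (ideal_power R I)"

abbreviation "rees_class R I \<equiv> seq_class (self_module R) (ideal_power R I)"

context filtered_mod
begin

lemma G_in: "x \<in> G p \<Longrightarrow> x \<in> carrier N" using submodule_in[OF G_sub] .

lemma seq_in: "f \<in> fin_seqs N G \<Longrightarrow> f p \<in> G p" by (simp add: fin_seqs_def)

lemma seq_carrier: "f \<in> fin_seqs N G \<Longrightarrow> f p \<in> carrier N" using seq_in G_in by blast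

lemma class_eq_iff:
  assumes "f \<in> fin_seqs N G" "g \<in> fin_seqs N G"
  shows "seq_class N G f = seq_class N G g \<longleftrightarrow> (\<forall>p. f p \<ominus>\<^bsub>N\<^esub> g p \<in> G (Suc p))"
  unfolding seq_class_def fun_eq_iff using N.coset_eq_iff[OF G_sub seq_carrier[OF assms(1)] seq_carrier[OF assms(2)]] by simp

lemma class_closed: "f \<in> fin_seqs N G \<Longrightarrow> seq_class N G f \<in> carrier (gr_module N G)"
proof -
  assume f: "f \<in> fin_seqs N G"
  then obtain n where n: "\<And>p. p \<ge> n \<Longrightarrow> f p = \<zero>\<^bsub>N\<^esub>" by (auto simp: fin_seqs_def)
  have "{p. seq_class N G f p \<noteq> G (Suc p)} \<subseteq> {..<n}"
  proof
    fix p assume "p \<in> {p. seq_class N G f p \<noteq> G (Suc p)}"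
    then show "p \<in> {..<n}" using n[of p] N.coset_zero[OF G_sub] by (force simp: seq_class_def not_less)
  qed
  then have "finite {p. seq_class N G f p \<noteq> G (Suc p)}" using finite_subset by blast
  then show ?thesis using seq_in[OF f] by (simp add: gr_module_def quotient_module_simps seq_class_def)
qed

lemma class_surj:
  assumes u: "u \<in> carrier (gr_module N G)"
  shows "\<exists>f\<in>fin_seqs N G. seq_class N G f = u"
proof -
  have "\<forall>p. \<exists>x. x \<in> G p \<and> u p = G (Suc p) +>\<^bsub>N\<^esub> x"
    using u by (auto simp: gr_module_def quotient_module_simps)
  then obtain h where h: "\<And>p. h p \<in> G p" "\<And>p. u p = G (Suc p) +>\<^bsub>N\<^esub> h p" by metis
  \<comment> \<open>Taking zero wherever the coset is trivial gives the lift finite support.\<close>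
  define f where "f p = (if u p = G (Suc p) then \<zero>\<^bsub>N\<^esub> else h p)" for p
  have "finite {p. u p \<noteq> G (Suc p)}" using u by (simp add: gr_module_def)
  then obtain n where "\<forall>p\<in>{p. u p \<noteq> G (Suc p)}. p < n" using finite_nat_set_iff_bounded by auto
  then have "\<forall>p\<ge>n. f p = \<zero>\<^bsub>N\<^esub>" unfolding f_def by force
  moreover have "f p \<in> G p" for p unfolding f_def using h submodule_zero[OF G_sub] by auto
  ultimately have "f \<in> fin_seqs N G" by (auto simp: fin_seqs_def)
  moreover have "seq_class N G f = u"
  proof
    fix p show "seq_class N G f p = u p"
      using h(2)[of p] N.coset_zero[OF G_sub, of "Suc p"] by (simp add: seq_class_def f_def)
  qed
  ultimately show ?thesis by blast
qed

lemma seq_zero: "(\<lambda>_. \<zero>\<^bsub>N\<^esub>) \<in> fin_seqs N G"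
  using submodule_zero[OF G_sub] by (auto simp: fin_seqs_def)

lemma class_zero: "seq_class N G (\<lambda>_. \<zero>\<^bsub>N\<^esub>) = \<zero>\<^bsub>gr_module N G\<^esub>"
  using N.coset_zero[OF G_sub] by (simp add: seq_class_def gr_module_def)

lemma seq_add:
  assumes "f \<in> fin_seqs N G" "g \<in> fin_seqs N G"
  shows "(\<lambda>p. f p \<oplus>\<^bsub>N\<^esub> g p) \<in> fin_seqs N G"
proof -
  obtain n m where "\<And>p. p \<ge> n \<Longrightarrow> f p = \<zero>\<^bsub>N\<^esub>" "\<And>p. p \<ge> m \<Longrightarrow> g p = \<zero>\<^bsub>N\<^esub>"
    using assms by (auto simp: fin_seqs_def)
  then have "\<forall>p\<ge>max n m. f p \<oplus>\<^bsub>N\<^esub> g p = \<zero>\<^bsub>N\<^esub>" by simp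
  then show ?thesis using seq_in[OF assms(1)] seq_in[OF assms(2)] submodule_add[OF G_sub]
    unfolding fin_seqs_def by blast
qed

lemma class_add:
  assumes "f \<in> fin_seqs N G" "g \<in> fin_seqs N G"
  shows "seq_class N G f \<oplus>\<^bsub>gr_module N G\<^esub> seq_class N G g = seq_class N G (\<lambda>p. f p \<oplus>\<^bsub>N\<^esub> g p)"
  using seq_carrier[OF assms(1)] seq_carrier[OF assms(2)]
  by (simp add: gr_module_def seq_class_def N.coset_add[OF G_sub])

lemma rees_in: "\<alpha> \<in> rees R I \<Longrightarrow> \<alpha> p \<in> ideal_power R I p"
  by (simp add: fin_seqs_def)

lemma rees_carrier: "\<alpha> \<in> rees R I \<Longrightarrow> \<alpha> p \<in> carrier R"
  using rees_in ideal_power_in[OF I_ideal] by blast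

lemma conv_term: "\<alpha> \<in> rees R I \<Longrightarrow> f \<in> fin_seqs N G \<Longrightarrow> p \<le> n \<Longrightarrow> \<alpha> p \<odot>\<^bsub>N\<^esub> f (n - p) \<in> G n"
  using G_power[OF rees_in[of \<alpha> p] seq_in[of f "n - p"]] by simp

lemma conv_closed:
  assumes \<alpha>: "\<alpha> \<in> rees R I" and f: "f \<in> fin_seqs N G"
  shows "conv N \<alpha> f \<in> fin_seqs N G"
proof -
  obtain n m where n: "\<And>p. p \<ge> n \<Longrightarrow> \<alpha> p = \<zero>" and m: "\<And>p. p \<ge> m \<Longrightarrow> f p = \<zero>\<^bsub>N\<^esub>"
    using \<alpha> f by (auto simp: fin_seqs_def)
  have "conv N \<alpha> f k = \<zero>\<^bsub>N\<^esub>" if k: "k \<ge> n + m" for k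
  proof -
    have "\<alpha> p \<odot>\<^bsub>N\<^esub> f (k - p) = \<zero>\<^bsub>N\<^esub>" for p
      using n[of p] m[of "k - p"] k rees_carrier[OF \<alpha>, of p] seq_carrier[OF f, of "k - p"]
      by (cases "p \<ge> n") auto
    then show ?thesis unfolding conv_def by (simp add: N.M.finsum_zero)
  qed
  moreover have "conv N \<alpha> f k \<in> G k" for k
    unfolding conv_def using conv_term[OF \<alpha> f] by (intro submodule_finsum[OF G_sub]) auto
  ultimately show ?thesis unfolding fin_seqs_def by blast
qed

lemma rees_coset: "\<alpha> \<in> rees R I \<Longrightarrow> r \<in> rees_class R I \<alpha> p \<Longrightarrow>
    \<exists>h\<in>ideal_power R I (Suc p). r = h \<oplus> \<alpha> p"
  unfolding seq_class_def self_coset a_r_coset_def' by auto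

text \<open>Changing \<open>\<alpha> p\<close> by the next ideal power, or \<open>f (n - p)\<close>
  by the next filtration step, changes their product only within \<open>G (Suc n)\<close>. Hence the
  unions over representatives in \<open>gr_module\<close> are single cosets
  (\<open>tm\<close>).\<close>

lemma class_smult:
  assumes \<alpha>: "\<alpha> \<in> rees R I" and f: "f \<in> fin_seqs N G"
  shows "rees_class R I \<alpha> \<odot>\<^bsub>gr_module N G\<^esub> seq_class N G f = seq_class N G (conv N \<alpha> f)"
proof
  fix n
  have tm: "(\<Union>r\<in>rees_class R I \<alpha> p. \<Union>x\<in>seq_class N G f (n - p). G (Suc n) +>\<^bsub>N\<^esub> (r \<odot>\<^bsub>N\<^esub> x))
      = G (Suc n) +>\<^bsub>N\<^esub> (\<alpha> p \<odot>\<^bsub>N\<^esub> f (n - p))" (is "?U = ?c") if p: "p \<le> n" for p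
  proof -
    have ac: "\<alpha> p \<in> carrier R" and fc: "f (n - p) \<in> carrier N"
      using rees_carrier[OF \<alpha>] seq_carrier[OF f] by auto
    have eq: "G (Suc n) +>\<^bsub>N\<^esub> (r \<odot>\<^bsub>N\<^esub> x) = ?c" if r: "r \<in> rees_class R I \<alpha> p" and x: "x \<in> seq_class N G f (n - p)" for r x
    proof -
      obtain h where h: "h \<in> ideal_power R I (Suc p)" "r = h \<oplus> \<alpha> p" using rees_coset[OF \<alpha> r] by auto
      have hc: "h \<in> carrier R" using ideal_power_in[OF I_ideal h(1)] .
      obtain g where g: "g \<in> G (Suc (n - p))" "x = g \<oplus>\<^bsub>N\<^esub> f (n - p)"
        using x by (auto simp: seq_class_def a_r_coset_def')
      have gc: "g \<in> carrier N" using G_in g by blast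
      have "x \<in> G (n - p)" unfolding g(2) using g(1) G_Suc seq_in[OF f] by (intro submodule_add[OF G_sub]) auto
      from G_power[OF h(1) this] have 1: "h \<odot>\<^bsub>N\<^esub> x \<in> G (Suc n)" using p by simp
      from G_power[OF rees_in[OF \<alpha>] g(1), of p] have 2: "\<alpha> p \<odot>\<^bsub>N\<^esub> g \<in> G (Suc n)" using p by simp
      have xc: "x \<in> carrier N" using g gc fc by simp
      have "r \<odot>\<^bsub>N\<^esub> x = (h \<odot>\<^bsub>N\<^esub> x \<oplus>\<^bsub>N\<^esub> \<alpha> p \<odot>\<^bsub>N\<^esub> g) \<oplus>\<^bsub>N\<^esub> \<alpha> p \<odot>\<^bsub>N\<^esub> f (n - p)"
        unfolding h(2) using hc ac xc gc fc by (simp add: N.smult_l_distr g(2) N.smult_r_distr N.M.a_ac)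
      then have "r \<odot>\<^bsub>N\<^esub> x \<ominus>\<^bsub>N\<^esub> \<alpha> p \<odot>\<^bsub>N\<^esub> f (n - p) = h \<odot>\<^bsub>N\<^esub> x \<oplus>\<^bsub>N\<^esub> \<alpha> p \<odot>\<^bsub>N\<^esub> g"
        using hc ac xc gc fc by (simp add: N.M.minus_eq N.M.a_assoc N.M.r_neg)
      then have "r \<odot>\<^bsub>N\<^esub> x \<ominus>\<^bsub>N\<^esub> \<alpha> p \<odot>\<^bsub>N\<^esub> f (n - p) \<in> G (Suc n)" using submodule_add[OF G_sub 1 2] by simp
      then show ?thesis using N.coset_eq_iff[OF G_sub] h(2) hc ac xc fc by simp
    qed
    have "\<alpha> p \<in> rees_class R I \<alpha> p"
      using module.coset_self[OF self_module ideal_self_submodule[OF ideal_power_ideal[OF I_ideal]], of "\<alpha> p" "Suc p"] ac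
      by (simp add: seq_class_def)
    moreover have "f (n - p) \<in> seq_class N G f (n - p)"
      unfolding seq_class_def by (rule N.coset_self[OF G_sub fc])
    ultimately show ?thesis using eq by blast
  qed
  let ?Q = "quotient_module N (G n) (G (Suc n))"
  interpret Q: module R ?Q by (rule N.quotient_is_module[OF G_sub G_sub])
  have tc: "(\<lambda>p. \<alpha> p \<odot>\<^bsub>N\<^esub> f (n - p)) \<in> {..n} \<rightarrow> G n" using conv_term[OF \<alpha> f] by auto
  have "(rees_class R I \<alpha> \<odot>\<^bsub>gr_module N G\<^esub> seq_class N G f) n
      = (\<Oplus>\<^bsub>?Q\<^esub>p\<in>{..n}. \<Union>r\<in>rees_class R I \<alpha> p. \<Union>x\<in>seq_class N G f (n - p). G (Suc n) +>\<^bsub>N\<^esub> (r \<odot>\<^bsub>N\<^esub> x))"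
    by (simp add: gr_module_def)
  also have "\<dots> = (\<Oplus>\<^bsub>?Q\<^esub>p\<in>{..n}. G (Suc n) +>\<^bsub>N\<^esub> (\<alpha> p \<odot>\<^bsub>N\<^esub> f (n - p)))"
    using tc tm by (intro Q.finsum_cong') (auto simp: quotient_module_simps)
  also have "\<dots> = G (Suc n) +>\<^bsub>N\<^esub> (\<Oplus>\<^bsub>N\<lparr>carrier := G n\<rparr>\<^esub>p\<in>{..n}. \<alpha> p \<odot>\<^bsub>N\<^esub> f (n - p))"
    using tc by (intro module_hom_finsum[OF N.submodule_is_module[OF G_sub] Q.module_axioms N.quotient_hom[OF G_sub G_sub], symmetric]) auto
  also have "(\<Oplus>\<^bsub>N\<lparr>carrier := G n\<rparr>\<^esub>p\<in>{..n}. \<alpha> p \<odot>\<^bsub>N\<^esub> f (n - p)) = conv N \<alpha> f n"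
    unfolding conv_def using tc
    by (intro module_hom_finsum[OF N.submodule_is_module[OF G_sub] N.module_axioms N.inclusion_hom[OF G_sub]]) auto
  finally show "(rees_class R I \<alpha> \<odot>\<^bsub>gr_module N G\<^esub> seq_class N G f) n = seq_class N G (conv N \<alpha> f) n"
    by (simp add: seq_class_def)
qed

lemma single_seq_closed: "x \<in> G q \<Longrightarrow> single_seq N q x \<in> fin_seqs N G"
proof -
  assume x: "x \<in> G q"
  have "\<forall>p\<ge>Suc q. single_seq N q x p = \<zero>\<^bsub>N\<^esub>" by (simp add: single_seq_def)
  then have "\<exists>n. \<forall>p\<ge>n. single_seq N q x p = \<zero>\<^bsub>N\<^esub>" by blast
  then show ?thesis using x submodule_zero[OF G_sub] by (simp add: fin_seqs_def) (simp add: single_seq_def)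
qed

end

lemma (in cring) rees_filtered: "ideal I R \<Longrightarrow> filtered_mod R I (self_module R) (ideal_power R I)"
  using is_cring self_module ideal_self_submodule ideal_power_ideal ideal_power_antimono[of I p "Suc p" for p] ideal_power_mult
  unfolding filtered_mod_def filtered_mod_axioms_def by auto

lemma gr_ring_simps:
  "carrier (gr_ring R I) = carrier (gr_module (self_module R) (ideal_power R I))"
  "add (gr_ring R I) = add (gr_module (self_module R) (ideal_power R I))"
  "zero (gr_ring R I) = zero (gr_module (self_module R) (ideal_power R I))"
  "mult (gr_ring R I) = smult (gr_module (self_module R) (ideal_power R I))"
  "one (gr_ring R I) = rees_class R I (\<lambda>p. if p = 0 then one R else zero R)"
  unfolding gr_ring_def Let_def by (simp_all only: ring.simps monoid.simps partial_object.simps seq_class_def self_coset)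

text \<open>Used with \<open>H\<close> the Rees algebra inside the polynomial ring
  \<open>UP R\<close>; only the large ring \<open>A\<close> has to be known as a ring.\<close>

lemma image_cring:
  assumes A: "cring A" and H: "H \<subseteq> carrier A" "\<zero>\<^bsub>A\<^esub> \<in> H" "\<one>\<^bsub>A\<^esub> \<in> H"
      "\<And>x y. x \<in> H \<Longrightarrow> y \<in> H \<Longrightarrow> x \<oplus>\<^bsub>A\<^esub> y \<in> H" "\<And>x y. x \<in> H \<Longrightarrow> y \<in> H \<Longrightarrow> x \<otimes>\<^bsub>A\<^esub> y \<in> H"
      "\<And>x. x \<in> H \<Longrightarrow> \<ominus>\<^bsub>A\<^esub> x \<in> H"
    and im: "h ` H = carrier B"
    and add: "\<And>x y. x \<in> H \<Longrightarrow> y \<in> H \<Longrightarrow> h (x \<oplus>\<^bsub>A\<^esub> y) = h x \<oplus>\<^bsub>B\<^esub> h y"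
    and mult: "\<And>x y. x \<in> H \<Longrightarrow> y \<in> H \<Longrightarrow> h (x \<otimes>\<^bsub>A\<^esub> y) = h x \<otimes>\<^bsub>B\<^esub> h y"
    and zero: "h \<zero>\<^bsub>A\<^esub> = \<zero>\<^bsub>B\<^esub>" and one: "h \<one>\<^bsub>A\<^esub> = \<one>\<^bsub>B\<^esub>"
  shows "cring B"
proof -
  interpret A: cring A by fact
  have ex: "\<exists>x\<in>H. y = h x" if "y \<in> carrier B" for y using that im by auto
  have hc: "h x \<in> carrier B" if "x \<in> H" for x using that im by auto
  note [simp] = H(1)[THEN subsetD]
  show ?thesis
  proof (rule cringI)
    show "abelian_group B"
    proof (rule abelian_groupI)
      show "\<zero>\<^bsub>B\<^esub> \<in> carrier B" using hc[OF H(2)] zero by simp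
      fix x assume "x \<in> carrier B"
      then obtain a where a: "a \<in> H" "x = h a" using ex by blast
      show "\<zero>\<^bsub>B\<^esub> \<oplus>\<^bsub>B\<^esub> x = x" unfolding a(2) zero[symmetric] using a(1) H by (simp add: add[symmetric])
      have "h (\<ominus>\<^bsub>A\<^esub> a) \<oplus>\<^bsub>B\<^esub> h a = \<zero>\<^bsub>B\<^esub>" using a(1) H by (simp add: add[symmetric] A.l_neg zero)
      then show "\<exists>y\<in>carrier B. y \<oplus>\<^bsub>B\<^esub> x = \<zero>\<^bsub>B\<^esub>" using a hc[of "\<ominus>\<^bsub>A\<^esub> a"] H(6) by auto
      fix y assume "y \<in> carrier B"
      then obtain b where b: "b \<in> H" "y = h b" using ex by blast
      show "x \<oplus>\<^bsub>B\<^esub> y \<in> carrier B" using a b hc H by (simp add: add[symmetric])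
      show "x \<oplus>\<^bsub>B\<^esub> y = y \<oplus>\<^bsub>B\<^esub> x" using a b by (simp add: add[symmetric] A.a_comm)
      fix z assume "z \<in> carrier B"
      then obtain c where c: "c \<in> H" "z = h c" using ex by blast
      show "(x \<oplus>\<^bsub>B\<^esub> y) \<oplus>\<^bsub>B\<^esub> z = x \<oplus>\<^bsub>B\<^esub> (y \<oplus>\<^bsub>B\<^esub> z)" using a b c H by (simp add: add[symmetric] A.a_assoc)
    qed
    show "Group.comm_monoid B"
    proof (rule comm_monoidI)
      show "\<one>\<^bsub>B\<^esub> \<in> carrier B" using hc[OF H(3)] one by simp
      fix x assume "x \<in> carrier B"
      then obtain a where a: "a \<in> H" "x = h a" using ex by blast
      show "\<one>\<^bsub>B\<^esub> \<otimes>\<^bsub>B\<^esub> x = x" unfolding a(2) one[symmetric] using a(1) H by (simp add: mult[symmetric])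
      fix y assume "y \<in> carrier B"
      then obtain b where b: "b \<in> H" "y = h b" using ex by blast
      show "x \<otimes>\<^bsub>B\<^esub> y \<in> carrier B" using a b hc H by (simp add: mult[symmetric])
      show "x \<otimes>\<^bsub>B\<^esub> y = y \<otimes>\<^bsub>B\<^esub> x" using a b by (simp add: mult[symmetric] A.m_comm)
      fix z assume "z \<in> carrier B"
      then obtain c where c: "c \<in> H" "z = h c" using ex by blast
      show "(x \<otimes>\<^bsub>B\<^esub> y) \<otimes>\<^bsub>B\<^esub> z = x \<otimes>\<^bsub>B\<^esub> (y \<otimes>\<^bsub>B\<^esub> z)" using a b c H by (simp add: mult[symmetric] A.m_assoc)
    qed
    fix x y z assume "x \<in> carrier B" "y \<in> carrier B" "z \<in> carrier B"
    then obtain a b c where a: "a \<in> H" "x = h a" and b: "b \<in> H" "y = h b" and c: "c \<in> H" "z = h c" using ex by meson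
    show "(x \<oplus>\<^bsub>B\<^esub> y) \<otimes>\<^bsub>B\<^esub> z = x \<otimes>\<^bsub>B\<^esub> z \<oplus>\<^bsub>B\<^esub> y \<otimes>\<^bsub>B\<^esub> z"
      using a b c H by (simp add: add[symmetric] mult[symmetric] A.l_distr)
  qed
qed

text \<open>Elements of \<open>UP R\<close> are coefficient functions and their product is
  convolution, so the Rees algebra is a subring and \<open>gr_ring\<close> is its image under
  \<open>rees_class\<close>. This avoids verifying ring laws for convolutions of cosets.\<close>

lemma (in cring) gr_ring_cring:
  assumes I: "ideal I R"
  shows "cring (gr_ring R I)"
proof -
  interpret P: UP_cring R "UP R" by (unfold_locales)
  interpret F: filtered_mod R I "self_module R" "ideal_power R I" by (rule rees_filtered[OF I])
  have upI: "f \<in> carrier (UP R)" if f: "f \<in> rees R I" for f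
  proof -
    obtain n where n: "\<And>p. p \<ge> n \<Longrightarrow> f p = \<zero>" using f by (auto simp: fin_seqs_def)
    have "bound \<zero> n f" using n by (intro bound.intro) auto
    then show ?thesis using F.rees_carrier[OF f] by (auto simp: UP_def up_def)
  qed
  have radd: "f \<oplus>\<^bsub>UP R\<^esub> g = (\<lambda>p. f p \<oplus> g p)" if "f \<in> rees R I" "g \<in> rees R I" for f g
    using upI[OF that(1)] upI[OF that(2)] by (simp add: UP_def)
  have rmult: "f \<otimes>\<^bsub>UP R\<^esub> g = conv (self_module R) f g" if f: "f \<in> rees R I" and g: "g \<in> rees R I" for f g
  proof
    fix n
    have "(\<Oplus>\<^bsub>self_module R\<^esub>p\<in>{..n}. f p \<otimes> g (n - p)) = (\<Oplus>p\<in>{..n}. f p \<otimes> g (n - p))"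
      unfolding finsum_def by (simp add: self_module_def finprod_def)
    then show "(f \<otimes>\<^bsub>UP R\<^esub> g) n = conv (self_module R) f g n"
      using upI[OF f] upI[OF g] by (simp add: UP_def conv_def)
  qed
  show ?thesis
  proof (rule image_cring[OF P.UP_cring, of "rees R I" "rees_class R I"])
    show "rees R I \<subseteq> carrier (UP R)" using upI by blast
    show z: "\<zero>\<^bsub>UP R\<^esub> \<in> rees R I" using F.seq_zero by (simp add: UP_def)
    show "\<one>\<^bsub>UP R\<^esub> \<in> rees R I"
      using F.single_seq_closed[of \<one> 0] by (simp add: UP_def single_seq_def cong: if_cong)
    fix x assume x: "x \<in> rees R I"
    have neg: "(\<ominus>\<^bsub>UP R\<^esub> x) i = \<ominus> x i" for i
    proof -
      have *: "coeff (UP R) f i = f i" if "f \<in> carrier (UP R)" for f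
        using that by (simp add: UP_def)
      show ?thesis using P.coeff_a_inv[OF upI[OF x], of i] *[OF P.P.a_inv_closed[OF upI[OF x]]] *[OF upI[OF x]] by simp
    qed
    obtain n where "\<And>p. p \<ge> n \<Longrightarrow> x p = \<zero>" using x by (auto simp: fin_seqs_def)
    then have "\<forall>p\<ge>n. \<ominus> x p = \<zero>" by simp
    then show "\<ominus>\<^bsub>UP R\<^esub> x \<in> rees R I"
      using F.seq_in[OF x] additive_subgroup.a_inv_closed[OF ideal.axioms(1)[OF ideal_power_ideal[OF I]]]
      by (auto simp: fin_seqs_def neg)
    fix y assume y: "y \<in> rees R I"
    show "x \<oplus>\<^bsub>UP R\<^esub> y \<in> rees R I" using F.seq_add[OF x y] by (simp add: radd[OF x y])
    show "x \<otimes>\<^bsub>UP R\<^esub> y \<in> rees R I" unfolding rmult[OF x y] by (rule F.conv_closed[OF x y])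
    show "rees_class R I (x \<oplus>\<^bsub>UP R\<^esub> y) = rees_class R I x \<oplus>\<^bsub>gr_ring R I\<^esub> rees_class R I y"
      using F.class_add[OF x y] by (simp add: radd[OF x y] gr_ring_simps)
    show "rees_class R I (x \<otimes>\<^bsub>UP R\<^esub> y) = rees_class R I x \<otimes>\<^bsub>gr_ring R I\<^esub> rees_class R I y"
      using F.class_smult[OF x y] by (simp add: rmult[OF x y] gr_ring_simps)
  next
    show "rees_class R I ` rees R I = carrier (gr_ring R I)"
      using F.class_closed F.class_surj by (auto simp: gr_ring_simps image_iff)
    show "rees_class R I \<zero>\<^bsub>UP R\<^esub> = \<zero>\<^bsub>gr_ring R I\<^esub>" using F.class_zero by (simp add: UP_def gr_ring_simps)
    show "rees_class R I \<one>\<^bsub>UP R\<^esub> = \<one>\<^bsub>gr_ring R I\<^esub>" by (simp add: UP_def gr_ring_simps)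
  qed
qed

text \<open>A model \<open>Q\<close> of the associated graded module of \<open>N\<close> with class
  map \<open>cl\<close>. Two kinds occur: \<open>gr_module\<close> itself, and free modules over
  \<open>gr_ring\<close> as models for shifted free modules (\<open>free_presented\<close>). Induced
  maps and exactness are treated once for both.\<close>

locale gr_presented = filtered_mod R I N G
  for R :: "('a, 'r) ring_scheme" (structure) and I :: "'a set" and N :: "('a, 'b, 'm) module_scheme"
    and G :: "nat \<Rightarrow> 'b set" +
  fixes Q :: "(nat \<Rightarrow> 'a set, 'q, 'n) module_scheme" and cl :: "(nat \<Rightarrow> 'b) \<Rightarrow> 'q"
  assumes cl_image: "cl ` fin_seqs N G = carrier Q"
    and cl_zero: "cl (\<lambda>_. \<zero>\<^bsub>N\<^esub>) = \<zero>\<^bsub>Q\<^esub>"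
    and cl_add: "f \<in> fin_seqs N G \<Longrightarrow> g \<in> fin_seqs N G \<Longrightarrow> cl (\<lambda>p. f p \<oplus>\<^bsub>N\<^esub> g p) = cl f \<oplus>\<^bsub>Q\<^esub> cl g"
    and cl_smult: "\<alpha> \<in> rees R I \<Longrightarrow> f \<in> fin_seqs N G \<Longrightarrow> cl (conv N \<alpha> f) = rees_class R I \<alpha> \<odot>\<^bsub>Q\<^esub> cl f"
    and cl_eq_iff: "f \<in> fin_seqs N G \<Longrightarrow> g \<in> fin_seqs N G \<Longrightarrow>
      cl f = cl g \<longleftrightarrow> (\<forall>q. f q \<ominus>\<^bsub>N\<^esub> g q \<in> G (Suc q))"
begin

lemma cl_surj: "v \<in> carrier Q \<Longrightarrow> \<exists>f\<in>fin_seqs N G. cl f = v"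
  by (auto simp: cl_image[symmetric])

lemma cl_closed: "f \<in> fin_seqs N G \<Longrightarrow> cl f \<in> carrier Q"
  using cl_image by blast

lemma cl_eq_zero: "f \<in> fin_seqs N G \<Longrightarrow> cl f = \<zero>\<^bsub>Q\<^esub> \<longleftrightarrow> (\<forall>q. f q \<in> G (Suc q))"
proof -
  assume f: "f \<in> fin_seqs N G"
  have "f q \<ominus>\<^bsub>N\<^esub> \<zero>\<^bsub>N\<^esub> = f q" for q using seq_carrier[OF f] by (simp add: N.M.minus_eq)
  then show ?thesis using cl_eq_iff[OF f seq_zero] cl_zero by simp
qed

end

lemma (in filtered_mod) gr_module_presented: "gr_presented R I N G (gr_module N G) (seq_class N G)"
proof (intro gr_presented.intro gr_presented_axioms.intro filtered_mod_axioms)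
  show "seq_class N G ` fin_seqs N G = carrier (gr_module N G)"
    using class_closed class_surj by (auto simp: image_iff)
qed (simp_all add: class_zero class_add class_smult class_eq_iff)

lemma (in cring) rees_presented: "ideal I R \<Longrightarrow>
    gr_presented R I (self_module R) (ideal_power R I) (gr_module (self_module R) (ideal_power R I)) (rees_class R I)"
  by (rule filtered_mod.gr_module_presented[OF rees_filtered])

text \<open>Coordinate \<open>l\<close> of the filtered free module has its degrees shifted by
  \<open>a l\<close>, so its part of degree \<open>p\<close> is read off from the member
  \<open>p + a l\<close> of the sequence. For \<open>q < a l\<close> the step \<open>Suc q\<close>
  does not restrict coordinate \<open>l\<close>, so \<open>f q\<close> contributes nothing
  there.\<close>

definition free_class :: "('a, 'r) ring_scheme \<Rightarrow> 'a set \<Rightarrow> nat \<Rightarrow> (nat \<Rightarrow> nat) \<Rightarrow> (nat \<Rightarrow> nat \<Rightarrow> 'a)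
    \<Rightarrow> nat \<Rightarrow> nat \<Rightarrow> 'a set" where
  "free_class R I b a f = (\<lambda>l\<in>{..<b}. rees_class R I (\<lambda>p. f (p + a l) l))"

context cring
begin

lemma shift_filtered: "ideal I R \<Longrightarrow> filtered_mod R I (free_module R b) (shift_filt R I b a)"
  using is_cring free_module shift_filt_submodule shift_filt_antimono[of I p "Suc p" for p] shift_filt_smult
  unfolding filtered_mod_def filtered_mod_axioms_def by auto

lemma free_ideal_smult_iff:
  assumes J: "ideal J R"
  shows "x \<in> ideal_smult R J (free_module R b) (carrier (free_module R b)) \<longleftrightarrow>
    x \<in> carrier (free_module R b) \<and> (\<forall>l<b. x l \<in> J)"
proof
  interpret F: module R "free_module R b" by (rule free_module)
  have "ideal_smult R J (free_module R b) (carrier (free_module R b)) \<subseteq>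
      {f \<in> carrier (free_module R b). \<forall>l<b. f l \<in> J}"
  proof (rule F.ideal_smult_subset[OF free_submoduleI])
    show "ideal J R" by fact
    show "r \<odot>\<^bsub>free_module R b\<^esub> x \<in> {f \<in> carrier (free_module R b). \<forall>l<b. f l \<in> J}"
      if "r \<in> J" "x \<in> carrier (free_module R b)" for r x
    proof -
      have "r \<otimes> x l \<in> J" if "l < b" for l
        using ideal.I_r_closed[OF J \<open>r \<in> J\<close> free_in[OF \<open>x \<in> carrier (free_module R b)\<close> that]] .
      then show ?thesis using that F.smult_closed[OF ideal.Icarr[OF J that(1)] that(2)] by (simp add: free_smult)
    qed
  qed
  then show "x \<in> ideal_smult R J (free_module R b) (carrier (free_module R b)) \<Longrightarrow>
      x \<in> carrier (free_module R b) \<and> (\<forall>l<b. x l \<in> J)" by blast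
  assume x: "x \<in> carrier (free_module R b) \<and> (\<forall>l<b. x l \<in> J)"
  have "comb (free_module R b) b (std_vec R b) x \<in> ideal_smult R J (free_module R b) (carrier (free_module R b))"
    by (rule comb_in_submodule[OF F.ideal_smult_submodule[OF J order_refl]])
      (use x std_vec_closed in \<open>auto intro: F.ideal_smultI[OF J order_refl]\<close>)
  then show "x \<in> ideal_smult R J (free_module R b) (carrier (free_module R b))"
    using free_comb_std x by simp
qed

lemma free_finsum_eq:
  assumes "finite A" "\<And>i. i \<in> A \<Longrightarrow> g i \<in> carrier (free_module R b)" "l < b"
  shows "(\<Oplus>\<^bsub>free_module R b\<^esub>i\<in>A. g i) l = (\<Oplus>i\<in>A. g i l)"
  using assms by (intro free_finsum) auto

lemma self_finsum: "(\<Oplus>\<^bsub>self_module R\<^esub>i\<in>A. g i) = (\<Oplus>i\<in>A. g i)"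
  unfolding finsum_def by (simp add: self_module_def finprod_def)

text \<open>After the index shift of \<open>free_class\<close> every clause reduces to single
  coordinates, where it is the corresponding clause for \<open>gr_ring\<close> itself.\<close>

lemma free_presented:
  assumes I: "ideal I R"
  shows "gr_presented R I (free_module R b) (shift_filt R I b a) (free_module (gr_ring R I) b) (free_class R I b a)"
proof -
  interpret F: filtered_mod R I "free_module R b" "shift_filt R I b a" by (rule shift_filtered[OF I])
  interpret P: gr_presented R I "self_module R" "ideal_power R I"
    "gr_module (self_module R) (ideal_power R I)" "rees_class R I" by (rule rees_presented[OF I])
  interpret S: cring "gr_ring R I" by (rule gr_ring_cring[OF I])
  let ?Seq = "fin_seqs (free_module R b) (shift_filt R I b a)"
  let ?cl = "free_class R I b a"
  have coord: "(\<lambda>p. f (p + a l) l) \<in> rees R I" if f: "f \<in> ?Seq" and l: "l < b" for f l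
  proof -
    have "f (p + a l) l \<in> ideal_power R I p" for p
    proof -
      have "f (p + a l) l \<in> ideal_power R I (p + a l - a l)"
        using F.seq_in[OF f, of "p + a l"] l unfolding shift_filt_def by blast
      then show ?thesis by (simp only: add_diff_cancel_right')
    qed
    moreover obtain n where "\<forall>p\<ge>n. f p = \<zero>\<^bsub>free_module R b\<^esub>" using f by (auto simp: fin_seqs_def)
    then have "\<forall>p\<ge>n. f (p + a l) l = \<zero>" using l by (simp add: free_zero)
    ultimately show ?thesis unfolding fin_seqs_def by auto
  qed
  have Qc: "v \<in> carrier (free_module (gr_ring R I) b) \<longleftrightarrow>
      v \<in> extensional {..<b} \<and> (\<forall>l<b. v l \<in> carrier (gr_module (self_module R) (ideal_power R I)))" for v
    unfolding S.free_carrier by (auto simp: PiE_iff gr_ring_simps)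
  have closed: "?cl f \<in> carrier (free_module (gr_ring R I) b)" if f: "f \<in> ?Seq" for f
    unfolding Qc using P.cl_closed[OF coord[OF f]] by (auto simp: free_class_def)
  have cl_eq: "?cl f = ?cl g \<longleftrightarrow> (\<forall>q. f q \<ominus>\<^bsub>free_module R b\<^esub> g q \<in> shift_filt R I b a (Suc q))"
    if f: "f \<in> ?Seq" and g: "g \<in> ?Seq" for f g
  proof -
    have "?cl f = ?cl g \<longleftrightarrow> (\<forall>l<b. rees_class R I (\<lambda>p. f (p + a l) l) = rees_class R I (\<lambda>p. g (p + a l) l))"
      unfolding free_class_def fun_eq_iff restrict_def by auto
    also have "\<dots> \<longleftrightarrow> (\<forall>l<b. \<forall>p. f (p + a l) l \<ominus> g (p + a l) l \<in> ideal_power R I (Suc p))"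
      using P.cl_eq_iff[OF coord[OF f] coord[OF g]] P.rees_carrier[OF coord[OF f]] P.rees_carrier[OF coord[OF g]]
      by (simp add: a_minus_def self_a_inv)
    also have "\<dots> \<longleftrightarrow> (\<forall>l<b. \<forall>q. f q l \<ominus> g q l \<in> ideal_power R I (Suc q - a l))"
    proof (rule all_cong1, rule imp_cong[OF refl])
      fix l assume l: "l < b"
      have "f q l \<ominus> g q l \<in> carrier R" for q
        using free_in[OF F.seq_carrier[OF f] l] free_in[OF F.seq_carrier[OF g] l] by simp
      \<comment> \<open>For \<open>q < a l\<close> truncated subtraction makes the condition void;
        the other \<open>q\<close> are exactly the shifted indices \<open>p + a l\<close>.\<close>
      moreover have "Suc q - a l = 0 \<or> (\<exists>p. q = p + a l \<and> Suc q - a l = Suc p)" for q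
        by (cases "a l \<le> q") (auto intro!: exI[of _ "q - a l"])
      ultimately show "(\<forall>p. f (p + a l) l \<ominus> g (p + a l) l \<in> ideal_power R I (Suc p)) =
          (\<forall>q. f q l \<ominus> g q l \<in> ideal_power R I (Suc q - a l))"
        by (metis Suc_diff_le add_diff_cancel_right' ideal_power_0 le_add2)
    qed
    also have "\<dots> \<longleftrightarrow> (\<forall>q. f q \<ominus>\<^bsub>free_module R b\<^esub> g q \<in> shift_filt R I b a (Suc q))"
      using F.seq_carrier[OF f] F.seq_carrier[OF g] F.N.M.minus_closed
      by (auto simp: shift_filt_def free_minus)
    finally show ?thesis .
  qed
  show ?thesis
  proof (intro gr_presented.intro gr_presented_axioms.intro F.filtered_mod_axioms)
    show "?cl ` ?Seq = carrier (free_module (gr_ring R I) b)"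
    proof
      show "?cl ` ?Seq \<subseteq> carrier (free_module (gr_ring R I) b)" using closed by blast
      show "carrier (free_module (gr_ring R I) b) \<subseteq> ?cl ` ?Seq"
      proof
        fix v assume v: "v \<in> carrier (free_module (gr_ring R I) b)"
        have "\<forall>l\<in>{..<b}. \<exists>\<alpha>. \<alpha> \<in> rees R I \<and> rees_class R I \<alpha> = v l"
          using v P.cl_surj unfolding Qc by blast
        from bchoice[OF this] obtain \<alpha> where \<alpha>: "\<And>l. l < b \<Longrightarrow> \<alpha> l \<in> rees R I \<and> rees_class R I (\<alpha> l) = v l" by auto
        have "\<forall>l\<in>{..<b}. \<exists>n. \<forall>p\<ge>n. \<alpha> l p = \<zero>" using \<alpha> by (auto simp: fin_seqs_def)
        from bchoice[OF this] obtain n where n: "\<And>l p. l < b \<Longrightarrow> p \<ge> n l \<Longrightarrow> \<alpha> l p = \<zero>" by auto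
        define f where "f q = (\<lambda>l\<in>{..<b}. if a l \<le> q then \<alpha> l (q - a l) else \<zero>)" for q
        have "f q \<in> shift_filt R I b a q" for q
          using \<alpha> P.rees_in P.rees_carrier
          by (auto simp: shift_filt_def f_def free_carrier)
        moreover have "f q = \<zero>\<^bsub>free_module R b\<^esub>" if q: "q \<ge> (\<Sum>l<b. n l + a l)" for q
        proof -
          have "\<alpha> l (q - a l) = \<zero>" if l: "l < b" for l
          proof (rule n[OF l])
            have "n l + a l \<le> (\<Sum>l<b. n l + a l)" using l by (intro member_le_sum) auto
            then show "n l \<le> q - a l" using q by simp
          qed
          then show ?thesis unfolding f_def free_zero by (intro restrict_ext) auto
        qed
        ultimately have fS: "f \<in> ?Seq" unfolding fin_seqs_def by blast
        have "(\<lambda>p. f (p + a l) l) = \<alpha> l" if "l < b" for l using that by (simp add: f_def)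
        then have "?cl f l = v l" if "l < b" for l using \<alpha> that by (simp add: free_class_def)
        then have "?cl f = v" using v unfolding Qc
          by (intro extensionalityI[of "?cl f" "{..<b}" v]) (auto simp: free_class_def)
        then show "v \<in> ?cl ` ?Seq" using fS by blast
      qed
    qed
    show "?cl (\<lambda>_. \<zero>\<^bsub>free_module R b\<^esub>) = \<zero>\<^bsub>free_module (gr_ring R I) b\<^esub>"
      unfolding free_class_def S.free_zero using P.cl_zero
      by (intro restrict_ext) (simp add: free_zero gr_ring_simps)
    show "?cl (\<lambda>p. f p \<oplus>\<^bsub>free_module R b\<^esub> g p) = ?cl f \<oplus>\<^bsub>free_module (gr_ring R I) b\<^esub> ?cl g"
      if f: "f \<in> ?Seq" and g: "g \<in> ?Seq" for f g
      unfolding S.free_add unfolding free_class_def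
      using P.cl_add[OF coord[OF f] coord[OF g]]
      by (intro restrict_ext) (simp add: free_add gr_ring_simps)
    show "?cl (conv (free_module R b) \<alpha> f) = rees_class R I \<alpha> \<odot>\<^bsub>free_module (gr_ring R I) b\<^esub> ?cl f"
      if \<alpha>: "\<alpha> \<in> rees R I" and f: "f \<in> ?Seq" for \<alpha> f
      unfolding S.free_smult unfolding free_class_def
    proof (intro restrict_ext)
      fix l assume "l \<in> {..<b}"
      then have l: "l < b" by simp
      let ?g = "\<lambda>p. f (p + a l) l" and ?h = "\<lambda>p. conv (free_module R b) \<alpha> f (p + a l) l"
      have ac: "\<alpha> i \<in> carrier R" for i by (rule P.rees_carrier[OF \<alpha>])
      have fc: "f i l \<in> carrier R" for i by (rule free_in[OF F.seq_carrier[OF f] l])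
      have cc: "conv (self_module R) \<alpha> ?g \<in> rees R I" by (rule P.conv_closed[OF \<alpha> coord[OF f l]])
      have hc: "?h \<in> rees R I" by (rule coord[OF F.conv_closed[OF \<alpha> f] l])
      have "rees_class R I ?h = rees_class R I (conv (self_module R) \<alpha> ?g)"
        unfolding P.cl_eq_iff[OF hc cc]
      proof
        fix p
        let ?t = "\<lambda>i. \<alpha> i \<otimes> f (p + a l - i) l"
        have "?h p = (\<Oplus>i\<in>{..p + a l}. (\<alpha> i \<odot>\<^bsub>free_module R b\<^esub> f (p + a l - i)) l)"
          unfolding conv_def using ac F.seq_carrier[OF f] l by (intro free_finsum_eq) auto
        also have "\<dots> = (\<Oplus>i\<in>{..p + a l}. ?t i)"
          using ac fc l by (intro finsum_cong') (auto simp: free_smult)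
        \<comment> \<open>The product in degree \<open>p + a l\<close> has \<open>a l\<close> more
          terms than the convolution of the shifted coordinates. In these terms
          \<open>\<alpha> i\<close> already lies in the power \<open>Suc p\<close>, so they vanish
          in the class.\<close>
        also have "{..p + a l} = {..p} \<union> {p<..p + a l}" by auto
        also have "(\<Oplus>i\<in>{..p} \<union> {p<..p + a l}. ?t i) = (\<Oplus>i\<in>{..p}. ?t i) \<oplus> (\<Oplus>i\<in>{p<..p + a l}. ?t i)"
          using ac fc by (intro finsum_Un_disjoint) auto
        also have "(\<Oplus>i\<in>{..p}. ?t i) = conv (self_module R) \<alpha> ?g p"
          unfolding conv_def self_finsum using ac fc by (intro finsum_cong') auto
        finally have h: "?h p = conv (self_module R) \<alpha> ?g p \<oplus> (\<Oplus>i\<in>{p<..p + a l}. ?t i)" .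
        have "(\<Oplus>\<^bsub>self_module R\<^esub>i\<in>{p<..p + a l}. ?t i) \<in> ideal_power R I (Suc p)"
        proof (rule submodule_finsum[OF P.G_sub])
          fix i assume "i \<in> {p<..p + a l}"
          then have "\<alpha> i \<in> ideal_power R I (Suc p)"
            using P.rees_in[OF \<alpha>, of i] ideal_power_antimono[OF I, of "Suc p" i] by auto
          then show "?t i \<in> ideal_power R I (Suc p)"
            using ideal.I_r_closed[OF ideal_power_ideal[OF I]] fc by blast
        qed simp
        then have "(\<Oplus>i\<in>{p<..p + a l}. ?t i) \<in> ideal_power R I (Suc p)" by (simp only: self_finsum)
        moreover have "?h p \<ominus>\<^bsub>self_module R\<^esub> conv (self_module R) \<alpha> ?g p = (\<Oplus>i\<in>{p<..p + a l}. ?t i)"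
          unfolding h using P.N.M.add_minus_left[of "conv (self_module R) \<alpha> ?g p" "\<Oplus>i\<in>{p<..p + a l}. ?t i"]
            P.rees_carrier[OF cc] ac fc by (simp add: Pi_iff)
        ultimately show "?h p \<ominus>\<^bsub>self_module R\<^esub> conv (self_module R) \<alpha> ?g p \<in> ideal_power R I (Suc p)" by simp
      qed
      then show "rees_class R I ?h = rees_class R I \<alpha> \<otimes>\<^bsub>gr_ring R I\<^esub> (\<lambda>l\<in>{..<b}. rees_class R I (\<lambda>p. f (p + a l) l)) l"
        using P.cl_smult[OF \<alpha> coord[OF f l]] l by (simp add: gr_ring_simps)
    qed
  qed (rule cl_eq)
qed

end

section \<open>Maps induced between associated graded modules\<close>

definition gr_induced :: "('a, 'b, 'm) module_scheme \<Rightarrow> (nat \<Rightarrow> 'b set) \<Rightarrow> ((nat \<Rightarrow> 'b) \<Rightarrow> 'q)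
    \<Rightarrow> ((nat \<Rightarrow> 'c) \<Rightarrow> 'p) \<Rightarrow> ('b \<Rightarrow> 'c) \<Rightarrow> 'q \<Rightarrow> 'p" where
  "gr_induced N G cl cl' \<phi> v = cl' (\<lambda>q. \<phi> ((SOME f. f \<in> fin_seqs N G \<and> cl f = v) q))"

locale gr_morphism = A: gr_presented R I N G Q cl + B: gr_presented R I N' G' Q' cl'
  for R :: "('a, 'r) ring_scheme" (structure) and I :: "'a set"
    and N :: "('a, 'b, 'm) module_scheme" and G and Q :: "(nat \<Rightarrow> 'a set, 'q, 'n) module_scheme" and cl
    and N' :: "('a, 'c, 'm2) module_scheme" and G' and Q' :: "(nat \<Rightarrow> 'a set, 'p, 'n2) module_scheme" and cl' +
  fixes \<phi>
  assumes \<phi>_hom: "\<phi> \<in> module_hom R N N'" and \<phi>_filt: "x \<in> G p \<Longrightarrow> \<phi> x \<in> G' p"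
begin

abbreviation "gr_map' \<equiv> gr_induced N G cl cl' \<phi>"

lemma \<phi>_seq: "f \<in> fin_seqs N G \<Longrightarrow> (\<lambda>q. \<phi> (f q)) \<in> fin_seqs N' G'"
  using \<phi>_filt module_hom_zero[OF A.N.module_axioms B.N.module_axioms \<phi>_hom]
  unfolding fin_seqs_def by fastforce

text \<open>Two lifts of a class differ in degree \<open>q\<close> by an element of
  \<open>G (Suc q)\<close>, which \<open>\<phi>\<close> maps into \<open>G' (Suc q)\<close>. So the
  lift chosen by \<open>SOME\<close> in \<open>gr_induced\<close> does not matter.\<close>

lemma gr_map_class:
  assumes f: "f \<in> fin_seqs N G"
  shows "gr_map' (cl f) = cl' (\<lambda>q. \<phi> (f q))"
proof -
  define g where "g = (SOME g. g \<in> fin_seqs N G \<and> cl g = cl f)"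
  have g: "g \<in> fin_seqs N G \<and> cl g = cl f" unfolding g_def by (rule someI[of _ f]) (simp add: f)
  have "\<phi> (g q) \<ominus>\<^bsub>N'\<^esub> \<phi> (f q) \<in> G' (Suc q)" for q
  proof -
    have "\<phi> (g q \<ominus>\<^bsub>N\<^esub> f q) \<in> G' (Suc q)" using g A.cl_eq_iff[of g f] f by (intro \<phi>_filt) blast
    then show ?thesis
      using module_hom_minus[OF A.N.module_axioms B.N.module_axioms \<phi>_hom] A.seq_carrier[OF f] A.seq_carrier g by simp
  qed
  then have "cl' (\<lambda>q. \<phi> (g q)) = cl' (\<lambda>q. \<phi> (f q))"
    using B.cl_eq_iff[OF \<phi>_seq \<phi>_seq] g f by blast
  then show ?thesis unfolding gr_induced_def g_def .
qed

lemma gr_map_hom: "gr_map' \<in> module_hom (gr_ring R I) Q Q'"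
proof (rule module_homI)
  fix x assume "x \<in> carrier Q"
  then obtain f where f: "f \<in> fin_seqs N G" "x = cl f" using A.cl_surj by blast
  show "gr_map' x \<in> carrier Q'" unfolding f(2) gr_map_class[OF f(1)] by (rule B.cl_closed[OF \<phi>_seq[OF f(1)]])
  fix y assume "y \<in> carrier Q"
  then obtain g where g: "g \<in> fin_seqs N G" "y = cl g" using A.cl_surj by blast
  have "gr_map' (x \<oplus>\<^bsub>Q\<^esub> y) = cl' (\<lambda>q. \<phi> (f q \<oplus>\<^bsub>N\<^esub> g q))"
    unfolding f g A.cl_add[OF f(1) g(1), symmetric] by (rule gr_map_class[OF A.seq_add[OF f(1) g(1)]])
  also have "\<dots> = cl' (\<lambda>q. \<phi> (f q) \<oplus>\<^bsub>N'\<^esub> \<phi> (g q))"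
    using module_hom_add[OF \<phi>_hom A.seq_carrier[OF f(1)] A.seq_carrier[OF g(1)]] by simp
  also have "\<dots> = gr_map' x \<oplus>\<^bsub>Q'\<^esub> gr_map' y"
    unfolding f g gr_map_class[OF f(1)] gr_map_class[OF g(1)] by (rule B.cl_add[OF \<phi>_seq[OF f(1)] \<phi>_seq[OF g(1)]])
  finally show "gr_map' (x \<oplus>\<^bsub>Q\<^esub> y) = gr_map' x \<oplus>\<^bsub>Q'\<^esub> gr_map' y" .
next
  fix r x assume "r \<in> carrier (gr_ring R I)" "x \<in> carrier Q"
  then obtain \<alpha> f where \<alpha>: "\<alpha> \<in> rees R I" "r = rees_class R I \<alpha>" and f: "f \<in> fin_seqs N G" "x = cl f"
    using A.cl_surj gr_presented.cl_surj[OF A.rees_presented[OF A.I_ideal]] unfolding gr_ring_simps by metis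
  have "gr_map' (r \<odot>\<^bsub>Q\<^esub> x) = cl' (\<lambda>q. \<phi> (conv N \<alpha> f q))"
    unfolding \<alpha> f A.cl_smult[OF \<alpha>(1) f(1), symmetric] by (rule gr_map_class[OF A.conv_closed[OF \<alpha>(1) f(1)]])
  also have "(\<lambda>q. \<phi> (conv N \<alpha> f q)) = conv N' \<alpha> (\<lambda>q. \<phi> (f q))"
  proof
    fix q
    have "\<phi> (conv N \<alpha> f q) = (\<Oplus>\<^bsub>N'\<^esub>p\<in>{..q}. \<phi> (\<alpha> p \<odot>\<^bsub>N\<^esub> f (q - p)))"
      unfolding conv_def using A.rees_carrier[OF \<alpha>(1)] A.seq_carrier[OF f(1)]
      by (intro module_hom_finsum[OF A.N.module_axioms B.N.module_axioms \<phi>_hom]) auto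
    also have "\<dots> = conv N' \<alpha> (\<lambda>q. \<phi> (f q)) q"
      unfolding conv_def using A.rees_carrier[OF \<alpha>(1)] A.seq_carrier[OF f(1)] module_hom_in[OF \<phi>_hom]
      by (intro B.N.M.finsum_cong') (auto simp: module_hom_smult[OF \<phi>_hom])
    finally show "\<phi> (conv N \<alpha> f q) = conv N' \<alpha> (\<lambda>q. \<phi> (f q)) q" .
  qed
  also have "cl' (conv N' \<alpha> (\<lambda>q. \<phi> (f q))) = r \<odot>\<^bsub>Q'\<^esub> gr_map' x"
    unfolding \<alpha>(2) f(2) gr_map_class[OF f(1)] by (rule B.cl_smult[OF \<alpha>(1) \<phi>_seq[OF f(1)]])
  finally show "gr_map' (r \<odot>\<^bsub>Q\<^esub> x) = r \<odot>\<^bsub>Q'\<^esub> gr_map' x" .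
qed

lemma gr_map_surj:
  assumes "\<And>p. \<phi> ` G p = G' p"
  shows "gr_map' ` carrier Q = carrier Q'"
proof
  show "gr_map' ` carrier Q \<subseteq> carrier Q'" using module_hom_in[OF gr_map_hom] by auto
  show "carrier Q' \<subseteq> gr_map' ` carrier Q"
  proof
    fix v assume "v \<in> carrier Q'"
    then obtain f where f: "f \<in> fin_seqs N' G'" "v = cl' f" using B.cl_surj by blast
    have "\<exists>x\<in>G q. \<phi> x = f q" for q using B.seq_in[OF f(1), of q] assms[of q] by (metis imageE)
    then obtain h where h: "\<And>q. h q \<in> G q \<and> \<phi> (h q) = f q" by metis
    \<comment> \<open>Arbitrary preimages \<open>h q\<close> need not vanish for large
      \<open>q\<close>; resetting them where \<open>f q\<close> is zero keeps the sequence
      finite.\<close>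
    define g where "g q = (if f q = \<zero>\<^bsub>N'\<^esub> then \<zero>\<^bsub>N\<^esub> else h q)" for q
    have "g \<in> fin_seqs N G"
      using f(1) h submodule_zero[OF A.G_sub] unfolding fin_seqs_def g_def by auto
    moreover have "(\<lambda>q. \<phi> (g q)) = f"
      using h module_hom_zero[OF A.N.module_axioms B.N.module_axioms \<phi>_hom] by (auto simp: g_def)
    ultimately show "v \<in> gr_map' ` carrier Q" using gr_map_class[of g] A.cl_closed[of g] f(2) by force
  qed
qed

end

text \<open>Strictness of \<open>\<psi>\<close> allows to correct a lift of a cycle of the associated graded complex to an actual cycle.\<close>

lemma gr_exact:
  assumes \<phi>: "gr_morphism R I N G Q cl N' G' Q' cl' \<phi>" and \<psi>: "gr_morphism R I N' G' Q' cl' N'' G'' Q'' cl'' \<psi>"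
    and exact: "\<And>p. \<phi> ` G p = {x \<in> G' p. \<psi> x = \<zero>\<^bsub>N''\<^esub>}"
    and strict: "\<And>p x. x \<in> G' p \<Longrightarrow> \<psi> x \<in> G'' (Suc p) \<Longrightarrow> \<exists>y\<in>G' (Suc p). \<psi> y = \<psi> x"
  shows "{v \<in> carrier Q'. gr_induced N' G' cl' cl'' \<psi> v = \<zero>\<^bsub>Q''\<^esub>} = gr_induced N G cl cl' \<phi> ` carrier Q"
proof
  interpret \<phi>: gr_morphism R I N G Q cl N' G' Q' cl' \<phi> by fact
  interpret \<psi>: gr_morphism R I N' G' Q' cl' N'' G'' Q'' cl'' \<psi> by fact
  show "\<phi>.gr_map' ` carrier Q \<subseteq> {v \<in> carrier Q'. \<psi>.gr_map' v = \<zero>\<^bsub>Q''\<^esub>}"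
  proof clarify
    fix u assume u: "u \<in> carrier Q"
    then obtain f where f: "f \<in> fin_seqs N G" "u = cl f" using \<phi>.A.cl_surj by blast
    have "\<psi> (\<phi> (f q)) = \<zero>\<^bsub>N''\<^esub>" for q using exact[of q] \<phi>.A.seq_in[OF f(1), of q] by blast
    then have "\<psi>.gr_map' (\<phi>.gr_map' u) = \<zero>\<^bsub>Q''\<^esub>"
      unfolding f(2) \<phi>.gr_map_class[OF f(1)] \<psi>.gr_map_class[OF \<phi>.\<phi>_seq[OF f(1)]] using \<psi>.B.cl_zero by simp
    then show "\<phi>.gr_map' u \<in> carrier Q' \<and> \<psi>.gr_map' (\<phi>.gr_map' u) = \<zero>\<^bsub>Q''\<^esub>"
      using module_hom_in[OF \<phi>.gr_map_hom u] by simp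
  qed
  show "{v \<in> carrier Q'. \<psi>.gr_map' v = \<zero>\<^bsub>Q''\<^esub>} \<subseteq> \<phi>.gr_map' ` carrier Q"
  proof
    fix v assume "v \<in> {v \<in> carrier Q'. \<psi>.gr_map' v = \<zero>\<^bsub>Q''\<^esub>}"
    then have v: "v \<in> carrier Q'" "\<psi>.gr_map' v = \<zero>\<^bsub>Q''\<^esub>" by auto
    obtain f where f: "f \<in> fin_seqs N' G'" "v = cl' f" using v \<phi>.B.cl_surj by blast
    have "\<psi> (f q) \<in> G'' (Suc q)" for q
      using v(2) \<psi>.B.cl_eq_zero[OF \<psi>.\<phi>_seq[OF f(1)]] unfolding f(2) \<psi>.gr_map_class[OF f(1)] by blast
    \<comment> \<open>Strictness supplies \<open>y\<close> one step deeper with the same image as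
      \<open>f q\<close>; the difference of \<open>f q\<close> and \<open>y\<close> is a genuine
      cycle in step \<open>q\<close> and is therefore hit by some \<open>x\<close> in
      \<open>G q\<close>.\<close>
    then have "\<exists>x\<in>G q. f q \<ominus>\<^bsub>N'\<^esub> \<phi> x \<in> G' (Suc q)" for q
    proof -
      assume *: "\<And>q. \<psi> (f q) \<in> G'' (Suc q)"
      obtain y where y: "y \<in> G' (Suc q)" "\<psi> y = \<psi> (f q)" using strict[OF \<phi>.B.seq_in[OF f(1)] *] by blast
      have yq: "y \<in> G' q" using y(1) \<phi>.B.G_Suc by blast
      have fc: "f q \<in> carrier N'" "y \<in> carrier N'" using \<phi>.B.seq_carrier[OF f(1)] \<phi>.B.G_in[OF yq] by auto
      have "f q \<ominus>\<^bsub>N'\<^esub> y \<in> G' q" by (rule submodule_minus[OF \<phi>.B.G_sub \<phi>.B.seq_in[OF f(1)] yq])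
      moreover have "\<psi> (f q \<ominus>\<^bsub>N'\<^esub> y) = \<zero>\<^bsub>N''\<^esub>"
        using module_hom_minus[OF \<phi>.B.N.module_axioms \<psi>.B.N.module_axioms \<psi>.\<phi>_hom fc] y(2)
          module_hom_in[OF \<psi>.\<phi>_hom fc(1)] by simp
      ultimately obtain x where x: "x \<in> G q" "f q \<ominus>\<^bsub>N'\<^esub> y = \<phi> x" using exact[of q] by blast
      have "f q = y \<oplus>\<^bsub>N'\<^esub> \<phi> x" unfolding x(2)[symmetric] using fc by (simp add: \<phi>.B.N.M.add_minus_right)
      then have "f q \<ominus>\<^bsub>N'\<^esub> \<phi> x = y"
        using fc x(2) \<phi>.B.N.M.add_minus_left[of "\<phi> x" y] \<phi>.B.N.M.minus_closed[OF fc] by (simp add: \<phi>.B.N.M.a_comm)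
      then show "\<exists>x\<in>G q. f q \<ominus>\<^bsub>N'\<^esub> \<phi> x \<in> G' (Suc q)" using x(1) y(1) by auto
    qed
    then obtain h where h: "\<And>q. h q \<in> G q" "\<And>q. f q \<ominus>\<^bsub>N'\<^esub> \<phi> (h q) \<in> G' (Suc q)" by metis
    define g where "g q = (if f q = \<zero>\<^bsub>N'\<^esub> then \<zero>\<^bsub>N\<^esub> else h q)" for q
    have g: "g \<in> fin_seqs N G"
      using f(1) h(1) submodule_zero[OF \<phi>.A.G_sub] unfolding fin_seqs_def g_def by auto
    have "f q \<ominus>\<^bsub>N'\<^esub> \<phi> (g q) \<in> G' (Suc q)" for q
      using h(2)[of q] module_hom_zero[OF \<phi>.A.N.module_axioms \<phi>.B.N.module_axioms \<phi>.\<phi>_hom]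
        submodule_minus[OF \<phi>.B.G_sub submodule_zero[OF \<phi>.B.G_sub] submodule_zero[OF \<phi>.B.G_sub], of "Suc q"]
      by (auto simp: g_def)
    then have "v = \<phi>.gr_map' (cl g)"
      unfolding f(2) \<phi>.gr_map_class[OF g] using \<phi>.B.cl_eq_iff[OF f(1) \<phi>.\<phi>_seq[OF g]] by blast
    then show "v \<in> \<phi>.gr_map' ` carrier Q" using \<phi>.A.cl_closed[OF g] by blast
  qed
qed

section \<open>The associated graded resolution\<close>

context filtered_resolution
begin

abbreviation "Sg \<equiv> gr_ring R \<mm>"
abbreviation "Mg \<equiv> gr_module M F"
abbreviation "Ng n \<equiv> free_module R (rk n)"
abbreviation "Gg n \<equiv> shift_filt R \<mm> (rk n) (sh n)"
abbreviation "clg n \<equiv> free_class R \<mm> (rk n) (sh n)"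

lemma M_filtered: "filtered_mod R \<mm> M F"
  using is_cring M_module \<mm>_ideal F_sub F_Suc F_power
  unfolding filtered_mod_def filtered_mod_axioms_def by auto

lemma Sg_cring: "cring Sg" by (rule gr_ring_cring[OF \<mm>_ideal])

lemma M_presented: "gr_presented R \<mm> M F Mg (seq_class M F)"
  by (rule filtered_mod.gr_module_presented[OF M_filtered])

lemma C_presented: "gr_presented R \<mm> (Ng n) (Gg n) (free_module Sg (rk n)) (clg n)"
  by (rule free_presented[OF \<mm>_ideal])

lemma \<epsilon>_morphism: "gr_morphism R \<mm> (Ng 0) (Gg 0) (free_module Sg (rk 0)) (clg 0) M F Mg (seq_class M F) \<epsilon>"
  using C_presented M_presented \<epsilon>_hom \<epsilon>_filt by (intro gr_morphism.intro gr_morphism_axioms.intro) auto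

lemma \<delta>_filt': "x \<in> Gg (Suc n) p \<Longrightarrow> \<delta> (Suc n) x \<in> Gg n p"
proof -
  assume x: "x \<in> Gg (Suc n) p"
  then have "\<delta> (Suc n) x \<in> \<delta> (Suc n) ` Gg (Suc n) p" by (rule imageI)
  then show "\<delta> (Suc n) x \<in> Gg n p"
  proof (cases n)
    case 0
    with \<open>\<delta> (Suc n) x \<in> _\<close> show ?thesis by (simp only: \<delta>_1_filt mem_Collect_eq)
  next
    case (Suc m)
    with \<open>\<delta> (Suc n) x \<in> _\<close> show ?thesis by (simp only: \<delta>_filt mem_Collect_eq)
  qed
qed

lemma \<delta>_morphism: "gr_morphism R \<mm> (Ng (Suc n)) (Gg (Suc n)) (free_module Sg (rk (Suc n))) (clg (Suc n))
    (Ng n) (Gg n) (free_module Sg (rk n)) (clg n) (\<delta> (Suc n))"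
  using C_presented \<delta>_hom \<delta>_filt' by (intro gr_morphism.intro gr_morphism_axioms.intro) auto

definition gr_diff :: "nat \<Rightarrow> (nat \<Rightarrow> nat \<Rightarrow> 'a set) \<Rightarrow> nat \<Rightarrow> nat \<Rightarrow> 'a set" where
  "gr_diff n = gr_induced (Ng n) (Gg n) (clg n) (clg (n - 1)) (\<delta> n)"

definition gr_eps :: "(nat \<Rightarrow> nat \<Rightarrow> 'a set) \<Rightarrow> nat \<Rightarrow> 'b set" where
  "gr_eps = gr_induced (Ng 0) (Gg 0) (clg 0) (seq_class M F) \<epsilon>"

definition gr_cplx :: "(nat \<Rightarrow> 'a set, nat \<Rightarrow> nat \<Rightarrow> 'a set) chain_complex" where
  "gr_cplx = \<lparr>obj = \<lambda>n. free_module Sg (rk n), differential = gr_diff\<rparr>"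

lemma gr_cplx_simps [simp]: "obj gr_cplx n = free_module Sg (rk n)" "differential gr_cplx = gr_diff"
  by (simp_all add: gr_cplx_def)

lemma gr_diff_Suc: "gr_diff (Suc n) = gr_induced (Ng (Suc n)) (Gg (Suc n)) (clg (Suc n)) (clg n) (\<delta> (Suc n))"
  by (simp add: gr_diff_def)

lemma gr_diff_hom: "gr_diff (Suc n) \<in> module_hom Sg (free_module Sg (rk (Suc n))) (free_module Sg (rk n))"
  unfolding gr_diff_Suc by (rule gr_morphism.gr_map_hom[OF \<delta>_morphism])

lemma gr_eps_hom: "gr_eps \<in> module_hom Sg (free_module Sg (rk 0)) Mg"
  unfolding gr_eps_def by (rule gr_morphism.gr_map_hom[OF \<epsilon>_morphism])

lemma gr_eps_surj: "gr_eps ` carrier (free_module Sg (rk 0)) = carrier Mg"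
  unfolding gr_eps_def by (rule gr_morphism.gr_map_surj[OF \<epsilon>_morphism \<epsilon>_filt])

lemma gr_exact_0:
  "{v \<in> carrier (free_module Sg (rk 0)). gr_eps v = \<zero>\<^bsub>Mg\<^esub>} = gr_diff (Suc 0) ` carrier (free_module Sg (rk (Suc 0)))"
  unfolding gr_eps_def gr_diff_Suc
proof (rule gr_exact[OF \<delta>_morphism \<epsilon>_morphism \<delta>_1_filt])
  fix p x assume "x \<in> Gg 0 p" "\<epsilon> x \<in> F (Suc p)"
  then show "\<exists>y\<in>Gg 0 (Suc p). \<epsilon> y = \<epsilon> x" using \<epsilon>_filt[of "Suc p"] by (metis imageE)
qed

lemma \<delta>_\<delta>: "x \<in> carrier (Ng (Suc (Suc n))) \<Longrightarrow> \<delta> (Suc n) (\<delta> (Suc (Suc n)) x) = \<zero>\<^bsub>Ng n\<^esub>"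
  using \<delta>_filt[of n 0] by (auto simp: shift_filt_0)

lemma \<epsilon>_\<delta>: "x \<in> carrier (Ng (Suc 0)) \<Longrightarrow> \<epsilon> (\<delta> (Suc 0) x) = \<zero>\<^bsub>M\<^esub>"
  using \<delta>_1_filt[of 0] by (auto simp: shift_filt_0)

lemma gr_exact_Suc:
  "{v \<in> carrier (free_module Sg (rk (Suc n))). gr_diff (Suc n) v = \<zero>\<^bsub>free_module Sg (rk n)\<^esub>}
    = gr_diff (Suc (Suc n)) ` carrier (free_module Sg (rk (Suc (Suc n))))"
  unfolding gr_diff_Suc
proof (rule gr_exact[OF \<delta>_morphism \<delta>_morphism \<delta>_filt])
  fix p x assume x: "x \<in> Gg (Suc n) p" and dx: "\<delta> (Suc n) x \<in> Gg n (Suc p)"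
  \<comment> \<open>Strictness comes from the filtration equalities:
    \<open>\<delta> (Suc n) x\<close> is annihilated by the following map and lies in step
    \<open>Suc p\<close>, so it is also the image of an element of step
    \<open>Suc p\<close>.\<close>
  show "\<exists>y\<in>Gg (Suc n) (Suc p). \<delta> (Suc n) y = \<delta> (Suc n) x"
  proof (cases n)
    case 0
    then have "\<delta> (Suc n) x \<in> \<delta> (Suc 0) ` Gg (Suc 0) (Suc p)"
      unfolding \<delta>_1_filt using dx \<epsilon>_\<delta> shift_filt_in[OF x] by simp
    then show ?thesis using 0 by auto
  next
    case (Suc m)
    then have "\<delta> (Suc n) x \<in> \<delta> (Suc (Suc m)) ` Gg (Suc (Suc m)) (Suc p)"
      unfolding \<delta>_filt using dx \<delta>_\<delta> shift_filt_in[OF x] by simp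
    then show ?thesis using Suc by auto
  qed
qed

lemma gr_zero_map:
  "gr_eps \<zero>\<^bsub>free_module Sg (rk 0)\<^esub> = \<zero>\<^bsub>Mg\<^esub>"
proof -
  interpret E: gr_morphism R \<mm> "Ng 0" "Gg 0" "free_module Sg (rk 0)" "clg 0" M F Mg "seq_class M F" \<epsilon>
    by (rule \<epsilon>_morphism)
  show ?thesis
    unfolding gr_eps_def E.A.cl_zero[symmetric] E.gr_map_class[OF E.A.seq_zero]
    using module_hom_zero[OF free_module M_module \<epsilon>_hom] E.B.cl_zero by simp
qed

text \<open>The module laws of the associated graded module are inherited from a free module over
  \<open>Sg\<close> through the surjection \<open>gr_eps\<close>.\<close>

lemma Mg_module: "module Sg Mg"
proof (rule image_module[OF cring.free_module[OF Sg_cring] gr_eps_surj])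
  show "gr_eps (x \<oplus>\<^bsub>free_module Sg (rk 0)\<^esub> y) = gr_eps x \<oplus>\<^bsub>Mg\<^esub> gr_eps y"
    if "x \<in> carrier (free_module Sg (rk 0))" "y \<in> carrier (free_module Sg (rk 0))" for x y
    by (rule module_hom_add[OF gr_eps_hom that])
  show "gr_eps (r \<odot>\<^bsub>free_module Sg (rk 0)\<^esub> x) = r \<odot>\<^bsub>Mg\<^esub> gr_eps x"
    if "r \<in> carrier Sg" "x \<in> carrier (free_module Sg (rk 0))" for r x
    by (rule module_hom_smult[OF gr_eps_hom that])
qed (rule gr_zero_map)

lemma gr_free_res: "free_res Sg Mg gr_cplx gr_eps rk"
proof -
  have "resolution Sg Mg gr_cplx gr_eps"
    unfolding resolution_def
  proof (intro conjI allI)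
    show "cycles gr_cplx (Suc n) = boundaries gr_cplx (Suc n)" for n
      using gr_exact_Suc by (simp add: cycles_def boundaries_def)
    show "{x \<in> carrier (obj gr_cplx 0). gr_eps x = \<zero>\<^bsub>Mg\<^esub>} = boundaries gr_cplx 0"
      using gr_exact_0 by (simp add: boundaries_def)
  qed (use gr_diff_hom gr_eps_hom gr_eps_surj in auto)
  then show ?thesis using Sg_cring Mg_module by (simp add: free_res_def free_res_axioms_def)
qed

lemma irrelevant_class_iff:
  assumes "\<alpha> \<in> rees R \<mm>"
  shows "rees_class R \<mm> \<alpha> \<in> gr_irrelevant R \<mm> \<longleftrightarrow> \<alpha> 0 \<in> \<mm>"
proof -
  interpret P: gr_presented R \<mm> "self_module R" "ideal_power R \<mm>"
    "gr_module (self_module R) (ideal_power R \<mm>)" "rees_class R \<mm>" by (rule rees_presented[OF \<mm>_ideal])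
  have "rees_class R \<mm> \<alpha> 0 = \<zero>\<^bsub>Sg\<^esub> 0 \<longleftrightarrow> \<alpha> 0 \<in> ideal_power R \<mm> (Suc 0)"
    using P.N.coset_eq_B[OF P.G_sub[of "Suc 0"], of "\<alpha> 0"] P.rees_carrier[OF assms]
    by (simp only: seq_class_def gr_ring_simps gr_module_def module.simps ring.simps self_module_simps)
  then show ?thesis using P.cl_closed[OF assms] ideal_power_Suc_0[OF \<mm>_ideal]
    by (simp add: gr_irrelevant_def gr_ring_simps)
qed

text \<open>An element outside the ideal has a unit as constant term. Multiplied by a constant
  inverse to it and corrected by some \<open>\<gamma>\<close> without constant term, it becomes one;
  so a properly larger ideal contains one.\<close>

lemma irrelevant_maximal: "maximalideal (gr_irrelevant R \<mm>) Sg"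
proof -
  interpret P: gr_presented R \<mm> "self_module R" "ideal_power R \<mm>"
    "gr_module (self_module R) (ideal_power R \<mm>)" "rees_class R \<mm>" by (rule rees_presented[OF \<mm>_ideal])
  interpret S: cring Sg by (rule Sg_cring)
  let ?J = "gr_irrelevant R \<mm>"
  have rep: "\<exists>\<alpha>\<in>rees R \<mm>. rees_class R \<mm> \<alpha> = a" if "a \<in> carrier Sg" for a
    using P.cl_surj[of a] that by (simp add: gr_ring_simps)
  have mult: "rees_class R \<mm> \<alpha> \<otimes>\<^bsub>Sg\<^esub> rees_class R \<mm> \<beta> = rees_class R \<mm> (conv (self_module R) \<alpha> \<beta>)"
    if "\<alpha> \<in> rees R \<mm>" "\<beta> \<in> rees R \<mm>" for \<alpha> \<beta> using P.cl_smult[OF that] by (simp add: gr_ring_simps)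
  have conv0: "conv (self_module R) \<alpha> \<beta> 0 = \<alpha> 0 \<otimes> \<beta> 0" if "\<alpha> \<in> rees R \<mm>" "\<beta> \<in> rees R \<mm>" for \<alpha> \<beta>
    using P.rees_carrier[OF that(1)] P.rees_carrier[OF that(2)] by (simp add: conv_def)
  have J: "ideal ?J Sg"
  proof (rule S.idealI')
    show sub: "?J \<subseteq> carrier Sg" by (auto simp: gr_irrelevant_def)
    show "\<zero>\<^bsub>Sg\<^esub> \<in> ?J" by (simp add: gr_irrelevant_def)
    fix x y assume x: "x \<in> ?J" and y: "y \<in> ?J"
    obtain \<alpha> where \<alpha>: "\<alpha> \<in> rees R \<mm>" "x = rees_class R \<mm> \<alpha>" using rep[OF subsetD[OF sub x]] by auto
    obtain \<beta> where \<beta>: "\<beta> \<in> rees R \<mm>" "y = rees_class R \<mm> \<beta>" using rep[OF subsetD[OF sub y]] by auto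
    have "x \<oplus>\<^bsub>Sg\<^esub> y = rees_class R \<mm> (\<lambda>p. \<alpha> p \<oplus> \<beta> p)" using P.cl_add[OF \<alpha>(1) \<beta>(1)] \<alpha>(2) \<beta>(2) by (simp add: gr_ring_simps)
    moreover have "(\<lambda>p. \<alpha> p \<oplus> \<beta> p) \<in> rees R \<mm>" using P.seq_add[OF \<alpha>(1) \<beta>(1)] by simp
    moreover have "\<alpha> 0 \<oplus> \<beta> 0 \<in> \<mm>" using x y \<alpha> \<beta> irrelevant_class_iff a_closed by auto
    ultimately show "x \<oplus>\<^bsub>Sg\<^esub> y \<in> ?J" using irrelevant_class_iff by simp
  next
    fix r y assume r: "r \<in> carrier Sg" and y: "y \<in> ?J"
    then have "y \<in> carrier Sg" by (simp add: gr_irrelevant_def)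
    then obtain \<beta> where \<beta>: "\<beta> \<in> rees R \<mm>" "y = rees_class R \<mm> \<beta>" using rep[of y] by auto
    obtain \<alpha> where \<alpha>: "\<alpha> \<in> rees R \<mm>" "r = rees_class R \<mm> \<alpha>" using rep[OF r] by auto
    have "\<alpha> 0 \<otimes> \<beta> 0 \<in> \<mm>" using y \<beta> irrelevant_class_iff P.rees_carrier[OF \<alpha>(1)] I_l_closed by auto
    then show "r \<otimes>\<^bsub>Sg\<^esub> y \<in> ?J"
      unfolding \<alpha>(2) \<beta>(2) mult[OF \<alpha>(1) \<beta>(1)] irrelevant_class_iff[OF P.conv_closed[OF \<alpha>(1) \<beta>(1)]] conv0[OF \<alpha>(1) \<beta>(1)] .
  qed
  have one_seq: "single_seq (self_module R) 0 c \<in> rees R \<mm>" if "c \<in> carrier R" for c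
    using that by (intro P.single_seq_closed) simp
  have one: "\<one>\<^bsub>Sg\<^esub> = rees_class R \<mm> (single_seq (self_module R) 0 \<one>)"
    by (simp add: gr_ring_simps single_seq_def cong: if_cong)
  have one_notin_J: "\<one>\<^bsub>Sg\<^esub> \<notin> ?J"
    unfolding one irrelevant_class_iff[OF one_seq[OF one_closed]] using one_notin by (simp add: single_seq_def)
  show ?thesis
  proof (rule maximalidealI[OF J])
    show "carrier Sg \<noteq> ?J" using one_notin_J by auto
    fix K assume K: "ideal K Sg" "?J \<subseteq> K" "K \<subseteq> carrier Sg"
    interpret K: ideal K Sg by fact
    show "K = ?J \<or> K = carrier Sg"
    proof (cases "K = ?J")
      case False
      then obtain y where y: "y \<in> K" "y \<notin> ?J" using K(2) by blast
      obtain \<beta> where \<beta>: "\<beta> \<in> rees R \<mm>" "y = rees_class R \<mm> \<beta>" using rep[of y] y K(3) by blast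
      have "\<beta> 0 \<notin> \<mm>" using y(2) \<beta> irrelevant_class_iff by blast
      then obtain c where c: "c \<in> carrier R" "c \<otimes> \<beta> 0 = \<one>" using in_max_or_unit P.rees_carrier[OF \<beta>(1)] by blast
      let ?c = "single_seq (self_module R) 0 c"
      have cy: "rees_class R \<mm> ?c \<otimes>\<^bsub>Sg\<^esub> y \<in> K"
        using K.I_l_closed[OF y(1)] P.cl_closed[OF one_seq[OF c(1)]] by (simp add: gr_ring_simps)
      have cyc: "rees_class R \<mm> ?c \<otimes>\<^bsub>Sg\<^esub> y = rees_class R \<mm> (conv (self_module R) ?c \<beta>)"
        unfolding \<beta>(2) by (rule mult[OF one_seq[OF c(1)] \<beta>(1)])
      define \<gamma> where "\<gamma> = (\<lambda>p. if p = 0 then \<zero> else \<ominus> (conv (self_module R) ?c \<beta> p))"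
      have conv_c: "conv (self_module R) ?c \<beta> \<in> rees R \<mm>" by (rule P.conv_closed[OF one_seq[OF c(1)] \<beta>(1)])
      have \<gamma>: "\<gamma> \<in> rees R \<mm>"
      proof -
        obtain n where "\<And>p. p \<ge> n \<Longrightarrow> conv (self_module R) ?c \<beta> p = \<zero>" using conv_c by (auto simp: fin_seqs_def)
        then have "\<forall>p\<ge>n. \<gamma> p = \<zero>" by (simp add: \<gamma>_def)
        moreover have "\<gamma> p \<in> ideal_power R \<mm> p" for p
          using P.seq_in[OF conv_c, of p] additive_subgroup.a_inv_closed[OF ideal.axioms(1)[OF ideal_power_ideal[OF \<mm>_ideal]]]
          by (auto simp: \<gamma>_def)
        ultimately show ?thesis by (auto simp: fin_seqs_def)
      qed
      have "\<gamma> 0 \<in> \<mm>" using additive_subgroup.zero_closed[OF is_additive_subgroup] by (simp add: \<gamma>_def)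
      then have gJ: "rees_class R \<mm> \<gamma> \<in> K" using irrelevant_class_iff[OF \<gamma>] K(2) by blast
      have "(\<lambda>p. conv (self_module R) ?c \<beta> p \<oplus> \<gamma> p) = single_seq (self_module R) 0 \<one>"
      proof
        fix p
        have "conv (self_module R) ?c \<beta> p \<in> carrier R" by (rule P.rees_carrier[OF conv_c])
        moreover have "conv (self_module R) ?c \<beta> 0 = \<one>"
          using conv0[OF one_seq[OF c(1)] \<beta>(1)] c(2) by (simp add: single_seq_def)
        ultimately show "conv (self_module R) ?c \<beta> p \<oplus> \<gamma> p = single_seq (self_module R) 0 \<one> p"
          by (simp add: \<gamma>_def single_seq_def r_neg)
      qed
      then have "rees_class R \<mm> ?c \<otimes>\<^bsub>Sg\<^esub> y \<oplus>\<^bsub>Sg\<^esub> rees_class R \<mm> \<gamma> = \<one>\<^bsub>Sg\<^esub>"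
        unfolding cyc one using P.cl_add[OF conv_c \<gamma>] by (simp add: gr_ring_simps)
      then have "\<one>\<^bsub>Sg\<^esub> \<in> K" using K.a_closed[OF cy gJ] by simp
      then show ?thesis using K.one_imp_carrier by simp
    qed simp
  qed
qed

text \<open>Minimality of the chosen generators makes the associated graded resolution minimal.\<close>

lemma free_class_irrelevant:
  assumes f: "f \<in> fin_seqs (Ng n) (Gg n)" and l: "l < rk n"
  shows "clg n f l \<in> gr_irrelevant R \<mm> \<longleftrightarrow> f (sh n l) l \<in> \<mm>"
proof -
  have "f (p + sh n l) l \<in> ideal_power R \<mm> p" for p
  proof -
    have "f (p + sh n l) l \<in> ideal_power R \<mm> (p + sh n l - sh n l)"
      using f l unfolding shift_filt_def fin_seqs_def by blast
    then show ?thesis by (simp only: add_diff_cancel_right')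
  qed
  moreover obtain m where "\<forall>p\<ge>m. f p = \<zero>\<^bsub>Ng n\<^esub>" using f by (auto simp: fin_seqs_def)
  then have "\<forall>p\<ge>m. f (p + sh n l) l = \<zero>" using l by (simp add: free_zero)
  ultimately have "(\<lambda>p. f (p + sh n l) l) \<in> rees R \<mm>" unfolding fin_seqs_def by auto
  from irrelevant_class_iff[OF this] show ?thesis using l by (simp add: free_class_def)
qed

text \<open>The constant term of coordinate \<open>l\<close> of a class is represented by
  \<open>f (sh n l) l\<close>. For a boundary, the vector \<open>f (sh n l)\<close> is sent to zero,
  in particular into the next filtration step, so \<open>\<epsilon>_min\<close> or
  \<open>\<delta>_min\<close> in degree \<open>sh n l\<close> puts this entry into
  \<open>\<mm>\<close>.\<close>

lemma gr_boundaries_minimal: "boundaries gr_cplx n \<subseteq> ideal_part Sg (gr_irrelevant R \<mm>) gr_cplx n"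
proof
  interpret D: gr_morphism R \<mm> "Ng (Suc n)" "Gg (Suc n)" "free_module Sg (rk (Suc n))" "clg (Suc n)"
    "Ng n" "Gg n" "free_module Sg (rk n)" "clg n" "\<delta> (Suc n)" by (rule \<delta>_morphism)
  interpret S: cring Sg by (rule Sg_cring)
  fix v assume "v \<in> boundaries gr_cplx n"
  then obtain w where w: "w \<in> carrier (free_module Sg (rk (Suc n)))" "v = gr_diff (Suc n) w"
    by (auto simp: boundaries_def)
  obtain h where h: "h \<in> fin_seqs (Ng (Suc n)) (Gg (Suc n))" "w = clg (Suc n) h" using D.A.cl_surj[OF w(1)] by blast
  define f where "f = (\<lambda>q. \<delta> (Suc n) (h q))"
  have f: "f \<in> fin_seqs (Ng n) (Gg n)" unfolding f_def by (rule D.\<phi>_seq[OF h(1)])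
  have v: "v = clg n f" unfolding w(2) h(2) gr_diff_Suc D.gr_map_class[OF h(1)] f_def ..
  have "f (sh n l) l \<in> \<mm>" if l: "l < rk n" for l
  proof (cases n)
    case 0
    have "\<epsilon> (f (sh n l)) = \<zero>\<^bsub>M\<^esub>" unfolding f_def 0 by (rule \<epsilon>_\<delta>) (rule D.A.seq_carrier[OF h(1), unfolded 0])
    then have e: "\<epsilon> (f (sh n l)) \<in> F (Suc (sh n l))" by (simp only: submodule_zero[OF F_sub])
    show ?thesis
      by (rule \<epsilon>_min[OF D.B.seq_in[OF f, of "sh n l", unfolded 0] e[unfolded 0] l[unfolded 0] refl, folded 0])
  next
    case (Suc m)
    have "\<delta> (Suc m) (f (sh n l)) = \<zero>\<^bsub>Ng m\<^esub>"
      unfolding f_def Suc by (rule \<delta>_\<delta>) (rule D.A.seq_carrier[OF h(1), unfolded Suc])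
    then have e: "\<delta> (Suc m) (f (sh n l)) \<in> Gg m (Suc (sh n l))"
      by (simp only: submodule_zero[OF shift_filt_submodule[OF \<mm>_ideal]])
    show ?thesis
      by (rule \<delta>_min[OF D.B.seq_in[OF f, of "sh n l", unfolded Suc] e[unfolded Suc] l[unfolded Suc] refl, folded Suc])
  qed
  then have "\<forall>l<rk n. v l \<in> gr_irrelevant R \<mm>" unfolding v using free_class_irrelevant[OF f] by blast
  then show "v \<in> ideal_part Sg (gr_irrelevant R \<mm>) gr_cplx n"
    using S.free_ideal_smult_iff[of "gr_irrelevant R \<mm>" v "rk n"] irrelevant_maximal D.B.cl_closed[OF f] v
    by (simp add: ideal_part_def maximalideal_def)
qed

end

section \<open>Gradings\<close>

text \<open>A direct sum decomposition is encoded by the projections \<open>\<pi> j\<close> and an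
  induction principle over sums of homogeneous elements, so that decompositions of single elements
  never have to be written down.\<close>

locale graded_group = abelian_group X for X :: "('x, 'm) ring_scheme" (structure) +
  fixes gX :: "int \<Rightarrow> 'x set" and \<pi> :: "int \<Rightarrow> 'x \<Rightarrow> 'x"
  assumes grad_sub: "x \<in> gX j \<Longrightarrow> x \<in> carrier X"
    and proj_in: "x \<in> carrier X \<Longrightarrow> \<pi> j x \<in> gX j"
    and proj_add: "x \<in> carrier X \<Longrightarrow> y \<in> carrier X \<Longrightarrow> \<pi> j (x \<oplus> y) = \<pi> j x \<oplus> \<pi> j y"
    and proj_grad: "x \<in> gX i \<Longrightarrow> \<pi> j x = (if i = j then x else \<zero>)"
    and grad_induct: "x \<in> carrier X \<Longrightarrow> \<zero> \<in> K \<Longrightarrow> (\<And>j. gX j \<subseteq> K) \<Longrightarrow>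
      (\<And>x y. x \<in> carrier X \<Longrightarrow> y \<in> carrier X \<Longrightarrow> x \<in> K \<Longrightarrow> y \<in> K \<Longrightarrow> x \<oplus> y \<in> K) \<Longrightarrow> x \<in> K"
begin

lemma proj_closed: "x \<in> carrier X \<Longrightarrow> \<pi> j x \<in> carrier X"
  by (rule grad_sub[OF proj_in])

lemma proj_zero: "\<pi> j \<zero> = \<zero>"
proof -
  have "\<pi> j \<zero> \<oplus> \<pi> j \<zero> = \<pi> j \<zero> \<oplus> \<zero>" using proj_add[of \<zero> \<zero> j] proj_closed[of \<zero> j] by simp
  then show ?thesis using proj_closed[of \<zero> j] by simp
qed

lemma in_gradI: "x \<in> carrier X \<Longrightarrow> \<pi> j x = x \<Longrightarrow> x \<in> gX j"
  using proj_in by metis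

lemma grad_zero: "\<zero> \<in> gX j"
  by (rule in_gradI) (simp_all add: proj_zero)

lemma grad_add: "x \<in> gX j \<Longrightarrow> y \<in> gX j \<Longrightarrow> x \<oplus> y \<in> gX j"
  by (rule in_gradI) (simp_all add: proj_add proj_grad grad_sub)

lemma grad_inv:
  assumes x: "x \<in> gX j"
  shows "\<ominus> x \<in> gX j"
proof (rule in_gradI)
  have "\<pi> j (\<ominus> x) \<oplus> x = \<zero>"
    using proj_add[of "\<ominus> x" x j] x grad_sub proj_grad by (simp add: l_neg proj_zero)
  then show "\<pi> j (\<ominus> x) = \<ominus> x"
    using minus_equality[of "\<pi> j (\<ominus> x)" x] x grad_sub proj_closed[of "\<ominus> x"] by simp
qed (use x grad_sub in simp)

lemma grad_finsum: "finite A \<Longrightarrow> (\<And>a. a \<in> A \<Longrightarrow> g a \<in> gX j) \<Longrightarrow> (\<Oplus>a\<in>A. g a) \<in> gX j"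
proof (induction A rule: finite_induct)
  case (insert a A)
  then have "g \<in> insert a A \<rightarrow> carrier X" using grad_sub by blast
  then show ?case using insert grad_add by (simp add: Pi_iff)
qed (simp add: grad_zero)

end

text \<open>For homogeneous elements both sides are known from \<open>proj_grad\<close>; additivity
  and \<open>grad_induct\<close> do the rest.\<close>

lemma graded_hom_proj:
  assumes X: "graded_group X gX \<pi>" and Y: "graded_group Y gY \<rho>"
    and closed: "\<And>x. x \<in> carrier X \<Longrightarrow> f x \<in> carrier Y"
    and add: "\<And>x y. x \<in> carrier X \<Longrightarrow> y \<in> carrier X \<Longrightarrow> f (x \<oplus>\<^bsub>X\<^esub> y) = f x \<oplus>\<^bsub>Y\<^esub> f y"
    and grad: "\<And>j x. x \<in> gX j \<Longrightarrow> f x \<in> gY j"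
    and x: "x \<in> carrier X"
  shows "f (\<pi> j x) = \<rho> j (f x)"
proof -
  interpret X: graded_group X gX \<pi> by fact
  interpret Y: graded_group Y gY \<rho> by fact
  have zero: "f \<zero>\<^bsub>X\<^esub> = \<zero>\<^bsub>Y\<^esub>"
  proof -
    have "f \<zero>\<^bsub>X\<^esub> \<oplus>\<^bsub>Y\<^esub> f \<zero>\<^bsub>X\<^esub> = f \<zero>\<^bsub>X\<^esub> \<oplus>\<^bsub>Y\<^esub> \<zero>\<^bsub>Y\<^esub>"
      using add[of "\<zero>\<^bsub>X\<^esub>" "\<zero>\<^bsub>X\<^esub>"] closed[of "\<zero>\<^bsub>X\<^esub>"] by simp
    then show ?thesis using closed[of "\<zero>\<^bsub>X\<^esub>"] by simp
  qed
  have "x \<in> {x. f (\<pi> j x) = \<rho> j (f x)}"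
  proof (rule X.grad_induct[OF x])
    show "\<zero>\<^bsub>X\<^esub> \<in> {x. f (\<pi> j x) = \<rho> j (f x)}" by (simp add: X.proj_zero Y.proj_zero zero)
    show "gX i \<subseteq> {x. f (\<pi> j x) = \<rho> j (f x)}" for i
      using grad[of _ i] by (auto simp: X.proj_grad[of _ i] Y.proj_grad[of _ i] zero)
    show "x \<oplus>\<^bsub>X\<^esub> y \<in> {x. f (\<pi> j x) = \<rho> j (f x)}" if "x \<in> carrier X" "y \<in> carrier X"
      "x \<in> {x. f (\<pi> j x) = \<rho> j (f x)}" "y \<in> {x. f (\<pi> j x) = \<rho> j (f x)}" for x y
      using that by (simp add: X.proj_add Y.proj_add closed add X.proj_closed)
  qed
  then show ?thesis by simp
qed

lemma (in cring) free_graded_group: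
  assumes S: "graded_group R gS \<pi>"
  shows "graded_group (free_module R b) (free_grading R gS b s) (\<lambda>j f. \<lambda>l\<in>{..<b}. \<pi> (j - s l) (f l))"
proof -
  interpret F: module R "free_module R b" by (rule free_module)
  interpret S: graded_group R gS \<pi> by fact
  let ?F = "free_module R b" and ?\<pi> = "\<lambda>j f. \<lambda>l\<in>{..<b}. \<pi> (j - s l) (f l)"
  show ?thesis
  proof unfold_locales
    show "x \<in> carrier ?F" if "x \<in> free_grading R gS b s j" for x j using that by (simp add: free_grading_def)
    show "?\<pi> j x \<in> free_grading R gS b s j" if "x \<in> carrier ?F" for x j
      using free_in[OF that] S.proj_in S.proj_closed by (auto simp: free_grading_def free_carrier)
    show "?\<pi> j (x \<oplus>\<^bsub>?F\<^esub> y) = ?\<pi> j x \<oplus>\<^bsub>?F\<^esub> ?\<pi> j y" if "x \<in> carrier ?F" "y \<in> carrier ?F" for x y j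
      unfolding free_add using free_in[OF that(1)] free_in[OF that(2)] S.proj_add by (intro restrict_ext) auto
    show "?\<pi> j x = (if i = j then x else \<zero>\<^bsub>?F\<^esub>)" if x: "x \<in> free_grading R gS b s i" for x i j
    proof (rule free_eqI)
      have xc: "x \<in> carrier ?F" and xg: "\<And>l. l < b \<Longrightarrow> x l \<in> gS (i - s l)" using x by (auto simp: free_grading_def)
      show "?\<pi> j x \<in> carrier ?F" using free_in[OF xc] S.proj_closed by (auto simp: free_carrier)
      show "(if i = j then x else \<zero>\<^bsub>?F\<^esub>) \<in> carrier ?F" using xc by simp
      show "?\<pi> j x l = (if i = j then x else \<zero>\<^bsub>?F\<^esub>) l" if "l < b" for l
        using S.proj_grad[OF xg[OF that], of "j - s l"] that by (simp add: free_zero)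
    qed
  next
    fix x K assume x: "x \<in> carrier ?F" and K0: "\<zero>\<^bsub>?F\<^esub> \<in> K" and Kg: "\<And>j. free_grading R gS b s j \<subseteq> K"
      and Ka: "\<And>x y. x \<in> carrier ?F \<Longrightarrow> y \<in> carrier ?F \<Longrightarrow> x \<in> K \<Longrightarrow> y \<in> K \<Longrightarrow> x \<oplus>\<^bsub>?F\<^esub> y \<in> K"
    \<comment> \<open>The vector with the single entry \<open>c\<close> at \<open>l\<close> is
      homogeneous if \<open>c\<close> is, with degree raised by \<open>s l\<close>. General entries
      follow by induction in the ring, and \<open>t\<close> below adds up the coordinates one by
      one.\<close>
    define v where "v l c = (\<lambda>l'\<in>{..<b}. if l' = l then c else \<zero>)" for l c
    have vc: "v l c \<in> carrier ?F" if "c \<in> carrier R" for l c using that by (auto simp: v_def free_carrier)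
    have single: "v l c \<in> K" if l: "l < b" and c: "c \<in> carrier R" for l c
    proof -
      have "c \<in> {c. v l c \<in> K}"
      proof (rule S.grad_induct[OF c])
        have "v l \<zero> = \<zero>\<^bsub>?F\<^esub>" by (auto simp: v_def free_zero)
        then show "\<zero> \<in> {c. v l c \<in> K}" using K0 by simp
        show "gS j \<subseteq> {c. v l c \<in> K}" for j
        proof
          fix c assume "c \<in> gS j"
          then have "v l c \<in> free_grading R gS b s (j + s l)"
            using vc[OF S.grad_sub] S.grad_zero by (auto simp: free_grading_def) (auto simp: v_def)
          then show "c \<in> {c. v l c \<in> K}" using Kg by blast
        qed
        fix c d assume "c \<in> carrier R" "d \<in> carrier R" "c \<in> {c. v l c \<in> K}" "d \<in> {c. v l c \<in> K}"
        moreover have "v l (c \<oplus> d) = v l c \<oplus>\<^bsub>?F\<^esub> v l d"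
          unfolding free_add v_def by (intro restrict_ext) auto
        ultimately show "c \<oplus> d \<in> {c. v l c \<in> K}" using Ka vc by simp
      qed
      then show ?thesis by simp
    qed
    define t where "t m = (\<lambda>l\<in>{..<b}. if l < m then x l else \<zero>)" for m
    have "m \<le> b \<Longrightarrow> t m \<in> K" for m
    proof (induction m)
      case 0
      have "t 0 = \<zero>\<^bsub>?F\<^esub>" by (simp only: t_def free_zero not_less0 if_False)
      then show ?case using K0 by simp
    next
      case (Suc m)
      have "t (Suc m) = t m \<oplus>\<^bsub>?F\<^esub> v m (x m)"
        unfolding free_add v_def t_def using free_in[OF x] by (intro restrict_ext) (auto simp: less_Suc_eq)
      moreover have "t m \<in> carrier ?F"
        using free_in[OF x] by (auto simp: t_def free_carrier)
      ultimately show ?case using Suc Ka[OF _ vc] single free_in[OF x] by simp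
    qed
    then have "t b \<in> K" by simp
    moreover have "t b = (\<lambda>l\<in>{..<b}. x l)" unfolding t_def by (intro restrict_ext) simp
    ultimately have "(\<lambda>l\<in>{..<b}. x l) \<in> K" by simp
    moreover have "(\<lambda>l\<in>{..<b}. x l) = x" using x unfolding free_carrier by (rule PiE_restrict)
    ultimately show "x \<in> K" by simp
  qed
qed

text \<open>The last axiom lets a scalar be replaced by its component of degree zero modulo
  \<open>I\<close>; in particular homogeneous scalars of nonzero degree lie in
  \<open>I\<close>.\<close>

locale graded_cring = residue_field S I + graded_group S gS \<pi>
  for S :: "('a, 'r) ring_scheme" (structure) and I gS \<pi> +
  assumes one_grad: "\<one> \<in> gS 0"
    and mult_grad: "r \<in> gS i \<Longrightarrow> t \<in> gS j \<Longrightarrow> r \<otimes> t \<in> gS (i + j)"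
    and irrelevant: "r \<in> carrier S \<Longrightarrow> r \<ominus> \<pi> 0 r \<in> I"
begin

abbreviation "gF \<equiv> free_grading S gS"

lemma gF_graded: "graded_group (free_module S b) (gF b s) (\<lambda>j f. \<lambda>l\<in>{..<b}. \<pi> (j - s l) (f l))"
  by (rule free_graded_group) unfold_locales

lemma gF_smult:
  assumes "r \<in> gS i" "x \<in> gF b s j"
  shows "r \<odot>\<^bsub>free_module S b\<^esub> x \<in> gF b s (i + j)"
proof -
  interpret F: module S "free_module S b" by (rule free_module)
  have "r \<otimes> x l \<in> gS (i + j - s l)" if "l < b" for l
    using mult_grad[of r i "x l" "j - s l"] assms that by (simp add: free_grading_def algebra_simps)
  then show ?thesis using assms grad_sub F.smult_closed by (simp add: free_grading_def free_smult)
qed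

lemma gF_std: "l < b \<Longrightarrow> std_vec S b l \<in> gF b s (s l)"
  using std_vec_closed[of b l] one_grad grad_zero by (auto simp: free_grading_def std_vec_def)

lemma gF_hom:
  assumes h: "h \<in> module_hom S (free_module S b) (free_module S c)"
    and std: "\<And>l. l < b \<Longrightarrow> h (std_vec S b l) \<in> gF c t (s l)" and x: "x \<in> gF b s j"
  shows "h x \<in> gF c t j"
proof -
  interpret G: graded_group "free_module S c" "gF c t" "\<lambda>j f. \<lambda>l\<in>{..<c}. \<pi> (j - t l) (f l)" by (rule gF_graded)
  have xc: "x \<in> carrier (free_module S b)" and xg: "\<And>l. l < b \<Longrightarrow> x l \<in> gS (j - s l)"
    using x by (auto simp: free_grading_def)
  have "x l \<odot>\<^bsub>free_module S c\<^esub> h (std_vec S b l) \<in> gF c t j" if "l < b" for l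
    using gF_smult[OF xg[OF that] std[OF that]] by simp
  then show ?thesis unfolding free_hom_eq_comb[OF free_module h xc] comb_def by (intro G.grad_finsum) auto
qed

end

section \<open>Graded free resolutions\<close>

locale graded_res = free_res_field S M C \<epsilon> b I + graded_cring S I gS \<pi> + GM: graded_group M gM \<rho>
  for S :: "('a, 'r) ring_scheme" (structure) and M :: "('a, 'b, 'm) module_scheme" and C \<epsilon> b I gS \<pi> gM \<rho> +
  fixes s :: "nat \<Rightarrow> nat \<Rightarrow> int"
  assumes d_grad: "x \<in> gF (b (Suc n)) (s (Suc n)) j \<Longrightarrow> differential C (Suc n) x \<in> gF (b n) (s n) j"
    and eps_grad: "x \<in> gF (b 0) (s 0) j \<Longrightarrow> \<epsilon> x \<in> gM j"
begin

abbreviation "gC n \<equiv> gF (b n) (s n)"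
abbreviation "pC n \<equiv> \<lambda>j f. \<lambda>l\<in>{..<b n}. \<pi> (j - s n l) (f l)"

lemma gC_graded: "graded_group (free_module S (b n)) (gC n) (pC n)" by (rule gF_graded)

lemma pC_in: "x \<in> carrier (obj C n) \<Longrightarrow> pC n j x \<in> gC n j"
  unfolding obj by (rule graded_group.proj_in[OF gC_graded])

lemma gC_in: "x \<in> gC n j \<Longrightarrow> x \<in> carrier (obj C n)"
  unfolding obj by (rule graded_group.grad_sub[OF gC_graded])

text \<open>Any preimage may be replaced by its projection to degree \<open>j\<close>, because a
  graded map commutes with the projections. The same argument proves
  \<open>graded_lift\<close>.\<close>

lemma graded_lift0:
  assumes "x \<in> gM j"
  shows "\<exists>y\<in>carrier (obj C 0). \<epsilon> y = x \<and> y \<in> gC 0 j"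
proof -
  have "x \<in> \<epsilon> ` carrier (obj C 0)" unfolding eps_surj using GM.grad_sub[OF assms] .
  then obtain y where y: "y \<in> carrier (obj C 0)" "x = \<epsilon> y" by blast
  have "\<epsilon> (pC 0 j y) = \<rho> j (\<epsilon> y)"
    using module_hom_in[OF eps_hom] module_hom_add[OF eps_hom] eps_grad y(1) unfolding obj
    by (intro graded_hom_proj[OF gC_graded GM.graded_group_axioms]) auto
  also have "\<dots> = x" using GM.proj_grad[OF assms, of j] y(2) by simp
  finally show ?thesis using pC_in[OF y(1)] gC_in by blast
qed

lemma graded_lift:
  assumes "x \<in> gC n j" "x \<in> boundaries C n"
  shows "\<exists>y\<in>carrier (obj C (Suc n)). d (Suc n) y = x \<and> y \<in> gC (Suc n) j"
proof -
  obtain y where y: "y \<in> carrier (obj C (Suc n))" "x = d (Suc n) y" using assms(2) by (auto simp: boundaries_def)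
  have "d (Suc n) (pC (Suc n) j y) = pC n j (d (Suc n) y)"
    using module_hom_in[OF d_hom[of n]] module_hom_add[OF d_hom[of n]] d_grad[of _ n] y(1) unfolding obj
    by (intro graded_hom_proj[OF gC_graded gC_graded]) auto
  also have "\<dots> = x" using graded_group.proj_grad[OF gC_graded assms(1), of j] y(2) by simp
  finally show ?thesis using pC_in[OF y(1)] gC_in by blast
qed

end

lemma graded_chain_map:
  assumes "graded_res S M C \<epsilon> b I gS \<pi> gM \<rho> s" "graded_res S M D \<eta> b' I gS \<pi> gM \<rho> s'"
  shows "\<exists>\<phi>. chain_map S C D \<phi> \<and> (\<forall>x\<in>carrier (obj C 0). \<eta> (\<phi> 0 x) = \<epsilon> x) \<and>
    (\<forall>n j x. x \<in> free_grading S gS (b n) (s n) j \<longrightarrow> \<phi> n x \<in> free_grading S gS (b' n) (s' n) j)"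
proof -
  interpret C: graded_res S M C \<epsilon> b I gS \<pi> gM \<rho> s by fact
  interpret D: graded_res S M D \<eta> b' I gS \<pi> gM \<rho> s' by fact
  show ?thesis
  proof (rule graded_comparison[OF C.free_res_axioms D.free_res_axioms, where gM = gM and s = s])
    show "std_vec S (b n) l \<in> C.gC n (s n l)" if "l < b n" for n l by (rule C.gF_std[OF that])
    show "C.d (Suc n) x \<in> C.gC n j" if "x \<in> C.gC (Suc n) j" for n j x by (rule C.d_grad[OF that])
    show "\<epsilon> x \<in> gM j" if "x \<in> C.gC 0 j" for j x by (rule C.eps_grad[OF that])
    show "\<exists>y\<in>carrier (obj D 0). \<eta> y = x \<and> y \<in> D.gC 0 j" if "x \<in> gM j" for j x by (rule D.graded_lift0[OF that])
    show "\<exists>y\<in>carrier (obj D (Suc n)). D.d (Suc n) y = x \<and> y \<in> D.gC (Suc n) j"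
      if "x \<in> D.gC n j" "x \<in> boundaries D n" for n j x by (rule D.graded_lift[OF that])
    show "h x \<in> D.gC n j" if "h \<in> module_hom S (obj C n) (obj D n)"
      "\<And>l. l < b n \<Longrightarrow> h (std_vec S (b n) l) \<in> D.gC n (s n l)" "x \<in> C.gC n j" for n h j x
      using that unfolding C.obj D.obj by (rule C.gF_hom)
  qed
qed

section \<open>Graded Betti numbers\<close>

abbreviation "residue_grading S I \<equiv>
  (\<lambda>q::int. if q = 0 then carrier (residue_module S I) else {\<zero>\<^bsub>residue_module S I\<^esub>})"

context graded_res
begin

lemma ideal_part_bounds: "ideal_part S I C n \<subseteq> B n"
  unfolding tor_bounds_def by (rule sum_sub_right[OF bound_sub ideal_part_sub[OF I_ideal]])

lemma constant_term:
  assumes r: "r \<in> carrier S" and x: "x \<in> carrier (obj C n)"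
  shows "r \<odot>\<^bsub>obj C n\<^esub> x \<ominus>\<^bsub>obj C n\<^esub> \<pi> 0 r \<odot>\<^bsub>obj C n\<^esub> x \<in> ideal_part S I C n"
proof -
  interpret X: module S "obj C n" by (rule obj_module)
  have "r \<odot>\<^bsub>obj C n\<^esub> x \<ominus>\<^bsub>obj C n\<^esub> \<pi> 0 r \<odot>\<^bsub>obj C n\<^esub> x = (r \<ominus> \<pi> 0 r) \<odot>\<^bsub>obj C n\<^esub> x"
    using r x proj_closed[OF r, of 0] by (simp add: minus_eq X.M.minus_eq X.smult_l_distr X.smult_l_minus)
  then show ?thesis unfolding ideal_part_def
    using X.ideal_smultI[OF I_ideal order_refl irrelevant[OF r] x] by simp
qed

lemma gC_smult0: "r \<in> carrier S \<Longrightarrow> x \<in> gC n j \<Longrightarrow> \<pi> 0 r \<odot>\<^bsub>obj C n\<^esub> x \<in> gC n j"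
  using gF_smult[OF proj_in[of r 0], of x "b n" "s n" j] unfolding obj by simp

text \<open>If \<open>r\<close> represents \<open>y\<close> of degree zero, then
  \<open>x \<otimes> y\<close> is the value of \<open>mu\<close> at \<open>\<pi> 0 r\<close> times
  \<open>x\<close>, since \<open>r\<close> and \<open>\<pi> 0 r\<close> agree modulo
  \<open>I\<close>; this multiple of \<open>x\<close> is still homogeneous of the same degree.
  Generators with \<open>y\<close> in another degree are zero.\<close>

lemma tensor_grading_eq:
  "tensor_grading S (obj C n) (gC n) k (residue_grading S I) j = mu (obj C n) ` gC n j"
proof
  interpret X: module S "obj C n" by (rule obj_module)
  interpret T: module S "tensor S (obj C n) k" by (rule tensor_module)
  interpret G: graded_group "free_module S (b n)" "gC n" "pC n" by (rule gC_graded)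
  note hom = mu_hom[of "obj C n"]
  let ?gen = "{pure_tensor S (obj C n) k x y | x y p q. p + q = j \<and> x \<in> gC n p \<and> y \<in> residue_grading S I q}"
  show "mu (obj C n) ` gC n j \<subseteq> tensor_grading S (obj C n) (gC n) k (residue_grading S I) j"
  proof
    fix t assume "t \<in> mu (obj C n) ` gC n j"
    then obtain x where x: "x \<in> gC n j" "t = pure_tensor S (obj C n) k x (res \<one>)" by (auto simp: mu_def)
    have "res \<one> \<in> residue_grading S I 0" using res_closed[of \<one>] by simp
    then have "t \<in> ?gen" using x by force
    then show "t \<in> tensor_grading S (obj C n) (gC n) k (residue_grading S I) j"
      unfolding tensor_grading_def by (rule generate.incl)
  qed
  have gen: "t \<in> mu (obj C n) ` gC n j" if t: "t \<in> ?gen" for t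
  proof -
    obtain x y p q where *: "t = pure_tensor S (obj C n) k x y" "p + q = j" "x \<in> gC n p" "y \<in> residue_grading S I q"
      using t by blast
    show ?thesis
    proof (cases "q = 0")
      case True
      with * obtain r where r: "r \<in> carrier S" "y = res r" by (auto elim: k_cases)
      have xc: "x \<in> carrier (obj C n)" by (rule gC_in[OF *(3)])
      have c: "r \<odot>\<^bsub>obj C n\<^esub> x \<in> carrier (obj C n)" "\<pi> 0 r \<odot>\<^bsub>obj C n\<^esub> x \<in> carrier (obj C n)"
        using r xc proj_closed by auto
      have "mu (obj C n) (r \<odot>\<^bsub>obj C n\<^esub> x) \<ominus>\<^bsub>obj Tc n\<^esub> mu (obj C n) (\<pi> 0 r \<odot>\<^bsub>obj C n\<^esub> x) = \<zero>\<^bsub>obj Tc n\<^esub>"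
        using constant_term[OF r(1) xc] mu_ker' c
        by (simp flip: module_hom_minus[OF obj_module tc_module mu_hom' c])
      then have "t = mu (obj C n) (\<pi> 0 r \<odot>\<^bsub>obj C n\<^esub> x)"
        using pure_tensor_res[OF obj_module xc r(1)] module_hom_in[OF hom c(1)] module_hom_in[OF hom c(2)] *(1) r(2)
        unfolding tc_simps by simp
      then show ?thesis using gC_smult0[OF r(1) *(3)] *(2) True by simp
    next
      case False
      have xc: "x \<in> carrier (obj C n)" by (rule gC_in[OF *(3)])
      have "y = res \<zero>" using * False res_eq_zero[of \<zero>] by simp
      then have "t = mu (obj C n) \<zero>\<^bsub>obj C n\<^esub>"
        using pure_tensor_res[OF obj_module xc, of \<zero>] xc *(1) by simp
      then show ?thesis using G.grad_zero unfolding obj by blast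
    qed
  qed
  show "tensor_grading S (obj C n) (gC n) k (residue_grading S I) j \<subseteq> mu (obj C n) ` gC n j"
    unfolding tensor_grading_def
  proof
    fix t assume "t \<in> generate (add_monoid (tensor S (obj C n) k)) ?gen"
    then show "t \<in> mu (obj C n) ` gC n j"
    proof (induction t rule: generate.induct)
      case one
      have "mu (obj C n) \<zero>\<^bsub>obj C n\<^esub> = \<zero>\<^bsub>tensor S (obj C n) k\<^esub>"
        by (rule module_hom_zero[OF obj_module tensor_module hom])
      then show ?case using G.grad_zero unfolding obj by (metis image_eqI monoid.simps(2))
    next
      case (incl h)
      then show ?case by (rule gen)
    next
      case (inv h)
      from gen[OF this] obtain x where x: "x \<in> gC n j" "h = mu (obj C n) x" by blast
      have xc: "x \<in> carrier (obj C n)" by (rule gC_in[OF x(1)])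
      have "mu (obj C n) (\<ominus>\<^bsub>obj C n\<^esub> x) \<oplus>\<^bsub>tensor S (obj C n) k\<^esub> h = mu (obj C n) (\<ominus>\<^bsub>obj C n\<^esub> x \<oplus>\<^bsub>obj C n\<^esub> x)"
        unfolding x(2) using xc by (intro module_hom_add[OF hom, symmetric]) auto
      also have "\<dots> = \<zero>\<^bsub>tensor S (obj C n) k\<^esub>"
        using xc module_hom_zero[OF obj_module tensor_module hom] by (simp add: X.M.l_neg)
      finally have "\<ominus>\<^bsub>tensor S (obj C n) k\<^esub> h = mu (obj C n) (\<ominus>\<^bsub>obj C n\<^esub> x)"
        using xc module_hom_in[OF hom] x(2) by (intro T.M.minus_equality) auto
      moreover have "\<ominus>\<^bsub>obj C n\<^esub> x \<in> gC n j" using G.grad_inv[OF x(1)] unfolding obj .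
      ultimately show ?case unfolding a_inv_def by blast
    next
      case (eng g h)
      then obtain x y where x: "x \<in> gC n j" "g = mu (obj C n) x" and y: "y \<in> gC n j" "h = mu (obj C n) y" by blast
      have "mu (obj C n) (x \<oplus>\<^bsub>obj C n\<^esub> y) = g \<oplus>\<^bsub>tensor S (obj C n) k\<^esub> h"
        unfolding x(2) y(2) by (rule module_hom_add[OF hom gC_in[OF x(1)] gC_in[OF y(1)]])
      moreover have "x \<oplus>\<^bsub>obj C n\<^esub> y \<in> gC n j" using G.grad_add[OF x(1) y(1)] unfolding obj .
      ultimately show ?case by (metis image_eqI monoid.simps(1))
    qed
  qed
qed

text \<open>Homogeneous cycles alone are not stable under scalars of nonzero degree. Such scalars
  map into \<open>ideal_part\<close>, so adding \<open>B n\<close> gives a submodule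
  (\<open>Zg_sub\<close>) without changing the set of classes in Tor (\<open>nu_Zg\<close>).\<close>

definition Zg :: "nat \<Rightarrow> int \<Rightarrow> (nat \<Rightarrow> 'a) set" where
  "Zg n j = (gC n j \<inter> Z n) <+>\<^bsub>obj C n\<^esub> B n"

lemma Zg_I: "x \<in> gC n j \<Longrightarrow> x \<in> Z n \<Longrightarrow> x \<in> Zg n j"
proof -
  interpret X: module S "obj C n" by (rule obj_module)
  assume x: "x \<in> gC n j" "x \<in> Z n"
  then have "x = x \<oplus>\<^bsub>obj C n\<^esub> \<zero>\<^bsub>obj C n\<^esub>" using gC_in by simp
  then show ?thesis using x submodule_zero[OF tor_bounds_sub[OF I_ideal]] unfolding Zg_def set_add_def' by blast
qed

lemma Zg_bounds: "B n \<subseteq> Zg n j"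
proof
  interpret X: module S "obj C n" by (rule obj_module)
  interpret G: graded_group "free_module S (b n)" "gC n" "pC n" by (rule gC_graded)
  fix x assume x: "x \<in> B n"
  then have "x = \<zero>\<^bsub>obj C n\<^esub> \<oplus>\<^bsub>obj C n\<^esub> x" using submodule_in[OF tor_bounds_sub[OF I_ideal]] by simp
  moreover have "\<zero>\<^bsub>obj C n\<^esub> \<in> gC n j \<inter> Z n"
    using G.grad_zero[of j] submodule_zero[OF tor_cycles_sub[OF I_ideal]] unfolding obj by blast
  ultimately show "x \<in> Zg n j" using x unfolding Zg_def set_add_def' by blast
qed

lemma Zg_sub: "submodule S (Zg n j) (obj C n)"
proof -
  interpret X: module S "obj C n" by (rule obj_module)
  interpret G: graded_group "free_module S (b n)" "gC n" "pC n" by (rule gC_graded)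
  have B: "submodule S (B n) (obj C n)" and Z: "submodule S (Z n) (obj C n)"
    by (rule tor_bounds_sub[OF I_ideal], rule tor_cycles_sub[OF I_ideal])
  have c: "x \<in> carrier (obj C n)" if "x \<in> gC n j \<or> x \<in> B n" for x using that gC_in submodule_in[OF B] by blast
  show ?thesis
  proof
    show "Zg n j \<subseteq> carrier (obj C n)" using c unfolding Zg_def by (auto elim!: in_sumE)
    show "\<zero>\<^bsub>obj C n\<^esub> \<in> Zg n j" using Zg_bounds submodule_zero[OF B] by blast
    fix v w assume "v \<in> Zg n j" "w \<in> Zg n j"
    then obtain x y x' y' where x: "x \<in> gC n j \<inter> Z n" "y \<in> B n" "v = x \<oplus>\<^bsub>obj C n\<^esub> y"
      and x': "x' \<in> gC n j \<inter> Z n" "y' \<in> B n" "w = x' \<oplus>\<^bsub>obj C n\<^esub> y'" unfolding Zg_def by (elim in_sumE)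
    have "v \<oplus>\<^bsub>obj C n\<^esub> w = (x \<oplus>\<^bsub>obj C n\<^esub> x') \<oplus>\<^bsub>obj C n\<^esub> (y \<oplus>\<^bsub>obj C n\<^esub> y')"
      using x x' c by (simp add: X.M.a_ac)
    moreover have "x \<oplus>\<^bsub>obj C n\<^esub> x' \<in> gC n j \<inter> Z n"
      using x x' G.grad_add[of x j x'] submodule_add[OF Z] unfolding obj by blast
    moreover have "y \<oplus>\<^bsub>obj C n\<^esub> y' \<in> B n" using x x' submodule_add[OF B] by blast
    ultimately show "v \<oplus>\<^bsub>obj C n\<^esub> w \<in> Zg n j" unfolding Zg_def set_add_def' by blast
  next
    fix r v assume r: "r \<in> carrier S" and "v \<in> Zg n j"
    then obtain x y where x: "x \<in> gC n j" "x \<in> Z n" "y \<in> B n" "v = x \<oplus>\<^bsub>obj C n\<^esub> y" unfolding Zg_def by (elim in_sumE) blast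
    have xc: "x \<in> carrier (obj C n)" "y \<in> carrier (obj C n)" using x c by auto
    let ?x0 = "\<pi> 0 r \<odot>\<^bsub>obj C n\<^esub> x"
    have x0: "?x0 \<in> gC n j \<inter> Z n" using gC_smult0[OF r x(1)] submodule_smult[OF Z proj_closed[OF r] x(2)] by blast
    have x0c: "?x0 \<in> carrier (obj C n)" using x0 c by blast
    have "r \<odot>\<^bsub>obj C n\<^esub> x \<ominus>\<^bsub>obj C n\<^esub> ?x0 \<in> B n" using constant_term[OF r xc(1)] ideal_part_bounds by blast
    then have "(r \<odot>\<^bsub>obj C n\<^esub> x \<ominus>\<^bsub>obj C n\<^esub> ?x0) \<oplus>\<^bsub>obj C n\<^esub> r \<odot>\<^bsub>obj C n\<^esub> y \<in> B n" (is "?y \<in> _")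
      using submodule_add[OF B _ submodule_smult[OF B r x(3)]] by blast
    moreover have "r \<odot>\<^bsub>obj C n\<^esub> v = ?x0 \<oplus>\<^bsub>obj C n\<^esub> ?y"
      using r xc x0c x(4) X.M.add_minus_right[of ?x0 "r \<odot>\<^bsub>obj C n\<^esub> x"]
      by (simp add: X.smult_r_distr X.M.a_assoc[symmetric])
    ultimately show "r \<odot>\<^bsub>obj C n\<^esub> v \<in> Zg n j" using x0 unfolding Zg_def set_add_def' by blast
  qed
qed

lemma nu_Zg: "nu n ` Zg n j = nu n ` (gC n j \<inter> Z n)"
proof
  interpret X: module S "obj C n" by (rule obj_module)
  show "nu n ` (gC n j \<inter> Z n) \<subseteq> nu n ` Zg n j" using Zg_I by blast
  show "nu n ` Zg n j \<subseteq> nu n ` (gC n j \<inter> Z n)"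
  proof clarify
    fix v assume "v \<in> Zg n j"
    then obtain x y where x: "x \<in> gC n j \<inter> Z n" "y \<in> B n" "v = x \<oplus>\<^bsub>obj C n\<^esub> y" unfolding Zg_def by (rule in_sumE)
    have c: "x \<in> carrier (obj C n)" "y \<in> carrier (obj C n)"
      using x gC_in submodule_in[OF tor_bounds_sub[OF I_ideal]] by auto
    have "nu n y = nu n \<zero>\<^bsub>obj C n\<^esub>"
      using nu_ker[OF c(2)] nu_ker[OF X.M.zero_closed] x(2) submodule_zero[OF tor_bounds_sub[OF I_ideal]] by simp
    then have "nu n v = nu n (x \<oplus>\<^bsub>obj C n\<^esub> \<zero>\<^bsub>obj C n\<^esub>)"
      unfolding x(3) nu_add[OF c] nu_add[OF c(1) X.M.zero_closed] by simp
    then show "nu n v \<in> nu n ` (gC n j \<inter> Z n)" using x(1) c by simp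
  qed
qed

lemma graded_classes:
  "(\<lambda>z. boundaries Tc n +>\<^bsub>obj Tc n\<^esub> z) ` (cycles Tc n \<inter> tensor_grading S (obj C n) (gC n) k (residue_grading S I) j)
    = nu n ` Zg n j"
proof -
  \<comment> \<open>A homogeneous \<open>x\<close> with the same image as some cycle
    \<open>z\<close> differs from \<open>z\<close> by an element of \<open>ideal_part\<close>, hence
    lies in \<open>Z n\<close> itself.\<close>
  have "cycles Tc n \<inter> mu (obj C n) ` gC n j = mu (obj C n) ` (gC n j \<inter> Z n)"
  proof
    show "mu (obj C n) ` (gC n j \<inter> Z n) \<subseteq> cycles Tc n \<inter> mu (obj C n) ` gC n j" unfolding tc_cycles by blast
    show "cycles Tc n \<inter> mu (obj C n) ` gC n j \<subseteq> mu (obj C n) ` (gC n j \<inter> Z n)"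
    proof
      fix t assume "t \<in> cycles Tc n \<inter> mu (obj C n) ` gC n j"
      then obtain x z where x: "x \<in> gC n j" "t = mu (obj C n) x" and z: "z \<in> Z n" "t = mu (obj C n) z"
        unfolding tc_cycles by blast
      have c: "x \<in> carrier (obj C n)" "z \<in> carrier (obj C n)"
        using gC_in[OF x(1)] submodule_in[OF tor_cycles_sub[OF I_ideal] z(1)] .
      interpret X: module S "obj C n" by (rule obj_module)
      interpret T: module S "obj Tc n" by (rule tc_module)
      have "mu (obj C n) (x \<ominus>\<^bsub>obj C n\<^esub> z) = t \<ominus>\<^bsub>obj Tc n\<^esub> t"
        using module_hom_minus[OF obj_module tc_module mu_hom' c] x(2) z(2) by simp
      then have "mu (obj C n) (x \<ominus>\<^bsub>obj C n\<^esub> z) = \<zero>\<^bsub>obj Tc n\<^esub>"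
        using module_hom_in[OF mu_hom' c(1)] x(2) by simp
      then have "x \<ominus>\<^bsub>obj C n\<^esub> z \<in> Z n"
        using mu_ker'[OF X.M.minus_closed[OF c]] ideal_part_bounds tor_bounds_cycles[OF I_ideal] by blast
      then have "x \<in> Z n" by (rule submodule_minusD[OF tor_cycles_sub[OF I_ideal] c(1) z(1)])
      then show "t \<in> mu (obj C n) ` (gC n j \<inter> Z n)" using x by blast
    qed
  qed
  then show ?thesis unfolding tensor_grading_eq nu_Zg by (simp add: nu_def image_image)
qed

lemma graded_dim:
  assumes V: "V = (homology Tc n)\<lparr>carrier := nu n ` Zg n j\<rparr>"
    and A: "finite A" "A \<subseteq> Zg n j" "Zg n j \<subseteq> module.span S (obj C n) A <+>\<^bsub>obj C n\<^esub> B n"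
  shows "residue_dim S I V = 0 \<longleftrightarrow> Zg n j \<subseteq> B n"
proof
  interpret X: module S "obj C n" by (rule obj_module)
  have B: "submodule S (B n) (obj C n)" by (rule tor_bounds_sub[OF I_ideal])
  assume "residue_dim S I V = 0"
  then have "Zg n j \<subseteq> X.span {} <+>\<^bsub>obj C n\<^esub> B n" using tor_dim(2)[OF Zg_sub V A] by auto
  also have "\<dots> \<subseteq> B n" by (rule sum_sub[OF B X.span_is_subset[OF _ B]]) auto
  finally show "Zg n j \<subseteq> B n" .
next
  interpret X: module S "obj C n" by (rule obj_module)
  assume "Zg n j \<subseteq> B n"
  also have "B n \<subseteq> X.span {} <+>\<^bsub>obj C n\<^esub> B n"
    by (rule sum_sub_right[OF X.span_is_submodule tor_bounds_sub[OF I_ideal]]) simp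
  finally show "residue_dim S I V = 0" using tor_dim(1)[OF Zg_sub V, of "{}"] by simp
qed

end

text \<open>For minimal \<open>C\<close> every element lies in \<open>tor_cycles\<close> and
  \<open>tor_bounds\<close> is contained in \<open>ideal_part\<close>. The map \<open>\<phi>\<close>
  carries the basis vectors of shift \<open>j\<close> to a spanning set of \<open>D.Zg n j\<close>
  in the selected resolution \<open>D\<close>; if one of them became trivial there,
  \<open>\<psi>\<close> would bring the basis vector itself into \<open>ideal_part\<close>.\<close>

theorem graded_betti_minimal:
  assumes C: "graded_res S M C \<epsilon> b I gS \<pi> gM \<rho> s"
    and min: "\<And>n. boundaries C n \<subseteq> ideal_part S I C n"
  shows "graded_betti S gS I M gM n j \<noteq> 0 \<longleftrightarrow> (\<exists>l<b n. s n l = j)"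
proof -
  interpret C: graded_res S M C \<epsilon> b I gS \<pi> gM \<rho> s by fact
  let ?P = "\<lambda>(C, gC). graded_free_resolution S gS M gM C gC"
  \<comment> \<open>The resolution selected by \<open>graded_Tor\<close>; \<open>C\<close> is the
    witness that it is a graded free resolution.\<close>
  obtain D gD where D: "(D, gD) = (SOME p. ?P p)" by (metis surj_pair)
  have "?P (C, C.gC)"
    unfolding graded_free_resolution_def using C.obj C.d_grad C.eps_grad C.res by (auto simp: image_subset_iff)
  from someI[of ?P, OF this] have "graded_free_resolution S gS M gM D gD" unfolding D[symmetric] by simp
  then obtain \<eta> where D1: "\<forall>n. \<exists>b s. obj D n = free_module S b \<and> gD n = free_grading S gS b s"
    and D2: "\<And>n j. differential D (Suc n) ` gD (Suc n) j \<subseteq> gD n j"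
    and D3: "resolution S M D \<eta>" "\<And>j. \<eta> ` gD 0 j \<subseteq> gM j"
    unfolding graded_free_resolution_def by blast
  obtain b' s' where D4: "\<And>n. obj D n = free_module S (b' n)" "\<And>n. gD n = free_grading S gS (b' n) (s' n)"
    using D1 by metis
  have Dres: "graded_res S M D \<eta> b' I gS \<pi> gM \<rho> s'"
  proof unfold_locales
  qed (use D2 D3 D4 in \<open>auto simp: image_subset_iff\<close>)
  interpret D: graded_res S M D \<eta> b' I gS \<pi> gM \<rho> s' by (rule Dres)
  interpret X: module S "obj D n" by (rule D.obj_module)
  let ?V = "(homology D.Tc n)\<lparr>carrier := D.nu n ` D.Zg n j\<rparr>"
  have gb: "graded_betti S gS I M gM n j = residue_dim S I ?V"
    unfolding graded_betti_def graded_Tor_def Let_def D[symmetric] prod.case D4(2) D.graded_classes by simp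
  obtain \<phi> where \<phi>: "chain_map S C D \<phi>" "\<And>x. x \<in> carrier (obj C 0) \<Longrightarrow> \<eta> (\<phi> 0 x) = \<epsilon> x"
    "\<And>n j x. x \<in> C.gC n j \<Longrightarrow> \<phi> n x \<in> D.gC n j" using graded_chain_map[OF C Dres] by blast
  obtain \<psi> where \<psi>: "chain_map S D C \<psi>" "\<And>x. x \<in> carrier (obj D 0) \<Longrightarrow> \<epsilon> (\<psi> 0 x) = \<eta> x"
    "\<And>n j x. x \<in> D.gC n j \<Longrightarrow> \<psi> n x \<in> C.gC n j" using graded_chain_map[OF Dres C] by blast
  have I: "ideal I S" by (rule C.I_ideal)
  have \<phi>_hom: "\<phi> n \<in> module_hom S (free_module S (b n)) (obj D n)" using chain_map_hom[OF \<phi>(1)] unfolding C.obj .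
  have CB: "C.B n \<subseteq> ideal_part S I C n" unfolding tor_bounds_def by (rule sum_sub[OF C.ideal_part_sub[OF I] min order_refl])
  have CZ: "x \<in> C.Z n" if "x \<in> carrier (obj C n)" for x
    using that min C.d_in_bound by (cases n) (auto simp: tor_cycles_def)
  have std: "std_vec S (b n) l \<in> carrier (obj C n)" for l unfolding C.obj by (rule C.std_vec_closed)
  have DB: "submodule S (D.B n) (obj D n)" by (rule D.tor_bounds_sub[OF I])
  \<comment> \<open>If no basis vector has shift \<open>j\<close>, this set is empty, and the
    spanning property shown below says that Tor vanishes in degree \<open>j\<close>.\<close>
  define A where "A = \<phi> n ` std_vec S (b n) ` {l. l < b n \<and> s n l = j}"
  have finA: "finite A" by (simp add: A_def)
  have stdZ: "\<phi> n (std_vec S (b n) l) \<in> D.Zg n j" if l: "l < b n" "s n l = j" for l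
    using \<phi>(3)[OF C.gF_std[OF l(1), of "s n"]] chain_map_tor(1)[OF C.free_res_axioms D.free_res_axioms I \<phi>(1) CZ[OF std]]
      l(2) by (intro D.Zg_I) auto
  then have AZ: "A \<subseteq> D.Zg n j" by (auto simp: A_def)
  then have Ac: "A \<subseteq> carrier (obj D n)" using submodule_in[OF D.Zg_sub] by blast
  let ?W = "X.span A <+>\<^bsub>obj D n\<^esub> D.B n"
  have W: "submodule S ?W (obj D n)" by (rule submodule_sum[OF X.span_is_submodule[OF Ac] DB])
  have BW: "D.B n \<subseteq> ?W" by (rule sum_sub_right[OF X.span_is_submodule[OF Ac] DB])
  have AW: "A \<subseteq> ?W" using X.in_own_span[OF Ac] sum_sub_left[OF X.span_is_submodule[OF Ac] DB] by blast
  have "z \<in> ?W" if z: "z \<in> D.gC n j" "z \<in> D.Z n" for z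
  proof -
    have zc: "z \<in> carrier (obj D n)" by (rule D.gC_in[OF z(1)])
    define y where "y = \<psi> n z"
    have y: "y \<in> C.gC n j" unfolding y_def by (rule \<psi>(3)[OF z(1)])
    then have yc: "y \<in> carrier (free_module S (b n))" and yl: "\<And>l. l < b n \<Longrightarrow> y l \<in> gS (j - s n l)"
      by (auto simp: free_grading_def)
    have "y l \<odot>\<^bsub>obj D n\<^esub> \<phi> n (std_vec S (b n) l) \<in> ?W" if l: "l < b n" for l
    proof (cases "s n l = j")
      case True
      then show ?thesis using submodule_smult[OF W C.grad_sub[OF yl[OF l]]] AW l by (auto simp: A_def)
    next
      case False
      \<comment> \<open>Here \<open>y l\<close> is homogeneous of the nonzero degree
        \<open>j - s n l\<close>, so it lies in \<open>I\<close>.\<close>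
      then have "\<pi> 0 (y l) = \<zero>\<^bsub>S\<^esub>" using C.proj_grad[OF yl[OF l], of 0] by simp
      then have "y l \<in> I" using C.irrelevant[OF C.grad_sub[OF yl[OF l]]] C.grad_sub[OF yl[OF l]] by (simp add: C.minus_eq)
      then have "y l \<odot>\<^bsub>obj D n\<^esub> \<phi> n (std_vec S (b n) l) \<in> ideal_part S I D n"
        unfolding ideal_part_def
        using module_hom_in[OF \<phi>_hom C.std_vec_closed] by (intro X.ideal_smultI[OF I order_refl])
      then show ?thesis using D.ideal_part_bounds BW by blast
    qed
    then have 1: "\<phi> n y \<in> ?W"
      unfolding C.free_hom_eq_comb[OF X.module_axioms \<phi>_hom yc] by (rule C.comb_in_submodule[OF W])
    have "\<phi> n y \<ominus>\<^bsub>obj D n\<^esub> z \<in> ?W"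
      using resolutions_homotopy_equivalent[OF D.free_res_axioms I \<psi>(1,2) \<phi>(1,2) z(2)] BW unfolding y_def by blast
    from submodule_minus[OF W 1 this] show ?thesis
      using module_hom_in[OF \<phi>_hom yc] zc by (simp add: X.M.minus_eq X.M.minus_add X.M.a_assoc[symmetric] X.M.r_neg)
  qed
  then have ZW: "D.Zg n j \<subseteq> ?W" unfolding D.Zg_def using BW by (intro sum_sub[OF W]) auto
  note dim = D.graded_dim[OF refl finA AZ ZW]
  show ?thesis
  proof
    assume "graded_betti S gS I M gM n j \<noteq> 0"
    then have "\<not> D.Zg n j \<subseteq> D.B n" using dim unfolding gb by simp
    moreover have "D.Zg n j \<subseteq> D.B n" if "A = {}"
    proof -
      have "?W \<subseteq> D.B n" unfolding that by (rule sum_sub[OF DB X.span_is_subset[OF _ DB]]) auto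
      then show ?thesis using ZW by blast
    qed
    ultimately show "\<exists>l<b n. s n l = j" unfolding A_def by blast
  next
    assume "\<exists>l<b n. s n l = j"
    then obtain l where l: "l < b n" "s n l = j" by blast
    let ?e = "std_vec S (b n) l"
    show "graded_betti S gS I M gM n j \<noteq> 0"
    proof
      assume "graded_betti S gS I M gM n j = 0"
      then have "\<phi> n ?e \<in> D.B n" using dim stdZ[OF l] unfolding gb by blast
      then have 1: "\<psi> n (\<phi> n ?e) \<in> ideal_part S I C n"
        using chain_map_tor(2)[OF D.free_res_axioms C.free_res_axioms I \<psi>(1)] CB by blast
      have 2: "\<psi> n (\<phi> n ?e) \<ominus>\<^bsub>obj C n\<^esub> ?e \<in> ideal_part S I C n"
        using resolutions_homotopy_equivalent[OF C.free_res_axioms I \<phi>(1,2) \<psi>(1,2) CZ[OF std]] CB by blast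
      interpret Y: module S "obj C n" by (rule C.obj_module)
      have c: "\<psi> n (\<phi> n ?e) \<in> carrier (obj C n)" using submodule_in[OF C.ideal_part_sub[OF I] 1] .
      have "?e \<in> ideal_part S I C n" using submodule_minus[OF C.ideal_part_sub[OF I] 1 2] c std[of l]
        by (simp add: Y.M.minus_eq Y.M.minus_add Y.M.a_assoc[symmetric] Y.M.r_neg)
      then have "?e l \<in> I" using C.free_ideal_smult_iff[OF I, of ?e "b n"] l unfolding ideal_part_def C.obj by blast
      then have "\<one>\<^bsub>S\<^esub> \<in> I" using l by (simp add: std_vec_def)
      then show False using C.I_notcarr ideal.one_imp_carrier[OF I] by blast
    qed
  qed
qed

section \<open>The gradings of associated graded objects\<close>

definition gr_proj :: "(nat \<Rightarrow> 'b set, 'm) ring_scheme \<Rightarrow> int \<Rightarrow> (nat \<Rightarrow> 'b set) \<Rightarrow> nat \<Rightarrow> 'b set" where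
  "gr_proj X j u = (\<lambda>p. if int p = j then u p else \<zero>\<^bsub>X\<^esub> p)"

definition part_seq :: "('a, 'b, 'm) module_scheme \<Rightarrow> int \<Rightarrow> (nat \<Rightarrow> 'b) \<Rightarrow> nat \<Rightarrow> 'b" where
  "part_seq N j f = (\<lambda>p. if int p = j then f p else \<zero>\<^bsub>N\<^esub>)"

context filtered_mod
begin

lemma part_seq_closed: "f \<in> fin_seqs N G \<Longrightarrow> part_seq N j f \<in> fin_seqs N G"
  using submodule_zero[OF G_sub] unfolding fin_seqs_def part_seq_def by auto

lemma class_part: "gr_proj (gr_module N G) j (seq_class N G f) = seq_class N G (part_seq N j f)"
  unfolding class_zero[symmetric] gr_proj_def by (rule ext) (simp add: seq_class_def part_seq_def)

lemma class_in_grading: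
  assumes f: "f \<in> fin_seqs N G" and part: "\<And>p. int p \<noteq> j \<Longrightarrow> f p = \<zero>\<^bsub>N\<^esub>"
  shows "seq_class N G f \<in> gr_grading (gr_module N G) j"
  using class_closed[OF f] part unfolding gr_grading_def class_zero[symmetric] by (simp add: seq_class_def)

lemma grading_proj: "u \<in> gr_grading (gr_module N G) i \<Longrightarrow>
    gr_proj (gr_module N G) j u = (if i = j then u else \<zero>\<^bsub>gr_module N G\<^esub>)"
  by (rule ext) (auto simp: gr_grading_def gr_proj_def)

lemma grading_class:
  assumes u: "u \<in> gr_grading (gr_module N G) j"
  shows "\<exists>f\<in>fin_seqs N G. seq_class N G f = u \<and> (\<forall>p. int p \<noteq> j \<longrightarrow> f p = \<zero>\<^bsub>N\<^esub>)"
proof -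
  obtain f where f: "f \<in> fin_seqs N G" "seq_class N G f = u" using class_surj[of u] u unfolding gr_grading_def by blast
  have "seq_class N G (part_seq N j f) = u" using grading_proj[OF u, of j] class_part[of j f] f(2) by simp
  then show ?thesis using part_seq_closed[OF f(1), of j] by (intro bexI[of _ "part_seq N j f"]) (auto simp: part_seq_def)
qed

text \<open>The group laws are supplied from outside: by the ring \<open>Sg\<close> for the graded
  ring, and by the surjection \<open>gr_eps\<close> for the graded module.\<close>

lemma gr_graded:
  assumes "abelian_group (gr_module N G)"
  shows "graded_group (gr_module N G) (gr_grading (gr_module N G)) (gr_proj (gr_module N G))"
proof -
  interpret Q: abelian_group "gr_module N G" by fact
  let ?Q = "gr_module N G"
  show ?thesis
  proof unfold_locales
    show "u \<in> carrier ?Q" if "u \<in> gr_grading ?Q j" for u j using that by (simp add: gr_grading_def)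
    show "gr_proj ?Q j u \<in> gr_grading ?Q j" if "u \<in> carrier ?Q" for u j
    proof -
      obtain f where f: "f \<in> fin_seqs N G" "u = seq_class N G f" using class_surj[OF \<open>u \<in> carrier ?Q\<close>] by blast
      show ?thesis unfolding f(2) class_part
        by (rule class_in_grading[OF part_seq_closed[OF f(1)]]) (simp add: part_seq_def)
    qed
    show "gr_proj ?Q j (u \<oplus>\<^bsub>?Q\<^esub> v) = gr_proj ?Q j u \<oplus>\<^bsub>?Q\<^esub> gr_proj ?Q j v" for u v j
    proof
      fix p
      have add: "(x \<oplus>\<^bsub>?Q\<^esub> y) p = x p <+>\<^bsub>N\<^esub> y p" for x y by (simp add: gr_module_def)
      have "(\<zero>\<^bsub>?Q\<^esub> \<oplus>\<^bsub>?Q\<^esub> \<zero>\<^bsub>?Q\<^esub>) p = \<zero>\<^bsub>?Q\<^esub> p" by simp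
      then show "gr_proj ?Q j (u \<oplus>\<^bsub>?Q\<^esub> v) p = (gr_proj ?Q j u \<oplus>\<^bsub>?Q\<^esub> gr_proj ?Q j v) p"
        unfolding add gr_proj_def by simp
    qed
    show "gr_proj ?Q j u = (if i = j then u else \<zero>\<^bsub>?Q\<^esub>)" if "u \<in> gr_grading ?Q i" for u i j
      by (rule grading_proj[OF that])
  next
    fix u K assume u: "u \<in> carrier ?Q" and K0: "\<zero>\<^bsub>?Q\<^esub> \<in> K" and Kg: "\<And>j. gr_grading ?Q j \<subseteq> K"
      and Ka: "\<And>u v. u \<in> carrier ?Q \<Longrightarrow> v \<in> carrier ?Q \<Longrightarrow> u \<in> K \<Longrightarrow> v \<in> K \<Longrightarrow> u \<oplus>\<^bsub>?Q\<^esub> v \<in> K"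
    obtain f where f: "f \<in> fin_seqs N G" "u = seq_class N G f" using class_surj[OF u] by blast
    obtain n where n: "\<And>p. p \<ge> n \<Longrightarrow> f p = \<zero>\<^bsub>N\<^esub>" using f(1) by (auto simp: fin_seqs_def)
    \<comment> \<open>Truncations of the lift; each step adds one homogeneous class.\<close>
    define t where "t m = (\<lambda>p. if p < m then f p else \<zero>\<^bsub>N\<^esub>)" for m
    have t: "t m \<in> fin_seqs N G" for m
      using f(1) submodule_zero[OF G_sub] unfolding fin_seqs_def t_def by auto
    have "seq_class N G (t m) \<in> K" for m
    proof (induction m)
      case 0
      have "t 0 = (\<lambda>_. \<zero>\<^bsub>N\<^esub>)" by (simp add: t_def)
      then show ?case using K0 class_zero by simp
    next
      case (Suc m)
      have s: "single_seq N m (f m) \<in> fin_seqs N G" by (rule single_seq_closed[OF seq_in[OF f(1)]])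
      have "t (Suc m) = (\<lambda>p. t m p \<oplus>\<^bsub>N\<^esub> single_seq N m (f m) p)"
        using seq_carrier[OF f(1)] by (auto simp: t_def single_seq_def fun_eq_iff less_Suc_eq)
      then have "seq_class N G (t (Suc m)) = seq_class N G (t m) \<oplus>\<^bsub>?Q\<^esub> seq_class N G (single_seq N m (f m))"
        using class_add[OF t s] by simp
      moreover have "seq_class N G (single_seq N m (f m)) \<in> gr_grading ?Q (int m)"
        by (rule class_in_grading[OF s]) (simp add: single_seq_def)
      then have "seq_class N G (single_seq N m (f m)) \<in> K" using Kg by blast
      ultimately show ?case using Ka[OF class_closed[OF t] class_closed[OF s] Suc] by simp
    qed
    moreover have "t n = f" using n by (auto simp: t_def fun_eq_iff)
    ultimately show "u \<in> K" unfolding f(2) by metis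
  qed
qed

end

section \<open>Gradings of the associated graded ring and resolution\<close>

context filtered_resolution
begin

abbreviation "Self \<equiv> self_module R"
abbreviation "Pw \<equiv> ideal_power R \<mm>"
abbreviation "irr \<equiv> gr_irrelevant R \<mm>"
abbreviation "gSg \<equiv> gr_grading Sg"
abbreviation "pSg \<equiv> gr_proj Sg"

lemma gSg_eq: "gSg = gr_grading (gr_module Self Pw)" "pSg = gr_proj (gr_module Self Pw)"
  by (simp_all add: fun_eq_iff gr_grading_def gr_proj_def gr_ring_simps)

lemma self_filtered: "filtered_mod R \<mm> Self Pw"
  by (rule rees_filtered[OF \<mm>_ideal])

lemma gr_self_abelian: "abelian_group (gr_module Self Pw)"
proof -
  interpret S: cring Sg by (rule Sg_cring)
  show ?thesis
  proof (rule abelian_groupI, unfold gr_ring_simps[symmetric])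
    show "\<exists>y\<in>carrier Sg. y \<oplus>\<^bsub>Sg\<^esub> x = \<zero>\<^bsub>Sg\<^esub>" if "x \<in> carrier Sg" for x
      using S.l_neg[OF that] S.a_inv_closed[OF that] by blast
  qed (auto simp: S.a_ac)
qed

lemma Sg_graded: "graded_group Sg gSg pSg"
proof -
  interpret S: cring Sg by (rule Sg_cring)
  have "graded_group_axioms (gr_module Self Pw) gSg pSg"
    using graded_group.axioms(2)[OF filtered_mod.gr_graded[OF self_filtered gr_self_abelian]] unfolding gSg_eq .
  then have "graded_group_axioms Sg gSg pSg" unfolding graded_group_axioms_def gr_ring_simps .
  then show ?thesis by (rule graded_group.intro[OF S.abelian_group_axioms])
qed

lemma Sg_graded_cring: "graded_cring Sg irr gSg pSg"
proof -
  interpret S: cring Sg by (rule Sg_cring)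
  interpret N: filtered_mod R \<mm> Self Pw by (rule self_filtered)
  have mult: "r \<otimes>\<^bsub>Sg\<^esub> t \<in> gSg (i + j)" if r: "r \<in> gSg i" and t: "t \<in> gSg j" for r t i j
  proof -
    obtain \<alpha> where \<alpha>: "\<alpha> \<in> rees R \<mm>" "rees_class R \<mm> \<alpha> = r" "\<And>p. int p \<noteq> i \<Longrightarrow> \<alpha> p = \<zero>"
      using N.grading_class r unfolding gSg_eq by auto
    obtain \<beta> where \<beta>: "\<beta> \<in> rees R \<mm>" "rees_class R \<mm> \<beta> = t" "\<And>p. int p \<noteq> j \<Longrightarrow> \<beta> p = \<zero>"
      using N.grading_class t unfolding gSg_eq by auto
    have "conv Self \<alpha> \<beta> n = \<zero>\<^bsub>Self\<^esub>" if "int n \<noteq> i + j" for n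
    proof -
      have "\<alpha> p \<odot>\<^bsub>Self\<^esub> \<beta> (n - p) = \<zero>\<^bsub>Self\<^esub>" if "p \<le> n" for p
      proof (cases "int p = i")
        case True
        then have "int (n - p) \<noteq> j" using \<open>int n \<noteq> i + j\<close> \<open>p \<le> n\<close> by auto
        then show ?thesis using \<beta>(3) N.rees_carrier[OF \<alpha>(1)] by simp
      next
        case False
        then show ?thesis using \<alpha>(3) N.rees_carrier[OF \<beta>(1)] by simp
      qed
      then show ?thesis unfolding conv_def by (intro N.N.M.add.finprod_one_eqI) auto
    qed
    then have "rees_class R \<mm> (conv Self \<alpha> \<beta>) \<in> gSg (i + j)"
      unfolding gSg_eq by (rule N.class_in_grading[OF N.conv_closed[OF \<alpha>(1) \<beta>(1)]])
    then show ?thesis using N.class_smult[OF \<alpha>(1) \<beta>(1)] \<alpha>(2) \<beta>(2) by (simp add: gr_ring_simps)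
  qed
  have irr: "r \<ominus>\<^bsub>Sg\<^esub> pSg 0 r \<in> irr" if r: "r \<in> carrier Sg" for r
  proof -
    obtain \<alpha> where \<alpha>: "\<alpha> \<in> rees R \<mm>" "rees_class R \<mm> \<alpha> = r" using N.class_surj r by (auto simp: gr_ring_simps)
    define \<gamma> where "\<gamma> = (\<lambda>p. if p = 0 then \<zero> else \<alpha> p)"
    have \<gamma>: "\<gamma> \<in> rees R \<mm>"
      using \<alpha>(1) submodule_zero[OF N.G_sub] unfolding fin_seqs_def \<gamma>_def by auto
    have \<pi>: "part_seq Self 0 \<alpha> \<in> rees R \<mm>" by (rule N.part_seq_closed[OF \<alpha>(1)])
    have "\<alpha> = (\<lambda>p. part_seq Self 0 \<alpha> p \<oplus>\<^bsub>Self\<^esub> \<gamma> p)"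
      using N.rees_carrier[OF \<alpha>(1)] by (auto simp: part_seq_def \<gamma>_def fun_eq_iff)
    then have "r = pSg 0 r \<oplus>\<^bsub>Sg\<^esub> rees_class R \<mm> \<gamma>"
      using N.class_add[OF \<pi> \<gamma>] \<alpha>(2) N.class_part[of 0 \<alpha>] unfolding gSg_eq by (simp add: gr_ring_simps)
    moreover have "pSg 0 r \<in> carrier Sg" "rees_class R \<mm> \<gamma> \<in> carrier Sg"
      using N.class_closed[OF \<pi>] N.class_closed[OF \<gamma>] N.class_part[of 0 \<alpha>] \<alpha>(2) by (simp_all add: gSg_eq gr_ring_simps)
    ultimately have "r \<ominus>\<^bsub>Sg\<^esub> pSg 0 r = rees_class R \<mm> \<gamma>" using S.add_minus_left by metis
    then show ?thesis using irrelevant_class_iff[OF \<gamma>] additive_subgroup.zero_closed[OF is_additive_subgroup]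
      by (simp add: \<gamma>_def)
  qed
  have one: "\<one>\<^bsub>Sg\<^esub> \<in> gSg 0"
  proof -
    have "single_seq Self 0 \<one> \<in> rees R \<mm>" by (rule N.single_seq_closed) simp
    moreover have "(\<lambda>p. if p = 0 then \<one> else \<zero>) = single_seq Self 0 \<one>" by (auto simp: single_seq_def)
    ultimately show ?thesis unfolding gSg_eq gr_ring_simps
      using N.class_in_grading[of "single_seq Self 0 \<one>" 0] by (simp add: single_seq_def)
  qed
  show ?thesis
    by (intro graded_cring.intro graded_cring_axioms.intro Sg_graded residue_field.intro Sg_cring irrelevant_maximal mult irr one)
qed

text \<open>The index shift \<open>p + sh n l\<close> in \<open>free_class\<close> turns degree
  \<open>j\<close> of the sequence into degree \<open>j\<close> minus \<open>sh n l\<close> of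
  coordinate \<open>l\<close>, which is what \<open>free_grading\<close> demands.\<close>

lemma free_class_grading:
  assumes f: "f \<in> fin_seqs (Ng n) (Gg n)" and part: "\<And>q. int q \<noteq> j \<Longrightarrow> f q = \<zero>\<^bsub>Ng n\<^esub>"
  shows "clg n f \<in> free_grading Sg gSg (rk n) (\<lambda>l. int (sh n l)) j"
proof -
  interpret P: gr_presented R \<mm> "Ng n" "Gg n" "free_module Sg (rk n)" "clg n" by (rule C_presented)
  interpret N: filtered_mod R \<mm> Self Pw by (rule self_filtered)
  have c: "clg n f \<in> carrier (free_module Sg (rk n))" by (rule P.cl_closed[OF f])
  have "clg n f l \<in> gSg (j - int (sh n l))" if l: "l < rk n" for l
  proof -
    have "clg n f l p = \<zero>\<^bsub>Sg\<^esub> p" if "int p \<noteq> j - int (sh n l)" for p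
    proof -
      have "f (p + sh n l) l = \<zero>" using part[of "p + sh n l"] that l by (simp add: free_zero)
      then show ?thesis using N.N.coset_zero[OF N.G_sub, of "Suc p"] l
        by (simp add: free_class_def seq_class_def gr_ring_simps gr_module_def)
    qed
    then show ?thesis using cring.free_in[OF Sg_cring c l] by (simp add: gr_grading_def)
  qed
  then show ?thesis using c by (simp add: free_grading_def)
qed

lemma grading_free_class:
  assumes v: "v \<in> free_grading Sg gSg (rk n) (\<lambda>l. int (sh n l)) j"
  shows "\<exists>f\<in>fin_seqs (Ng n) (Gg n). clg n f = v \<and> (\<forall>q. int q \<noteq> j \<longrightarrow> f q = \<zero>\<^bsub>Ng n\<^esub>)"
proof -
  interpret P: gr_presented R \<mm> "Ng n" "Gg n" "free_module Sg (rk n)" "clg n" by (rule C_presented)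
  interpret N: filtered_mod R \<mm> Self Pw by (rule self_filtered)
  have vc: "v \<in> carrier (free_module Sg (rk n))" and vl: "\<And>l. l < rk n \<Longrightarrow> v l \<in> gSg (j - int (sh n l))"
    using v by (auto simp: free_grading_def)
  obtain f where f: "f \<in> fin_seqs (Ng n) (Gg n)" "clg n f = v" using P.cl_surj[OF vc] by blast
  have f': "part_seq (Ng n) j f \<in> fin_seqs (Ng n) (Gg n)" by (rule P.part_seq_closed[OF f(1)])
  have "clg n (part_seq (Ng n) j f) = v"
  proof (rule cring.free_eqI[OF Sg_cring P.cl_closed[OF f'] vc])
    fix l assume l: "l < rk n"
    have "(\<lambda>p. part_seq (Ng n) j f (p + sh n l) l) = part_seq Self (j - int (sh n l)) (\<lambda>p. f (p + sh n l) l)"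
      using l by (auto simp: part_seq_def free_zero fun_eq_iff)
    then have "clg n (part_seq (Ng n) j f) l = pSg (j - int (sh n l)) (clg n f l)"
      using N.class_part l unfolding gSg_eq by (simp add: free_class_def)
    also have "\<dots> = v l" using N.grading_proj vl[OF l] f(2) unfolding gSg_eq by simp
    finally show "clg n (part_seq (Ng n) j f) l = v l" .
  qed
  then show ?thesis using f' by (intro bexI[of _ "part_seq (Ng n) j f"]) (auto simp: part_seq_def)
qed

lemma gr_graded_res:
  "graded_res Sg Mg gr_cplx gr_eps rk irr gSg pSg (gr_grading Mg) (gr_proj Mg) (\<lambda>n l. int (sh n l))"
proof -
  interpret F: filtered_mod R \<mm> M F by (rule M_filtered)
  have M: "abelian_group Mg" using Mg_module by (simp add: module_def)
  have d: "differential gr_cplx (Suc n) v \<in> free_grading Sg gSg (rk n) (\<lambda>l. int (sh n l)) j"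
    if v: "v \<in> free_grading Sg gSg (rk (Suc n)) (\<lambda>l. int (sh (Suc n) l)) j" for n j v
  proof -
    interpret D: gr_morphism R \<mm> "Ng (Suc n)" "Gg (Suc n)" "free_module Sg (rk (Suc n))" "clg (Suc n)"
      "Ng n" "Gg n" "free_module Sg (rk n)" "clg n" "\<delta> (Suc n)" by (rule \<delta>_morphism)
    obtain f where f: "f \<in> fin_seqs (Ng (Suc n)) (Gg (Suc n))" "clg (Suc n) f = v"
      "\<And>q. int q \<noteq> j \<Longrightarrow> f q = \<zero>\<^bsub>Ng (Suc n)\<^esub>" using grading_free_class[OF v] by blast
    have "\<delta> (Suc n) (f q) = \<zero>\<^bsub>Ng n\<^esub>" if "int q \<noteq> j" for q
      unfolding f(3)[OF that] by (rule module_hom_zero[OF free_module free_module \<delta>_hom])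
    then show ?thesis
      unfolding gr_cplx_simps f(2)[symmetric] gr_diff_Suc D.gr_map_class[OF f(1)]
      by (rule free_class_grading[OF D.\<phi>_seq[OF f(1)]])
  qed
  have e: "gr_eps v \<in> gr_grading Mg j" if v: "v \<in> free_grading Sg gSg (rk 0) (\<lambda>l. int (sh 0 l)) j" for j v
  proof -
    interpret E: gr_morphism R \<mm> "Ng 0" "Gg 0" "free_module Sg (rk 0)" "clg 0" M F Mg "seq_class M F" \<epsilon>
      by (rule \<epsilon>_morphism)
    obtain f where f: "f \<in> fin_seqs (Ng 0) (Gg 0)" "clg 0 f = v"
      "\<And>q. int q \<noteq> j \<Longrightarrow> f q = \<zero>\<^bsub>Ng 0\<^esub>" using grading_free_class[OF v] by blast
    have "\<epsilon> (f q) = \<zero>\<^bsub>M\<^esub>" if "int q \<noteq> j" for q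
      unfolding f(3)[OF that] by (rule module_hom_zero[OF free_module M_module \<epsilon>_hom])
    then show ?thesis
      unfolding f(2)[symmetric] gr_eps_def E.gr_map_class[OF f(1)]
      by (rule F.class_in_grading[OF E.\<phi>_seq[OF f(1)]])
  qed
  show ?thesis
    using gr_free_res Sg_graded_cring F.gr_graded[OF M] d e
    unfolding graded_res_def graded_res_axioms_def free_res_field_def graded_cring_def by blast
qed

theorem gr_betti_iff: "gr_betti R \<mm> M F n j \<noteq> 0 \<longleftrightarrow> (\<exists>l<rk n. int (sh n l) = j)"
  unfolding gr_betti_def by (rule graded_betti_minimal[OF gr_graded_res gr_boundaries_minimal])

end

section \<open>Minimal resolutions and Betti numbers\<close>

text \<open>An inverse in the field \<open>R Quot I\<close>, read back in \<open>R\<close>; the ring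
  itself need not be local.\<close>

lemma (in residue_field) residue_unit:
  assumes r: "r \<in> carrier R" "r \<notin> I"
  shows "\<exists>c\<in>carrier R. \<one> \<ominus> c \<otimes> r \<in> I"
proof -
  interpret K: field "R Quot I" by (rule quotient_is_field[OF is_cring])
  have "I +> r \<in> carrier (R Quot I)" using r by (auto simp: FactRing_def A_RCOSETS_def')
  moreover have "I +> r \<noteq> \<zero>\<^bsub>R Quot I\<^esub>"
    using r res_eq_zero[OF r(1)] by (simp add: res_def k_zero FactRing_def)
  ultimately obtain y where y: "y \<in> carrier (R Quot I)" "y \<otimes>\<^bsub>R Quot I\<^esub> (I +> r) = \<one>\<^bsub>R Quot I\<^esub>"
    using K.field_Units K.Units_l_inv_ex[of "I +> r"] by blast
  obtain c where c: "c \<in> carrier R" "y = I +> c" using y(1) by (auto simp: FactRing_def A_RCOSETS_def')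
  have "res (c \<otimes> r) = res \<one>" using y(2) rcoset_mult_add[OF c(1) r(1)] unfolding c(2) by (simp add: FactRing_def res_def)
  then show ?thesis using res_eq_iff[of \<one> "c \<otimes> r"] c r by auto
qed

text \<open>
  If the coordinate \<open>a b\<close> of a generator \<open>a\<close> is a unit modulo \<open>I\<close>, the projection to the first \<open>b\<close>
  coordinates along \<open>a\<close> kills \<open>a\<close> modulo \<open>I\<close>.
\<close>

lemma (in residue_field) rank_le_card_span:
  assumes "finite A" "A \<subseteq> carrier (free_module R b)"
    and "carrier (free_module R b) \<subseteq>
      module.span R (free_module R b) A <+>\<^bsub>free_module R b\<^esub> ideal_smult R I (free_module R b) (carrier (free_module R b))"
  shows "b \<le> card A"
  using assms
proof (induction b arbitrary: A)
  case (Suc b)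
  interpret X: module R "free_module R (Suc b)" by (rule free_module)
  interpret Y: module R "free_module R b" by (rule free_module)
  let ?X = "free_module R (Suc b)" and ?Y = "free_module R b"
  let ?IX = "ideal_smult R I ?X (carrier ?X)" and ?IY = "ideal_smult R I ?Y (carrier ?Y)"
  note I = I_ideal
  have IX: "submodule R ?IX ?X" and IY: "submodule R ?IY ?Y"
    by (rule X.ideal_smult_submodule[OF I order_refl], rule Y.ideal_smult_submodule[OF I order_refl])
  \<comment> \<open>Otherwise every vector spanned modulo \<open>I\<close> would have its last
    coordinate in \<open>I\<close>, unlike the last basis vector.\<close>
  have "\<exists>a\<in>A. a b \<notin> I"
  proof (rule ccontr)
    assume no: "\<not> ?thesis"
    let ?K = "{f \<in> carrier ?X. \<forall>l<Suc b. f l \<in> (if l = b then I else carrier R)}"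
    have K: "submodule R ?K ?X" by (rule free_submoduleI) (use I oneideal in auto)
    have "A \<subseteq> ?K" using no Suc.prems(2) free_in by auto
    then have "X.span A \<subseteq> ?K" using K by (rule X.span_is_subset)
    moreover have "?IX \<subseteq> ?K" using free_ideal_smult_iff[OF I, of _ "Suc b"] Icarr by auto
    ultimately have "carrier ?X \<subseteq> ?K" using Suc.prems(3) sum_sub[OF K] by blast
    then have "std_vec R (Suc b) b \<in> ?K" by (rule subsetD) (rule std_vec_closed)
    then have "std_vec R (Suc b) b b \<in> I" by auto
    then show False using I_notcarr ideal.one_imp_carrier[OF I] by (simp add: std_vec_def)
  qed
  then obtain a where a: "a \<in> A" "a b \<notin> I" by blast
  have ac: "a l \<in> carrier R" if "l < Suc b" for l using free_in[OF _ that] Suc.prems(2) a(1) by blast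
  obtain c where c: "c \<in> carrier R" "\<one> \<ominus> c \<otimes> a b \<in> I" using residue_unit[OF ac[of b] a(2)] by auto
  define \<pi> where "\<pi> x = (\<lambda>l\<in>{..<b}. x l \<ominus> (x b \<otimes> c) \<otimes> a l)" for x
  have \<pi>: "\<pi> \<in> module_hom R ?X ?Y"
  proof (rule module_homI)
    fix x assume x: "x \<in> carrier ?X"
    have xl: "x l \<in> carrier R" if "l < Suc b" for l using free_in[OF x that] .
    show "\<pi> x \<in> carrier ?Y" using xl ac c by (auto simp: \<pi>_def free_carrier)
    show "\<pi> (x \<oplus>\<^bsub>?X\<^esub> y) = \<pi> x \<oplus>\<^bsub>?Y\<^esub> \<pi> y" if y: "y \<in> carrier ?X" for y
    proof -
      have yl: "y l \<in> carrier R" if "l < Suc b" for l using free_in[OF y that] .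
      have "(x l \<oplus> y l) \<ominus> ((x b \<oplus> y b) \<otimes> c) \<otimes> a l = (x l \<ominus> (x b \<otimes> c) \<otimes> a l) \<oplus> (y l \<ominus> (y b \<otimes> c) \<otimes> a l)"
        if l: "l < b" for l
      proof -
        have "x l \<in> carrier R" "x b \<in> carrier R" "y l \<in> carrier R" "y b \<in> carrier R" "a l \<in> carrier R"
          using xl yl ac l by auto
        then show ?thesis using c(1) by algebra
      qed
      then show ?thesis unfolding free_add unfolding \<pi>_def by (intro restrict_ext) simp
    qed
    show "\<pi> (r \<odot>\<^bsub>?X\<^esub> x) = r \<odot>\<^bsub>?Y\<^esub> \<pi> x" if r: "r \<in> carrier R" for r
    proof -
      have "r \<otimes> x l \<ominus> ((r \<otimes> x b) \<otimes> c) \<otimes> a l = r \<otimes> (x l \<ominus> (x b \<otimes> c) \<otimes> a l)"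
        if l: "l < b" for l
      proof -
        have "x l \<in> carrier R" "x b \<in> carrier R" "a l \<in> carrier R" using xl ac l by auto
        then show ?thesis using c(1) r by algebra
      qed
      then show ?thesis unfolding free_smult unfolding \<pi>_def by (intro restrict_ext) simp
    qed
  qed
  have \<pi>a: "\<pi> a \<in> ?IY"
    unfolding free_ideal_smult_iff[OF I]
  proof (intro conjI allI impI)
    show "\<pi> a \<in> carrier ?Y" using module_hom_in[OF \<pi>] a Suc.prems(2) by blast
    fix l assume l: "l < b"
    have al: "a l \<in> carrier R" "a b \<in> carrier R" using ac l by auto
    then have "a l \<ominus> (a b \<otimes> c) \<otimes> a l = (\<one> \<ominus> c \<otimes> a b) \<otimes> a l" using c(1) by algebra
    then show "\<pi> a l \<in> I" using l I_r_closed[OF c(2) al(1)] by (simp add: \<pi>_def)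
  qed
  let ?A = "\<pi> ` (A - {a})"
  have A: "finite ?A" "?A \<subseteq> carrier ?Y" using Suc.prems(1,2) module_hom_in[OF \<pi>] by auto
  let ?W = "Y.span ?A <+>\<^bsub>?Y\<^esub> ?IY"
  have W: "submodule R ?W ?Y" by (rule submodule_sum[OF Y.span_is_submodule[OF A(2)] IY])
  have AW: "?A \<subseteq> ?W" and IW: "?IY \<subseteq> ?W"
    using Y.in_own_span[OF A(2)] sum_sub_left[OF Y.span_is_submodule[OF A(2)] IY]
      sum_sub_right[OF Y.span_is_submodule[OF A(2)] IY] by auto
  let ?V = "{x \<in> carrier ?X. \<pi> x \<in> ?W}"
  have V: "submodule R ?V ?X" by (rule module_hom_vimage[OF free_module free_module \<pi> W])
  have "A \<subseteq> ?V" using Suc.prems(2) AW IW \<pi>a by auto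
  then have "X.span A \<subseteq> ?V" using V by (rule X.span_is_subset)
  moreover have "?IX \<subseteq> ?V"
    using module_hom_ideal_smult[OF free_module free_module \<pi> I] IW submodule_in[OF IX] by blast
  ultimately have XV: "carrier ?X \<subseteq> ?V" using Suc.prems(3) sum_sub[OF V] by blast
  have "carrier ?Y \<subseteq> ?W"
  proof
    fix y assume y: "y \<in> carrier ?Y"
    \<comment> \<open>The vector \<open>y\<close> extended by zero; \<open>\<pi>\<close> returns
      \<open>y\<close> because the coordinate used for the correction is zero.\<close>
    define x where "x = (\<lambda>l\<in>{..<Suc b}. if l < b then y l else \<zero>)"
    have x: "x \<in> carrier ?X" using free_in[OF y] by (auto simp: x_def free_carrier)
    have "\<pi> x = y"
    proof (rule free_eqI[OF module_hom_in[OF \<pi> x] y])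
      show "\<pi> x l = y l" if "l < b" for l
        using that free_in[OF y that] ac[of l] c(1) by (simp add: \<pi>_def x_def minus_eq)
    qed
    then show "y \<in> ?W" using XV x by auto
  qed
  then have "b \<le> card ?A" by (rule Suc.IH[OF A])
  also have "\<dots> \<le> card (A - {a})" using Suc.prems(1) by (intro card_image_le) simp
  also have "\<dots> < card A" using Suc.prems(1) a(1) by (rule card_Diff1_less)
  finally show ?case by simp
qed simp

context free_res
begin

lemma minimal_tor_bounds:
  "ideal I S \<Longrightarrow> boundaries C n \<subseteq> ideal_part S I C n \<Longrightarrow> tor_bounds S I C n = ideal_part S I C n"
  unfolding tor_bounds_def
  using sum_sub[OF ideal_part_sub, of I "boundaries C n" n "ideal_part S I C n"] sum_sub_right[OF bound_sub ideal_part_sub, of I n]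
  by blast

lemma minimal_tor_cycles:
  "(\<And>m. n = Suc m \<Longrightarrow> boundaries C m \<subseteq> ideal_part S I C m) \<Longrightarrow> tor_cycles S I C n = carrier (obj C n)"
  using d_in_bound by (cases n) (auto simp: tor_cycles_def)

text \<open>By minimality, a spanning set of Tor lifts to a set that spans the free module modulo
  \<open>I\<close>. One exists with at most as many elements as the Betti number, and
  \<open>rank_le_card_span\<close> bounds the rank by its size.\<close>

lemma rank_le_betti:
  assumes I: "maximalideal I S" and min: "\<And>n. boundaries C n \<subseteq> ideal_part S I C n"
  shows "b n \<le> betti S I M n"
proof -
  interpret X: module S "obj C n" by (rule obj_module)
  interpret K: residue_field S I using I is_cring by (simp add: residue_field_def)
  have I': "ideal I S" by (rule K.I_ideal)
  let ?A = "std_vec S (b n) ` {..<b n}"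
  have A: "?A \<subseteq> carrier (obj C n)" unfolding obj using std_vec_closed by auto
  have W: "submodule S (X.span ?A) (obj C n)" by (rule X.span_is_submodule[OF A])
  have "carrier (obj C n) \<subseteq> X.span ?A"
  proof
    fix x assume x: "x \<in> carrier (obj C n)"
    have "comb (obj C n) (b n) (std_vec S (b n)) x \<in> X.span ?A"
      using x X.in_own_span[OF A] unfolding obj
      by (intro comb_in_submodule[OF W[unfolded obj]] submodule_smult[OF W[unfolded obj]]) (auto intro: free_in)
    then show "x \<in> X.span ?A" using free_comb_std x unfolding obj by simp
  qed
  then have "spans_tor S I C n ?A"
    unfolding spans_tor_def minimal_tor_cycles[OF min]
    using A sum_sub_left[OF W tor_bounds_sub[OF I']] by blast
  from betti_spans_tor(2)[OF free_res_axioms I this]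
  obtain A' where A': "spans_tor S I C n A'" "card A' \<le> betti S I M n" by blast
  have "b n \<le> card A'"
    using A'(1) unfolding spans_tor_def minimal_tor_cycles[OF min] minimal_tor_bounds[OF I' min] ideal_part_def obj
    by (intro K.rank_le_card_span) auto
  then show ?thesis using A'(2) by simp
qed

end

text \<open>A boundary with a unit coordinate makes one of the generators superfluous.\<close>

lemma (in noetherian_local_ring) minimal_if_rank_le_betti:
  assumes C: "free_res R M C \<epsilon> b" and le: "\<And>n. b n \<le> betti R \<mm> M n"
  shows "boundaries C n \<subseteq> ideal_part R \<mm> C n"
proof (induction n rule: less_induct)
  case (less n)
  interpret C: free_res R M C \<epsilon> b by fact
  interpret X: module R "free_module R (b n)" by (rule free_module)
  \<comment> \<open>The induction hypothesis, minimality in the preceding degree, makes every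
    element of degree \<open>n\<close> a lift of a cycle; this is where the order of the induction
    matters.\<close>
  have Z: "tor_cycles R \<mm> C n = carrier (free_module R (b n))"
    using C.minimal_tor_cycles[of n \<mm>] less unfolding C.obj by auto
  show ?case
  proof
    fix f assume f: "f \<in> boundaries C n"
    have fc: "f \<in> carrier (free_module R (b n))" using C.bound_in[OF f] unfolding C.obj .
    have "f l \<in> \<mm>" if l: "l < b n" for l
    proof (rule ccontr)
      assume "f l \<notin> \<mm>"
      then obtain c where c: "c \<in> carrier R" "c \<otimes> f l = \<one>" using in_max_or_unit free_in[OF fc l] by blast
      \<comment> \<open>Without basis vector \<open>l\<close> the others still span modulo
        \<open>tor_bounds\<close>, since \<open>f\<close> is a boundary with a unit at
        \<open>l\<close>. This bounds the Betti number by fewer than \<open>b n\<close> elements,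
        against the hypothesis.\<close>
      define A where "A = std_vec R (b n) ` ({..<b n} - {l})"
      have A: "A \<subseteq> carrier (free_module R (b n))" unfolding A_def using std_vec_closed by auto
      let ?W = "X.span A <+>\<^bsub>free_module R (b n)\<^esub> tor_bounds R \<mm> C n"
      have B: "submodule R (tor_bounds R \<mm> C n) (free_module R (b n))" using C.tor_bounds_sub[OF \<mm>_ideal] unfolding C.obj .
      have W: "submodule R ?W (free_module R (b n))" by (rule submodule_sum[OF X.span_is_submodule[OF A] B])
      have AW: "A \<subseteq> ?W" and BW: "tor_bounds R \<mm> C n \<subseteq> ?W"
        using X.in_own_span[OF A] sum_sub_left[OF X.span_is_submodule[OF A] B] sum_sub_right[OF X.span_is_submodule[OF A] B] by auto
      have fW: "f \<in> ?W" using f sum_sub_left[OF C.bound_sub C.ideal_part_sub[OF \<mm>_ideal]] BW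
        unfolding tor_bounds_def by blast
      define g where "g = (\<lambda>i\<in>{..<b n}. if i = l then \<zero> else f i)"
      have gc: "g \<in> carrier (free_module R (b n))" using free_in[OF fc] by (auto simp: g_def free_carrier)
      have "comb (free_module R (b n)) (b n) (std_vec R (b n)) g \<in> ?W"
      proof (rule comb_in_submodule[OF W])
        fix i assume i: "i < b n"
        show "g i \<odot>\<^bsub>free_module R (b n)\<^esub> std_vec R (b n) i \<in> ?W"
        proof (cases "i = l")
          case True
          then have "g i \<odot>\<^bsub>free_module R (b n)\<^esub> std_vec R (b n) i = \<zero>\<^bsub>free_module R (b n)\<^esub>"
            using X.smult_l_null[OF std_vec_closed] i by (simp add: g_def)
          then show ?thesis using submodule_zero[OF W] by simp
        next
          case False
          then have "std_vec R (b n) i \<in> ?W" using AW i by (auto simp: A_def)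
          then show ?thesis using submodule_smult[OF W free_in[OF gc i]] by blast
        qed
      qed
      then have gW: "g \<in> ?W" using free_comb_std[OF gc] by simp
      have "c \<odot>\<^bsub>free_module R (b n)\<^esub> (f \<ominus>\<^bsub>free_module R (b n)\<^esub> g) = std_vec R (b n) l"
      proof (rule free_eqI[OF _ std_vec_closed])
        show "c \<odot>\<^bsub>free_module R (b n)\<^esub> (f \<ominus>\<^bsub>free_module R (b n)\<^esub> g) \<in> carrier (free_module R (b n))"
          using c fc gc by simp
        show "(c \<odot>\<^bsub>free_module R (b n)\<^esub> (f \<ominus>\<^bsub>free_module R (b n)\<^esub> g)) i = std_vec R (b n) l i" if i: "i < b n" for i
        proof -
          have "g i = (if i = l then \<zero> else f i)" using i by (simp add: g_def)
          then show ?thesis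
            using i c free_in[OF fc i] by (auto simp: free_smult free_minus[OF fc gc i] std_vec_def minus_eq r_neg)
        qed
      qed
      then have stdW: "std_vec R (b n) l \<in> ?W"
        using submodule_smult[OF W c(1) submodule_minus[OF W fW gW]] by simp
      have "carrier (free_module R (b n)) \<subseteq> ?W"
      proof
        fix x assume x: "x \<in> carrier (free_module R (b n))"
        have "std_vec R (b n) i \<in> ?W" if "i < b n" for i using AW stdW that by (cases "i = l") (auto simp: A_def)
        then have "comb (free_module R (b n)) (b n) (std_vec R (b n)) x \<in> ?W"
          using free_in[OF x] submodule_smult[OF W] by (intro comb_in_submodule[OF W]) blast
        then show "x \<in> ?W" using free_comb_std[OF x] by simp
      qed
      then have "spans_tor R \<mm> C n A"
        unfolding spans_tor_def Z C.obj using A by (simp add: A_def)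
      then have "betti R \<mm> M n \<le> card A" by (rule betti_spans_tor(1)[OF C maximalideal_axioms])
      also have "\<dots> \<le> card ({..<b n} - {l})" unfolding A_def by (rule card_image_le) simp
      also have "\<dots> < b n" using l by simp
      finally show False using le[of n] by simp
    qed
    then show "f \<in> ideal_part R \<mm> C n"
      unfolding ideal_part_def C.obj free_ideal_smult_iff[OF \<mm>_ideal] using fc by blast
  qed
qed

section \<open>The linear part of a minimal resolution\<close>

text \<open>\<open>gr_map\<close> forms a union over a coset; its members differ by elements of
  \<open>G (Suc p)\<close>, which \<open>\<phi>\<close> maps into \<open>G' (Suc p)\<close>, so only
  one coset of the target occurs.\<close>

lemma gr_map_class:
  assumes N: "filtered_mod R I N G" and N': "filtered_mod R I N' G'" and \<phi>: "\<phi> \<in> module_hom R N N'"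
    and filt: "\<And>p x. x \<in> G p \<Longrightarrow> \<phi> x \<in> G' p" and f: "f \<in> fin_seqs N G"
  shows "gr_map N' G' \<phi> (seq_class N G f) = seq_class N' G' (\<lambda>q. \<phi> (f q))"
proof
  interpret N: filtered_mod R I N G by fact
  interpret N': filtered_mod R I N' G' by fact
  fix p
  have fc: "f p \<in> carrier N" by (rule N.seq_carrier[OF f])
  have "G' (Suc p) +>\<^bsub>N'\<^esub> \<phi> x = G' (Suc p) +>\<^bsub>N'\<^esub> \<phi> (f p)" if x: "x \<in> G (Suc p) +>\<^bsub>N\<^esub> f p" for x
  proof -
    note mem = N.N.coset_mem[OF N.G_sub fc x]
    have "\<phi> x \<ominus>\<^bsub>N'\<^esub> \<phi> (f p) \<in> G' (Suc p)"
      using filt[OF mem(2)] module_hom_minus[OF N.N.module_axioms N'.N.module_axioms \<phi> mem(1) fc] by simp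
    then show ?thesis
      using N'.N.coset_eq_iff[OF N'.G_sub module_hom_in[OF \<phi> mem(1)] module_hom_in[OF \<phi> fc]] by simp
  qed
  moreover have "f p \<in> G (Suc p) +>\<^bsub>N\<^esub> f p" by (rule N.N.coset_self[OF N.G_sub fc])
  ultimately show "gr_map N' G' \<phi> (seq_class N G f) p = seq_class N' G' (\<lambda>q. \<phi> (f q)) p"
    unfolding gr_map_def seq_class_def by blast
qed

context free_res
begin

text \<open>In the standard filtration all basis vectors of homological degree \<open>n\<close> have
  shift \<open>n\<close>, so the results on \<open>shift_filt\<close> apply to the linear
  part.\<close>

lemma standard_filtration_shift:
  "ideal I S \<Longrightarrow> standard_filtration S I C n = shift_filt S I (b n) (\<lambda>_. n)"
  using free_ideal_smult_iff[OF ideal_power_ideal]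
  by (auto simp: fun_eq_iff standard_filtration_def shift_filt_def obj)

text \<open>Passing from homological degree \<open>Suc n\<close> to \<open>n\<close> lowers the
  shift by one, so one more power of \<open>I\<close> may be demanded; the entries of a minimal
  differential lie in \<open>I\<close> and supply it.\<close>

lemma d_square:
  assumes I: "ideal I S" and min: "boundaries C n \<subseteq> ideal_part S I C n"
    and x: "x \<in> shift_filt S I (b (Suc n)) (\<lambda>_. Suc n) p"
  shows "d (Suc n) x \<in> shift_filt S I (b n) (\<lambda>_. n) p"
proof -
  have hom: "d (Suc n) \<in> module_hom S (free_module S (b (Suc n))) (free_module S (b n))"
    using d_hom[of n] unfolding obj .
  have xc: "x \<in> carrier (free_module S (b (Suc n)))" by (rule shift_filt_in[OF x])
  have "x l \<odot>\<^bsub>free_module S (b n)\<^esub> d (Suc n) (std_vec S (b (Suc n)) l) \<in> shift_filt S I (b n) (\<lambda>_. n) p"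
    if l: "l < b (Suc n)" for l
  proof -
    let ?e = "d (Suc n) (std_vec S (b (Suc n)) l)"
    have "?e \<in> boundaries C n" by (rule d_in_bound) (simp only: obj std_vec_closed)
    then have e: "?e \<in> carrier (free_module S (b n))" "\<And>i. i < b n \<Longrightarrow> ?e i \<in> I"
      using min free_ideal_smult_iff[OF I, of ?e "b n"] unfolding ideal_part_def obj by blast+
    have xl: "x l \<in> ideal_power S I (p - Suc n)" using x l by (auto simp: shift_filt_def)
    have "x l \<otimes> ?e i \<in> ideal_power S I (p - n)" if "i < b n" for i
    proof (rule subsetD[OF ideal_power_antimono[OF I] ideal_power_mult_I[OF I xl e(2)[OF that]]])
      show "p - n \<le> Suc (p - Suc n)" by simp
    qed
    then show ?thesis
      using module.smult_closed[OF free_module free_in[OF xc l] e(1)] by (simp add: shift_filt_def free_smult)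
  qed
  then show ?thesis
    unfolding free_hom_eq_comb[OF free_module hom xc]
    by (rule comb_in_submodule[OF shift_filt_submodule[OF I]])
qed

text \<open>
  The class of \<open>x\<close> in degree \<open>Suc n\<close> of the linear part is a cycle, hence a boundary; but a
  boundary comes from \<open>\<partial> C\<^sub>n\<^sub>+\<^sub>2 \<subseteq> I C\<^sub>n\<^sub>+\<^sub>1\<close>.
\<close>

lemma lin_exact:
  assumes I: "ideal I S" and min: "\<And>n. boundaries C n \<subseteq> ideal_part S I C n"
    and zero: "zero_module (homology (lin_complex S I C) (Suc n))"
    and x: "x \<in> carrier (obj C (Suc n))"
    and dx: "d (Suc n) x \<in> ideal_smult S (ideal_power S I 2) (obj C n) (carrier (obj C n))"
  shows "x \<in> ideal_part S I C (Suc n)"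
proof -
  let ?N = "\<lambda>m. free_module S (b m)" and ?G = "\<lambda>m. shift_filt S I (b m) (\<lambda>_. m)"
  let ?L = "lin_complex S I C"
  have N: "filtered_mod S I (?N m) (?G m)" for m by (rule shift_filtered[OF I])
  interpret N: filtered_mod S I "?N (Suc n)" "?G (Suc n)" by (rule N)
  have hom: "d (Suc m) \<in> module_hom S (?N (Suc m)) (?N m)" for m using d_hom[of m] unfolding obj .
  have L: "obj ?L m = gr_module (?N m) (?G m)" for m
    by (simp add: lin_complex_def obj standard_filtration_shift[OF I])
  have dL: "differential ?L (Suc m) (seq_class (?N (Suc m)) (?G (Suc m)) f)
      = seq_class (?N m) (?G m) (\<lambda>q. d (Suc m) (f q))" if "f \<in> fin_seqs (?N (Suc m)) (?G (Suc m))" for m f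
    using gr_map_class[OF N N hom d_square[OF I min] that]
    by (simp add: lin_complex_def obj standard_filtration_shift[OF I])
  let ?cl = "seq_class (?N (Suc n)) (?G (Suc n))"
  \<comment> \<open>\<open>x\<close> is placed in internal degree \<open>Suc n\<close>, the lowest
    one that occurs in homological degree \<open>Suc n\<close>: step \<open>Suc n\<close> of the
    filtration is the whole module and the next step is \<open>ideal_part\<close>.\<close>
  define s where "s = single_seq (?N (Suc n)) (Suc n) x"
  have xc: "x \<in> carrier (?N (Suc n))" using x unfolding obj .
  then have "x \<in> ?G (Suc n) (Suc n)" using free_in by (simp add: shift_filt_def)
  then have s: "s \<in> fin_seqs (?N (Suc n)) (?G (Suc n))" unfolding s_def by (rule N.single_seq_closed)
  \<comment> \<open>The cycle condition. For \<open>q = Suc n\<close> the step \<open>Suc q\<close>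
    of the filtration in homological degree \<open>n\<close> is the square of \<open>I\<close> times
    the module, because \<open>Suc (Suc n) - n = 2\<close>.\<close>
  have "d (Suc n) (s q) \<in> ?G n (Suc q)" for q
  proof (cases "q = Suc n")
    case True
    have "ideal (ideal_power S I (Suc (Suc 0))) S" by (rule ideal_power_ideal[OF I])
    from free_ideal_smult_iff[OF this] show ?thesis
      using dx True unfolding obj numeral_2_eq_2 by (simp add: s_def single_seq_def shift_filt_def Suc_diff_le)
  next
    case False
    then show ?thesis
      using module_hom_zero[OF free_module free_module hom] submodule_zero[OF shift_filt_submodule[OF I]]
      by (simp add: s_def single_seq_def)
  qed
  then have coset: "?G n (Suc q) +>\<^bsub>?N n\<^esub> d (Suc n) (s q) = ?G n (Suc q)" for q
    using module.coset_eq_B[OF free_module shift_filt_submodule[OF I] shift_filt_in] by blast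
  have "seq_class (?N n) (?G n) (\<lambda>q. d (Suc n) (s q)) = \<zero>\<^bsub>gr_module (?N n) (?G n)\<^esub>"
    unfolding seq_class_def coset by (simp add: gr_module_def)
  then have "?cl s \<in> cycles ?L (Suc n)"
    using N.class_closed[OF s] dL[OF s] by (simp add: cycles_def L)
  then have "boundaries ?L (Suc n) +>\<^bsub>obj ?L (Suc n)\<^esub> ?cl s \<in> carrier (homology ?L (Suc n))"
    by (auto simp: homology_def quotient_module_def)
  then have eq: "boundaries ?L (Suc n) +>\<^bsub>obj ?L (Suc n)\<^esub> ?cl s = boundaries ?L (Suc n)"
    using zero by (simp add: zero_module_def) (simp add: homology_def quotient_module_def)
  interpret N2: filtered_mod S I "?N (Suc (Suc n))" "?G (Suc (Suc n))" by (rule N)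
  have "\<zero>\<^bsub>gr_module (?N (Suc n)) (?G (Suc n))\<^esub> \<in> boundaries ?L (Suc n)"
  proof -
    have "differential ?L (Suc (Suc n)) \<zero>\<^bsub>gr_module (?N (Suc (Suc n))) (?G (Suc (Suc n)))\<^esub>
        = \<zero>\<^bsub>gr_module (?N (Suc n)) (?G (Suc n))\<^esub>"
      unfolding N2.class_zero[symmetric] dL[OF N2.seq_zero]
      unfolding N.class_zero[symmetric] module_hom_zero[OF free_module free_module hom] ..
    then show ?thesis unfolding boundaries_def L
      using N2.class_closed[OF N2.seq_zero] N2.class_zero by (metis image_eqI)
  qed
  moreover have "\<zero>\<^bsub>gr_module (?N (Suc n)) (?G (Suc n))\<^esub> \<oplus>\<^bsub>gr_module (?N (Suc n)) (?G (Suc n))\<^esub> ?cl s = ?cl s"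
    unfolding N.class_zero[symmetric] N.class_add[OF N.seq_zero s] using N.seq_carrier[OF s] by simp
  ultimately have "?cl s \<in> boundaries ?L (Suc n) +>\<^bsub>obj ?L (Suc n)\<^esub> ?cl s"
    unfolding L a_r_coset_def' by (auto intro!: bexI)
  then have "?cl s \<in> boundaries ?L (Suc n)" unfolding eq .
  then obtain w where w: "w \<in> carrier (gr_module (?N (Suc (Suc n))) (?G (Suc (Suc n))))"
    "?cl s = differential ?L (Suc (Suc n)) w" unfolding boundaries_def L by blast
  obtain g where g: "g \<in> fin_seqs (?N (Suc (Suc n))) (?G (Suc (Suc n)))"
    "w = seq_class (?N (Suc (Suc n))) (?G (Suc (Suc n))) g" using N2.class_surj[OF w(1)] by blast
  \<comment> \<open>Only the member of \<open>g\<close> with index \<open>Suc n\<close> is compared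
    with \<open>x\<close>: its boundary agrees with \<open>x\<close> modulo
    \<open>ideal_part\<close>, and by minimality this boundary lies in \<open>ideal_part\<close> as
    well.\<close>
  let ?y = "d (Suc (Suc n)) (g (Suc n))"
  have gc: "g (Suc n) \<in> carrier (obj C (Suc (Suc n)))" unfolding obj by (rule N2.seq_carrier[OF g(1)])
  have yb: "?y \<in> boundaries C (Suc n)" by (rule d_in_bound[OF gc])
  have yc: "?y \<in> carrier (?N (Suc n))" using bound_in[OF yb] unfolding obj .
  have "?cl s (Suc n) = seq_class (?N (Suc n)) (?G (Suc n)) (\<lambda>q. d (Suc (Suc n)) (g q)) (Suc n)"
    unfolding w(2) g(2) dL[OF g(1)] ..
  then have "?G (Suc n) (Suc (Suc n)) +>\<^bsub>?N (Suc n)\<^esub> x = ?G (Suc n) (Suc (Suc n)) +>\<^bsub>?N (Suc n)\<^esub> ?y"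
    by (simp only: seq_class_def s_def single_seq_def refl if_True)
  then have "x \<ominus>\<^bsub>?N (Suc n)\<^esub> ?y \<in> ?G (Suc n) (Suc (Suc n))"
    using N.N.coset_eq_iff[OF N.G_sub xc yc] by blast
  moreover have "?G (Suc n) (Suc (Suc n)) = ideal_part S I C (Suc n)"
  proof -
    have "Suc (Suc n) - Suc n = Suc 0" by simp
    then show ?thesis
      using free_ideal_smult_iff[OF I, of _ "b (Suc n)"] ideal_power_Suc_0[OF I]
      unfolding ideal_part_def obj shift_filt_def by (auto simp del: diff_Suc_Suc)
  qed
  ultimately have "x \<ominus>\<^bsub>obj C (Suc n)\<^esub> ?y \<in> ideal_part S I C (Suc n)" unfolding obj by simp
  then show ?thesis using submodule_minusD[OF ideal_part_sub[OF I] x] yb min by blast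
qed

end

text \<open>The hypothesis \<open>mini\<close> makes \<open>SOME\<close> return a minimal
  resolution. That resolution is kept as the witness, so that linear parts of different minimal
  resolutions need not be compared.\<close>

lemma linearity_defect_exact:
  assumes mini: "minimal_free_resolution R \<mm> M C0" and ld: "linearity_defect R \<mm> M = ereal (real d)"
  shows "\<exists>C. minimal_free_resolution R \<mm> M C \<and>
    (\<forall>i>d. zero_module (homology (lin_complex R \<mm> C) i))"
proof -
  define C where "C = (SOME C. minimal_free_resolution R \<mm> M C)"
  have "minimal_free_resolution R \<mm> M C"
    unfolding C_def by (rule someI[of "minimal_free_resolution R \<mm> M", OF mini])
  moreover have "zero_module (homology (lin_complex R \<mm> C) i)" if "i > d" for i
  proof (rule ccontr)
    assume "\<not> ?thesis"
    then have "ereal (real i) \<le> linearity_defect R \<mm> M"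
      unfolding linearity_defect_def Let_def C_def[symmetric] by (intro Sup_upper) blast
    then show False using that ld by simp
  qed
  ultimately show ?thesis by blast
qed

section \<open>Descent of shifts and the regularity\<close>

context filtered_resolution
begin

lemma cplx_free_res: "free_res R M cplx \<epsilon> rk"
proof -
  have "resolution R M cplx \<epsilon>"
    unfolding resolution_def
  proof (intro conjI allI)
    show "\<epsilon> ` carrier (obj cplx 0) = carrier M" using \<epsilon>_filt[of 0] by (simp add: shift_filt_0 F_0)
    show "{x \<in> carrier (obj cplx 0). \<epsilon> x = \<zero>\<^bsub>M\<^esub>} = boundaries cplx 0"
      using \<delta>_1_filt[of 0] by (simp add: shift_filt_0 boundaries_def)
    show "cycles cplx (Suc n) = boundaries cplx (Suc n)" for n
      using \<delta>_filt[of n 0] by (simp add: shift_filt_0 boundaries_def cycles_def)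
  qed (use \<epsilon>_hom \<delta>_hom in auto)
  then show ?thesis using is_cring M_module by (simp add: free_res_def free_res_axioms_def)
qed

text \<open>The rank is bounded by the Betti number of the associated graded module because
  \<open>gr_cplx\<close> is minimal, and that Betti number is the one of \<open>M\<close>; then
  \<open>minimal_if_rank_le_betti\<close> applies to \<open>cplx\<close>.\<close>

lemma homogeneous_minimal:
  assumes "homogeneous_type R \<mm> M F"
  shows "boundaries cplx n \<subseteq> ideal_part R \<mm> cplx n"
proof (rule minimal_if_rank_le_betti[OF cplx_free_res])
  show "rk n \<le> betti R \<mm> M n" for n
    using free_res.rank_le_betti[OF gr_free_res irrelevant_maximal gr_boundaries_minimal] assms
    by (simp add: homogeneous_type_def)
qed

text \<open>Vanishing homology of the linear part is known for the selected resolution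
  \<open>C'\<close>, not for \<open>cplx\<close>. So the basis vector is sent to \<open>C'\<close>,
  where \<open>lin_exact\<close> puts it into \<open>ideal_part\<close>, and brought back. The round
  trip is the identity modulo \<open>\<mm>\<close>, so the basis vector would have all coordinates
  in \<open>\<mm>\<close>.\<close>

lemma strand:
  assumes hom: "homogeneous_type R \<mm> M F" and ld: "linearity_defect R \<mm> M = ereal (real d)"
    and n: "d \<le> n" and l: "l < rk (Suc n)"
  shows "\<exists>l'<rk n. sh (Suc n) l \<le> Suc (sh n l')"
proof (rule ccontr)
  assume no: "\<not> ?thesis"
  note min = homogeneous_minimal[OF hom]
  interpret C: free_res R M cplx \<epsilon> rk by (rule cplx_free_res)
  have "minimal_free_resolution R \<mm> M cplx"
    using min C.res unfolding minimal_free_resolution_def free_resolution_def ideal_part_def by auto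
  from linearity_defect_exact[OF this ld] obtain C' where C': "minimal_free_resolution R \<mm> M C'"
    and lin: "\<And>i. i > d \<Longrightarrow> zero_module (homology (lin_complex R \<mm> C') i)" by blast
  then obtain \<eta> b where "resolution R M C' \<eta>" "\<And>n. obj C' n = free_module R (b n)"
    unfolding minimal_free_resolution_def free_resolution_def by metis
  then have res: "free_res R M C' \<eta> b"
    using is_cring M_module by (simp add: free_res_def free_res_axioms_def)
  interpret D: free_res R M C' \<eta> b by (rule res)
  have minD: "boundaries C' n \<subseteq> ideal_part R \<mm> C' n" for n
    using C' by (simp add: minimal_free_resolution_def ideal_part_def)
  obtain \<phi> where \<phi>: "chain_map R cplx C' \<phi>" "\<And>x. x \<in> carrier (obj cplx 0) \<Longrightarrow> \<eta> (\<phi> 0 x) = \<epsilon> x"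
    using comparison[OF C.free_res_axioms res] by blast
  obtain \<psi> where \<psi>: "chain_map R C' cplx \<psi>" "\<And>x. x \<in> carrier (obj C' 0) \<Longrightarrow> \<epsilon> (\<psi> 0 x) = \<eta> x"
    using comparison[OF res C.free_res_axioms] by blast
  let ?e = "std_vec R (rk (Suc n)) l"
  have e: "?e \<in> carrier (obj cplx (Suc n))" by (simp add: std_vec_closed)
  have "?e \<in> Gg (Suc n) (sh (Suc n) l)"
    using std_vec_closed[of "rk (Suc n)" l] submodule_zero[OF ideal_self_submodule[OF ideal_power_ideal[OF \<mm>_ideal]]]
    by (auto simp: shift_filt_def std_vec_def)
  then have de: "\<delta> (Suc n) ?e \<in> Gg n (sh (Suc n) l)" by (rule \<delta>_filt')
  have "\<delta> (Suc n) ?e i \<in> ideal_power R \<mm> 2" if i: "i < rk n" for i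
  proof -
    \<comment> \<open>The negated claim makes the shifts differ by at least two for every
      \<open>i\<close>, hence all entries of the image lie in the square of
      \<open>\<mm>\<close>.\<close>
    have "sh (Suc n) l > Suc (sh n i)" using no i by auto
    then have "ideal_power R \<mm> (sh (Suc n) l - sh n i) \<subseteq> ideal_power R \<mm> 2"
      by (intro ideal_power_antimono[OF \<mm>_ideal]) simp
    then show ?thesis using de i unfolding shift_filt_def by blast
  qed
  then have "\<delta> (Suc n) ?e \<in> ideal_smult R (ideal_power R \<mm> 2) (obj cplx n) (carrier (obj cplx n))"
    unfolding cplx_simps free_ideal_smult_iff[OF ideal_power_ideal[OF \<mm>_ideal]] using shift_filt_in[OF de] by blast
  then have "\<phi> n (\<delta> (Suc n) ?e) \<in> ideal_smult R (ideal_power R \<mm> 2) (obj C' n) (carrier (obj C' n))"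
    by (rule module_hom_ideal_smult[OF C.obj_module D.obj_module chain_map_hom[OF \<phi>(1)] ideal_power_ideal[OF \<mm>_ideal]])
  then have "D.d (Suc n) (\<phi> (Suc n) ?e) \<in> ideal_smult R (ideal_power R \<mm> 2) (obj C' n) (carrier (obj C' n))"
    using \<phi>(1) e unfolding chain_map_def by simp
  then have "\<phi> (Suc n) ?e \<in> ideal_part R \<mm> C' (Suc n)"
    using n by (intro D.lin_exact[OF \<mm>_ideal minD lin module_hom_in[OF chain_map_hom[OF \<phi>(1)] e]]) auto
  then have 1: "\<psi> (Suc n) (\<phi> (Suc n) ?e) \<in> ideal_part R \<mm> cplx (Suc n)"
    by (rule chain_map_tor(3)[OF res C.free_res_axioms \<mm>_ideal \<psi>(1)])
  have "?e \<in> tor_cycles R \<mm> cplx (Suc n)" unfolding C.minimal_tor_cycles[OF min] by (rule e)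
  from resolutions_homotopy_equivalent[OF C.free_res_axioms \<mm>_ideal \<phi> \<psi> this]
  have 2: "\<psi> (Suc n) (\<phi> (Suc n) ?e) \<ominus>\<^bsub>obj cplx (Suc n)\<^esub> ?e \<in> ideal_part R \<mm> cplx (Suc n)"
    unfolding C.minimal_tor_bounds[OF \<mm>_ideal min] .
  interpret X: module R "obj cplx (Suc n)" by (rule C.obj_module)
  have c: "\<psi> (Suc n) (\<phi> (Suc n) ?e) \<in> carrier (obj cplx (Suc n))"
    by (rule submodule_in[OF C.ideal_part_sub[OF \<mm>_ideal] 1])
  have "?e \<in> ideal_part R \<mm> cplx (Suc n)"
    using submodule_minus[OF C.ideal_part_sub[OF \<mm>_ideal] 1 2] c e
    by (simp add: X.M.minus_eq X.M.minus_add X.M.a_assoc[symmetric] X.M.r_neg del: cplx_simps)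
  then have "?e l \<in> \<mm>"
    unfolding ideal_part_def cplx_simps free_ideal_smult_iff[OF \<mm>_ideal] using l by blast
  then show False using one_notin l by (simp add: std_vec_def)
qed

text \<open>By \<open>strand\<close>, shift minus homological degree does not drop when a basis
  vector is replaced by a suitable one in the degree below; this is repeated down to
  \<open>d\<close>.\<close>

lemma strand_descent:
  assumes "homogeneous_type R \<mm> M F" "linearity_defect R \<mm> M = ereal (real d)" "d \<le> n" "l < rk n"
  shows "\<exists>l'<rk d. int (sh n l) - int n \<le> int (sh d l') - int d"
  using assms(3,4)
proof (induction n arbitrary: l rule: dec_induct)
  case base
  then show ?case by blast
next
  case (step n)
  obtain l1 where l1: "l1 < rk n" "sh (Suc n) l \<le> Suc (sh n l1)"
    using strand[OF assms(1,2) step.hyps(1) step.prems] by blast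
  obtain l' where "l' < rk d" "int (sh n l1) - int n \<le> int (sh d l') - int d" using step.IH[OF l1(1)] by blast
  then show ?case using l1(2) by (intro exI[of _ l']) auto
qed

text \<open>By \<open>gr_betti_iff\<close> both invariants are suprema over shifts, and degrees
  above \<open>d\<close> are dominated by degree \<open>d\<close> through
  \<open>strand_descent\<close>. In \<open>ereal\<close> an index without generators contributes
  minus infinity, so it needs no separate treatment.\<close>

theorem regularity_eq:
  assumes "homogeneous_type R \<mm> M F" "linearity_defect R \<mm> M = ereal (real d)"
  shows "gr_regularity R \<mm> M F = Max ((\<lambda>i. gr_top_degree R \<mm> M F i - ereal (real i)) ` {0..d})"
    (is "?reg = Max (?t ` _)")
proof (rule antisym)
  have t: "ereal (real_of_int (int (sh i l) - int i)) \<le> ?t i" if "l < rk i" for i l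
  proof -
    have "ereal (real_of_int (int (sh i l))) \<le> gr_top_degree R \<mm> M F i"
      unfolding gr_top_degree_def gr_betti_iff by (rule Sup_upper) (use that in blast)
    then have "ereal (real_of_int (int (sh i l))) - ereal (real i) \<le> ?t i" by (rule ereal_minus_mono) simp
    then show ?thesis by simp
  qed
  have tm: "?t i \<le> Max (?t ` {0..d})" if "i \<le> d" for i using that by (intro Max_ge) auto
  show "?reg \<le> Max (?t ` {0..d})"
    unfolding gr_regularity_def
  proof (rule Sup_least)
    fix z assume "z \<in> {ereal (real_of_int (j - int i)) |i j. gr_betti R \<mm> M F i j \<noteq> 0}"
    then obtain i j l where z: "z = ereal (real_of_int (j - int i))" and l: "l < rk i" "int (sh i l) = j"
      unfolding gr_betti_iff by blast
    show "z \<le> Max (?t ` {0..d})"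
    proof (cases "i \<le> d")
      case True
      show ?thesis using order_trans[OF t[OF l(1)] tm[OF True]] l(2) z by simp
    next
      case False
      then obtain l' where l': "l' < rk d" "int (sh i l) - int i \<le> int (sh d l') - int d"
        using strand_descent[OF assms _ l(1)] by auto
      have "z \<le> ereal (real_of_int (int (sh d l') - int d))"
        unfolding z using l' l(2) by (simp only: ereal_less_eq of_int_le_iff)
      also have "\<dots> \<le> ?t d" by (rule t[OF l'(1)])
      also have "\<dots> \<le> Max (?t ` {0..d})" by (rule tm) simp
      finally show ?thesis .
    qed
  qed
  \<comment> \<open>The finite number \<open>real i\<close> is moved to the other side, so that the
    supremum in \<open>gr_top_degree\<close> can be bounded term by term.\<close>
  have "?t i \<le> ?reg" for i
  proof -
    have "gr_top_degree R \<mm> M F i \<le> ?reg + ereal (real i)"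
      unfolding gr_top_degree_def
    proof (rule Sup_least)
      fix z assume "z \<in> {ereal (real_of_int j) |j. gr_betti R \<mm> M F i j \<noteq> 0}"
      then obtain j where z: "z = ereal (real_of_int j)" and j: "gr_betti R \<mm> M F i j \<noteq> 0" by blast
      have "z = ereal (real_of_int (j - int i)) + ereal (real i)" by (simp add: z)
      also have "\<dots> \<le> ?reg + ereal (real i)"
        unfolding gr_regularity_def using j by (intro add_right_mono Sup_upper) blast
      finally show "z \<le> ?reg + ereal (real i)" .
    qed
    then show ?thesis by (simp add: ereal_minus_le)
  qed
  then show "Max (?t ` {0..d}) \<le> ?reg" by (intro Max.boundedI) auto
qed

end

theorem corollary4p4:
  fixes R :: "('a, 'r) ring_scheme"
    and \<mm> :: "'a set"
    and M :: "('a, 'b, 'm) module_scheme"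
    and F :: "nat \<Rightarrow> 'b set"
    and d :: nat
  assumes "noetherian_local_ring R \<mm>"
    and "module R M"
    and "finitely_generated R M"
    and "\<not> zero_module M"
    and "stable_filtration R \<mm> M F"
    and "linearity_defect R \<mm> M = ereal (real d)"
    and "homogeneous_type R \<mm> M F"
  shows "gr_regularity R \<mm> M F =
    Max ((\<lambda>i. gr_top_degree R \<mm> M F i - ereal (real i)) ` {0..d})"
proof -
  interpret stable_filtered_module R \<mm> M F
    using assms(1-3,5) by (simp add: stable_filtered_module_def stable_filtered_module_axioms_def)
  obtain rk sh \<delta> \<epsilon> where "filtered_resolution R \<mm> M F rk sh \<delta> \<epsilon>" using ex_filtered_resolution by blast
  then show ?thesis using assms(6,7) by (intro filtered_resolution.regularity_eq)
qed

end
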